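(* Let $(\boldsymbol n_k)_{k\in\mathbb N}\subset\mathcal A_{-1}$ be (after translations and passing to a subsequence, not relabeled) a sequence whose densities $(\rho_k)$ satisfy the dichotomy alternative, and let $r_k\to\infty$ and $\beta>0$ be such that $$\int_{B_{r_k+3}\setminus B_{r_k-2}}\rho_k\,dx\to0,\qquad\int_{B_{r_k-2}}\rho_k\,dx\ge\beta,\qquad\int_{\mathbb R^2\setminus B_{r_k+3}}\rho_k\,dx\ge\beta .$$ Then, for all sufficiently large $k$, there exist maps $\boldsymbol n_k^{\mathrm{in}},\boldsymbol n_k^{\mathrm{out}}\in\mathcal A$ satisfying $$\boldsymbol n_k^{\mathrm{in}}=\begin{cases}\boldsymbol n_k&\text{on }B_{r_k},\\ \boldsymbol e_3&\text{on }\mathbb R^2\setminus B_{r_k+1},\end{cases}\qquad \boldsymbol n_k^{\mathrm{out}}=\begin{cases}\boldsymbol e_3&\text{on }B_{r_k},\\ \boldsymbol n_k&\text{on }\mathbb R^2\setminus B_{r_k+1}.\end{cases}$$ Their degrees split exactly: $$Q(\boldsymbol n_k^{\mathrm{in}})+Q(\boldsymbol n_k^{\mathrm{out}})=Q(\boldsymbol n_k).$$ Moreover, $$\sup_{0\le\varepsilon\le2}\big|\mathcal F_\varepsilon(\boldsymbol n_k^{\mathrm{in}})+\mathcal F_\varepsilon(\boldsymbol n_k^{\mathrm{out}})-\mathcal F_\varepsilon(\boldsymbol n_k)\big|\longrightarrow0 .$$ If $\rho_k^{\mathrm{in}}$ and $\rho_k^{\mathrm{out}}$ denote the densities associated with $\boldsymbol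 n_k^{\mathrm{in}}$ and $\boldsymbol n_k^{\mathrm{out}}$, respectively, then $$\int_{B_{r_k-2}}\rho_k^{\mathrm{in}}\,dx\ge\beta,\qquad\int_{\mathbb R^2\setminus B_{r_k+3}}\rho_k^{\mathrm{out}}\,dx\ge\beta .$$
   Context: Let $\boldsymbol e_3=(0,0,1)$ and $\mathcal A=\{\boldsymbol m:\mathbb R^2\to\mathbb S^2:\ \boldsymbol m-\boldsymbol e_3\in H^2(\mathbb R^2;\mathbb R^3)\}$ (each element identified with its uniformly continuous representative). $Q(\boldsymbol m)=\frac1{4\pi}\int_{\mathbb R^2}\boldsymbol m\cdot(\partial_1\boldsymbol m\times\partial_2\boldsymbol m)\,dx\in\mathbb Z$ is the topological degree and $\mathcal A_{-1}=\{\boldsymbol m\in\mathcal A:Q(\boldsymbol m)=-1\}$. For $0\le\varepsilon\le2$, $$\mathcal F_\varepsilon(\boldsymbol n)=\frac12\int_{\mathbb R^2}\big(|\Delta\boldsymbol n|^2+|\boldsymbol n-\boldsymbol e_3|^2-\varepsilon|\nabla\boldsymbol n|^2\big)dx,\qquad\widehat I_{-1}(\varepsilon)=\inf_{\mathcal A_{-1}}\mathcal F_\varepsilon .$$ The density associated with $\boldsymbol n\in\mathcal A$ is $|\boldsymbol n-\boldsymbol e_3|^2+|\nabla\boldsymbol n|^2+|D^2\boldsymbol n|^2\in L^1(\mathbb R^2)$; $\rho_k$ is the density associated with $\boldsymbol n_k$. $B_r(x)$ is the open disk of radius $r$ centered at $x$ and $B_r=B_r(0)$. Standing setting: $(\boldsymbol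 n_k)\subset\mathcal A_{-1}$ is a minimizing sequence for $\widehat I_{-1}(\varepsilon)$ for a fixed $\varepsilon\in[0,2)$, with $\int_{\mathbb R^2}\rho_k\,dx\to M>0$. Dichotomy alternative: there is $\lambda\in(0,M)$ such that for every $\eta>0$ one can find a radius $R>0$, centers $x_k\in\mathbb R^2$ and radii $S_k\to\infty$ such that, for all sufficiently large $k$, $$\Big|\int_{B_R(x_k)}\rho_k\,dx-\lambda\Big|<\eta,\quad\Big|\int_{\mathbb R^2\setminus B_{S_k}(x_k)}\rho_k\,dx-(M-\lambda)\Big|<\eta,\quad\int_{B_{S_k}(x_k)\setminus B_R(x_k)}\rho_k\,dx<\eta .$$ *)

theory Defs
  imports "HOL-Analysis.Analysis"
begin

section \<open>Smooth test functions\<close>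

definition partial_derivative :: "'n::finite \<Rightarrow> (real^'n \<Rightarrow> real) \<Rightarrow> real^'n \<Rightarrow> real" where
  "partial_derivative i f x = frechet_derivative f (at x) (axis i 1)"

text \<open>A list of coordinate directions plays the role of a multi-index.\<close>

definition partial_derivatives :: "'n::finite list \<Rightarrow> (real^'n \<Rightarrow> real) \<Rightarrow> real^'n \<Rightarrow> real" where
  "partial_derivatives \<alpha> f = foldr partial_derivative \<alpha> f"

text \<open>Being \<open>C\<^sup>\<infinity>\<close>: all iterated partial derivatives are Frechet differentiable everywhere (hence all of
  them are continuous, and no junk value of \<^const>\<open>frechet_derivative\<close> is used).\<close>

definition smooth :: "(real^'n::finite \<Rightarrow> real) \<Rightarrow> bool" where
  "smooth f \<longleftrightarrow> (\<forall>\<alpha>. partial_derivatives \<alpha> f differentiable_on UNIV)"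

definition test_function :: "(real^'n::finite \<Rightarrow> real) \<Rightarrow> bool" where
  "test_function \<phi> \<longleftrightarrow> smooth \<phi> \<and> compact (closure {x. \<phi> x \<noteq> 0})"


section \<open>Weak derivatives and Sobolev spaces\<close>

definition locally_integrable :: "(real^'n::finite \<Rightarrow> 'b::euclidean_space) \<Rightarrow> bool" where
  "locally_integrable u \<longleftrightarrow> u \<in> borel_measurable lborel \<and>
     (\<forall>K. compact K \<longrightarrow> set_integrable lborel K u)"

definition has_weak_derivative ::
    "'n::finite list \<Rightarrow> (real^'n \<Rightarrow> 'b::euclidean_space) \<Rightarrow> (real^'n \<Rightarrow> 'b) \<Rightarrow> bool" where
  "has_weak_derivative \<alpha> u g \<longleftrightarrow> locally_integrable u \<and> locally_integrable g \<and>
     (\<forall>\<phi>. test_function \<phi> \<longrightarrow>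
        (LINT x|lborel. partial_derivatives \<alpha> \<phi> x *\<^sub>R u x)
          = (-1) ^ length \<alpha> *\<^sub>R (LINT x|lborel. \<phi> x *\<^sub>R g x))"

text \<open>An arbitrary representative of the weak derivative, which is unique up to null sets; it is
  only ever used under an integral.\<close>

definition weak_derivative ::
    "'n::finite list \<Rightarrow> (real^'n \<Rightarrow> 'b::euclidean_space) \<Rightarrow> real^'n \<Rightarrow> 'b" where
  "weak_derivative \<alpha> u = (SOME g. has_weak_derivative \<alpha> u g)"

definition square_integrable :: "(real^'n::finite \<Rightarrow> 'b::euclidean_space) \<Rightarrow> bool" where
  "square_integrable u \<longleftrightarrow> u \<in> borel_measurable lborel \<and> integrable lborel (\<lambda>x. (norm (u x))\<^sup>2)"

text \<open>The Sobolev space \<open>H\<^sup>k\<close>, as a set of functions rather than of classes modulo null sets;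
  \<open>\<alpha> = []\<close> gives \<open>u \<in> L\<^sup>2\<close>.\<close>

definition sobolev_H :: "nat \<Rightarrow> (real^'n::finite \<Rightarrow> 'b::euclidean_space) set" where
  "sobolev_H k = {u. \<forall>\<alpha>. length \<alpha> \<le> k \<longrightarrow> (\<exists>g. has_weak_derivative \<alpha> u g \<and> square_integrable g)}"


section \<open>Admissible maps, degree and energy\<close>

definition e3 :: "real^3" where
  "e3 = vector [0, 0, 1]"

text \<open>Uniform continuity selects the uniformly continuous representative of each class.\<close>

definition admissible :: "(real^2 \<Rightarrow> real^3) set" where
  "admissible = {m. (\<forall>x. m x \<in> sphere 0 1) \<and> (\<lambda>x. m x - e3) \<in> sobolev_H 2 \<and>
                    uniformly_continuous_on UNIV m}"

definition top_degree :: "(real^2 \<Rightarrow> real^3) \<Rightarrow> real" where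
  "top_degree m = 1 / (4 * pi) *
     (LINT x|lborel. m x \<bullet> cross3 (weak_derivative [1] m x) (weak_derivative [2] m x))"

definition admissible_of_degree :: "int \<Rightarrow> (real^2 \<Rightarrow> real^3) set" where
  "admissible_of_degree d = {m \<in> admissible. top_degree m = of_int d}"

definition weak_laplacian :: "(real^2 \<Rightarrow> real^3) \<Rightarrow> real^2 \<Rightarrow> real^3" where
  "weak_laplacian m x = (\<Sum>i\<in>UNIV. weak_derivative [i, i] m x)"

definition gradient_sq :: "(real^2 \<Rightarrow> real^3) \<Rightarrow> real^2 \<Rightarrow> real" where
  "gradient_sq m x = (\<Sum>i\<in>UNIV. (norm (weak_derivative [i] m x))\<^sup>2)"

definition hessian_sq :: "(real^2 \<Rightarrow> real^3) \<Rightarrow> real^2 \<Rightarrow> real" where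
  "hessian_sq m x = (\<Sum>i\<in>UNIV. \<Sum>j\<in>UNIV. (norm (weak_derivative [i, j] m x))\<^sup>2)"

definition energy :: "real \<Rightarrow> (real^2 \<Rightarrow> real^3) \<Rightarrow> real" where
  "energy \<epsilon> m = 1 / 2 * (LINT x|lborel.
     (norm (weak_laplacian m x))\<^sup>2 + (norm (m x - e3))\<^sup>2 - \<epsilon> * gradient_sq m x)"

definition min_energy :: "int \<Rightarrow> real \<Rightarrow> real" where
  "min_energy d \<epsilon> = (INF m\<in>admissible_of_degree d. energy \<epsilon> m)"

definition map_density :: "(real^2 \<Rightarrow> real^3) \<Rightarrow> real^2 \<Rightarrow> real" where
  "map_density m x = (norm (m x - e3))\<^sup>2 + gradient_sq m x + hessian_sq m x"

definition dichotomy :: "(nat \<Rightarrow> real^2 \<Rightarrow> real) \<Rightarrow> real \<Rightarrow> bool" where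
  "dichotomy \<rho> M \<longleftrightarrow>
     (\<exists>l. 0 < l \<and> l < M \<and>
       (\<forall>\<eta>>0. \<exists>R>0. \<exists>(c :: nat \<Rightarrow> real^2) (S :: nat \<Rightarrow> real).
          filterlim S at_top sequentially \<and>
          (\<forall>\<^sub>F k in sequentially.
             \<bar>(LINT x:ball (c k) R|lborel. \<rho> k x) - l\<bar> < \<eta> \<and>
             \<bar>(LINT x:UNIV - ball (c k) (S k)|lborel. \<rho> k x) - (M - l)\<bar> < \<eta> \<and>
             (LINT x:ball (c k) (S k) - ball (c k) R|lborel. \<rho> k x) < \<eta>)))"

end

theory Submission
  imports Defs
begin

text \<open>
  Let \<open>\<xi>\<close> be a smooth cutoff with \<open>\<xi> = 1\<close> on \<open>B\<^sub>r\<close> and \<open>\<xi> = 0\<close> off \<open>B\<^bsub>r+1\<^esub>\<close>. The two parts of \<open>m\<close> are the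
  normalisations of \<open>e3 + \<xi> (m - e3)\<close> and \<open>e3 + (1 - \<xi>) (m - e3)\<close>. A two-dimensional Sobolev bound shows
  that \<open>m\<close> is uniformly close to \<open>e3\<close> on \<open>B\<^bsub>r+1\<^esub> - B\<^sub>r\<close> once the mass of the density on the shell
  \<open>B\<^bsub>r+3\<^esub> - B\<^bsub>r-2\<^esub>\<close> is small, so the normalisation is harmless. On \<open>B\<^bsub>r+1\<^esub> - B\<^sub>r\<close> the second derivatives
  of the parts are pointwise at most a constant times \<open>|m - e3| + |Dm| + |Dm|\<^sup>2 + |D\<^sup>2m|\<close>. The square of this
  is controlled by the shell mass, because \<open>|Dm|\<^sup>4\<close> is integrable with a local bound obtained by
  integrating the derivative of \<open>\<zeta>\<^sup>2 f\<^sup>3 v\<close>, where \<open>f\<close> is a derivative of the bounded function \<open>v\<close>. This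
  gives the energy estimate, uniformly in the parameter. The degree splits exactly because near the
  pole \<open>e3\<close> the area form is exact, so the area integral over the annulus is determined
  by the values near its boundary, where each part is \<open>m\<close> or \<open>e3\<close>.
\<close>

text \<open>Normalising to unit length is nonlinear, so the second derivatives of the parts contain
  |Dm|^2, which membership in H^2 does not bound pointwise; boundedness of m is what turns the local
  L^2 size of Dm and D^2 m into one for |Dm|^2. Every constant has to be the same for all maps,
  radii and parameters. This is why cutoffs of all radii come from convolution with one fixed
  mollifier, and why bounds are collected in the form "at most a constant times an envelope", a form
  preserved by the algebra of the construction. Derivatives are given only by testing and are
  arbitrary representatives: inequalities are shown for mollifications and passed to the limit, and
  equalities hold almost everywhere. The transition is placed between the radii r + 1/4 and r + 3/4,
  so that each part equals m or e3 on open neighbourhoods of the prescribed regions and shares its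
  weak derivatives there. For the degree, the primitive of the area form is extended across the
  opposite pole by a C^1 weight; it is then defined for the whole map and only has to be correct in
  the transition region, where all maps stay near e3.\<close>

section \<open>Calculus of partial derivatives and smooth functions\<close>

lemma partial_derivatives_simps [simp]:
  "partial_derivatives [] f = f"
  "partial_derivatives (i # \<alpha>) f = partial_derivative i (partial_derivatives \<alpha> f)"
  by (simp_all add: partial_derivatives_def)

lemma partial_derivatives_append:
  "partial_derivatives (\<alpha> @ \<beta>) f = partial_derivatives \<alpha> (partial_derivatives \<beta> f)"
  by (simp add: partial_derivatives_def)

lemma partial_derivative_eq:
  "(f has_derivative f') (at x) \<Longrightarrow> partial_derivative i f x = f' (axis i 1)"
  unfolding partial_derivative_def using frechet_derivative_at by metis

lemma differentiable_const_mult_real: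
  fixes f :: "'a::real_normed_vector \<Rightarrow> real"
  shows "f differentiable (at x) \<Longrightarrow> (\<lambda>x. c * f x) differentiable (at x)"
  by (intro differentiable_mult) auto

lemma partial_derivative_const [simp]: "partial_derivative i (\<lambda>x. c) = (\<lambda>x. 0)"
  by (rule ext, rule partial_derivative_eq) (rule has_derivative_const)

lemma partial_derivative_add:
  assumes "\<And>x. f differentiable (at x)" "\<And>x. g differentiable (at x)"
  shows "partial_derivative i (\<lambda>x. f x + g x) = (\<lambda>x. partial_derivative i f x + partial_derivative i g x)"
proof
  fix x
  obtain f' g' where "(f has_derivative f') (at x)" "(g has_derivative g') (at x)"
    using assms unfolding differentiable_def by blast
  then show "partial_derivative i (\<lambda>x. f x + g x) x = partial_derivative i f x + partial_derivative i g x"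
    by (simp add: partial_derivative_eq partial_derivative_eq[OF has_derivative_add])
qed

lemma partial_derivative_mult:
  assumes "\<And>x. f differentiable (at x)" "\<And>x. g differentiable (at x)"
  shows "partial_derivative i (\<lambda>x. f x * g x) = (\<lambda>x. partial_derivative i f x * g x + f x * partial_derivative i g x)"
proof
  fix x
  obtain f' g' where "(f has_derivative f') (at x)" "(g has_derivative g') (at x)"
    using assms unfolding differentiable_def by blast
  then show "partial_derivative i (\<lambda>x. f x * g x) x = partial_derivative i f x * g x + f x * partial_derivative i g x"
    by (simp add: partial_derivative_eq partial_derivative_eq[OF has_derivative_mult])
qed

lemma partial_derivative_cmult:
  assumes "\<And>x. f differentiable (at x)"
  shows "partial_derivative i (\<lambda>x. c * f x) = (\<lambda>x. c * partial_derivative i f x)"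
  using partial_derivative_mult[of "\<lambda>x. c" f i] assms by simp

lemma partial_derivative_affine:
  fixes f :: "real^'n::finite \<Rightarrow> real"
  assumes "\<And>x. f differentiable (at x)"
  shows "partial_derivative i (\<lambda>x. f (a *\<^sub>R x + b)) = (\<lambda>x. a * partial_derivative i f (a *\<^sub>R x + b))"
    and "(\<lambda>x. f (a *\<^sub>R x + b)) differentiable (at x)"
proof -
  have *: "\<exists>f'. (f has_derivative f') (at (a *\<^sub>R x + b)) \<and> ((\<lambda>x. f (a *\<^sub>R x + b)) has_derivative (\<lambda>h. f' (a *\<^sub>R h))) (at x)" for x
  proof -
    obtain f' where f': "(f has_derivative f') (at (a *\<^sub>R x + b))"
      using assms unfolding differentiable_def by blast
    have "((\<lambda>x. a *\<^sub>R x + b) has_derivative (\<lambda>h. a *\<^sub>R h)) (at x)"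
      by (auto intro!: derivative_eq_intros)
    from has_derivative_compose[OF this f'] f' show ?thesis by blast
  qed
  show "partial_derivative i (\<lambda>x. f (a *\<^sub>R x + b)) = (\<lambda>x. a * partial_derivative i f (a *\<^sub>R x + b))"
  proof
    fix x
    obtain f' where f': "(f has_derivative f') (at (a *\<^sub>R x + b))"
      "((\<lambda>x. f (a *\<^sub>R x + b)) has_derivative (\<lambda>h. f' (a *\<^sub>R h))) (at x)" using * by blast
    show "partial_derivative i (\<lambda>x. f (a *\<^sub>R x + b)) x = a * partial_derivative i f (a *\<^sub>R x + b)"
      by (simp add: partial_derivative_eq[OF f'(1)] partial_derivative_eq[OF f'(2)]
          linear_cmul[OF has_derivative_linear[OF f'(1)]])
  qed
  show "(\<lambda>x. f (a *\<^sub>R x + b)) differentiable (at x)"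
    using * unfolding differentiable_def by blast
qed

text \<open>Coinduction: a family of differentiable functions closed under partial differentiation
  contains all iterated derivatives of its members. It replaces explicit formulas for higher
  derivatives; the smoothness proofs below name such a family or reduce to one.\<close>

lemma smooth_coinduct:
  assumes "f \<in> S" "\<And>g x. g \<in> S \<Longrightarrow> g differentiable (at x)"
    "\<And>g i. g \<in> S \<Longrightarrow> partial_derivative i g \<in> S"
  shows "smooth f"
proof -
  have "partial_derivatives \<alpha> f \<in> S" for \<alpha>
    by (induction \<alpha>) (use assms in auto)
  then show ?thesis unfolding smooth_def differentiable_on_def using assms(2) by auto
qed

lemma smooth_differentiable: "smooth f \<Longrightarrow> f differentiable (at x)"
  unfolding smooth_def differentiable_on_def by (metis UNIV_I partial_derivatives_simps(1))

lemma smooth_partial_derivative [intro]: "smooth f \<Longrightarrow> smooth (partial_derivative i f)"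
  unfolding smooth_def by (metis partial_derivatives_append partial_derivatives_simps)

lemma smooth_continuous: "smooth f \<Longrightarrow> continuous_on A f"
  by (meson smooth_differentiable continuous_at_imp_continuous_on differentiable_imp_continuous_within)

lemma smooth_const [intro]: "smooth (\<lambda>x :: real^'n::finite. c)"
proof (rule smooth_coinduct)
  show "(\<lambda>x. c) \<in> {g. \<exists>c. g = (\<lambda>x. c)}" by blast
  fix g :: "real^'n \<Rightarrow> real" and x :: "real^'n" and i :: 'n
  assume "g \<in> {g. \<exists>c. g = (\<lambda>x. c)}"
  then obtain c where g: "g = (\<lambda>x. c)" by (elim CollectE exE)
  show "g differentiable (at x)" unfolding g by (rule differentiable_const)
  show "partial_derivative i g \<in> {g. \<exists>c. g = (\<lambda>x. c)}"
    unfolding g partial_derivative_const by blast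
qed

text \<open>Products alone are not closed under differentiation, since the Leibniz rule produces
  sums. The algebra generated by all smooth functions is closed, which settles sums and products
  together.\<close>

inductive_set smooth_closure :: "(real^'n::finite \<Rightarrow> real) set" where
  base: "smooth f \<Longrightarrow> f \<in> smooth_closure"
| add: "f \<in> smooth_closure \<Longrightarrow> g \<in> smooth_closure \<Longrightarrow> (\<lambda>x. f x + g x) \<in> smooth_closure"
| mult: "f \<in> smooth_closure \<Longrightarrow> g \<in> smooth_closure \<Longrightarrow> (\<lambda>x. f x * g x) \<in> smooth_closure"

lemma smooth_closure_differentiable: "f \<in> smooth_closure \<Longrightarrow> f differentiable (at x)"
proof (induction rule: smooth_closure.induct)
  case (base f)
  then show ?case by (rule smooth_differentiable)
next
  case (add f g)
  show ?case by (rule differentiable_add) fact+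
next
  case (mult f g)
  show ?case by (rule differentiable_mult) fact+
qed

lemma smooth_closure_partial_derivative:
  "f \<in> smooth_closure \<Longrightarrow> partial_derivative i f \<in> smooth_closure"
proof (induction rule: smooth_closure.induct)
  case (base f)
  then show ?case using smooth_closure.base smooth_partial_derivative by blast
next
  case (add f g)
  then show ?case
    by (simp only: partial_derivative_add smooth_closure_differentiable smooth_closure.add)
next
  case (mult f g)
  then show ?case
    by (simp only: partial_derivative_mult smooth_closure_differentiable smooth_closure.add smooth_closure.mult)
qed

lemma smooth_closure_smooth: "f \<in> smooth_closure \<Longrightarrow> smooth f"
  using smooth_coinduct[OF _ smooth_closure_differentiable smooth_closure_partial_derivative] .

lemma smooth_add [intro]: "smooth f \<Longrightarrow> smooth g \<Longrightarrow> smooth (\<lambda>x. f x + g x)"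
  by (rule smooth_closure_smooth[OF smooth_closure.add[OF smooth_closure.base smooth_closure.base]])

lemma smooth_mult [intro]: "smooth f \<Longrightarrow> smooth g \<Longrightarrow> smooth (\<lambda>x. f x * g x)"
  by (rule smooth_closure_smooth[OF smooth_closure.mult[OF smooth_closure.base smooth_closure.base]])

lemma smooth_diff [intro]:
  assumes "smooth f" "smooth g" shows "smooth (\<lambda>x. f x - g x)"
  using smooth_add[OF assms(1) smooth_mult[OF smooth_const[of "-1"] assms(2)]] by simp

lemma smooth_power [intro]: "smooth f \<Longrightarrow> smooth (\<lambda>x. f x ^ k)"
proof (induction k)
  case (Suc k)
  from smooth_mult[OF Suc.prems Suc.IH[OF Suc.prems]] show ?case by simp
qed (simp add: smooth_const)

lemma smooth_affine:
  fixes f :: "real^'n::finite \<Rightarrow> real"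
  assumes "smooth f" shows "smooth (\<lambda>x. f (a *\<^sub>R x + b))"
proof (rule smooth_coinduct)
  \<comment> \<open>The scalar \<open>c\<close> is carried along because every derivative of the
    composite brings out a factor \<open>a\<close>.\<close>
  let ?S = "{\<lambda>x. c * f (a *\<^sub>R x + b) |c f. smooth f}"
  show "(\<lambda>x. f (a *\<^sub>R x + b)) \<in> ?S" using assms by (auto intro!: exI[of _ 1] exI[of _ f])
  fix g assume "g \<in> ?S"
  then obtain c f where g: "g = (\<lambda>x. c * f (a *\<^sub>R x + b))" "smooth f" by blast
  show "g differentiable (at x)" for x unfolding g
    by (intro differentiable_const_mult_real partial_derivative_affine smooth_differentiable g)
  fix i
  have "partial_derivative i g = (\<lambda>x. (c * a) * partial_derivative i f (a *\<^sub>R x + b))"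
    unfolding g using g(2)
    by (subst partial_derivative_cmult)
      (auto simp: partial_derivative_affine smooth_differentiable)
  then show "partial_derivative i g \<in> ?S" using g(2) by blast
qed

subsection \<open>Mollifiers\<close>

text \<open>The classical flat function exp(-1/t), multiplied by powers of 1/t: differentiation
  raises the exponent by one or two, so the family over all \<open>k\<close> spans a space closed
  under differentiation.\<close>

definition flat_exp :: "nat \<Rightarrow> real \<Rightarrow> real" where
  "flat_exp k t = (if t > 0 then inverse t ^ k * exp (- inverse t) else 0)"

text \<open>The substitution s = 1/t turns the right-hand limit into that of s^k / exp s at
  infinity; on the left the function is zero.\<close>

lemma flat_exp_tendsto_0: "(flat_exp k \<longlongrightarrow> 0) (at 0)"
proof -
  have "((\<lambda>t. (inverse t) ^ k / exp (inverse t)) \<longlongrightarrow> (0::real)) (at_right 0)"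
    using filterlim_compose[OF tendsto_power_div_exp_0 filterlim_inverse_at_top_right] .
  moreover have "\<forall>\<^sub>F t in at_right 0. inverse t ^ k / exp (inverse t) = flat_exp k t"
    using eventually_at_right_less[of 0]
    by (rule eventually_mono) (simp only: flat_exp_def exp_minus divide_inverse if_True)
  ultimately have "((\<lambda>t. flat_exp k t) \<longlongrightarrow> 0) (at_right 0)"
    by (rule Lim_transform_eventually)
  moreover have "((\<lambda>t. flat_exp k t) \<longlongrightarrow> 0) (at_left 0)"
  proof (rule Lim_transform_eventually[OF tendsto_const])
    have "\<forall>\<^sub>F t in at_left (0::real). t < 0" by (simp add: eventually_at_filter)
    then show "\<forall>\<^sub>F t in at_left 0. 0 = flat_exp k t"
      by (rule eventually_mono) (simp add: flat_exp_def)
  qed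
  ultimately show ?thesis by (simp add: filterlim_split_at_real)
qed

lemma flat_exp_has_derivative:
  "(flat_exp k has_real_derivative (- real k * flat_exp (Suc k) t + flat_exp (Suc (Suc k)) t)) (at t)"
proof (cases "0 :: real" t rule: linorder_cases)
  case less
  then have t: "t > 0" by simp
  have "((\<lambda>t. inverse t ^ k * exp (- inverse t)) has_real_derivative (- real k * flat_exp (Suc k) t + flat_exp (Suc (Suc k)) t)) (at t)"
  proof -
    have i: "(inverse has_real_derivative - (inverse t ^ 2)) (at t)"
      using DERIV_inverse[of t UNIV] t by (simp add: numeral_2_eq_2)
    have e: "((\<lambda>t. exp (- inverse t)) has_real_derivative exp (- inverse t) * inverse t ^ 2) (at t)"
      using DERIV_chain2[OF DERIV_exp DERIV_minus[OF i]] by simp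
    have p: "((\<lambda>t. inverse t ^ k) has_real_derivative - (real k * inverse t ^ Suc k)) (at t)"
      using DERIV_power[OF i, of k] by (cases k) (simp_all add: power2_eq_square mult_ac)
    show ?thesis
      by (rule DERIV_cong[OF DERIV_mult[OF p e]]) (use t in \<open>simp add: flat_exp_def power2_eq_square mult_ac\<close>)
  qed
  then show ?thesis
    by (rule has_field_derivative_transform_within_open[where S="{0<..}"]) (use t in \<open>auto simp: flat_exp_def\<close>)
next
  case equal
  \<comment> \<open>At the origin the difference quotient of \<open>flat_exp k\<close> is exactly
    \<open>flat_exp (Suc k)\<close>, since division by h raises the exponent by one; the derivative
    is therefore the limit 0 found above.\<close>
  have *: "(flat_exp k (0 + h) - flat_exp k 0) / h = flat_exp (Suc k) h" for h
    unfolding flat_exp_def by (cases "h > 0") (simp_all only: divide_inverse power_Suc, simp_all)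
  have "(flat_exp k has_real_derivative 0) (at 0)"
    unfolding DERIV_def * by (rule flat_exp_tendsto_0)
  then show ?thesis unfolding equal[symmetric] by (simp add: flat_exp_def)
next
  case greater
  then have t: "t < 0" by simp
  have "((\<lambda>t. 0) has_real_derivative (- real k * flat_exp (Suc k) t + flat_exp (Suc (Suc k)) t)) (at t)"
    using t by (auto simp: flat_exp_def)
  then show ?thesis
    by (rule has_field_derivative_transform_within_open[where S="{..<0}"]) (use t in \<open>auto simp: flat_exp_def\<close>)
qed

text \<open>Coordinates enter through the chain rule: a partial derivative of
  \<open>1 - x \<bullet> x\<close> is a multiple of a coordinate. With constants, sums and products
  the generated algebra is closed under all partial derivatives.\<close>

inductive_set bump_closure :: "(real^'n::finite \<Rightarrow> real) set" where
  const: "(\<lambda>x. c) \<in> bump_closure"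
| coord: "(\<lambda>x. x $ i) \<in> bump_closure"
| flat: "(\<lambda>x. flat_exp k (1 - x \<bullet> x)) \<in> bump_closure"
| add: "f \<in> bump_closure \<Longrightarrow> g \<in> bump_closure \<Longrightarrow> (\<lambda>x. f x + g x) \<in> bump_closure"
| mult: "f \<in> bump_closure \<Longrightarrow> g \<in> bump_closure \<Longrightarrow> (\<lambda>x. f x * g x) \<in> bump_closure"

lemma flat_exp_compose_derivative:
  fixes x :: "real^'n::finite"
  shows "((\<lambda>x. flat_exp k (1 - x \<bullet> x)) has_derivative
    (\<lambda>h. (- real k * flat_exp (Suc k) (1 - x \<bullet> x) + flat_exp (Suc (Suc k)) (1 - x \<bullet> x)) * (- 2 * (x \<bullet> h)))) (at x)"
proof -
  have "((\<lambda>x. 1 - x \<bullet> x) has_derivative (\<lambda>h. - 2 * (x \<bullet> h))) (at x)"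
    by (auto intro!: derivative_eq_intros simp: inner_commute)
  from has_derivative_compose[OF this flat_exp_has_derivative[unfolded has_field_derivative_def]]
  show ?thesis by simp
qed

lemma has_derivative_vec_nth_at: "((\<lambda>x. x $ i) has_derivative (\<lambda>h. h $ i)) (at x)"
  using bounded_linear.has_derivative[OF bounded_linear_vec_nth has_derivative_ident] .

lemma bump_closure_differentiable: "f \<in> bump_closure \<Longrightarrow> f differentiable (at x)"
proof (induction rule: bump_closure.induct)
  case (const c)
  then show ?case by (rule differentiable_const)
next
  case (coord i)
  show ?case by (rule differentiableI[OF has_derivative_vec_nth_at])
next
  case (flat k)
  show ?case by (rule differentiableI[OF flat_exp_compose_derivative])
next
  case (add f g)
  show ?case by (rule differentiable_add) fact+
next
  case (mult f g)
  show ?case by (rule differentiable_mult) fact+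
qed

lemma bump_closure_partial_derivative:
  "f \<in> bump_closure \<Longrightarrow> partial_derivative i f \<in> bump_closure"
proof (induction rule: bump_closure.induct)
  case (const c)
  show ?case unfolding partial_derivative_const by (rule bump_closure.const)
next
  case (coord j)
  have "partial_derivative i (\<lambda>x. x $ j) = (\<lambda>x. axis i 1 $ j)"
    by (rule ext) (rule partial_derivative_eq[OF has_derivative_vec_nth_at])
  then show ?case by (simp only: bump_closure.const)
next
  case (flat k)
  have "partial_derivative i (\<lambda>x. flat_exp k (1 - x \<bullet> x)) =
    (\<lambda>x. (- real k * flat_exp (Suc k) (1 - x \<bullet> x) + flat_exp (Suc (Suc k)) (1 - x \<bullet> x)) * (- 2 * (x $ i)))"
  proof
    fix x :: "real^'a"
    have "x \<bullet> axis i 1 = x $ i" by (simp add: inner_axis)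
    then show "partial_derivative i (\<lambda>x. flat_exp k (1 - x \<bullet> x)) x =
      (- real k * flat_exp (Suc k) (1 - x \<bullet> x) + flat_exp (Suc (Suc k)) (1 - x \<bullet> x)) * (- 2 * (x $ i))"
      using partial_derivative_eq[OF flat_exp_compose_derivative, of i k x] by (simp only:)
  qed
  moreover have "(\<lambda>x. (- real k * flat_exp (Suc k) (1 - x \<bullet> x) + flat_exp (Suc (Suc k)) (1 - x \<bullet> x)) * (- 2 * (x $ i))) \<in> bump_closure"
    by (rule bump_closure.mult[OF bump_closure.add[OF bump_closure.mult[OF bump_closure.const bump_closure.flat]
        bump_closure.flat] bump_closure.mult[OF bump_closure.const bump_closure.coord]])
  ultimately show ?case by (simp only:)
next
  case (add f g)
  then show ?case
    by (simp only: partial_derivative_add bump_closure_differentiable bump_closure.add)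
next
  case (mult f g)
  then show ?case
    by (simp only: partial_derivative_mult bump_closure_differentiable bump_closure.add bump_closure.mult)
qed

lemma bump_closure_smooth: "f \<in> bump_closure \<Longrightarrow> smooth f"
  using smooth_coinduct[OF _ bump_closure_differentiable bump_closure_partial_derivative] .

definition bump :: "real^'n::finite \<Rightarrow> real" where
  "bump x = flat_exp 0 (1 - x \<bullet> x)"

lemma bump_smooth: "smooth bump"
  unfolding bump_def[abs_def] by (rule bump_closure_smooth[OF bump_closure.flat])

lemma bump_nonneg: "0 \<le> bump x" and bump_pos: "norm x < 1 \<Longrightarrow> 0 < bump x"
  and bump_zero: "1 \<le> norm x \<Longrightarrow> bump x = 0"
proof -
  have *: "x \<bullet> x < 1 \<longleftrightarrow> norm x < 1"
    by (simp add: norm_eq_sqrt_inner)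
  show "0 \<le> bump x" by (simp add: bump_def flat_exp_def)
  show "0 < bump x" if "norm x < 1" using that * by (simp add: bump_def flat_exp_def)
  show "bump x = 0" if "1 \<le> norm x" using that * by (simp add: bump_def flat_exp_def)
qed


section \<open>Test functions: supports, closure properties and integrability\<close>

lemma test_function_smooth: "test_function \<phi> \<Longrightarrow> smooth \<phi>"
  by (simp add: test_function_def)

lemma test_functionI:
  assumes "smooth \<phi>" "compact K" "\<And>x. x \<notin> K \<Longrightarrow> \<phi> x = 0"
  shows "test_function \<phi>"
proof -
  have "closure {x. \<phi> x \<noteq> 0} \<subseteq> K"
    using assms by (intro closure_minimal) (auto simp: compact_imp_closed)
  then show ?thesis
    unfolding test_function_def using assms(1,2) by (metis closed_closure compact_Int_closed inf.absorb2)
qed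

text \<open>Closedness of \<open>K\<close> makes its complement a neighbourhood of each of its
  points on which \<open>f\<close> is constantly zero, so derivatives vanish off the same set and
  supports do not grow.\<close>

lemma partial_derivative_zero:
  fixes f :: "real^'n::finite \<Rightarrow> real"
  assumes "closed K" "\<And>x. x \<notin> K \<Longrightarrow> f x = 0" "x \<notin> K"
  shows "partial_derivative i f x = 0"
proof -
  have "(f has_derivative (\<lambda>h. 0)) (at x)"
  proof (rule has_derivative_transform_within_open)
    show "((\<lambda>x. 0) has_derivative (\<lambda>h. 0)) (at x)" by (rule has_derivative_const)
    show "open (- K)" by (rule open_Compl[OF assms(1)])
    show "x \<in> - K" using assms(3) by simp
    show "0 = f y" if "y \<in> - K" for y
      by (rule assms(2)[symmetric]) (use that in \<open>simp only: Compl_iff not_False_eq_True\<close>)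
  qed
  then show ?thesis by (rule partial_derivative_eq)
qed

lemma partial_derivatives_zero:
  fixes f :: "real^'n::finite \<Rightarrow> real"
  assumes "closed K" "\<And>x. x \<notin> K \<Longrightarrow> f x = 0" "x \<notin> K"
  shows "partial_derivatives \<alpha> f x = 0"
  using assms(3)
proof (induction \<alpha> arbitrary: x)
  case Nil
  then show ?case using assms(2) by simp
next
  case (Cons i \<alpha>)
  then show ?case using partial_derivative_zero[OF assms(1), of "partial_derivatives \<alpha> f" x i] by simp
qed

lemma test_functionE:
  assumes "test_function (\<phi> :: real^'n::finite \<Rightarrow> real)"
  obtains R where "R > 0" "\<And>x. x \<notin> cball 0 R \<Longrightarrow> \<phi> x = 0"
proof -
  let ?K = "closure {x. \<phi> x \<noteq> 0}"
  have "bounded ?K" using assms compact_imp_bounded unfolding test_function_def by blast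
  then obtain R where R: "R > 0" "?K \<subseteq> ball 0 R"
    using bounded_subset_ballD[of ?K 0] by blast
  have "\<phi> x = 0" if "x \<notin> cball 0 R" for x
  proof (rule ccontr)
    assume "\<phi> x \<noteq> 0"
    then have "x \<in> ?K" using closure_subset[of "{x. \<phi> x \<noteq> 0}"] by blast
    with R(2) that show False by auto
  qed
  with R that[of R] show ?thesis by blast
qed

lemma test_function_partial_derivative [intro]:
  assumes "test_function \<phi>" shows "test_function (partial_derivative i \<phi>)"
proof -
  obtain R where "\<And>x. x \<notin> cball 0 R \<Longrightarrow> \<phi> x = 0" using assms test_functionE by metis
  from partial_derivative_zero[OF closed_cball this]
  show ?thesis
    by (rule test_functionI[OF smooth_partial_derivative[OF test_function_smooth[OF assms]] compact_cball])
qed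

lemma test_function_mult_smooth:
  assumes "test_function \<phi>" "smooth f" shows "test_function (\<lambda>x. \<phi> x * f x)"
proof -
  obtain R where "\<And>x. x \<notin> cball 0 R \<Longrightarrow> \<phi> x = 0" using assms test_functionE by metis
  then show ?thesis
    using test_functionI[OF smooth_mult[OF test_function_smooth[OF assms(1)] assms(2)] compact_cball[of 0 R]]
    by simp
qed

lemma test_function_add:
  assumes "test_function \<phi>" "test_function f" shows "test_function (\<lambda>x. \<phi> x + f x)"
proof -
  obtain R where R: "\<And>x. x \<notin> cball 0 R \<Longrightarrow> \<phi> x = 0" using assms test_functionE by metis
  obtain S where S: "\<And>x. x \<notin> cball 0 S \<Longrightarrow> f x = 0" using assms test_functionE by metis
  show ?thesis
    by (rule test_functionI[of _ "cball 0 R \<union> cball 0 S"])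
      (use R S assms in \<open>auto simp: test_function_smooth intro!: smooth_add\<close>)
qed

lemma test_function_diff:
  assumes "test_function \<phi>" "test_function f" shows "test_function (\<lambda>x. \<phi> x - f x)"
proof -
  have "(\<lambda>x. \<phi> x - f x) = (\<lambda>x. \<phi> x + f x * (-1))" by auto
  then show ?thesis
    by (simp only: test_function_add test_function_mult_smooth assms smooth_const)
qed

lemma test_function_affine:
  assumes "test_function \<phi>" "a \<noteq> 0" shows "test_function (\<lambda>x. \<phi> (a *\<^sub>R x + b))"
proof -
  obtain R where R: "R > 0" "\<And>x. x \<notin> cball 0 R \<Longrightarrow> \<phi> x = 0" using assms test_functionE by metis
  show ?thesis
  proof (rule test_functionI)
    show "smooth (\<lambda>x. \<phi> (a *\<^sub>R x + b))" by (intro smooth_affine test_function_smooth assms)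
    show "compact (cball 0 ((R + norm b) / \<bar>a\<bar>) :: (real^'a) set)" by simp
    fix x :: "real^'a" assume "x \<notin> cball 0 ((R + norm b) / \<bar>a\<bar>)"
    then have "R + norm b < \<bar>a\<bar> * norm x" using assms(2) by (simp add: field_simps not_le)
    moreover have "norm (a *\<^sub>R x) \<le> norm (a *\<^sub>R x + b) + norm b"
      using norm_triangle_ineq4[of "a *\<^sub>R x + b" b] by simp
    ultimately have "a *\<^sub>R x + b \<notin> cball 0 R" by (simp add: not_le)
    then show "\<phi> (a *\<^sub>R x + b) = 0" by (rule R)
  qed
qed

lemma smooth_borel: "smooth (f :: real^'n::finite \<Rightarrow> real) \<Longrightarrow> f \<in> borel_measurable borel"
  by (rule borel_measurable_continuous_onI) (rule smooth_continuous)

lemma continuous_compact_support_bounded: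
  fixes f :: "'a::metric_space \<Rightarrow> real"
  assumes "continuous_on UNIV f" "compact K" "\<And>x. x \<notin> K \<Longrightarrow> f x = 0"
  shows "\<exists>B>0. \<forall>x. \<bar>f x\<bar> \<le> B"
proof -
  have "bounded (f ` K)"
    using assms by (intro compact_imp_bounded compact_continuous_image) (auto intro: continuous_on_subset)
  then obtain B where "B > 0" "\<forall>x\<in>K. \<bar>f x\<bar> \<le> B" unfolding bounded_pos by auto
  then show ?thesis using assms(3) by (metis abs_zero less_eq_real_def)
qed

lemma test_function_bounded:
  assumes "test_function \<phi>" shows "\<exists>B>0. \<forall>x. \<bar>\<phi> x\<bar> \<le> B"
proof -
  obtain R where "\<And>x. x \<notin> cball 0 R \<Longrightarrow> \<phi> x = 0" using assms test_functionE by metis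
  then show ?thesis
    by (intro continuous_compact_support_bounded[of _ "cball 0 R"] smooth_continuous test_function_smooth assms) auto
qed

lemma continuous_compact_support_integrable:
  fixes f :: "'a::euclidean_space \<Rightarrow> real"
  assumes "continuous_on UNIV f" "compact K" "\<And>x. x \<notin> K \<Longrightarrow> f x = 0"
  shows "integrable lborel f"
proof -
  have "integrable lborel (\<lambda>x. indicator K x *\<^sub>R f x)"
    by (rule borel_integrable_compact) (use assms in \<open>auto intro: continuous_on_subset\<close>)
  moreover have "(\<lambda>x. indicator K x *\<^sub>R f x) = f" using assms(3) by (auto simp: indicator_def fun_eq_iff)
  ultimately show ?thesis by simp
qed

lemma test_function_integrable:
  assumes "test_function \<phi>" shows "integrable lborel \<phi>"
proof -
  obtain R where "\<And>x. x \<notin> cball 0 R \<Longrightarrow> \<phi> x = 0" using assms test_functionE by metis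
  then show ?thesis
    by (intro continuous_compact_support_integrable[of _ "cball 0 R"] smooth_continuous test_function_smooth assms) auto
qed

section \<open>Normalised mollifiers\<close>

definition mollifier :: "real \<Rightarrow> real^'n::finite \<Rightarrow> real" where
  "mollifier e x = bump (x /\<^sub>R e) / (LINT y|lborel. bump (y /\<^sub>R e :: real^'n))"

lemma
  fixes e :: real
  assumes e: "e > 0"
  shows mollifier_test: "test_function (mollifier e :: real^'n::finite \<Rightarrow> real)"
    and mollifier_nonneg: "mollifier e (x :: real^'n) \<ge> 0"
    and mollifier_zero: "norm (x :: real^'n) \<ge> e \<Longrightarrow> mollifier e x = 0"
    and mollifier_integral: "(LINT x|lborel. mollifier e (x :: real^'n)) = 1"
proof -
  let ?b = "\<lambda>x :: real^'n. bump (x /\<^sub>R e)"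
  have z: "?b x = 0" if "norm x \<ge> e" for x
    using that e by (intro bump_zero) (simp add: field_simps)
  have sm: "smooth ?b" using smooth_affine[OF bump_smooth, of "inverse e" 0] by simp
  have test: "test_function ?b"
    by (rule test_functionI[OF sm compact_cball[of 0 e]]) (use z in auto)
  have int: "integrable lborel ?b" by (rule test_function_integrable[OF test])
  \<comment> \<open>A vanishing integral would force the nonnegative bump to be zero almost
    everywhere, against its positivity on a ball of positive measure.\<close>
  have pos: "(LINT y|lborel. ?b y) > 0"
  proof (rule ccontr)
    assume "\<not> ?thesis"
    then have "(LINT y|lborel. ?b y) = 0"
      using integral_nonneg_AE[of ?b lborel, OF AE_I2[OF bump_nonneg]] by (simp only: not_less order_antisym)
    then have "AE y in lborel. ?b y = 0"
      using integral_nonneg_eq_0_iff_AE[OF int AE_I2[OF bump_nonneg]] by (simp only:)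
    then have "AE y in lborel. y \<notin> ball (0 :: real^'n) e"
    proof eventually_elim
      case (elim y)
      then show ?case using bump_pos[of "y /\<^sub>R e"] e by (auto simp: field_simps)
    qed
    then have "emeasure lborel (ball (0 :: real^'n) e) = 0"
      by (subst (asm) AE_iff_measurable[of "ball 0 e"]) auto
    moreover have "emeasure lborel (ball (0 :: real^'n) e) \<noteq> 0"
      using e by (simp add: emeasure_ball ennreal_eq_0_iff not_le)
    ultimately show False by simp
  qed
  let ?I = "LINT y|lborel. ?b y"
  have eq: "(mollifier e :: real^'n \<Rightarrow> real) = (\<lambda>x. ?b x * inverse ?I)"
    by (simp add: mollifier_def fun_eq_iff divide_inverse)
  show "test_function (mollifier e :: real^'n \<Rightarrow> real)"
    unfolding eq by (rule test_function_mult_smooth[OF test smooth_const])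
  show "mollifier e x \<ge> 0" unfolding eq using pos by (intro mult_nonneg_nonneg bump_nonneg) simp
  show "norm x \<ge> e \<Longrightarrow> mollifier e x = 0" unfolding eq using z by simp
  show "(LINT x|lborel. mollifier e (x :: real^'n)) = 1" unfolding eq using pos by simp
qed

section \<open>Translations, reflections and locally integrable functions\<close>

lemma integral_lborel_translate:
  fixes f :: "'a::euclidean_space \<Rightarrow> 'b::{banach, second_countable_topology}"
  assumes [measurable]: "f \<in> borel_measurable borel"
  shows "(LINT x|lborel. f (x + a)) = (LINT x|lborel. f x)"
    and "integrable lborel (\<lambda>x. f (x + a)) \<longleftrightarrow> integrable lborel f"
  using integral_distr[of "(+) a" lborel borel f] integrable_distr_eq[of "(+) a" lborel borel f]
  by (simp_all add: lborel_distr_plus add.commute)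

lemma lborel_distr_reflect:
  fixes t :: "'a::euclidean_space"
  shows "distr lborel borel (\<lambda>x. t - x) = lborel"
  using lborel_affine[of "-1" t] by (simp add: density_1)

lemma integral_lborel_reflect:
  fixes f :: "'a::euclidean_space \<Rightarrow> 'b::{banach, second_countable_topology}"
  assumes [measurable]: "f \<in> borel_measurable borel"
  shows "(LINT x|lborel. f (a - x)) = (LINT x|lborel. f x)"
    and "integrable lborel (\<lambda>x. f (a - x)) \<longleftrightarrow> integrable lborel f"
  using integral_distr[of "(-) a" lborel borel f] integrable_distr_eq[of "(-) a" lborel borel f]
  by (simp_all add: lborel_distr_reflect)

lemma locally_integrable_borel: "locally_integrable u \<Longrightarrow> u \<in> borel_measurable borel"
  by (simp add: locally_integrable_def)

lemma locally_integrable_indicator: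
  "locally_integrable w \<Longrightarrow> compact K \<Longrightarrow> integrable lborel (\<lambda>x. indicator K x *\<^sub>R w x)"
  by (simp add: locally_integrable_def set_integrable_def)

lemma locally_integrable_mult_bounded:
  fixes w :: "real^'n::finite \<Rightarrow> 'b::euclidean_space"
  assumes "locally_integrable w" "b \<in> borel_measurable borel" "compact K"
    "\<And>x. x \<notin> K \<Longrightarrow> b x = 0" "\<And>x. \<bar>b x\<bar> \<le> B"
  shows "integrable lborel (\<lambda>x. b x *\<^sub>R w x)"
proof (rule Bochner_Integration.integrable_bound)
  show "integrable lborel (\<lambda>x. B * norm (indicator K x *\<^sub>R w x))"
    by (intro integrable_mult_right integrable_norm locally_integrable_indicator assms)
  show "(\<lambda>x. b x *\<^sub>R w x) \<in> borel_measurable lborel"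
    using assms(2) locally_integrable_borel[OF assms(1)] by simp
  show "AE x in lborel. norm (b x *\<^sub>R w x) \<le> norm (B * norm (indicator K x *\<^sub>R w x))"
  proof (rule AE_I2)
    fix x
    show "norm (b x *\<^sub>R w x) \<le> norm (B * norm (indicator K x *\<^sub>R w x))"
    proof (cases "x \<in> K")
      case True
      have "\<bar>b x\<bar> * norm (w x) \<le> \<bar>B\<bar> * norm (w x)"
        using assms(5)[of x] by (intro mult_right_mono) auto
      with True show ?thesis by (simp add: abs_mult)
    qed (simp add: assms(4))
  qed
qed

lemma locally_integrable_test:
  fixes w :: "real^'n::finite \<Rightarrow> 'b::euclidean_space"
  assumes "locally_integrable w" "test_function \<phi>"
  shows "integrable lborel (\<lambda>x. \<phi> x *\<^sub>R w x)"
proof -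
  obtain R where "\<And>x. x \<notin> cball 0 R \<Longrightarrow> \<phi> x = 0" using assms test_functionE by metis
  moreover obtain B where "\<And>x. \<bar>\<phi> x\<bar> \<le> B" using assms test_function_bounded by metis
  ultimately show ?thesis
    by (intro locally_integrable_mult_bounded[OF assms(1) _ compact_cball[of 0 R]] smooth_borel
      test_function_smooth assms(2))
qed

lemma locally_integrable_const [simp]: "locally_integrable (\<lambda>x :: real^'n::finite. c :: 'b::euclidean_space)"
  unfolding locally_integrable_def set_integrable_def
  by (auto intro!: borel_integrable_compact)

section \<open>Compactly supported functions of class C^1\<close>

lemma has_derivative_partials:
  fixes f :: "real^'n::finite \<Rightarrow> real"
  assumes "f differentiable (at x)"
  shows "(f has_derivative (\<lambda>h. \<Sum>i\<in>UNIV. h $ i * partial_derivative i f x)) (at x)"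
proof -
  obtain f' where f': "(f has_derivative f') (at x)" using assms unfolding differentiable_def by blast
  have lin: "linear f'" by (rule has_derivative_linear[OF f'])
  have "f' h = (\<Sum>i\<in>UNIV. h $ i * partial_derivative i f x)" for h
  proof -
    have "f' h = f' (\<Sum>i\<in>UNIV. h $ i *\<^sub>R axis i 1)"
      using basis_expansion[of h] by (simp add: scalar_mult_eq_scaleR)
    also have "\<dots> = (\<Sum>i\<in>UNIV. h $ i * f' (axis i 1))"
      by (simp add: linear_sum[OF lin] linear_cmul[OF lin])
    finally show ?thesis by (simp add: partial_derivative_eq[OF f'])
  qed
  then have "f' = (\<lambda>h. \<Sum>i\<in>UNIV. h $ i * partial_derivative i f x)" by blast
  with f' show ?thesis by simp
qed

text \<open>Two points at distance below 1 either both lie in the ball of radius R + 1, where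
  compactness gives uniform continuity, or both lie outside the ball of radius R, where
  \<open>f\<close> vanishes.\<close>

lemma compact_support_uniformly_continuous:
  fixes f :: "'a::euclidean_space \<Rightarrow> 'b::real_normed_vector"
  assumes "continuous_on UNIV f" "\<And>x. x \<notin> cball 0 R \<Longrightarrow> f x = 0"
  shows "uniformly_continuous_on UNIV f"
proof -
  have uc: "uniformly_continuous_on (cball 0 (R + 1)) f"
    using assms(1) by (intro compact_uniformly_continuous) (auto intro: continuous_on_subset)
  show ?thesis unfolding uniformly_continuous_on_def
  proof (intro allI impI)
    fix e :: real assume "e > 0"
    then obtain d where d: "d > 0" "\<And>x x'. x \<in> cball 0 (R + 1) \<Longrightarrow> x' \<in> cball 0 (R + 1) \<Longrightarrow> dist x' x < d \<Longrightarrow> dist (f x') (f x) < e"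
      using uc unfolding uniformly_continuous_on_def by metis
    have "dist (f x') (f x) < e" if "dist x' x < min d 1" for x x'
    proof (cases "x \<in> cball 0 (R + 1) \<and> x' \<in> cball 0 (R + 1)")
      case False
      have "\<bar>norm x - norm x'\<bar> \<le> dist x' x"
        using norm_triangle_ineq3[of x x'] by (simp add: dist_norm norm_minus_commute)
      with False that have "R < norm x" "R < norm x'" by (auto simp: not_le)
      then have "f x = 0" "f x' = 0" by (auto intro!: assms(2) simp: not_le)
      then show ?thesis using \<open>e > 0\<close> by simp
    qed (use d that in auto)
    then show "\<exists>d>0. \<forall>x\<in>UNIV. \<forall>x'\<in>UNIV. dist x' x < d \<longrightarrow> dist (f x') (f x) < e"
      using d(1) by (intro exI[of _ "min d 1"]) auto
  qed
qed

text \<open>A class wider than test functions, needed for the weak chain rule: there a test function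
  is multiplied by F(u) with F merely of class C^1, and the integral of a derivative of this product
  must still vanish.\<close>

definition C1_compact :: "(real^'n::finite \<Rightarrow> real) \<Rightarrow> bool" where
  "C1_compact \<phi> \<longleftrightarrow> (\<forall>x. \<phi> differentiable (at x)) \<and> (\<forall>i. continuous_on UNIV (partial_derivative i \<phi>)) \<and>
    (\<exists>R. \<forall>x. x \<notin> cball 0 R \<longrightarrow> \<phi> x = 0)"

lemma C1_compact_differentiable: "C1_compact \<phi> \<Longrightarrow> \<phi> differentiable (at x)"
  and C1_compact_continuous_partial: "C1_compact \<phi> \<Longrightarrow> continuous_on A (partial_derivative i \<phi>)"
  unfolding C1_compact_def by (blast, metis continuous_on_subset subset_UNIV)

lemma C1_compact_continuous: "C1_compact \<phi> \<Longrightarrow> continuous_on A \<phi>"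
  by (intro continuous_at_imp_continuous_on ballI differentiable_imp_continuous_within C1_compact_differentiable)

lemma C1_compactE:
  assumes "C1_compact \<phi>"
  obtains R where "\<And>x. x \<notin> cball 0 R \<Longrightarrow> \<phi> x = 0" "\<And>i x. x \<notin> cball 0 R \<Longrightarrow> partial_derivative i \<phi> x = 0"
proof -
  obtain R where R: "\<And>x. x \<notin> cball 0 R \<Longrightarrow> \<phi> x = 0" using assms unfolding C1_compact_def by blast
  show thesis by (rule that[OF R partial_derivative_zero[OF closed_cball R]])
qed

lemma test_function_C1_compact: "test_function \<phi> \<Longrightarrow> C1_compact \<phi>"
  unfolding C1_compact_def
  by (metis test_functionE test_function_smooth smooth_differentiable smooth_continuous smooth_partial_derivative)

text \<open>The mean value theorem on the segment from z to z + h, with uniform continuity of the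
  partial derivatives. The point is that \<open>d\<close> does not depend on z, so the remainder can
  be integrated under a convolution.\<close>

lemma C1_compact_taylor:
  fixes \<phi> :: "real^'n::finite \<Rightarrow> real"
  assumes "C1_compact \<phi>" "e > 0"
  shows "\<exists>d>0. \<forall>z h. norm h < d \<longrightarrow>
    \<bar>\<phi> (z + h) - \<phi> z - (\<Sum>i\<in>UNIV. h $ i * partial_derivative i \<phi> z)\<bar> \<le> e * norm h"
proof -
  let ?D = "\<lambda>i. partial_derivative i \<phi>"
  define e' where "e' = e / real CARD('n)"
  have e': "e' > 0" using assms(2) by (simp add: e'_def)
  obtain R where R: "\<And>i x. x \<notin> cball 0 R \<Longrightarrow> ?D i x = 0" using C1_compactE[OF assms(1)] by metis
  have "\<exists>d>0. \<forall>x x'. dist x' x < d \<longrightarrow> dist (?D i x') (?D i x) < e'" for i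
  proof -
    have "uniformly_continuous_on UNIV (?D i)"
      by (rule compact_support_uniformly_continuous)
        (use R C1_compact_continuous_partial[OF assms(1)] in auto)
    then show ?thesis using e' unfolding uniformly_continuous_on_def by auto
  qed
  then obtain d where d: "\<And>i. d i > 0" "\<And>i x x'. dist x' x < d i \<Longrightarrow> \<bar>?D i x' - ?D i x\<bar> < e'"
    unfolding dist_real_def by metis
  define d0 where "d0 = Min (range d)"
  have d0: "d0 > 0" "\<And>i. d0 \<le> d i" using d(1) by (auto simp: d0_def)
  have diff: "(\<phi> has_derivative (\<lambda>h. \<Sum>i\<in>UNIV. h $ i * ?D i x)) (at x)" for x
    by (intro has_derivative_partials C1_compact_differentiable assms)
  have "\<bar>\<phi> (z + h) - \<phi> z - (\<Sum>i\<in>UNIV. h $ i * ?D i z)\<bar> \<le> e * norm h" if h: "norm h < d0" for z h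
  proof -
    have "((\<lambda>t. \<phi> (z + t *\<^sub>R h)) has_real_derivative (\<Sum>i\<in>UNIV. h $ i * ?D i (z + t *\<^sub>R h))) (at t)" for t
    proof -
      have "((\<lambda>t. z + t *\<^sub>R h) has_derivative (\<lambda>s. s *\<^sub>R h)) (at t)"
        by (auto intro!: derivative_eq_intros)
      from has_derivative_compose[OF this diff]
      show ?thesis unfolding has_field_derivative_def
        by (rule has_derivative_eq_rhs) (simp add: fun_eq_iff sum_distrib_left mult_ac)
    qed
    from MVT2[of 0 1, OF _ this] obtain t where t: "0 < t" "t < 1"
      "\<phi> (z + h) - \<phi> z = (\<Sum>i\<in>UNIV. h $ i * ?D i (z + t *\<^sub>R h))" by auto
    have "\<bar>\<phi> (z + h) - \<phi> z - (\<Sum>i\<in>UNIV. h $ i * ?D i z)\<bar> = \<bar>\<Sum>i\<in>UNIV. h $ i * (?D i (z + t *\<^sub>R h) - ?D i z)\<bar>"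
      by (simp add: t(3) right_diff_distrib sum_subtractf)
    also have "\<dots> \<le> (\<Sum>i\<in>UNIV. \<bar>h $ i * (?D i (z + t *\<^sub>R h) - ?D i z)\<bar>)" by (rule sum_abs)
    also have "\<dots> \<le> (\<Sum>i\<in>(UNIV :: 'n set). norm h * e')"
    proof (rule sum_mono)
      fix i
      have "dist (z + t *\<^sub>R h) z = t * norm h" using t by (simp add: dist_norm)
      also have "\<dots> \<le> norm h" using t by (simp add: mult_left_le_one_le)
      finally have "dist (z + t *\<^sub>R h) z < d i" using h d0(2)[of i] by linarith
      from d(2)[OF this] component_le_norm_cart[of h i]
      show "\<bar>h $ i * (?D i (z + t *\<^sub>R h) - ?D i z)\<bar> \<le> norm h * e'"
        unfolding abs_mult by (intro mult_mono) auto
    qed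
    also have "\<dots> = e * norm h" by (simp add: e'_def)
    finally show ?thesis .
  qed
  then show ?thesis using d0(1) by blast
qed

subsection \<open>Convolution with test functions\<close>

definition convolve :: "(real^'n::finite \<Rightarrow> real) \<Rightarrow> (real^'n \<Rightarrow> real) \<Rightarrow> real^'n \<Rightarrow> real" where
  "convolve \<phi> w x = (LINT y|lborel. \<phi> (x - y) * w y)"

lemma test_function_reflect: "test_function \<phi> \<Longrightarrow> test_function (\<lambda>y. \<phi> (x - y))"
  using test_function_affine[of \<phi> "-1" x] by (simp add: algebra_simps)

lemma convolve_integrable_continuous:
  fixes w :: "real^'n::finite \<Rightarrow> real"
  assumes w: "locally_integrable w" and c: "continuous_on UNIV \<phi>" and z: "\<And>x. x \<notin> cball 0 R \<Longrightarrow> \<phi> x = 0"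
  shows "integrable lborel (\<lambda>y. \<phi> (x - y) * w y)"
proof -
  obtain B where B: "\<And>x. \<bar>\<phi> x\<bar> \<le> B"
    using continuous_compact_support_bounded[OF c compact_cball z] by metis
  have [measurable]: "\<phi> \<in> borel_measurable borel" using c by (rule borel_measurable_continuous_onI)
  have "(\<lambda>y. \<phi> (x - y)) \<in> borel_measurable borel" by measurable
  moreover have "\<phi> (x - y) = 0" if "y \<notin> cball x R" for y
    by (rule z) (use that in \<open>simp only: mem_cball dist_norm diff_0 norm_minus_cancel not_False_eq_True\<close>)
  ultimately have "integrable lborel (\<lambda>y. \<phi> (x - y) *\<^sub>R w y)"
    by (intro locally_integrable_mult_bounded[OF w _ compact_cball _ B])
  then show ?thesis by simp
qed

lemma convolve_integrable:
  fixes w :: "real^'n::finite \<Rightarrow> real"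
  assumes "locally_integrable w" "test_function \<phi>"
  shows "integrable lborel (\<lambda>y. \<phi> (x - y) * w y)"
  using locally_integrable_test[OF assms(1) test_function_reflect[OF assms(2)]] by simp

text \<open>The uniform Taylor remainder is integrated against |w|. For increments below 1 it is
  supported in one fixed compact ball, on which w is integrable.\<close>

lemma convolve_has_derivative:
  fixes w :: "real^'n::finite \<Rightarrow> real"
  assumes w: "locally_integrable w" and \<phi>: "C1_compact \<phi>"
  shows "(convolve \<phi> w has_derivative (\<lambda>h. \<Sum>i\<in>UNIV. h $ i * convolve (partial_derivative i \<phi>) w x)) (at x)"
  unfolding has_derivative_at_alt
proof (intro conjI allI impI)
  let ?D = "\<lambda>i. partial_derivative i \<phi>"
  obtain R where R: "\<And>x. x \<notin> cball 0 R \<Longrightarrow> \<phi> x = 0" "\<And>i x. x \<notin> cball 0 R \<Longrightarrow> ?D i x = 0"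
    using C1_compactE[OF \<phi>] by metis
  have int: "integrable lborel (\<lambda>y. ?D i (x - y) * w y)" for i x
    by (rule convolve_integrable_continuous[OF w C1_compact_continuous_partial[OF \<phi>] R(2)])
  have int0: "integrable lborel (\<lambda>y. \<phi> (x - y) * w y)" for x
    by (rule convolve_integrable_continuous[OF w C1_compact_continuous[OF \<phi>] R(1)])
  show "bounded_linear (\<lambda>h. \<Sum>i\<in>UNIV. h $ i * convolve (?D i) w x)"
    by (intro bounded_linear_sum bounded_linear_mult_const bounded_linear_vec_nth)
  fix e :: real assume e: "e > 0"
  let ?K = "cball x (R + 1)"
  define C where "C = (LINT y|lborel. indicator ?K y * \<bar>w y\<bar>)"
  have intK: "integrable lborel (\<lambda>y. indicator ?K y * \<bar>w y\<bar>)"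
  proof -
    have "integrable lborel (\<lambda>y. \<bar>indicator ?K y *\<^sub>R w y\<bar>)"
      by (rule integrable_abs[OF locally_integrable_indicator[OF w compact_cball]])
    moreover have "indicator ?K y * \<bar>w y\<bar> = \<bar>indicator ?K y *\<^sub>R w y\<bar>" for y
      by (simp add: indicator_def)
    ultimately show ?thesis by (simp only:)
  qed
  have C: "C \<ge> 0" unfolding C_def by (intro integral_nonneg_AE) auto
  \<comment> \<open>Chosen so that \<open>e' * C \<le> e\<close>; the added 1 covers the case where
    w vanishes almost everywhere on the ball.\<close>
  define e' where "e' = e / (C + 1)"
  have e': "e' > 0" using e C by (simp add: e'_def)
  obtain d where d: "d > 0" "\<And>z h. norm h < d \<Longrightarrow>
    \<bar>\<phi> (z + h) - \<phi> z - (\<Sum>i\<in>UNIV. h $ i * ?D i z)\<bar> \<le> e' * norm h"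
    using C1_compact_taylor[OF \<phi> e'] by metis
  show "\<exists>d>0. \<forall>y. norm (y - x) < d \<longrightarrow> norm (convolve \<phi> w y - convolve \<phi> w x -
      (\<Sum>i\<in>UNIV. (y - x) $ i * convolve (?D i) w x)) \<le> e * norm (y - x)"
  proof (intro exI[of _ "min d 1"] conjI allI impI)
    show "0 < min d 1" using d(1) by simp
    fix z assume z: "norm (z - x) < min d 1"
    define h where "h = z - x"
    let ?r = "\<lambda>y. \<phi> (x - y + h) - \<phi> (x - y) - (\<Sum>i\<in>UNIV. h $ i * ?D i (x - y))"
    have bound: "\<bar>?r y\<bar> \<le> e' * norm h * indicator ?K y" for y
    proof (cases "y \<in> ?K")
      case True
      then show ?thesis using d(2)[of h "x - y"] z by (simp add: h_def)
    next
      case False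
      then have n: "norm (x - y) > R + 1" by (simp add: dist_norm)
      have "norm (x - y) \<le> norm (x - y + h) + norm h"
        using norm_triangle_ineq4[of "x - y + h" h] by simp
      with n z have "norm (x - y + h) > R" unfolding h_def by linarith
      with n have "\<phi> (x - y + h) = 0" "\<phi> (x - y) = 0" "?D i (x - y) = 0" for i
        using R by (auto simp: not_le)
      with False show ?thesis by simp
    qed
    have "convolve \<phi> w z - convolve \<phi> w x - (\<Sum>i\<in>UNIV. h $ i * convolve (?D i) w x)
      = (LINT y|lborel. ?r y * w y)"
    proof -
      have "(LINT y|lborel. ?r y * w y) = (LINT y|lborel. \<phi> (z - y) * w y - \<phi> (x - y) * w y
        - (\<Sum>i\<in>UNIV. h $ i * (?D i (x - y) * w y)))"
        by (intro Bochner_Integration.integral_cong refl)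
          (simp add: h_def algebra_simps sum_distrib_left sum_distrib_right)
      also have "\<dots> = convolve \<phi> w z - convolve \<phi> w x - (\<Sum>i\<in>UNIV. h $ i * convolve (?D i) w x)"
        unfolding convolve_def
        by (simp add: Bochner_Integration.integral_diff Bochner_Integration.integral_sum
            Bochner_Integration.integrable_diff Bochner_Integration.integrable_sum
            integrable_mult_right int0 int)
      finally show ?thesis by simp
    qed
    also have "norm \<dots> \<le> (LINT y|lborel. (e' * norm h) * (indicator ?K y * \<bar>w y\<bar>))"
    proof (rule Bochner_Integration.integral_norm_bound_integral)
      show "integrable lborel (\<lambda>y. (e' * norm h) * (indicator ?K y * \<bar>w y\<bar>))"
        using intK by simp
      show "norm (?r y * w y) \<le> (e' * norm h) * (indicator ?K y * \<bar>w y\<bar>)" for y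
        using mult_right_mono[OF bound[of y], of "\<bar>w y\<bar>"] by (simp add: abs_mult mult_ac)
      have "integrable lborel (\<lambda>y. \<phi> (z - y) * w y - \<phi> (x - y) * w y
        - (\<Sum>i\<in>UNIV. h $ i * (?D i (x - y) * w y)))"
        by (intro Bochner_Integration.integrable_diff Bochner_Integration.integrable_sum integrable_mult_right int0 int)
      then show "integrable lborel (\<lambda>y. ?r y * w y)"
        by (rule back_subst[where P="integrable lborel"])
          (simp add: fun_eq_iff h_def algebra_simps sum_distrib_left sum_distrib_right)
    qed
    also have "\<dots> = e' * norm h * C" by (simp add: C_def)
    also have "\<dots> \<le> e * norm h"
    proof -
      have "e' * C \<le> e" using e C by (simp add: e'_def field_simps)
      then have "e' * C * norm h \<le> e * norm h" by (intro mult_right_mono) auto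
      then show ?thesis by (simp add: mult_ac)
    qed
    finally show "norm (convolve \<phi> w z - convolve \<phi> w x - (\<Sum>i\<in>UNIV. (z - x) $ i * convolve (?D i) w x)) \<le> e * norm (z - x)"
      by (simp add: h_def)
  qed
qed

lemma convolve_partial_derivative:
  assumes "locally_integrable w" "C1_compact \<phi>"
  shows "partial_derivative i (convolve \<phi> w) = convolve (partial_derivative i \<phi>) w"
proof
  fix x
  have "partial_derivative i (convolve \<phi> w) x = (\<Sum>j\<in>UNIV. axis i 1 $ j * convolve (partial_derivative j \<phi>) w x)"
    by (rule partial_derivative_eq[OF convolve_has_derivative[OF assms]])
  also have "\<dots> = (\<Sum>j\<in>UNIV. if j = i then convolve (partial_derivative j \<phi>) w x else 0)"
    by (intro sum.cong refl) (simp add: axis_def)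
  finally show "partial_derivative i (convolve \<phi> w) x = convolve (partial_derivative i \<phi>) w x" by simp
qed

lemma convolve_smooth:
  assumes "locally_integrable w" "test_function \<phi>"
  shows "smooth (convolve \<phi> w)"
proof (rule smooth_coinduct)
  show "convolve \<phi> w \<in> {convolve \<psi> w |\<psi>. test_function \<psi>}" using assms(2) by blast
  fix g :: "real^'a \<Rightarrow> real" and x :: "real^'a" and i :: 'a
  assume "g \<in> {convolve \<psi> w |\<psi>. test_function \<psi>}"
  then obtain \<psi> where g: "g = convolve \<psi> w" "test_function \<psi>" by blast
  show "g differentiable (at x)"
    unfolding g by (rule differentiableI[OF convolve_has_derivative[OF assms(1) test_function_C1_compact[OF g(2)]]])
  show "partial_derivative i g \<in> {convolve \<psi> w |\<psi>. test_function \<psi>}"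
    unfolding g convolve_partial_derivative[OF assms(1) test_function_C1_compact[OF g(2)]]
    using test_function_partial_derivative[OF g(2)] by blast
qed

text \<open>The derivative of the constant function \<open>convolve \<phi> (\<lambda>x. 1)\<close> is computed in two ways.\<close>

lemma integral_partial_derivative:
  assumes "C1_compact \<phi>"
  shows "(LINT x|lborel. partial_derivative i \<phi> x) = 0"
proof -
  have c: "convolve \<psi> (\<lambda>x. 1) x = (LINT x|lborel. \<psi> x)" if "continuous_on UNIV \<psi>" for \<psi> :: "real^'a \<Rightarrow> real" and x
    using integral_lborel_reflect(1)[OF borel_measurable_continuous_onI[OF that], of x]
    by (simp add: convolve_def)
  have "(LINT x|lborel. partial_derivative i \<phi> x) = convolve (partial_derivative i \<phi>) (\<lambda>x. 1) 0"
    using c[OF C1_compact_continuous_partial[OF assms]] by simp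
  also have "\<dots> = partial_derivative i (convolve \<phi> (\<lambda>x. 1)) 0"
    by (simp add: convolve_partial_derivative[OF locally_integrable_const assms])
  also have "\<dots> = partial_derivative i (\<lambda>x. LINT x|lborel. \<phi> x) 0"
  proof -
    have "convolve \<phi> (\<lambda>x. 1) = (\<lambda>x. LINT x|lborel. \<phi> x)" using c[OF C1_compact_continuous[OF assms]] by blast
    then show ?thesis by simp
  qed
  finally show ?thesis by simp
qed

subsection \<open>Continuity of translations and convergence of mollifications\<close>

text \<open>A point of an open set stays in it under small translations, so dominated convergence
  handles the part of U that is left. For indicator values, |a - b| = a - b + 2 b (1 - a), and
  translation invariance cancels the integrals of a and b, which accounts for the part that is
  entered.\<close>

lemma translation_L1_open:
  fixes U :: "'a::euclidean_space set"
  assumes "open U" "emeasure lborel U < \<infinity>" "h \<longlonglongrightarrow> 0"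
  shows "(\<lambda>k. LINT x|lborel. \<bar>indicator U (x - h k) - indicator U x\<bar>) \<longlonglongrightarrow> (0 :: real)"
proof -
  let ?u = "indicator U :: 'a \<Rightarrow> real"
  have [measurable]: "U \<in> sets borel" using assms(1) by simp
  have int: "integrable lborel ?u" using assms by (simp add: integrable_indicator_iff)
  have tr: "(LINT x|lborel. ?u (x - a)) = (LINT x|lborel. ?u x)" "integrable lborel (\<lambda>x. ?u (x - a))" for a
    using integral_lborel_translate[of ?u "-a"] int by simp_all
  have int2: "integrable lborel (\<lambda>x. ?u x * (1 - ?u (x - a)))" for a
    by (rule Bochner_Integration.integrable_bound[OF int]) (auto simp: indicator_def)
  have "(\<lambda>k. LINT x|lborel. ?u x * (1 - ?u (x - h k))) \<longlonglongrightarrow> (LINT x|(lborel :: 'a measure). 0)"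
  proof (rule integral_dominated_convergence[where w="?u"])
    show "AE x in lborel. (\<lambda>k. ?u x * (1 - ?u (x - h k))) \<longlonglongrightarrow> 0"
    proof (rule AE_I2)
      fix x
      show "(\<lambda>k. ?u x * (1 - ?u (x - h k))) \<longlonglongrightarrow> 0"
      proof (cases "x \<in> U")
        case True
        have "(\<lambda>k. x - h k) \<longlonglongrightarrow> x - 0" by (intro tendsto_intros assms)
        then have "\<forall>\<^sub>F k in sequentially. x - h k \<in> U"
          using topological_tendstoD[of _ x sequentially U] assms(1) True by simp
        show ?thesis
        proof (intro Lim_transform_eventually[OF tendsto_const])
          show "\<forall>\<^sub>F k in sequentially. 0 = ?u x * (1 - ?u (x - h k))"
            using \<open>\<forall>\<^sub>F k in sequentially. x - h k \<in> U\<close> by (rule eventually_mono) simp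
        qed
      qed simp
    qed
  qed (use int in \<open>auto simp: indicator_def\<close>)
  then have lim: "(\<lambda>k. 2 * (LINT x|lborel. ?u x * (1 - ?u (x - h k)))) \<longlonglongrightarrow> 0"
    using tendsto_mult_right_zero by auto
  have "(LINT x|lborel. \<bar>?u (x - h k) - ?u x\<bar>) = 2 * (LINT x|lborel. ?u x * (1 - ?u (x - h k)))" for k
  proof -
    have "(LINT x|lborel. \<bar>?u (x - h k) - ?u x\<bar>)
      = (LINT x|lborel. ?u (x - h k) - ?u x + 2 * (?u x * (1 - ?u (x - h k))))"
      by (intro Bochner_Integration.integral_cong refl) (auto simp: indicator_def)
    also have "\<dots> = 2 * (LINT x|lborel. ?u x * (1 - ?u (x - h k)))"
      using int int2 tr by simp
    finally show ?thesis .
  qed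
  with lim show ?thesis by simp
qed

text \<open>Induction over integrable functions: indicators are compared with open sets by outer
  regularity, and sums and dominated limits pass through the triangle inequality.\<close>

lemma translation_L1:
  fixes f :: "'a::euclidean_space \<Rightarrow> real"
  assumes "integrable lborel f" "h \<longlonglongrightarrow> 0"
  shows "(\<lambda>k. LINT x|lborel. \<bar>f (x - h k) - f x\<bar>) \<longlonglongrightarrow> 0"
  using assms(1)
proof (induction rule: integrable_induct)
  case (base A c)
  let ?i = "\<lambda>A. indicator A :: 'a \<Rightarrow> real"
  have [measurable]: "A \<in> sets borel" using base by simp
  have iA: "integrable lborel (?i A)" using base by (simp add: integrable_indicator_iff)
  have "(\<lambda>k. LINT x|lborel. \<bar>?i A (x - h k) - ?i A x\<bar>) \<longlonglongrightarrow> 0"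
  proof (rule LIMSEQ_I)
    fix e :: real assume e: "e > 0"
    \<comment> \<open>The remainder U - A is paid for twice, once translated and once in place, so
      e/4 leaves e/2 for the open set itself.\<close>
    obtain U where U: "open U" "A \<subseteq> U" "emeasure lborel (U - A) < ennreal (e / 4)"
      using outer_regular_lborel[of A "e / 4"] e by auto
    have [measurable]: "U \<in> sets borel" using U by simp
    have "emeasure lborel U \<le> emeasure lborel A + emeasure lborel (U - A)"
      using U(2) by (metis Un_Diff_cancel2 \<open>A \<in> sets borel\<close> \<open>U \<in> sets borel\<close> emeasure_subadditive
          sets.Diff sets_lborel sup.absorb_iff1 sup_commute)
    also have "\<dots> < \<infinity>" using base U(3) by (simp add: less_top[symmetric] ennreal_add_eq_top) (metis ennreal_less_top less_trans top.not_eq_extremum)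
    finally have fU: "emeasure lborel U < \<infinity>" .
    have iD: "integrable lborel (?i (U - A))"
      using U(3) by (simp add: integrable_indicator_iff less_trans[OF _ ennreal_less_top])
    have mD: "(LINT x|lborel. ?i (U - A) x) < e / 4"
    proof -
      have "emeasure lborel (U - A) = ennreal (measure lborel (U - A))"
        using U(3) by (intro emeasure_eq_ennreal_measure) (metis ennreal_less_top less_trans top.not_eq_extremum)
      with U(3) have "measure lborel (U - A) < e / 4" by (simp add: ennreal_less_iff)
      then show ?thesis by simp
    qed
    have iU: "integrable lborel (?i U)" using fU by (simp add: integrable_indicator_iff)
    obtain N where N: "\<And>k. k \<ge> N \<Longrightarrow> (LINT x|lborel. \<bar>?i U (x - h k) - ?i U x\<bar>) < e / 2"
      using LIMSEQ_D[OF translation_L1_open[OF U(1) fU assms(2)], of "e / 2"] e by fastforce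
    have tr: "integrable lborel (\<lambda>x. ?i B (x - a))" "(LINT x|lborel. ?i B (x - a)) = (LINT x|lborel. ?i B x)"
      if "integrable lborel (?i B)" "B \<in> sets borel" for B a
      using integral_lborel_translate[of "?i B" "-a"] that by simp_all
    have "(LINT x|lborel. \<bar>?i A (x - h k) - ?i A x\<bar>) < e" if k: "k \<ge> N" for k
    proof -
      have "(LINT x|lborel. \<bar>?i A (x - h k) - ?i A x\<bar>)
        \<le> (LINT x|lborel. \<bar>?i U (x - h k) - ?i U x\<bar> + (?i (U - A) (x - h k) + ?i (U - A) x))"
      proof (rule integral_mono)
        show "\<bar>?i A (x - h k) - ?i A x\<bar> \<le> \<bar>?i U (x - h k) - ?i U x\<bar> + (?i (U - A) (x - h k) + ?i (U - A) x)" for x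
          using U(2) by (auto simp: indicator_def)
      qed (simp_all add: iA iU iD tr)
      also have "\<dots> = (LINT x|lborel. \<bar>?i U (x - h k) - ?i U x\<bar>) + 2 * (LINT x|lborel. ?i (U - A) x)"
        using iU iD tr[OF iU] tr[OF iD] by simp
      also have "\<dots> < e" using N[OF k] mD by simp
      finally show ?thesis .
    qed
    then show "\<exists>N. \<forall>k\<ge>N. norm ((LINT x|lborel. \<bar>?i A (x - h k) - ?i A x\<bar>) - 0) < e"
      by (intro exI[of _ N]) (auto intro!: integral_nonneg_AE simp: abs_of_nonneg)
  qed
  from tendsto_mult_left[OF this, of "\<bar>c\<bar>"]
  show ?case
    by (simp add: abs_mult[symmetric] right_diff_distrib' mult.commute flip: integral_mult_right_zero)
next
  case (add f g)
  note int = add.hyps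
  have tr: "integrable lborel (\<lambda>x. \<bar>f (x - a) - f x\<bar>)" if "integrable lborel f" for f :: "'a \<Rightarrow> real" and a
    using integral_lborel_translate(2)[of f "-a"] that by (auto intro!: integrable_abs)
  show ?case
  proof (rule tendsto_sandwich[OF _ _ tendsto_const])
    show "(\<lambda>k. (LINT x|lborel. \<bar>f (x - h k) - f x\<bar>) + (LINT x|lborel. \<bar>g (x - h k) - g x\<bar>)) \<longlonglongrightarrow> 0"
      using tendsto_add[OF add.IH] by simp
    have "(LINT x|lborel. \<bar>f (x - h k) + g (x - h k) - (f x + g x)\<bar>)
      \<le> (LINT x|lborel. \<bar>f (x - h k) - f x\<bar> + \<bar>g (x - h k) - g x\<bar>)" for k
      using int tr[of "\<lambda>x. f x + g x" "h k"] tr[of f "h k"] tr[of g "h k"]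
      by (intro integral_mono) auto
    then show "\<forall>\<^sub>F k in sequentially. (LINT x|lborel. \<bar>f (x - h k) + g (x - h k) - (f x + g x)\<bar>)
      \<le> (LINT x|lborel. \<bar>f (x - h k) - f x\<bar>) + (LINT x|lborel. \<bar>g (x - h k) - g x\<bar>)"
      using tr int by simp
  qed (auto intro!: always_eventually integral_nonneg_AE)
next
  case (lim f s)
  have tr: "integrable lborel (\<lambda>x. \<bar>f (x - a) - f x\<bar>)" if "integrable lborel f" for f :: "'a \<Rightarrow> real" and a
    using integral_lborel_translate(2)[of f "-a"] that by (auto intro!: integrable_abs)
  \<comment> \<open>The approximants of the induction rule satisfy |s i| \<le> 2 |f|, hence the
    dominating function 3 |f|.\<close>
  have "(\<lambda>i. LINT x|lborel. \<bar>f x - s i x\<bar>) \<longlonglongrightarrow> (LINT x|(lborel :: 'a measure). 0)"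
  proof (rule integral_dominated_convergence[where w="\<lambda>x. 3 * \<bar>f x\<bar>"])
    show "AE x in lborel. (\<lambda>i. \<bar>f x - s i x\<bar>) \<longlonglongrightarrow> 0"
      using lim(2) by (auto intro!: AE_I2 tendsto_eq_intros)
    show "AE x in lborel. norm \<bar>f x - s i x\<bar> \<le> 3 * \<bar>f x\<bar>" for i
      using lim(3)[of _ i] by (intro AE_I2) (simp add: abs_diff_le_iff, smt (verit))
  qed (use lim in \<open>auto intro: borel_measurable_integrable\<close>)
  then have L: "(\<lambda>i. LINT x|lborel. \<bar>f x - s i x\<bar>) \<longlonglongrightarrow> 0" by simp
  show ?case
  proof (rule LIMSEQ_I)
    fix e :: real assume e: "e > 0"
    obtain i where i: "(LINT x|lborel. \<bar>f x - s i x\<bar>) < e / 4"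
      using LIMSEQ_D[OF L, of "e / 4"] e by fastforce
    obtain N where N: "\<And>k. k \<ge> N \<Longrightarrow> (LINT x|lborel. \<bar>s i (x - h k) - s i x\<bar>) < e / 2"
      using LIMSEQ_D[OF lim(5)[of i], of "e / 2"] e by fastforce
    have id: "integrable lborel (\<lambda>x. \<bar>f x - s i x\<bar>)" using lim by (auto intro!: integrable_abs)
    have tr2: "integrable lborel (\<lambda>x. \<bar>f (x - a) - s i (x - a)\<bar>)"
      "(LINT x|lborel. \<bar>f (x - a) - s i (x - a)\<bar>) = (LINT x|lborel. \<bar>f x - s i x\<bar>)" for a
      using integral_lborel_translate[of "\<lambda>x. \<bar>f x - s i x\<bar>" "-a"] id borel_measurable_integrable[OF id]
      by simp_all
    have "(LINT x|lborel. \<bar>f (x - h k) - f x\<bar>) < e" if k: "k \<ge> N" for k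
    proof -
      have "(LINT x|lborel. \<bar>f (x - h k) - f x\<bar>)
        \<le> (LINT x|lborel. \<bar>s i (x - h k) - s i x\<bar> + (\<bar>f (x - h k) - s i (x - h k)\<bar> + \<bar>f x - s i x\<bar>))"
        by (rule integral_mono)
          (use tr[OF lim(4)] tr[OF lim(1)] tr2 id in \<open>auto intro!: Bochner_Integration.integrable_add\<close>)
      also have "\<dots> = (LINT x|lborel. \<bar>s i (x - h k) - s i x\<bar>) + 2 * (LINT x|lborel. \<bar>f x - s i x\<bar>)"
        using tr[OF lim(1)] tr2 id by simp
      also have "\<dots> < e" using N[OF k] i by simp
      finally show ?thesis .
    qed
    then show "\<exists>N. \<forall>k\<ge>N. norm ((LINT x|lborel. \<bar>f (x - h k) - f x\<bar>) - 0) < e"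
      by (intro exI[of _ N]) (auto intro!: integral_nonneg_AE simp: abs_of_nonneg)
  qed
qed

lemma square_sum3_le: "(x + y + z :: real)\<^sup>2 \<le> 3 * x\<^sup>2 + 3 * y\<^sup>2 + 3 * z\<^sup>2"
proof -
  have "3 * x\<^sup>2 + 3 * y\<^sup>2 + 3 * z\<^sup>2 - (x + y + z)\<^sup>2 = (x - y)\<^sup>2 + (y - z)\<^sup>2 + (x - z)\<^sup>2"
    by (simp add: power2_eq_square algebra_simps)
  then show ?thesis by (smt (verit) zero_le_power2)
qed

text \<open>Reduction to L^1 by truncation: for values in [-M, M] the squared difference is at most
  2 M times the absolute difference, while the truncation error tends to 0 in L^2 by dominated
  convergence.\<close>

lemma translation_L2:
  fixes f :: "'a::euclidean_space \<Rightarrow> real"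
  assumes f: "integrable lborel f" and f2: "integrable lborel (\<lambda>x. (f x)\<^sup>2)" and h: "h \<longlonglongrightarrow> 0"
  shows "(\<lambda>k. LINT x|lborel. (f (x - h k) - f x)\<^sup>2) \<longlonglongrightarrow> 0"
proof -
  have [measurable]: "f \<in> borel_measurable borel" using borel_measurable_integrable[OF f] by simp
  define g where "g = (\<lambda>M x. max (- M) (min M (f x)))"
  have [measurable]: "g M \<in> borel_measurable borel" for M unfolding g_def by measurable
  have g1: "\<bar>g M x\<bar> \<le> \<bar>f x\<bar>" "\<bar>f x - g M x\<bar> \<le> \<bar>f x\<bar>" "\<bar>g M x\<bar> \<le> M" if "M \<ge> 0" for M x
    using that unfolding g_def by auto
  have ig: "integrable lborel (g M)" if "M \<ge> 0" for M
    by (rule Bochner_Integration.integrable_bound[OF f]) (use g1[OF that] in auto)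
  have ir: "integrable lborel (\<lambda>x. (f x - g M x)\<^sup>2)" if "M \<ge> 0" for M
    by (rule Bochner_Integration.integrable_bound[OF f2])
      (use g1[OF that] in \<open>auto simp: power2_le_iff_abs_le abs_le_square_iff[symmetric]\<close>)
  have "(\<lambda>i. LINT x|lborel. (f x - g (real i) x)\<^sup>2) \<longlonglongrightarrow> (LINT x|(lborel :: 'a measure). 0)"
  proof (rule integral_dominated_convergence[where w="\<lambda>x. (f x)\<^sup>2"])
    show "AE x in lborel. (\<lambda>i. (f x - g (real i) x)\<^sup>2) \<longlonglongrightarrow> 0"
    proof (rule AE_I2)
      fix x
      obtain N :: nat where "\<bar>f x\<bar> \<le> real N" using real_arch_simple by blast
      then have "\<forall>i\<ge>N. 0 = (f x - g (real i) x)\<^sup>2" unfolding g_def by (auto simp: max_def min_def)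
      then show "(\<lambda>i. (f x - g (real i) x)\<^sup>2) \<longlonglongrightarrow> 0"
        by (intro Lim_transform_eventually[OF tendsto_const]) (auto simp: eventually_sequentially)
    qed
    show "AE x in lborel. norm ((f x - g (real i) x)\<^sup>2) \<le> (f x)\<^sup>2" for i
      using g1(2)[of "real i"] by (auto intro!: AE_I2 simp: abs_le_square_iff[symmetric])
  qed (use f2 in auto)
  then have L: "(\<lambda>i. LINT x|lborel. (f x - g (real i) x)\<^sup>2) \<longlonglongrightarrow> 0" by simp
  have if2: "integrable lborel (\<lambda>x. (f (x - a) - f x)\<^sup>2)" for a
  proof (rule Bochner_Integration.integrable_bound)
    show "integrable lborel (\<lambda>x. 2 * (f (x - a))\<^sup>2 + 2 * (f x)\<^sup>2)"
      using f2 integral_lborel_translate(2)[of "\<lambda>x. (f x)\<^sup>2" "-a"] by simp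
    show "AE x in lborel. norm ((f (x - a) - f x)\<^sup>2) \<le> norm (2 * (f (x - a))\<^sup>2 + 2 * (f x)\<^sup>2)"
    proof (rule AE_I2)
      fix x
      have "(f (x - a) - f x)\<^sup>2 \<le> 2 * (f (x - a))\<^sup>2 + 2 * (f x)\<^sup>2"
        using zero_le_power2[of "f (x - a) + f x"] by (simp add: power2_sum power2_diff)
      then show "norm ((f (x - a) - f x)\<^sup>2) \<le> norm (2 * (f (x - a))\<^sup>2 + 2 * (f x)\<^sup>2)" by simp
    qed
  qed measurable
  show ?thesis
  proof (rule LIMSEQ_I)
    fix e :: real assume e: "e > 0"
    \<comment> \<open>The truncation error occurs with factor 3 for each of the two arguments, in
      total 6 e/12 = e/2; the factor 6 M of the other term is 3 times 2 M.\<close>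
    obtain i where i: "(LINT x|lborel. (f x - g (real i) x)\<^sup>2) < e / 12"
      using LIMSEQ_D[OF L, of "e / 12"] e by fastforce
    define M where "M = real i"
    have M: "M \<ge> 0" by (simp add: M_def)
    have "(\<lambda>k. 6 * M * (LINT x|lborel. \<bar>g M (x - h k) - g M x\<bar>)) \<longlonglongrightarrow> 6 * M * 0"
      by (intro tendsto_mult_left translation_L1 ig M h)
    then obtain N where N: "\<And>k. k \<ge> N \<Longrightarrow> 6 * M * (LINT x|lborel. \<bar>g M (x - h k) - g M x\<bar>) < e / 2"
      using LIMSEQ_D[of _ 0 "e / 2"] e by fastforce
    have tr: "integrable lborel (\<lambda>x. \<bar>g M (x - a) - g M x\<bar>)" for a
      using integral_lborel_translate(2)[of "g M" "-a"] ig[OF M] by (auto intro!: integrable_abs)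
    have tr2: "integrable lborel (\<lambda>x. (f (x - a) - g M (x - a))\<^sup>2)"
      "(LINT x|lborel. (f (x - a) - g M (x - a))\<^sup>2) = (LINT x|lborel. (f x - g M x)\<^sup>2)" for a
      using integral_lborel_translate[of "\<lambda>x. (f x - g M x)\<^sup>2" "-a"] ir[OF M] by simp_all
    have "(LINT x|lborel. (f (x - h k) - f x)\<^sup>2) < e" if k: "k \<ge> N" for k
    proof -
      have pt: "(a - b)\<^sup>2 \<le> 6 * M * \<bar>c - d\<bar> + (3 * (a - c)\<^sup>2 + 3 * (b - d)\<^sup>2)"
        if "\<bar>c\<bar> \<le> M" "\<bar>d\<bar> \<le> M" for a b c d :: real
      proof -
        have "(a - b)\<^sup>2 = ((a - c) + (c - d) + (d - b))\<^sup>2" by simp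
        also have "\<dots> \<le> 3 * (a - c)\<^sup>2 + 3 * (c - d)\<^sup>2 + 3 * (d - b)\<^sup>2"
          by (rule square_sum3_le)
        also have "(c - d)\<^sup>2 \<le> 2 * M * \<bar>c - d\<bar>"
          using mult_right_mono[of "\<bar>c - d\<bar>" "2 * M" "\<bar>c - d\<bar>"] that by (simp add: power2_eq_square)
        finally show ?thesis by (simp add: power2_commute)
      qed
      have "(LINT x|lborel. (f (x - h k) - f x)\<^sup>2)
        \<le> (LINT x|lborel. 6 * M * \<bar>g M (x - h k) - g M x\<bar> +
            (3 * (f (x - h k) - g M (x - h k))\<^sup>2 + 3 * (f x - g M x)\<^sup>2))"
        using tr tr2 ir[OF M] if2
        by (intro integral_mono Bochner_Integration.integrable_add integrable_mult_right pt g1(3) M)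
      also have "\<dots> = 6 * M * (LINT x|lborel. \<bar>g M (x - h k) - g M x\<bar>) + 6 * (LINT x|lborel. (f x - g M x)\<^sup>2)"
        using tr tr2 ir[OF M] by simp
      also have "\<dots> < e" using N[OF k] i by (simp add: M_def)
      finally show ?thesis .
    qed
    then show "\<exists>N. \<forall>k\<ge>N. norm ((LINT x|lborel. (f (x - h k) - f x)\<^sup>2) - 0) < e"
      by (intro exI[of _ N]) (auto intro!: integral_nonneg_AE simp: abs_of_nonneg)
  qed
qed

text \<open>For exponent 2 this is nonnegativity of the variance, the integral of \<rho> (g - c)^2
  with c the mean. Stated with extended nonnegative values so that a divergent right-hand side makes
  the claim trivial.\<close>

lemma jensen_mollify:
  fixes \<rho> g :: "'a \<Rightarrow> real"
  assumes \<rho>: "integrable M \<rho>" "\<And>x. \<rho> x \<ge> 0" "(LINT x|M. \<rho> x) = 1"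
    and g: "g \<in> borel_measurable M" "integrable M (\<lambda>x. \<rho> x * g x)" and p: "p = 1 \<or> p = (2 :: nat)"
  shows "ennreal (\<bar>LINT x|M. \<rho> x * g x\<bar> ^ p) \<le> (\<integral>\<^sup>+x. ennreal (\<rho> x * \<bar>g x\<bar> ^ p) \<partial>M)"
proof (cases "integrable M (\<lambda>x. \<rho> x * \<bar>g x\<bar> ^ p)")
  case True
  have "\<bar>LINT x|M. \<rho> x * g x\<bar> ^ p \<le> (LINT x|M. \<rho> x * \<bar>g x\<bar> ^ p)"
    using p
  proof
    assume "p = 1"
    then show ?thesis
      using integral_abs_bound[of M "\<lambda>x. \<rho> x * g x"] \<rho>(2) by (simp add: abs_mult)
  next
    assume p: "p = 2"
    define c where "c = (LINT x|M. \<rho> x * g x)"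
    have i2: "integrable M (\<lambda>x. \<rho> x * (g x)\<^sup>2)" using True p by simp
    have "0 \<le> (LINT x|M. \<rho> x * (g x - c)\<^sup>2)"
      by (intro integral_nonneg_AE AE_I2 mult_nonneg_nonneg \<rho>) simp
    also have "\<dots> = (LINT x|M. \<rho> x * (g x)\<^sup>2 - 2 * c * (\<rho> x * g x) + c\<^sup>2 * \<rho> x)"
      by (intro Bochner_Integration.integral_cong refl) (simp add: power2_diff algebra_simps)
    also have "\<dots> = (LINT x|M. \<rho> x * (g x)\<^sup>2) - 2 * c * c + c\<^sup>2 * 1"
      using i2 g(2) \<rho> by (simp add: c_def)
    finally show ?thesis using p by (simp add: c_def power2_eq_square)
  qed
  then show ?thesis
    using nn_integral_eq_integral[OF True] \<rho>(2) by (simp add: ennreal_leI)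
next
  case False
  have "(\<integral>\<^sup>+x. ennreal (\<rho> x * \<bar>g x\<bar> ^ p) \<partial>M) = \<infinity>"
  proof (rule ccontr)
    assume "\<not> ?thesis"
    then have "integrable M (\<lambda>x. \<rho> x * \<bar>g x\<bar> ^ p)"
      using \<rho> g(1) by (intro integrableI_bounded) (auto simp: less_top abs_mult)
    with False show False by simp
  qed
  then show ?thesis by simp
qed

abbreviation mollify :: "real \<Rightarrow> (real^'n::finite \<Rightarrow> real) \<Rightarrow> real^'n \<Rightarrow> real" where
  "mollify e \<equiv> convolve (mollifier e)"

lemma convolve_commute:
  fixes w :: "real^'n::finite \<Rightarrow> real"
  assumes "w \<in> borel_measurable borel" "\<phi> \<in> borel_measurable borel"
  shows "convolve \<phi> w x = (LINT h|lborel. \<phi> h * w (x - h))"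
    and "integrable lborel (\<lambda>y. \<phi> (x - y) * w y) \<longleftrightarrow> integrable lborel (\<lambda>h. \<phi> h * w (x - h))"
proof -
  have [measurable]: "w \<in> borel_measurable borel" "\<phi> \<in> borel_measurable borel" by fact+
  have "(\<lambda>y. \<phi> (x - y) * w y) \<in> borel_measurable borel" by measurable
  note * = integral_lborel_reflect[OF this, of x]
  show "convolve \<phi> w x = (LINT h|lborel. \<phi> h * w (x - h))"
    using *(1) by (simp add: convolve_def)
  show "integrable lborel (\<lambda>y. \<phi> (x - y) * w y) \<longleftrightarrow> integrable lborel (\<lambda>h. \<phi> h * w (x - h))"
    using *(2) by simp
qed

text \<open>The mollification error is an average of translation errors over shifts shorter than e.
  Jensen moves the power inside the average, Fubini exchanges the integrals, and each shift
  contributes at most \<delta>. The sequential hypothesis \<open>lim\<close> is first converted into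
  a threshold \<open>d\<close> by contradiction.\<close>

lemma mollify_Lp:
  fixes f :: "real^'n::finite \<Rightarrow> real"
  assumes f: "integrable lborel f" and p: "p = 1 \<or> p = (2 :: nat)"
    and int: "\<And>a. integrable lborel (\<lambda>x. \<bar>f (x - a) - f x\<bar> ^ p)"
    and lim: "\<And>h. h \<longlonglongrightarrow> 0 \<Longrightarrow> (\<lambda>k. LINT x|lborel. \<bar>f (x - h k) - f x\<bar> ^ p) \<longlonglongrightarrow> 0"
    and \<delta>: "\<delta> > 0"
  shows "\<exists>d>0. \<forall>e. 0 < e \<and> e < d \<longrightarrow> integrable lborel (\<lambda>x. \<bar>mollify e f x - f x\<bar> ^ p) \<and>
    (LINT x|lborel. \<bar>mollify e f x - f x\<bar> ^ p) \<le> \<delta>"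
proof -
  have [measurable]: "f \<in> borel_measurable borel" using borel_measurable_integrable[OF f] by simp
  have lif: "locally_integrable f"
    unfolding locally_integrable_def set_integrable_def using f
    using integrable_mult_indicator[OF _ f] borel_compact by auto
  have "\<exists>d>0. \<forall>h. norm h < d \<longrightarrow> (LINT x|lborel. \<bar>f (x - h) - f x\<bar> ^ p) < \<delta>"
  proof (rule ccontr)
    assume neg: "\<not> ?thesis"
    have "\<exists>h. norm h < inverse (real (Suc k)) \<and> \<not> (LINT x|lborel. \<bar>f (x - h) - f x\<bar> ^ p) < \<delta>" for k
    proof (rule ccontr)
      assume "\<not> ?thesis"
      then have "\<forall>h. norm h < inverse (real (Suc k)) \<longrightarrow> (LINT x|lborel. \<bar>f (x - h) - f x\<bar> ^ p) < \<delta>"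
        by blast
      moreover have "0 < inverse (real (Suc k))" by simp
      ultimately show False using neg by blast
    qed
    then obtain h where h: "\<And>k. norm (h k) < inverse (real (Suc k))"
      "\<And>k. \<not> (LINT x|lborel. \<bar>f (x - h k) - f x\<bar> ^ p) < \<delta>" by metis
    have "(\<lambda>k. norm (h k)) \<longlonglongrightarrow> 0"
      by (rule tendsto_sandwich[OF _ _ tendsto_const LIMSEQ_inverse_real_of_nat])
        (use h(1) in \<open>auto intro!: always_eventually less_imp_le\<close>)
    then have "h \<longlonglongrightarrow> 0" by (rule tendsto_norm_zero_cancel)
    from order_tendstoD(2)[OF lim[OF this] \<delta>] h(2) show False by simp
  qed
  then obtain d where d: "d > 0" "\<And>h. norm h < d \<Longrightarrow> (LINT x|lborel. \<bar>f (x - h) - f x\<bar> ^ p) < \<delta>" by blast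
  show ?thesis
  proof (intro exI[of _ d] conjI allI impI d(1))
    fix e assume "0 < e \<and> e < d"
    then have e: "0 < e" "e < d" by auto
    let ?\<rho> = "mollifier e :: real^'n \<Rightarrow> real"
    have rt: "test_function ?\<rho>" and rn: "\<And>x. 0 \<le> ?\<rho> x" and rz: "\<And>x. norm x \<ge> e \<Longrightarrow> ?\<rho> x = 0"
      and ri: "(LINT x|lborel. ?\<rho> x) = 1"
      by (rule mollifier_test[OF e(1)] mollifier_nonneg[OF e(1)] mollifier_zero[OF e(1)]
          mollifier_integral[OF e(1)]; assumption)+
    have [measurable]: "?\<rho> \<in> borel_measurable borel" by (rule smooth_borel[OF test_function_smooth[OF rt]])
    have [measurable]: "mollify e f \<in> borel_measurable borel" by (rule smooth_borel[OF convolve_smooth[OF lif rt]])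
    have int\<rho>: "integrable lborel ?\<rho>" by (rule test_function_integrable[OF rt])
    have i1: "integrable lborel (\<lambda>h. ?\<rho> h * f (x - h))" for x
      using convolve_integrable[OF lif rt] convolve_commute(2)[of f ?\<rho>] by simp
    have i2: "integrable lborel (\<lambda>h. ?\<rho> h * (f (x - h) - f x))" for x
      using i1[of x] int\<rho> by (simp add: right_diff_distrib)
    have eq: "mollify e f x - f x = (LINT h|lborel. ?\<rho> h * (f (x - h) - f x))" for x
      using i1[of x] int\<rho> ri convolve_commute(1)[of f ?\<rho> x] by (simp add: right_diff_distrib)
    have "(\<integral>\<^sup>+x. ennreal (\<bar>mollify e f x - f x\<bar> ^ p) \<partial>lborel)
      \<le> (\<integral>\<^sup>+x. (\<integral>\<^sup>+h. ennreal (?\<rho> h * \<bar>f (x - h) - f x\<bar> ^ p) \<partial>lborel) \<partial>lborel)"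
      unfolding eq by (intro nn_integral_mono jensen_mollify int\<rho> rn ri i2 p) measurable
    also have "\<dots> = (\<integral>\<^sup>+h. (\<integral>\<^sup>+x. ennreal (?\<rho> h * \<bar>f (x - h) - f x\<bar> ^ p) \<partial>lborel) \<partial>lborel)"
      by (rule lborel_pair.Fubini') measurable
    also have "\<dots> \<le> (\<integral>\<^sup>+h. ennreal (?\<rho> h * \<delta>) \<partial>lborel)"
    proof (rule nn_integral_mono)
      fix h :: "real^'n"
      have "(\<integral>\<^sup>+x. ennreal (?\<rho> h * \<bar>f (x - h) - f x\<bar> ^ p) \<partial>lborel)
        = ennreal (?\<rho> h * (LINT x|lborel. \<bar>f (x - h) - f x\<bar> ^ p))"
        using int[of h] rn[of h] by (subst nn_integral_eq_integral) (auto intro!: AE_I2)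
      also have "\<dots> \<le> ennreal (?\<rho> h * \<delta>)"
      proof (cases "norm h < d")
        case True
        then show ?thesis using d(2)[of h] rn[of h] by (intro ennreal_leI mult_left_mono) auto
      next
        case False
        then have "?\<rho> h = 0" using e by (intro rz) simp
        then show ?thesis by simp
      qed
      finally show "(\<integral>\<^sup>+x. ennreal (?\<rho> h * \<bar>f (x - h) - f x\<bar> ^ p) \<partial>lborel) \<le> ennreal (?\<rho> h * \<delta>)" .
    qed
    also have "\<dots> = ennreal \<delta>"
      using int\<rho> rn ri \<delta> by (subst nn_integral_eq_integral) (auto intro!: AE_I2)
    finally have le: "(\<integral>\<^sup>+x. ennreal (\<bar>mollify e f x - f x\<bar> ^ p) \<partial>lborel) \<le> ennreal \<delta>" .
    show I: "integrable lborel (\<lambda>x. \<bar>mollify e f x - f x\<bar> ^ p)"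
      by (rule integrableI_bounded) (use le_less_trans[OF le] in \<open>auto simp: abs_mult\<close>)
    show "(LINT x|lborel. \<bar>mollify e f x - f x\<bar> ^ p) \<le> \<delta>"
      using le nn_integral_eq_integral[OF I] \<delta> by simp
  qed
qed

definition eps :: "nat \<Rightarrow> real" where "eps k = inverse (real (Suc k))"

lemma eps_pos [simp]: "0 < eps k" and eps_le_1 [simp]: "eps k \<le> 1" and eps_tendsto: "eps \<longlonglongrightarrow> 0"
  using LIMSEQ_inverse_real_of_nat by (simp_all add: eps_def[abs_def] inverse_le_1_iff)

lemma mollify_local:
  assumes "0 < e" "\<And>y. norm (x - y) < e \<Longrightarrow> f y = g y"
  shows "mollify e f x = mollify e g x"
  unfolding convolve_def
proof (intro Bochner_Integration.integral_cong refl)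
  fix y show "mollifier e (x - y) * f y = mollifier e (x - y) * g y"
    using assms mollifier_zero[OF assms(1), of "x - y"] by (cases "norm (x - y) < e") auto
qed

text \<open>Since \<open>eps k \<le> 1\<close>, mollification on the ball of radius R sees only the
  ball of radius R + 1; cutting w off there makes it globally integrable. Integrability of the error
  is claimed only eventually, once the scale is below the threshold of the global estimate.\<close>

lemma mollify_tendsto_Lp:
  fixes w :: "real^'n::finite \<Rightarrow> real"
  assumes w: "locally_integrable w" and wp: "locally_integrable (\<lambda>x. \<bar>w x\<bar> ^ p)" and p: "p = 1 \<or> p = (2 :: nat)"
  shows "(\<lambda>k. LINT x|lborel. indicator (cball 0 R) x * \<bar>mollify (eps k) w x - w x\<bar> ^ p) \<longlonglongrightarrow> 0"
    and "\<forall>\<^sub>F k in sequentially. integrable lborel (\<lambda>x. indicator (cball 0 R) x * \<bar>mollify (eps k) w x - w x\<bar> ^ p)"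
proof -
  let ?K = "cball (0 :: real^'n) (R + 1)"
  define f where "f = (\<lambda>x. indicator ?K x * w x)"
  have [measurable]: "w \<in> borel_measurable borel" by (rule locally_integrable_borel[OF w])
  have f: "integrable lborel f" using locally_integrable_indicator[OF w, of ?K] by (simp add: f_def)
  have fp: "integrable lborel (\<lambda>x. \<bar>f x\<bar> ^ p)"
  proof -
    have "(\<lambda>x. \<bar>f x\<bar> ^ p) = (\<lambda>x. indicator ?K x *\<^sub>R \<bar>w x\<bar> ^ p)"
      using p by (auto simp: f_def indicator_def fun_eq_iff)
    then show ?thesis using locally_integrable_indicator[OF wp, of ?K] by simp
  qed
  have int: "integrable lborel (\<lambda>x. \<bar>f (x - a) - f x\<bar> ^ p)" for a
  proof (rule Bochner_Integration.integrable_bound)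
    have "integrable lborel (\<lambda>x. \<bar>f (x - a)\<bar> ^ p)"
      using integral_lborel_translate(2)[of "\<lambda>x. \<bar>f x\<bar> ^ p" "-a"] fp borel_measurable_integrable[OF fp] by simp
    then show "integrable lborel (\<lambda>x. 2 * \<bar>f (x - a)\<bar> ^ p + 2 * \<bar>f x\<bar> ^ p)" using fp by simp
    have pt: "\<bar>s - t\<bar> ^ p \<le> 2 * \<bar>s\<bar> ^ p + 2 * \<bar>t\<bar> ^ p" for s t :: real
      using p
    proof
      assume "p = 2"
      then show ?thesis using zero_le_power2[of "s + t"] by (simp add: power2_sum power2_diff)
    qed auto
    show "AE x in lborel. norm (\<bar>f (x - a) - f x\<bar> ^ p) \<le> norm (2 * \<bar>f (x - a)\<bar> ^ p + 2 * \<bar>f x\<bar> ^ p)"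
      using pt by (intro AE_I2) (simp add: abs_of_nonneg)
    have [measurable]: "f \<in> borel_measurable borel" using borel_measurable_integrable[OF f] by simp
    show "(\<lambda>x. \<bar>f (x - a) - f x\<bar> ^ p) \<in> borel_measurable lborel" by measurable
  qed
  have lim: "(\<lambda>k. LINT x|lborel. \<bar>f (x - h k) - f x\<bar> ^ p) \<longlonglongrightarrow> 0" if "h \<longlonglongrightarrow> 0" for h
    using p translation_L1[OF f that] translation_L2[OF f _ that] fp by auto
  have loc: "indicator (cball 0 R) x * \<bar>mollify (eps k) w x - w x\<bar> ^ p
    = indicator (cball 0 R) x * \<bar>mollify (eps k) f x - f x\<bar> ^ p" for k x
  proof (cases "x \<in> cball 0 R")
    case True
    have "mollify (eps k) w x = mollify (eps k) f x"
    proof (rule mollify_local)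
      fix y assume "norm (x - y) < eps k"
      then have "norm y \<le> R + 1"
        using True[unfolded mem_cball_0] norm_triangle_ineq2[of y x] eps_le_1[of k]
        unfolding norm_minus_commute[of x y] by linarith
      then show "w y = f y" by (simp add: f_def)
    qed simp
    moreover have "f x = w x" using True by (simp add: f_def)
    ultimately show ?thesis by simp
  qed simp
  have main: "\<forall>\<^sub>F k in sequentially. integrable lborel (\<lambda>x. \<bar>mollify (eps k) f x - f x\<bar> ^ p) \<and>
    (LINT x|lborel. \<bar>mollify (eps k) f x - f x\<bar> ^ p) \<le> \<delta>" if \<delta>: "\<delta> > 0" for \<delta>
  proof -
    obtain d where d: "d > 0" "\<And>e. 0 < e \<Longrightarrow> e < d \<Longrightarrow> integrable lborel (\<lambda>x. \<bar>mollify e f x - f x\<bar> ^ p) \<and>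
      (LINT x|lborel. \<bar>mollify e f x - f x\<bar> ^ p) \<le> \<delta>"
      using mollify_Lp[OF f p int lim \<delta>] by blast
    show ?thesis using order_tendstoD(2)[OF eps_tendsto d(1)]
      by (rule eventually_mono) (use d(2) in auto)
  qed
  have ind: "integrable lborel (\<lambda>x. indicator (cball 0 R) x * \<bar>mollify (eps k) f x - f x\<bar> ^ p)"
    if "integrable lborel (\<lambda>x. \<bar>mollify (eps k) f x - f x\<bar> ^ p)" for k
    using integrable_mult_indicator[OF _ that, of "cball 0 R"] by simp
  show "\<forall>\<^sub>F k in sequentially. integrable lborel (\<lambda>x. indicator (cball 0 R) x * \<bar>mollify (eps k) w x - w x\<bar> ^ p)"
    unfolding loc using main[OF zero_less_one] by (rule eventually_mono) (use ind in blast)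
  show "(\<lambda>k. LINT x|lborel. indicator (cball 0 R) x * \<bar>mollify (eps k) w x - w x\<bar> ^ p) \<longlonglongrightarrow> 0"
    unfolding loc
  proof (rule order_tendstoI)
    fix a :: real assume "a < 0"
    moreover have "0 \<le> (LINT x|lborel. indicator (cball 0 R) x * \<bar>mollify (eps k) f x - f x\<bar> ^ p)" for k
      by (intro integral_nonneg_AE) auto
    ultimately show "\<forall>\<^sub>F k in sequentially. a < (LINT x|lborel. indicator (cball 0 R) x * \<bar>mollify (eps k) f x - f x\<bar> ^ p)"
      by (intro always_eventually allI) (rule less_le_trans)
  next
    fix a :: real assume "0 < a"
    then have "a / 2 > 0" by simp
    from main[OF this]
    show "\<forall>\<^sub>F k in sequentially. (LINT x|lborel. indicator (cball 0 R) x * \<bar>mollify (eps k) f x - f x\<bar> ^ p) < a"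
    proof (rule eventually_mono)
      fix k assume k: "integrable lborel (\<lambda>x. \<bar>mollify (eps k) f x - f x\<bar> ^ p) \<and>
        (LINT x|lborel. \<bar>mollify (eps k) f x - f x\<bar> ^ p) \<le> a / 2"
      have "(LINT x|lborel. indicator (cball 0 R) x * \<bar>mollify (eps k) f x - f x\<bar> ^ p)
        \<le> (LINT x|lborel. \<bar>mollify (eps k) f x - f x\<bar> ^ p)"
        by (rule integral_mono) (use k ind in \<open>auto simp: indicator_def\<close>)
      with k \<open>0 < a\<close> show "(LINT x|lborel. indicator (cball 0 R) x * \<bar>mollify (eps k) f x - f x\<bar> ^ p) < a" by simp
    qed
  qed
qed

text \<open>A mollification is an average with nonnegative weights of total mass 1 over a ball of
  radius e. Taking a = b will give the exact values of cutoff functions.\<close>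

lemma mollify_bounds:
  fixes w :: "real^'n::finite \<Rightarrow> real"
  assumes w: "locally_integrable w" and e: "0 < e" and b: "\<And>y. norm (x - y) < e \<Longrightarrow> a \<le> w y \<and> w y \<le> b"
  shows "a \<le> mollify e w x" "mollify e w x \<le> b"
proof -
  let ?\<rho> = "mollifier e :: real^'n \<Rightarrow> real"
  have t: "test_function (\<lambda>y. ?\<rho> (x - y))" by (rule test_function_reflect[OF mollifier_test[OF e]])
  have i: "integrable lborel (\<lambda>y. ?\<rho> (x - y))" by (rule test_function_integrable[OF t])
  have one: "(LINT y|lborel. ?\<rho> (x - y)) = 1"
    using integral_lborel_reflect(1)[OF smooth_borel[OF test_function_smooth[OF mollifier_test[OF e]]], of x]
      mollifier_integral[OF e] by simp
  have iw: "integrable lborel (\<lambda>y. ?\<rho> (x - y) * w y)" by (rule convolve_integrable[OF w mollifier_test[OF e]])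
  have pt: "?\<rho> (x - y) * a \<le> ?\<rho> (x - y) * w y \<and> ?\<rho> (x - y) * w y \<le> ?\<rho> (x - y) * b" for y
    using b[of y] mollifier_nonneg[OF e, of "x - y"] mollifier_zero[OF e, of "x - y"]
    by (cases "norm (x - y) < e") (auto intro: mult_left_mono)
  have "(LINT y|lborel. ?\<rho> (x - y) * a) \<le> mollify e w x"
    unfolding convolve_def by (rule integral_mono) (use i iw pt in auto)
  then show "a \<le> mollify e w x" using one by simp
  have "mollify e w x \<le> (LINT y|lborel. ?\<rho> (x - y) * b)"
    unfolding convolve_def by (rule integral_mono) (use i iw pt in auto)
  then show "mollify e w x \<le> b" using one by simp
qed

lemma mollify_tendsto_continuous:
  fixes w :: "real^'n::finite \<Rightarrow> real"
  assumes w: "locally_integrable w" and c: "continuous_on UNIV w"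
  shows "(\<lambda>k. mollify (eps k) w x) \<longlonglongrightarrow> w x"
proof (rule LIMSEQ_I)
  fix r :: real assume r: "r > 0"
  have "isCont w x" using c by (simp add: continuous_on_eq_continuous_at)
  then obtain d where d: "d > 0" "\<And>y. norm (y - x) < d \<Longrightarrow> norm (w y - w x) < r / 2"
    using r unfolding isCont_def LIM_eq by (metis diff_self half_gt_zero_iff norm_zero)
  obtain N where N: "\<And>k. k \<ge> N \<Longrightarrow> eps k < d"
    using order_tendstoD(2)[OF eps_tendsto d(1)] unfolding eventually_sequentially by blast
  have "norm (mollify (eps k) w x - w x) < r" if k: "k \<ge> N" for k
  proof -
    have "w x - r / 2 \<le> w y \<and> w y \<le> w x + r / 2" if "norm (x - y) < eps k" for y
    proof -
      have "norm (y - x) < d" using that N[OF k] by (simp add: norm_minus_commute)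
      from d(2)[OF this] show ?thesis by (simp add: abs_diff_less_iff less_imp_le) argo
    qed
    from mollify_bounds[OF w eps_pos this] have "w x - r / 2 \<le> mollify (eps k) w x" "mollify (eps k) w x \<le> w x + r / 2"
      by auto
    then show ?thesis using r by (simp add: abs_diff_less_iff)
  qed
  then show "\<exists>N. \<forall>k\<ge>N. norm (mollify (eps k) w x - w x) < r" by blast
qed

text \<open>L^1 convergence on a ball yields an almost everywhere convergent subsequence. The index
  is shifted by \<open>N\<close> because the errors are known to be integrable only from some index
  on.\<close>

lemma mollify_AE_subseq:
  fixes w :: "real^'n::finite \<Rightarrow> real"
  assumes w: "locally_integrable w"
  obtains r where "strict_mono r"
    "AE x in lborel. x \<in> cball 0 R \<longrightarrow> (\<lambda>k. mollify (eps (r k)) w x) \<longlonglongrightarrow> w x"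
proof -
  have aw: "locally_integrable (\<lambda>x. \<bar>w x\<bar> ^ 1)"
    unfolding locally_integrable_def set_integrable_def
  proof (intro conjI allI impI)
    show "(\<lambda>x. \<bar>w x\<bar> ^ 1) \<in> borel_measurable lborel" using locally_integrable_borel[OF w] by simp
    fix K :: "(real^'n) set" assume "compact K"
    from integrable_abs[OF locally_integrable_indicator[OF w this]]
    show "integrable lborel (\<lambda>x. indicator K x *\<^sub>R \<bar>w x\<bar> ^ 1)" by (simp add: abs_mult)
  qed
  let ?u = "\<lambda>k x. indicator (cball 0 R) x * (mollify (eps k) w x - w x)"
  obtain N where N: "\<And>k. k \<ge> N \<Longrightarrow> integrable lborel (\<lambda>x. indicator (cball 0 R) x * \<bar>mollify (eps k) w x - w x\<bar> ^ 1)"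
    using mollify_tendsto_Lp(2)[OF w aw, of R] unfolding eventually_sequentially by auto
  have lim: "(\<lambda>k. LINT x|lborel. indicator (cball 0 R) x * \<bar>mollify (eps k) w x - w x\<bar> ^ 1) \<longlonglongrightarrow> 0"
    using mollify_tendsto_Lp(1)[OF w aw, of R] by auto
  have wm: "w \<in> borel_measurable borel" "mollify (eps k) w \<in> borel_measurable borel" for k
    by (rule locally_integrable_borel[OF w] smooth_borel[OF convolve_smooth[OF w mollifier_test[OF eps_pos]]])+
  have int: "integrable lborel (?u (k + N))" for k
  proof (rule Bochner_Integration.integrable_bound[OF N[of "k + N"]])
    have "?u (k + N) \<in> borel_measurable borel"
      by (intro borel_measurable_times borel_measurable_diff borel_measurable_indicator wm) simp
    then show "?u (k + N) \<in> borel_measurable lborel" by simp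
  qed (auto simp: abs_mult)
  have "(\<lambda>k. LINT x|lborel. norm (?u (k + N) x)) \<longlonglongrightarrow> 0"
    using LIMSEQ_ignore_initial_segment[OF lim, of N] by (simp add: abs_mult)
  from tendsto_L1_AE_subseq[OF int this] obtain r where r: "strict_mono r"
    "AE x in lborel. (\<lambda>n. ?u (r n + N) x) \<longlonglongrightarrow> 0" by blast
  show thesis
  proof (rule that[of "\<lambda>k. r k + N"])
    show "strict_mono (\<lambda>k. r k + N)" using r(1) by (simp add: strict_mono_def)
    show "AE x in lborel. x \<in> cball 0 R \<longrightarrow> (\<lambda>k. mollify (eps (r k + N)) w x) \<longlonglongrightarrow> w x"
      using r(2) by eventually_elim (auto simp: LIM_zero_iff)
  qed
qed

lemma fundamental_lemma:
  fixes g :: "real^'n::finite \<Rightarrow> real"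
  assumes g: "locally_integrable g" and O: "open O'"
    and z: "\<And>\<phi> K. test_function \<phi> \<Longrightarrow> compact K \<Longrightarrow> K \<subseteq> O' \<Longrightarrow> (\<And>x. x \<notin> K \<Longrightarrow> \<phi> x = 0) \<Longrightarrow>
      (LINT x|lborel. \<phi> x * g x) = 0"
  shows "AE x in lborel. x \<in> O' \<longrightarrow> g x = 0"
proof -
  have "AE x in lborel. x \<in> cball 0 (real N) \<longrightarrow> x \<in> O' \<longrightarrow> g x = 0" for N
  proof -
    obtain r where r: "strict_mono r"
      "AE x in lborel. x \<in> cball 0 (real N) \<longrightarrow> (\<lambda>k. mollify (eps (r k)) g x) \<longlonglongrightarrow> g x"
      by (rule mollify_AE_subseq[OF g])
    show ?thesis using r(2)
    proof eventually_elim
      case (elim x)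
      have "g x = 0" if x: "x \<in> cball 0 (real N)" "x \<in> O'"
      proof -
        obtain d where d: "d > 0" "ball x d \<subseteq> O'" using O x(2) open_contains_ball by blast
        have "(\<lambda>k. eps (r k)) \<longlonglongrightarrow> 0" using LIMSEQ_subseq_LIMSEQ[OF eps_tendsto r(1)] by (simp add: o_def)
        from order_tendstoD(2)[OF this d(1)]
        have "\<forall>\<^sub>F k in sequentially. 0 = mollify (eps (r k)) g x"
        proof (rule eventually_mono)
          fix k assume k: "eps (r k) < d"
          have m: "mollifier (eps (r k)) (x - y) = 0" if "y \<notin> cball x (eps (r k))" for y
            by (rule mollifier_zero) (use that in \<open>simp_all add: dist_norm\<close>)
          have "cball x (eps (r k)) \<subseteq> O'" using k d(2) by (auto simp: subset_eq)
          then show "0 = mollify (eps (r k)) g x"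
            unfolding convolve_def
            by (intro z[OF _ compact_cball _ m, symmetric] test_function_reflect mollifier_test eps_pos)
        qed
        then have "(\<lambda>k. mollify (eps (r k)) g x) \<longlonglongrightarrow> 0" by (rule Lim_transform_eventually[OF tendsto_const])
        with elim x(1) show ?thesis using LIMSEQ_unique by blast
      qed
      then show ?case by blast
    qed
  qed
  then have "AE x in lborel. \<forall>N :: nat. x \<in> cball 0 (real N) \<longrightarrow> x \<in> O' \<longrightarrow> g x = 0"
    unfolding AE_all_countable by blast
  then show ?thesis
  proof eventually_elim
    case (elim x)
    obtain N :: nat where "norm x \<le> real N" using real_arch_simple by blast
    then show ?case using elim by auto
  qed
qed

subsection \<open>Weak derivatives of scalar functions\<close>

lemma locally_integrable_bound:
  fixes f :: "real^'n::finite \<Rightarrow> 'b::euclidean_space" and g :: "real^'n \<Rightarrow> 'c::euclidean_space"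
  assumes g: "locally_integrable g" and f: "f \<in> borel_measurable borel" and b: "\<And>x. norm (f x) \<le> norm (g x)"
  shows "locally_integrable f"
  unfolding locally_integrable_def set_integrable_def
proof (intro conjI allI impI)
  show "f \<in> borel_measurable lborel" using f by simp
  fix K :: "(real^'n) set" assume K: "compact K"
  show "integrable lborel (\<lambda>x. indicator K x *\<^sub>R f x)"
  proof (rule Bochner_Integration.integrable_bound[OF locally_integrable_indicator[OF g K]])
    have "(\<lambda>x. indicator K x *\<^sub>R f x) \<in> borel_measurable borel"
      using K borel_compact f by (intro borel_measurable_scaleR borel_measurable_indicator) auto
    then show "(\<lambda>x. indicator K x *\<^sub>R f x) \<in> borel_measurable lborel" by simp
    show "AE x in lborel. norm (indicator K x *\<^sub>R f x) \<le> norm (indicator K x *\<^sub>R g x)"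
      using b by (intro AE_I2) (simp add: mult_left_mono)
  qed
qed

lemma locally_integrable_add:
  "locally_integrable f \<Longrightarrow> locally_integrable g \<Longrightarrow> locally_integrable (\<lambda>x. f x + g x)"
  unfolding locally_integrable_def set_integrable_def
  by (simp add: scaleR_right_distrib borel_measurable_add)

lemma locally_integrable_diff:
  "locally_integrable f \<Longrightarrow> locally_integrable g \<Longrightarrow> locally_integrable (\<lambda>x. f x - g x)"
  unfolding locally_integrable_def set_integrable_def
  by (simp add: scaleR_right_diff_distrib borel_measurable_diff)

lemma locally_integrable_cmult:
  assumes "locally_integrable f" shows "locally_integrable (\<lambda>x. c * f x :: real)"
  unfolding locally_integrable_def set_integrable_def
proof (intro conjI allI impI)
  show "(\<lambda>x. c * f x) \<in> borel_measurable lborel" using locally_integrable_borel[OF assms] by simp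
  fix K :: "(real^'a) set" assume "compact K"
  from integrable_mult_right[OF locally_integrable_indicator[OF assms this], of c]
  show "integrable lborel (\<lambda>x. indicator K x *\<^sub>R (c * f x))" by (simp add: mult_ac)
qed

section \<open>Locally square integrable functions and limits of pairings\<close>

text \<open>The class in which the product of two functions is locally integrable, so that both
  sides of the Leibniz rule for weak derivatives are meaningful.\<close>

definition L2_loc :: "(real^'n::finite \<Rightarrow> real) \<Rightarrow> bool" where
  "L2_loc w \<longleftrightarrow> w \<in> borel_measurable borel \<and> locally_integrable (\<lambda>x. (w x)\<^sup>2)"

lemma L2_loc_borel: "L2_loc w \<Longrightarrow> w \<in> borel_measurable borel"
  and L2_loc_square: "L2_loc w \<Longrightarrow> locally_integrable (\<lambda>x. (w x)\<^sup>2)"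
  by (simp_all add: L2_loc_def)

lemma L2_loc_mult:
  assumes "L2_loc f" "L2_loc g" shows "locally_integrable (\<lambda>x. f x * g x)"
proof (rule locally_integrable_bound)
  show "locally_integrable (\<lambda>x. (f x)\<^sup>2 + (g x)\<^sup>2)" by (intro locally_integrable_add L2_loc_square assms)
  show "(\<lambda>x. f x * g x) \<in> borel_measurable borel" by (intro borel_measurable_times L2_loc_borel assms)
  fix x
  have "2 * \<bar>f x\<bar> * \<bar>g x\<bar> \<le> (f x)\<^sup>2 + (g x)\<^sup>2" using sum_squares_bound[of "\<bar>f x\<bar>" "\<bar>g x\<bar>"] by simp
  moreover have "0 \<le> \<bar>f x\<bar> * \<bar>g x\<bar>" by simp
  ultimately show "norm (f x * g x) \<le> norm ((f x)\<^sup>2 + (g x)\<^sup>2)"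
    unfolding real_norm_def abs_mult by linarith
qed

lemma L2_loc_bound:
  assumes "L2_loc g" "f \<in> borel_measurable borel" "\<And>x. \<bar>f x\<bar> \<le> \<bar>c * g x\<bar>"
  shows "L2_loc f"
  unfolding L2_loc_def
proof
  show "f \<in> borel_measurable borel" by fact
  show "locally_integrable (\<lambda>x. (f x)\<^sup>2)"
  proof (rule locally_integrable_bound)
    show "locally_integrable (\<lambda>x. c\<^sup>2 * (g x)\<^sup>2)" by (intro locally_integrable_cmult L2_loc_square assms)
    show "(\<lambda>x. (f x)\<^sup>2) \<in> borel_measurable borel" using assms(2) by simp
    show "norm ((f x)\<^sup>2) \<le> norm (c\<^sup>2 * (g x)\<^sup>2)" for x
      using assms(3)[of x] by (simp add: abs_le_square_iff power_mult_distrib)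
  qed
qed

lemma L2_loc_const: "L2_loc (\<lambda>x. c)"
  by (simp add: L2_loc_def)

lemma L2_loc_bounded:
  "f \<in> borel_measurable borel \<Longrightarrow> (\<And>x. \<bar>f x\<bar> \<le> B) \<Longrightarrow> L2_loc f"
  by (rule L2_loc_bound[OF L2_loc_const[of 1], of _ B]) (auto intro: order_trans[OF _ abs_ge_self])

lemma L2_loc_locally_integrable: "L2_loc f \<Longrightarrow> locally_integrable f"
  using L2_loc_mult[OF _ L2_loc_const[of 1]] by simp

lemma L2_loc_add:
  assumes "L2_loc f" "L2_loc g" shows "L2_loc (\<lambda>x. f x + g x)"
  unfolding L2_loc_def power2_sum mult.assoc
  by (intro conjI borel_measurable_add locally_integrable_add locally_integrable_cmult L2_loc_mult
      L2_loc_square L2_loc_borel assms)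

lemma L2_loc_bounded_mult:
  assumes "L2_loc f" "b \<in> borel_measurable borel" "\<And>x. \<bar>b x\<bar> \<le> B"
  shows "L2_loc (\<lambda>x. b x * f x)"
proof (rule L2_loc_bound[OF assms(1), of _ B])
  show "(\<lambda>x. b x * f x) \<in> borel_measurable borel" by (intro borel_measurable_times assms L2_loc_borel)
  show "\<bar>b x * f x\<bar> \<le> \<bar>B * f x\<bar>" for x
    unfolding abs_mult using assms(3)[of x] by (intro mult_right_mono) auto
qed

lemma L2_loc_continuous:
  fixes f :: "real^'n::finite \<Rightarrow> real"
  assumes "continuous_on UNIV f" shows "L2_loc f"
proof -
  have [measurable]: "f \<in> borel_measurable borel" using assms by (rule borel_measurable_continuous_onI)
  have "continuous_on K (\<lambda>x. (f x)\<^sup>2)" for K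
    using continuous_on_subset[OF assms, of K] by (intro continuous_intros) simp
  then show ?thesis
    unfolding L2_loc_def locally_integrable_def set_integrable_def
    using borel_integrable_compact[of _ "\<lambda>x. (f x)\<^sup>2"] by simp
qed

text \<open>The dual side of \<open>L2_loc\<close>: weights whose product with any locally square
  integrable function is integrable over the whole space.\<close>

definition L2_compact :: "real \<Rightarrow> (real^'n::finite \<Rightarrow> real) \<Rightarrow> bool" where
  "L2_compact R \<psi> \<longleftrightarrow> \<psi> \<in> borel_measurable borel \<and> integrable lborel (\<lambda>x. (\<psi> x)\<^sup>2) \<and> (\<forall>x. x \<notin> cball 0 R \<longrightarrow> \<psi> x = 0)"

lemma L2_compact_mult:
  assumes "L2_loc f" "b \<in> borel_measurable borel" "\<And>x. \<bar>b x\<bar> \<le> B" "\<And>x. x \<notin> cball 0 R \<Longrightarrow> b x = 0"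
  shows "L2_compact R (\<lambda>x. b x * f x)"
  unfolding L2_compact_def
proof (intro conjI allI impI)
  show "(\<lambda>x. b x * f x) \<in> borel_measurable borel" by (intro borel_measurable_times assms L2_loc_borel)
  have "(\<lambda>x. (b x * f x)\<^sup>2) = (\<lambda>x. (b x)\<^sup>2 *\<^sub>R (f x)\<^sup>2)" by (simp add: power_mult_distrib)
  moreover have "\<bar>(b x)\<^sup>2\<bar> \<le> B\<^sup>2" for x
    using power_mono[OF assms(3)[of x], of 2] by simp
  ultimately show "integrable lborel (\<lambda>x. (b x * f x)\<^sup>2)"
    using locally_integrable_mult_bounded[OF L2_loc_square[OF assms(1)], of "\<lambda>x. (b x)\<^sup>2" "cball 0 R" "B\<^sup>2"] assms(2,4)
    by simp
qed (use assms(4) in auto)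

lemma test_L2_compact:
  assumes "L2_loc f" "test_function \<phi>" obtains R where "L2_compact R (\<lambda>x. \<phi> x * f x)"
proof -
  obtain R where R: "\<And>x. x \<notin> cball 0 R \<Longrightarrow> \<phi> x = 0" using assms test_functionE by metis
  obtain B where B: "\<And>x. \<bar>\<phi> x\<bar> \<le> B" using test_function_bounded[OF assms(2)] by blast
  show thesis
    by (rule that[OF L2_compact_mult[OF assms(1) smooth_borel[OF test_function_smooth[OF assms(2)]] B R]])
qed

lemma L2_compact_integrable:
  assumes "L2_compact R \<psi>" "L2_loc f" shows "integrable lborel (\<lambda>x. \<psi> x * f x)"
proof (rule Bochner_Integration.integrable_bound)
  have [measurable]: "\<psi> \<in> borel_measurable borel" "f \<in> borel_measurable borel"
    using assms by (auto simp: L2_compact_def L2_loc_def)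
  show "integrable lborel (\<lambda>x. (\<psi> x)\<^sup>2 + indicator (cball 0 R) x *\<^sub>R (f x)\<^sup>2)"
    using assms locally_integrable_indicator[OF L2_loc_square[OF assms(2)], of "cball 0 R"]
    unfolding L2_compact_def by (intro Bochner_Integration.integrable_add) auto
  show "(\<lambda>x. \<psi> x * f x) \<in> borel_measurable lborel" by measurable
  show "AE x in lborel. norm (\<psi> x * f x) \<le> norm ((\<psi> x)\<^sup>2 + indicator (cball 0 R) x *\<^sub>R (f x)\<^sup>2)"
  proof (rule AE_I2)
    fix x
    show "norm (\<psi> x * f x) \<le> norm ((\<psi> x)\<^sup>2 + indicator (cball 0 R) x *\<^sub>R (f x)\<^sup>2)"
    proof (cases "x \<in> cball 0 R")
      case True
      have "2 * \<bar>\<psi> x\<bar> * \<bar>f x\<bar> \<le> (\<psi> x)\<^sup>2 + (f x)\<^sup>2" using sum_squares_bound[of "\<bar>\<psi> x\<bar>" "\<bar>f x\<bar>"] by simp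
      moreover have "0 \<le> \<bar>\<psi> x\<bar> * \<bar>f x\<bar>" by simp
      ultimately have "\<bar>\<psi> x\<bar> * \<bar>f x\<bar> \<le> \<bar>(\<psi> x)\<^sup>2 + (f x)\<^sup>2\<bar>" by linarith
      then show ?thesis using True by (simp add: abs_mult)
    next
      case False
      then have "\<psi> x = 0" using assms(1) unfolding L2_compact_def by blast
      then show ?thesis by simp
    qed
  qed
qed

lemma mollify_smooth: "L2_loc f \<Longrightarrow> smooth (mollify (eps k) f)"
  by (intro convolve_smooth L2_loc_locally_integrable mollifier_test eps_pos)

lemma mollify_L2_loc: "L2_loc f \<Longrightarrow> L2_loc (mollify (eps k) f)"
  by (rule L2_loc_continuous[OF smooth_continuous[OF mollify_smooth]])

lemma mollify_tendsto_L2: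
  assumes "L2_loc f"
  shows "(\<lambda>k. LINT x|lborel. indicator (cball 0 R) x * (mollify (eps k) f x - f x)\<^sup>2) \<longlonglongrightarrow> 0"
    and "\<forall>\<^sub>F k in sequentially. integrable lborel (\<lambda>x. indicator (cball 0 R) x * (mollify (eps k) f x - f x)\<^sup>2)"
  using mollify_tendsto_Lp[OF L2_loc_locally_integrable[OF assms], of 2 R] L2_loc_square[OF assms]
  by simp_all

text \<open>The weight may vary with k as long as a fixed square integrable one dominates it. This
  freedom serves the chain rule, where the weight contains F' of the mollified function, and passage
  to absolute values, where it contains a sign.\<close>

lemma mollify_pairing_gen:
  assumes f: "L2_loc f" and \<psi>: "L2_compact R \<psi>" and b: "\<And>k x. \<bar>\<psi>' k x\<bar> \<le> \<bar>\<psi> x\<bar>"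
  shows "(\<lambda>k. LINT x|lborel. \<psi>' k x * (mollify (eps k) f x - f x)) \<longlonglongrightarrow> 0"
proof (rule tendstoI)
  fix e :: real assume e: "e > 0"
  define P where "P = (LINT x|lborel. (\<psi> x)\<^sup>2)"
  \<comment> \<open>Parameter of Young's inequality: the term \<open>t / 2 * P\<close> is at most
    e/2, and once the L^2 error is below e t the other term is below e/2.\<close>
  define t where "t = e / (P + 1)"
  have P: "P \<ge> 0" unfolding P_def by (intro integral_nonneg_AE) auto
  then have t: "t > 0" "t * P \<le> e" using e by (auto simp: t_def field_simps)
  let ?a = "\<lambda>k x. indicator (cball 0 R) x * (mollify (eps k) f x - f x)\<^sup>2"
  have "\<forall>\<^sub>F k in sequentially. (LINT x|lborel. ?a k x) < e * t"
    using order_tendstoD(2)[OF mollify_tendsto_L2(1)[OF f]] e t by simp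
  with mollify_tendsto_L2(2)[OF f, of R]
  show "\<forall>\<^sub>F k in sequentially. dist (LINT x|lborel. \<psi>' k x * (mollify (eps k) f x - f x)) 0 < e"
  proof eventually_elim
    case (elim k)
    have pt: "\<bar>\<psi>' k x * (mollify (eps k) f x - f x)\<bar> \<le> t / 2 * (\<psi> x)\<^sup>2 + 1 / (2 * t) * ?a k x" for x
    proof (cases "x \<in> cball 0 R")
      case True
      define d where "d = mollify (eps k) f x - f x"
      have "\<bar>\<psi>' k x * d\<bar> \<le> \<bar>\<psi> x\<bar> * \<bar>d\<bar>" unfolding abs_mult by (intro mult_right_mono b) simp
      moreover have "0 \<le> (t * \<bar>\<psi> x\<bar> - \<bar>d\<bar>)\<^sup>2" by simp
      then have "2 * t * (\<bar>\<psi> x\<bar> * \<bar>d\<bar>) \<le> t\<^sup>2 * (\<psi> x)\<^sup>2 + d\<^sup>2"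
        by (simp add: power2_diff power_mult_distrib mult_ac)
      then have "\<bar>\<psi> x\<bar> * \<bar>d\<bar> \<le> t / 2 * (\<psi> x)\<^sup>2 + 1 / (2 * t) * d\<^sup>2"
        using t(1) by (simp add: field_simps power2_eq_square)
      ultimately show ?thesis using True by (simp add: d_def)
    next
      case False
      then have "\<psi> x = 0" using \<psi> unfolding L2_compact_def by blast
      with b[of k x] False show ?thesis by simp
    qed
    have "\<bar>LINT x|lborel. \<psi>' k x * (mollify (eps k) f x - f x)\<bar>
      \<le> (LINT x|lborel. t / 2 * (\<psi> x)\<^sup>2 + 1 / (2 * t) * ?a k x)"
    proof (cases "integrable lborel (\<lambda>x. \<psi>' k x * (mollify (eps k) f x - f x))")
      case True
      show ?thesis
        by (rule integral_abs_bound_integral[OF True _ pt])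
          (use \<psi> elim in \<open>auto simp: L2_compact_def\<close>)
    next
      case False
      \<comment> \<open>The integral of a nonintegrable function is 0 by convention, so the bound
        needs no integrability of the varying weight.\<close>
      then have "(LINT x|lborel. \<psi>' k x * (mollify (eps k) f x - f x)) = 0"
        by (rule not_integrable_integral_eq)
      moreover have "0 \<le> (LINT x|lborel. t / 2 * (\<psi> x)\<^sup>2 + 1 / (2 * t) * ?a k x)"
        using t by (intro integral_nonneg_AE) auto
      ultimately show ?thesis by simp
    qed
    also have "\<dots> = t / 2 * P + 1 / (2 * t) * (LINT x|lborel. ?a k x)"
      using \<psi> elim unfolding P_def L2_compact_def by simp
    also have "\<dots> < t / 2 * P + 1 / (2 * t) * (e * t)"
      using elim t(1) by (intro add_strict_left_mono mult_strict_left_mono) auto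
    also have "\<dots> \<le> e" using t by simp
    finally show ?case by simp
  qed
qed

lemma mollify_pairing:
  assumes f: "L2_loc f" and \<psi>: "L2_compact R \<psi>"
  shows "(\<lambda>k. LINT x|lborel. \<psi> x * mollify (eps k) f x) \<longlonglongrightarrow> (LINT x|lborel. \<psi> x * f x)"
proof -
  have "(LINT x|lborel. \<psi> x * (mollify (eps k) f x - f x))
    = (LINT x|lborel. \<psi> x * mollify (eps k) f x) - (LINT x|lborel. \<psi> x * f x)" for k
    using L2_compact_integrable[OF \<psi> f] L2_compact_integrable[OF \<psi> mollify_L2_loc[OF f]]
    by (simp add: right_diff_distrib)
  with mollify_pairing_gen[OF f \<psi>, of "\<lambda>k. \<psi>"] show ?thesis by (simp add: LIM_zero_iff)
qed

text \<open>From a^2 - b^2 = (a - b)^2 + 2 b (a - b) with a the mollification and b its limit: the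
  square tends to 0 in the local L^2 sense, and the cross term is a pairing with a fixed
  weight.\<close>

lemma mollify_square:
  assumes f: "L2_loc f" and b: "b \<in> borel_measurable borel" "\<And>x. \<bar>b x\<bar> \<le> B" "\<And>x. x \<notin> cball 0 R \<Longrightarrow> b x = 0"
  shows "(\<lambda>k. LINT x|lborel. b x * (mollify (eps k) f x)\<^sup>2) \<longlonglongrightarrow> (LINT x|lborel. b x * (f x)\<^sup>2)"
proof -
  let ?f = "\<lambda>k. mollify (eps k) f"
  have c: "L2_compact R (\<lambda>x. b x * f x)" by (rule L2_compact_mult[OF f b(1,2)]) (rule b(3))
  have ic: "integrable lborel (\<lambda>x. b x * (g x)\<^sup>2)" if "L2_loc g" for g
    using L2_compact_integrable[OF L2_compact_mult[OF that b(1,2), of R] that] b(3)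
    by (simp add: power2_eq_square mult.assoc)
  have L1: "(\<lambda>k. 2 * (LINT x|lborel. (b x * f x) * (?f k x - f x))) \<longlonglongrightarrow> 0"
    using tendsto_mult_right_zero[OF mollify_pairing_gen[OF f c, where \<psi>'="\<lambda>k x. b x * f x", OF order_refl], of 2] by simp
  have L2: "(\<lambda>k. LINT x|lborel. b x * (?f k x - f x)\<^sup>2) \<longlonglongrightarrow> 0"
  proof (rule Lim_null_comparison)
    show "(\<lambda>k. B * (LINT x|lborel. indicator (cball 0 R) x * (?f k x - f x)\<^sup>2)) \<longlonglongrightarrow> 0"
      using tendsto_mult_right_zero[OF mollify_tendsto_L2(1)[OF f]] by simp
    have "0 \<le> B" using b(2)[of 0] by simp
    show "\<forall>\<^sub>F k in sequentially. norm (LINT x|lborel. b x * (?f k x - f x)\<^sup>2)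
      \<le> B * (LINT x|lborel. indicator (cball 0 R) x * (?f k x - f x)\<^sup>2)"
      using mollify_tendsto_L2(2)[OF f, of R]
    proof eventually_elim
      case (elim k)
      have "L2_loc (\<lambda>x. ?f k x - f x)"
        using L2_loc_add[OF mollify_L2_loc[OF f] L2_loc_bounded_mult[OF f, of "\<lambda>x. -1" 1]] by simp
      from ic[OF this] have "integrable lborel (\<lambda>x. b x * (?f k x - f x)\<^sup>2)" .
      then have "norm (LINT x|lborel. b x * (?f k x - f x)\<^sup>2)
        \<le> (LINT x|lborel. B * (indicator (cball 0 R) x * (?f k x - f x)\<^sup>2))"
      proof (rule Bochner_Integration.integral_norm_bound_integral)
        fix x
        show "norm (b x * (?f k x - f x)\<^sup>2) \<le> B * (indicator (cball 0 R) x * (?f k x - f x)\<^sup>2)"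
          using b(2)[of x] b(3)[of x] by (cases "x \<in> cball 0 R") (simp_all add: abs_mult mult_right_mono)
      qed (use elim in simp)
      then show ?case by simp
    qed
  qed
  have "(LINT x|lborel. b x * (?f k x)\<^sup>2) - (LINT x|lborel. b x * (f x)\<^sup>2)
    = (LINT x|lborel. b x * (?f k x - f x)\<^sup>2) + 2 * (LINT x|lborel. (b x * f x) * (?f k x - f x))" for k
  proof -
    have d: "L2_loc (\<lambda>x. ?f k x - f x)"
      using L2_loc_add[OF mollify_L2_loc[OF f] L2_loc_bounded_mult[OF f, of "\<lambda>x. -1" 1]] by simp
    have "(LINT x|lborel. b x * (?f k x)\<^sup>2) - (LINT x|lborel. b x * (f x)\<^sup>2)
      = (LINT x|lborel. b x * (?f k x)\<^sup>2 - b x * (f x)\<^sup>2)"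
      using ic[OF f] ic[OF mollify_L2_loc[OF f]] by simp
    also have "\<dots> = (LINT x|lborel. b x * (?f k x - f x)\<^sup>2 + 2 * ((b x * f x) * (?f k x - f x)))"
      by (intro Bochner_Integration.integral_cong refl) (simp add: power2_eq_square algebra_simps)
    also have "\<dots> = (LINT x|lborel. b x * (?f k x - f x)\<^sup>2) + 2 * (LINT x|lborel. (b x * f x) * (?f k x - f x))"
      using ic[OF d] L2_compact_integrable[OF c d] by simp
    finally show ?thesis .
  qed
  with tendsto_add[OF L2 L1]
  have "(\<lambda>k. (LINT x|lborel. b x * (?f k x)\<^sup>2) - (LINT x|lborel. b x * (f x)\<^sup>2)) \<longlonglongrightarrow> 0" by simp
  then show ?thesis by (rule LIM_zero_cancel)
qed

section \<open>Rules for weak derivatives: uniqueness, products, order and composition\<close>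

lemma weak_derivativeD:
  fixes u g :: "real^'n::finite \<Rightarrow> real"
  assumes "has_weak_derivative [i] u g" "test_function \<phi>"
  shows "(LINT x|lborel. partial_derivative i \<phi> x * u x) = - (LINT x|lborel. \<phi> x * g x)"
  using assms unfolding has_weak_derivative_def by simp

lemma weak_derivativeI:
  fixes u g :: "real^'n::finite \<Rightarrow> real"
  assumes "locally_integrable u" "locally_integrable g"
    "\<And>\<phi>. test_function \<phi> \<Longrightarrow> (LINT x|lborel. partial_derivative i \<phi> x * u x) = - (LINT x|lborel. \<phi> x * g x)"
  shows "has_weak_derivative [i] u g"
  using assms unfolding has_weak_derivative_def by simp

lemma weak_derivative_locally_integrable:
  "has_weak_derivative \<alpha> u g \<Longrightarrow> locally_integrable u" "has_weak_derivative \<alpha> u g \<Longrightarrow> locally_integrable g"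
  by (simp_all add: has_weak_derivative_def)

text \<open>The derivative falls on the mollifier; as a function of the integration variable the
  mollifier is reflected, which gives a minus sign, and integration by parts gives the second
  one.\<close>

lemma mollify_weak_derivative:
  fixes u g :: "real^'n::finite \<Rightarrow> real"
  assumes "has_weak_derivative [i] u g"
  shows "partial_derivative i (mollify (eps k) u) = mollify (eps k) g"
proof
  fix x
  let ?\<rho> = "mollifier (eps k) :: real^'n \<Rightarrow> real"
  note t = mollifier_test[OF eps_pos, of k]
  have "partial_derivative i (mollify (eps k) u) x = convolve (partial_derivative i ?\<rho>) u x"
    by (simp add: convolve_partial_derivative weak_derivative_locally_integrable[OF assms] test_function_C1_compact t)
  also have "\<dots> = - (LINT y|lborel. partial_derivative i (\<lambda>y. ?\<rho> (x - y)) y * u y)"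
    using partial_derivative_affine(1)[OF smooth_differentiable[OF test_function_smooth[OF t]], of i "-1" x]
    by (simp add: convolve_def)
  also have "\<dots> = mollify (eps k) g x"
    using weak_derivativeD[OF assms test_function_reflect[OF t, of x]] by (simp add: convolve_def)
  finally show "partial_derivative i (mollify (eps k) u) x = mollify (eps k) g x" .
qed

text \<open>Test functions supported in the open set see only the common values there, and so do
  their derivatives. Two different functions are allowed because the parts coincide with m or e3 on
  open sets only.\<close>

lemma weak_derivative_local_unique:
  fixes u u' g g' :: "real^'n::finite \<Rightarrow> real"
  assumes g: "has_weak_derivative \<alpha> u g" and g': "has_weak_derivative \<alpha> u' g'"
    and O: "open O'" and eq: "\<And>x. x \<in> O' \<Longrightarrow> u x = u' x"
  shows "AE x in lborel. x \<in> O' \<longrightarrow> g x = g' x"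
proof -
  have "AE x in lborel. x \<in> O' \<longrightarrow> g x - g' x = 0"
  proof (rule fundamental_lemma[OF _ O])
    show "locally_integrable (\<lambda>x. g x - g' x)"
      by (intro locally_integrable_diff weak_derivative_locally_integrable[OF g] weak_derivative_locally_integrable[OF g'])
    fix \<phi> :: "real^'n \<Rightarrow> real" and K assume \<phi>: "test_function \<phi>" and K: "compact K" "K \<subseteq> O'"
      and z: "\<And>x. x \<notin> K \<Longrightarrow> \<phi> x = 0"
    have i: "integrable lborel (\<lambda>x. \<phi> x * h x)" if "locally_integrable h" for h :: "real^'n \<Rightarrow> real"
      using locally_integrable_test[OF that \<phi>] by simp
    have "(LINT x|lborel. partial_derivatives \<alpha> \<phi> x * u x) = (LINT x|lborel. partial_derivatives \<alpha> \<phi> x * u' x)"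
    proof (intro Bochner_Integration.integral_cong refl)
      fix x
      show "partial_derivatives \<alpha> \<phi> x * u x = partial_derivatives \<alpha> \<phi> x * u' x"
      proof (cases "x \<in> K")
        case True
        then show ?thesis using eq[of x] K(2) by auto
      next
        case False
        have "partial_derivatives \<alpha> \<phi> x = 0"
          by (rule partial_derivatives_zero[OF compact_imp_closed[OF K(1)] _ False]) (rule z)
        then show ?thesis by simp
      qed
    qed
    then have "(- 1) ^ length \<alpha> * (LINT x|lborel. \<phi> x * g x) = (- 1) ^ length \<alpha> * (LINT x|lborel. \<phi> x * g' x)"
      using g g' \<phi> unfolding has_weak_derivative_def by simp
    then have "(LINT x|lborel. \<phi> x * g x) = (LINT x|lborel. \<phi> x * g' x)" by simp
    then show "(LINT x|lborel. \<phi> x * (g x - g' x)) = 0"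
      using i[OF weak_derivative_locally_integrable(2)[OF g]] i[OF weak_derivative_locally_integrable(2)[OF g']]
      by (simp add: right_diff_distrib)
  qed
  then show ?thesis by simp
qed

lemma weak_derivative_unique:
  fixes u g g' :: "real^'n::finite \<Rightarrow> real"
  assumes "has_weak_derivative \<alpha> u g" "has_weak_derivative \<alpha> u g'"
  shows "AE x in lborel. g x = g' x"
  using weak_derivative_local_unique[OF assms open_UNIV] by simp

text \<open>Only one factor is mollified: the product of \<phi> with a mollification of w is again a
  test function and can be inserted into the definition of U. The three resulting pairings converge
  separately.\<close>

lemma weak_derivative_mult:
  fixes u w U W :: "real^'n::finite \<Rightarrow> real"
  assumes u: "has_weak_derivative [i] u U" and w: "has_weak_derivative [i] w W"
    and L: "L2_loc u" "L2_loc w" "L2_loc U" "L2_loc W"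
  shows "has_weak_derivative [i] (\<lambda>x. u x * w x) (\<lambda>x. U x * w x + u x * W x)"
proof (rule weak_derivativeI)
  show "locally_integrable (\<lambda>x. u x * w x)" "locally_integrable (\<lambda>x. U x * w x + u x * W x)"
    by (intro locally_integrable_add L2_loc_mult L)+
  fix \<phi> :: "real^'n \<Rightarrow> real" assume \<phi>: "test_function \<phi>"
  note d\<phi> = test_function_partial_derivative[OF \<phi>, of i]
  let ?w = "\<lambda>k. mollify (eps k) w" and ?W = "\<lambda>k. mollify (eps k) W"
  obtain R1 where c1: "L2_compact R1 (\<lambda>x. partial_derivative i \<phi> x * u x)" by (rule test_L2_compact[OF L(1) d\<phi>])
  obtain R2 where c2: "L2_compact R2 (\<lambda>x. \<phi> x * u x)" by (rule test_L2_compact[OF L(1) \<phi>])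
  obtain R3 where c3: "L2_compact R3 (\<lambda>x. \<phi> x * U x)" by (rule test_L2_compact[OF L(3) \<phi>])
  have eq: "(LINT x|lborel. (partial_derivative i \<phi> x * u x) * ?w k x) + (LINT x|lborel. (\<phi> x * u x) * ?W k x)
    = - (LINT x|lborel. (\<phi> x * U x) * ?w k x)" for k
  proof -
    have t: "test_function (\<lambda>x. \<phi> x * ?w k x)" by (rule test_function_mult_smooth[OF \<phi> mollify_smooth[OF L(2)]])
    have "partial_derivative i (\<lambda>x. \<phi> x * ?w k x) = (\<lambda>x. partial_derivative i \<phi> x * ?w k x + \<phi> x * ?W k x)"
      unfolding mollify_weak_derivative[OF w, symmetric]
      by (rule partial_derivative_mult)
        (auto intro: smooth_differentiable test_function_smooth[OF \<phi>] mollify_smooth L)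
    from weak_derivativeD[OF u t, unfolded this]
    have "(LINT x|lborel. (partial_derivative i \<phi> x * u x) * ?w k x + (\<phi> x * u x) * ?W k x)
      = - (LINT x|lborel. (\<phi> x * U x) * ?w k x)" by (simp add: algebra_simps)
    then show ?thesis
      using L2_compact_integrable[OF c1 mollify_L2_loc[OF L(2)]] L2_compact_integrable[OF c2 mollify_L2_loc[OF L(4)]]
      by simp
  qed
  have "(\<lambda>k. (LINT x|lborel. (partial_derivative i \<phi> x * u x) * ?w k x) + (LINT x|lborel. (\<phi> x * u x) * ?W k x))
    \<longlonglongrightarrow> (LINT x|lborel. (partial_derivative i \<phi> x * u x) * w x) + (LINT x|lborel. (\<phi> x * u x) * W x)"
    by (intro tendsto_add mollify_pairing[OF _ c1] mollify_pairing[OF _ c2] L)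
  moreover have "(\<lambda>k. - (LINT x|lborel. (\<phi> x * U x) * ?w k x)) \<longlonglongrightarrow> - (LINT x|lborel. (\<phi> x * U x) * w x)"
    by (intro tendsto_minus mollify_pairing[OF _ c3] L)
  ultimately have "(LINT x|lborel. (partial_derivative i \<phi> x * u x) * w x) + (LINT x|lborel. (\<phi> x * u x) * W x)
    = - (LINT x|lborel. (\<phi> x * U x) * w x)"
    unfolding eq by (rule LIMSEQ_unique)
  moreover have "(LINT x|lborel. \<phi> x * (U x * w x + u x * W x))
    = (LINT x|lborel. (\<phi> x * U x) * w x) + (LINT x|lborel. (\<phi> x * u x) * W x)"
    using L2_compact_integrable[OF c3 L(2)] L2_compact_integrable[OF c2 L(4)]
    by (simp add: distrib_left mult.assoc)
  ultimately show "(LINT x|lborel. partial_derivative i \<phi> x * (u x * w x)) = - (LINT x|lborel. \<phi> x * (U x * w x + u x * W x))"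
    by (simp add: mult.assoc)
qed

lemma smooth_L2_loc: "smooth f \<Longrightarrow> L2_loc f"
  by (rule L2_loc_continuous[OF smooth_continuous])

lemma convolve_swap:
  assumes "test_function \<phi>" "test_function \<psi>"
  shows "convolve \<phi> \<psi> = convolve \<psi> \<phi>"
proof
  fix x
  have "convolve \<phi> \<psi> x = (LINT h|lborel. \<phi> h * \<psi> (x - h))"
    by (intro convolve_commute smooth_borel test_function_smooth assms)
  then show "convolve \<phi> \<psi> x = convolve \<psi> \<phi> x" by (simp add: convolve_def mult.commute)
qed

text \<open>Both orders of differentiation agree for convolutions, since each derivative may be
  moved to either factor; mollification transfers this to a test function.\<close>

lemma test_function_partial_commute:
  fixes \<psi> :: "real^'n::finite \<Rightarrow> real"
  assumes \<psi>: "test_function \<psi>"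
  shows "partial_derivative i (partial_derivative j \<psi>) = partial_derivative j (partial_derivative i \<psi>)"
proof
  fix x
  let ?D = partial_derivative
  note li = L2_loc_locally_integrable[OF smooth_L2_loc[OF test_function_smooth]]
  have cD: "convolve (?D i \<phi>) w = ?D i (convolve \<phi> w)" if "test_function \<phi>" "test_function w"
    for i and \<phi> w :: "real^'n \<Rightarrow> real"
    by (rule convolve_partial_derivative[OF li[OF that(2)] test_function_C1_compact[OF that(1)], symmetric])
  have eq: "convolve \<rho> (?D i (?D j \<psi>)) = convolve \<rho> (?D j (?D i \<psi>))" if \<rho>: "test_function \<rho>"
    for \<rho> :: "real^'n \<Rightarrow> real"
  proof -
    note t = \<psi> \<rho> test_function_partial_derivative
    have "convolve \<rho> (?D i (?D j \<psi>)) = convolve (?D i (?D j \<psi>)) \<rho>" by (intro convolve_swap t)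
    also have "\<dots> = ?D i (convolve (?D j \<psi>) \<rho>)" by (intro cD t)
    also have "\<dots> = ?D i (convolve \<rho> (?D j \<psi>))" by (simp add: convolve_swap[OF \<rho> test_function_partial_derivative[OF \<psi>]])
    also have "\<dots> = convolve (?D i \<rho>) (?D j \<psi>)" by (intro cD[symmetric] t)
    also have "\<dots> = convolve (?D j \<psi>) (?D i \<rho>)" by (intro convolve_swap t)
    also have "\<dots> = ?D j (convolve \<psi> (?D i \<rho>))" by (intro cD t)
    also have "\<dots> = ?D j (convolve (?D i \<rho>) \<psi>)" by (simp add: convolve_swap[OF \<psi> test_function_partial_derivative[OF \<rho>]])
    also have "\<dots> = ?D j (?D i (convolve \<rho> \<psi>))" by (simp add: cD[OF \<rho> \<psi>])
    also have "\<dots> = ?D j (?D i (convolve \<psi> \<rho>))" by (simp add: convolve_swap[OF \<psi> \<rho>])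
    also have "\<dots> = ?D j (convolve (?D i \<psi>) \<rho>)" by (simp add: cD[OF \<psi> \<rho>])
    also have "\<dots> = convolve (?D j (?D i \<psi>)) \<rho>" by (intro cD[symmetric] t)
    also have "\<dots> = convolve \<rho> (?D j (?D i \<psi>))" by (intro convolve_swap t)
    finally show ?thesis .
  qed
  have lim: "(\<lambda>k. mollify (eps k) (?D i (?D j \<psi>)) x) \<longlonglongrightarrow> ?D i (?D j \<psi>) x" for i j
    by (intro mollify_tendsto_continuous li test_function_partial_derivative \<psi>
        smooth_continuous test_function_smooth)
  show "?D i (?D j \<psi>) x = ?D j (?D i \<psi>) x"
    using lim[of i j] lim[of j i] unfolding eq[OF mollifier_test[OF eps_pos]] by (rule LIMSEQ_unique)
qed

text \<open>Fixes the order convention: the list [i, j] tests u against the i-derivative of the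
  j-derivative of \<phi>, so the outer i is integrated by parts first and [i, j] means
  differentiating u by i and the result by j.\<close>

lemma weak_derivative_second:
  fixes u g :: "real^'n::finite \<Rightarrow> real"
  assumes "has_weak_derivative [i] u a"
  shows "has_weak_derivative [i, j] u g \<longleftrightarrow> has_weak_derivative [j] a g"
proof -
  have "(LINT x|lborel. partial_derivative i (partial_derivative j \<phi>) x * u x)
    = - (LINT x|lborel. partial_derivative j \<phi> x * a x)" if "test_function \<phi>" for \<phi>
    by (rule weak_derivativeD[OF assms test_function_partial_derivative[OF that]])
  then show ?thesis
    using weak_derivative_locally_integrable[OF assms] unfolding has_weak_derivative_def by auto
qed

text \<open>The two derivatives can be exchanged on test functions, so both iterated weak
  derivatives satisfy the same defining identity for u.\<close>

lemma weak_derivative_commute: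
  fixes u a b c d :: "real^'n::finite \<Rightarrow> real"
  assumes "has_weak_derivative [i] u a" "has_weak_derivative [j] u b"
    "has_weak_derivative [j] a c" "has_weak_derivative [i] b d"
  shows "AE x in lborel. c x = d x"
proof -
  have "has_weak_derivative [i, j] u c" using weak_derivative_second[OF assms(1)] assms(3) by blast
  moreover have "has_weak_derivative [j, i] u d" using weak_derivative_second[OF assms(2)] assms(4) by blast
  then have "has_weak_derivative [i, j] u d"
    unfolding has_weak_derivative_def by (simp add: test_function_partial_commute[of _ i j])
  ultimately show ?thesis by (rule weak_derivative_unique)
qed

lemma weak_derivative_smooth:
  fixes f :: "real^'n::finite \<Rightarrow> real"
  assumes "smooth f" shows "has_weak_derivative [i] f (partial_derivative i f)"
proof (rule weak_derivativeI)
  show "locally_integrable f" "locally_integrable (partial_derivative i f)"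
    by (intro L2_loc_locally_integrable smooth_L2_loc smooth_partial_derivative assms)+
  fix \<phi> :: "real^'n \<Rightarrow> real" assume \<phi>: "test_function \<phi>"
  have t: "test_function (\<lambda>x. \<phi> x * f x)" by (rule test_function_mult_smooth[OF \<phi> assms])
  have "0 = (LINT x|lborel. partial_derivative i \<phi> x * f x + \<phi> x * partial_derivative i f x)"
    using integral_partial_derivative[OF test_function_C1_compact[OF t], of i]
    by (simp add: partial_derivative_mult smooth_differentiable test_function_smooth assms \<phi>)
  also have "\<dots> = (LINT x|lborel. partial_derivative i \<phi> x * f x) + (LINT x|lborel. \<phi> x * partial_derivative i f x)"
    by (intro Bochner_Integration.integral_add test_function_integrable test_function_mult_smooth
        test_function_partial_derivative smooth_partial_derivative assms \<phi>)
  finally show "(LINT x|lborel. partial_derivative i \<phi> x * f x) = - (LINT x|lborel. \<phi> x * partial_derivative i f x)"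
    by simp
qed

lemma weak_derivative_add:
  fixes u w U W :: "real^'n::finite \<Rightarrow> real"
  assumes u: "has_weak_derivative [i] u U" and w: "has_weak_derivative [i] w W"
  shows "has_weak_derivative [i] (\<lambda>x. u x + w x) (\<lambda>x. U x + W x)"
proof (rule weak_derivativeI)
  note l = weak_derivative_locally_integrable[OF u] weak_derivative_locally_integrable[OF w]
  show "locally_integrable (\<lambda>x. u x + w x)" "locally_integrable (\<lambda>x. U x + W x)"
    by (intro locally_integrable_add l)+
  fix \<phi> :: "real^'n \<Rightarrow> real" assume \<phi>: "test_function \<phi>"
  have i: "integrable lborel (\<lambda>x. \<psi> x * h x)" if "locally_integrable h" "test_function \<psi>" for h \<psi> :: "real^'n \<Rightarrow> real"
    using locally_integrable_test[OF that] by simp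
  show "(LINT x|lborel. partial_derivative i \<phi> x * (u x + w x)) = - (LINT x|lborel. \<phi> x * (U x + W x))"
    using weak_derivativeD[OF u \<phi>] weak_derivativeD[OF w \<phi>] l i \<phi> test_function_partial_derivative[OF \<phi>]
    by (simp add: distrib_left)
qed

lemma weak_derivative_cmult:
  fixes u U :: "real^'n::finite \<Rightarrow> real"
  assumes u: "has_weak_derivative [i] u U"
  shows "has_weak_derivative [i] (\<lambda>x. c * u x) (\<lambda>x. c * U x)"
proof (rule weak_derivativeI)
  show "locally_integrable (\<lambda>x. c * u x)" "locally_integrable (\<lambda>x. c * U x)"
    by (intro locally_integrable_cmult weak_derivative_locally_integrable[OF u])+
  fix \<phi> :: "real^'n \<Rightarrow> real" assume "test_function \<phi>"
  from weak_derivativeD[OF u this]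
  show "(LINT x|lborel. partial_derivative i \<phi> x * (c * u x)) = - (LINT x|lborel. \<phi> x * (c * U x))"
    by (simp add: mult.left_commute[of _ c])
qed

lemma weak_derivative_const:
  "has_weak_derivative [i] (\<lambda>x :: real^'n::finite. c :: real) (\<lambda>x. 0)"
  using weak_derivative_smooth[OF smooth_const, of i c] by simp

lemma bounded_on_interval:
  fixes F :: "real \<Rightarrow> real"
  assumes "continuous_on {a..b} F" obtains B where "\<And>s. a \<le> s \<Longrightarrow> s \<le> b \<Longrightarrow> \<bar>F s\<bar> \<le> B"
proof -
  have "bounded (F ` {a..b})" by (intro compact_imp_bounded compact_continuous_image assms) simp
  then obtain B where "\<forall>y\<in>F ` {a..b}. norm y \<le> B" unfolding bounded_iff by blast
  then show thesis by (intro that[of B]) auto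
qed

text \<open>The classical chain rule holds for mollifications of u. Continuity of u makes them
  converge pointwise, so F and F' of them converge boundedly; the derivatives converge only in the
  local L^2 sense and are handled by a pairing.\<close>

lemma weak_derivative_compose:
  fixes u U :: "real^'n::finite \<Rightarrow> real" and F F' :: "real \<Rightarrow> real"
  assumes u: "has_weak_derivative [i] u U" and U: "L2_loc U" and cu: "continuous_on UNIV u"
    and ab: "\<And>x. a \<le> u x \<and> u x \<le> b"
    and F: "\<And>s. a \<le> s \<Longrightarrow> s \<le> b \<Longrightarrow> (F has_real_derivative F' s) (at s)"
    and cF': "continuous_on {a..b} F'"
  shows "has_weak_derivative [i] (\<lambda>x. F (u x)) (\<lambda>x. F' (u x) * U x)"
proof (rule weak_derivativeI)
  let ?u = "\<lambda>k. mollify (eps k) u" and ?U = "\<lambda>k. mollify (eps k) U"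
  have lu: "L2_loc u" by (rule L2_loc_continuous[OF cu])
  have su: "smooth (?u k)" for k by (rule mollify_smooth[OF lu])
  \<comment> \<open>Averages stay in the interval [a, b], so F and F' are only ever evaluated where
    they are controlled.\<close>
  have ab': "a \<le> ?u k x" "?u k x \<le> b" for k x
    using mollify_bounds[OF L2_loc_locally_integrable[OF lu] eps_pos, of x k a b] ab by blast+
  have cF: "continuous_on {a..b} F"
  proof (intro continuous_at_imp_continuous_on ballI)
    show "isCont F s" if "s \<in> {a..b}" for s by (rule DERIV_isCont[OF F]) (use that in auto)
  qed
  obtain B where B: "\<And>s. a \<le> s \<Longrightarrow> s \<le> b \<Longrightarrow> \<bar>F s\<bar> \<le> B" using bounded_on_interval[OF cF] by blast
  obtain B' where B': "\<And>s. a \<le> s \<Longrightarrow> s \<le> b \<Longrightarrow> \<bar>F' s\<bar> \<le> B'" using bounded_on_interval[OF cF'] by blast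
  have comp: "continuous_on UNIV (\<lambda>x. G (w x))"
    if "continuous_on {a..b} G" "continuous_on UNIV w" "\<And>x. a \<le> w x \<and> w x \<le> b" for G and w :: "real^'n \<Rightarrow> real"
  proof -
    have "range w \<subseteq> {a..b}" using that(3) by (simp add: image_subset_iff)
    then show ?thesis by (rule continuous_on_compose2[OF that(1,2)])
  qed
  have cFu: "continuous_on UNIV (\<lambda>x. F (u x))" "continuous_on UNIV (\<lambda>x. F' (u x))"
    by (rule comp[OF cF cu ab] comp[OF cF' cu ab])+
  have cFuk: "continuous_on UNIV (\<lambda>x. F (?u k x))" "continuous_on UNIV (\<lambda>x. F' (?u k x))" for k
    using comp[OF cF smooth_continuous[OF su, of UNIV k]] comp[OF cF' smooth_continuous[OF su, of UNIV k]] ab' by blast+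
  note meas = borel_measurable_continuous_onI
  show "locally_integrable (\<lambda>x. F (u x))" by (rule L2_loc_locally_integrable[OF L2_loc_continuous[OF cFu(1)]])
  show "locally_integrable (\<lambda>x. F' (u x) * U x)"
    by (rule L2_loc_mult[OF L2_loc_continuous[OF cFu(2)] U])
  fix \<phi> :: "real^'n \<Rightarrow> real" assume \<phi>: "test_function \<phi>"
  note s\<phi> = test_function_smooth[OF \<phi>]
  note d\<phi> = test_function_partial_derivative[OF \<phi>, of i]
  have [measurable]: "\<phi> \<in> borel_measurable borel" "partial_derivative i \<phi> \<in> borel_measurable borel"
    "U \<in> borel_measurable borel" "(\<lambda>x. F (u x)) \<in> borel_measurable borel" "(\<lambda>x. F' (u x)) \<in> borel_measurable borel"
    by (intro smooth_borel s\<phi> smooth_partial_derivative L2_loc_borel[OF U] meas cFu)+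
  have [measurable]: "(\<lambda>x. F (?u k x)) \<in> borel_measurable borel" "(\<lambda>x. F' (?u k x)) \<in> borel_measurable borel"
    "mollify (eps k) U \<in> borel_measurable borel" for k
    by (intro meas cFuk smooth_borel mollify_smooth U)+
  have eq: "(LINT x|lborel. partial_derivative i \<phi> x * F (?u k x)) = - (LINT x|lborel. \<phi> x * F' (?u k x) * ?U k x)" for k
  proof -
    let ?h = "\<lambda>x. \<phi> x * F (?u k x)"
    have diff: "((\<lambda>x. F (?u k x)) has_derivative (\<lambda>h. F' (?u k x) * (\<Sum>j\<in>UNIV. h $ j * partial_derivative j (?u k) x))) (at x)" for x
      using has_derivative_compose[OF has_derivative_partials[OF smooth_differentiable[OF su]]
          F[OF ab', unfolded has_field_derivative_def]] .
    have pd: "partial_derivative j (\<lambda>x. F (?u k x)) = (\<lambda>x. F' (?u k x) * partial_derivative j (?u k) x)" for j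
    proof
      fix x
      have "(\<Sum>l\<in>UNIV. axis j 1 $ l * partial_derivative l (?u k) x) = (\<Sum>l\<in>UNIV. if l = j then partial_derivative l (?u k) x else 0)"
        by (intro sum.cong refl) (simp add: axis_def)
      then show "partial_derivative j (\<lambda>x. F (?u k x)) x = F' (?u k x) * partial_derivative j (?u k) x"
        unfolding partial_derivative_eq[OF diff] by simp
    qed
    have dF: "(\<lambda>x. F (?u k x)) differentiable (at x)" for x using diff differentiableI by blast
    have pdh: "partial_derivative j ?h = (\<lambda>x. partial_derivative j \<phi> x * F (?u k x) + \<phi> x * (F' (?u k x) * partial_derivative j (?u k) x))" for j
      using partial_derivative_mult[OF smooth_differentiable[OF s\<phi>] dF, of j] by (simp only: pd)
    have C1: "C1_compact ?h"
      unfolding C1_compact_def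
    proof (intro conjI allI)
      show "?h differentiable (at x)" for x by (intro differentiable_mult dF smooth_differentiable s\<phi>)
      show "continuous_on UNIV (partial_derivative j ?h)" for j
        unfolding pdh by (intro continuous_intros smooth_continuous s\<phi> smooth_partial_derivative su cFuk)
      obtain R where "\<And>x. x \<notin> cball 0 R \<Longrightarrow> \<phi> x = 0" using \<phi> test_functionE by metis
      then show "\<exists>R. \<forall>x. x \<notin> cball 0 R \<longrightarrow> ?h x = 0" by (metis mult_zero_left)
    qed
    have i1: "integrable lborel (\<lambda>x. partial_derivative i \<phi> x * F (?u k x))"
      using locally_integrable_test[OF L2_loc_locally_integrable[OF L2_loc_continuous[OF cFuk(1)]] d\<phi>] by simp
    have i2: "integrable lborel (\<lambda>x. \<phi> x * (F' (?u k x) * ?U k x))"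
      using locally_integrable_test[OF L2_loc_mult[OF L2_loc_continuous[OF cFuk(2)] mollify_L2_loc[OF U]] \<phi>] by simp
    show ?thesis
      using integral_partial_derivative[OF C1, of i] i1 i2
      unfolding pdh mollify_weak_derivative[OF u] by (simp add: mult.assoc)
  qed
  have lim1: "(\<lambda>k. LINT x|lborel. partial_derivative i \<phi> x * F (?u k x)) \<longlonglongrightarrow> (LINT x|lborel. partial_derivative i \<phi> x * F (u x))"
  proof (rule integral_dominated_convergence[where w="\<lambda>x. B * \<bar>partial_derivative i \<phi> x\<bar>"])
    show "integrable lborel (\<lambda>x. B * \<bar>partial_derivative i \<phi> x\<bar>)"
      using test_function_integrable[OF d\<phi>] by simp
    show "AE x in lborel. norm (partial_derivative i \<phi> x * F (?u k x)) \<le> B * \<bar>partial_derivative i \<phi> x\<bar>" for k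
      using B[OF ab'] by (intro AE_I2) (simp add: abs_mult mult.commute[of B] mult_left_mono)
    have "(\<lambda>k. F (?u k x)) \<longlonglongrightarrow> F (u x)" for x
      by (rule isCont_tendsto_compose[OF DERIV_isCont[OF F]])
        (use ab[of x] mollify_tendsto_continuous[OF L2_loc_locally_integrable[OF lu] cu] in auto)
    then show "AE x in lborel. (\<lambda>k. partial_derivative i \<phi> x * F (?u k x)) \<longlonglongrightarrow> partial_derivative i \<phi> x * F (u x)"
      by (intro AE_I2 tendsto_mult_left)
  qed measurable
  have iU: "integrable lborel (\<lambda>x. \<phi> x * U x)"
    using locally_integrable_test[OF L2_loc_locally_integrable[OF U] \<phi>] by simp
  have b2: "\<bar>\<phi> x * F' (?u k x) * U x\<bar> \<le> B' * \<bar>\<phi> x * U x\<bar>" for k x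
    using mult_left_mono[OF B'[OF ab'], of "\<bar>\<phi> x * U x\<bar>" k x] by (simp add: abs_mult mult_ac)
  have lim2: "(\<lambda>k. LINT x|lborel. \<phi> x * F' (?u k x) * U x) \<longlonglongrightarrow> (LINT x|lborel. \<phi> x * F' (u x) * U x)"
  proof (rule integral_dominated_convergence[where w="\<lambda>x. B' * \<bar>\<phi> x * U x\<bar>"])
    show "integrable lborel (\<lambda>x. B' * \<bar>\<phi> x * U x\<bar>)" using iU by simp
    show "AE x in lborel. norm (\<phi> x * F' (?u k x) * U x) \<le> B' * \<bar>\<phi> x * U x\<bar>" for k
      using b2 by simp
    have "(\<lambda>k. F' (?u k x)) \<longlonglongrightarrow> F' (u x)" for x
      using continuous_on_tendsto_compose[OF cF' mollify_tendsto_continuous[OF L2_loc_locally_integrable[OF lu] cu, of x]]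
        ab[of x] ab' by auto
    then show "AE x in lborel. (\<lambda>k. \<phi> x * F' (?u k x) * U x) \<longlonglongrightarrow> \<phi> x * F' (u x) * U x"
      by (intro AE_I2 tendsto_mult tendsto_const)
  qed measurable
  obtain R where c: "L2_compact R (\<lambda>x. \<phi> x * B')" by (rule test_L2_compact[OF L2_loc_const \<phi>])
  have lim3: "(\<lambda>k. LINT x|lborel. (\<phi> x * F' (?u k x)) * (?U k x - U x)) \<longlonglongrightarrow> 0"
  proof (rule mollify_pairing_gen[OF U c])
    fix k x
    show "\<bar>\<phi> x * F' (?u k x)\<bar> \<le> \<bar>\<phi> x * B'\<bar>"
      using mult_left_mono[OF order_trans[OF B'[OF ab'] abs_ge_self], of "\<bar>\<phi> x\<bar>" k x] by (simp add: abs_mult)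
  qed
  \<comment> \<open>Both factors depend on k. The split isolates an error paired with a dominated
    varying weight and a term with U fixed, to which dominated convergence applies.\<close>
  have "(LINT x|lborel. \<phi> x * F' (?u k x) * ?U k x)
    = (LINT x|lborel. (\<phi> x * F' (?u k x)) * (?U k x - U x)) + (LINT x|lborel. \<phi> x * F' (?u k x) * U x)" for k
  proof -
    have i2: "integrable lborel (\<lambda>x. \<phi> x * F' (?u k x) * ?U k x)"
      using locally_integrable_test[OF L2_loc_mult[OF L2_loc_continuous[OF cFuk(2)] mollify_L2_loc[OF U]] \<phi>]
      by (simp add: mult.assoc)
    have i3: "integrable lborel (\<lambda>x. \<phi> x * F' (?u k x) * U x)"
      using locally_integrable_test[OF L2_loc_mult[OF L2_loc_continuous[OF cFuk(2)] U] \<phi>] by (simp add: mult.assoc)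
    show ?thesis using i2 i3 by (simp add: right_diff_distrib)
  qed
  then have "(\<lambda>k. LINT x|lborel. \<phi> x * F' (?u k x) * ?U k x) \<longlonglongrightarrow> (LINT x|lborel. \<phi> x * F' (u x) * U x)"
    using tendsto_add[OF lim3 lim2] by simp
  from LIMSEQ_unique[OF lim1[unfolded eq] tendsto_minus[OF this]]
  show "(LINT x|lborel. partial_derivative i \<phi> x * F (u x)) = - (LINT x|lborel. \<phi> x * (F' (u x) * U x))"
    by (simp add: mult.assoc)
qed

text \<open>Integrate the derivative of \<open>\<zeta>\<^sup>2 f\<^sup>3 v\<close> with \<open>f\<close> the derivative of \<open>v\<close>, and absorb the
  fourth powers by Young's inequality.\<close>

lemma smooth_L4:
  fixes v \<zeta> :: "real^'n::finite \<Rightarrow> real" and i :: 'n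
  assumes v: "smooth v" "\<And>x. \<bar>v x\<bar> \<le> 2" and \<zeta>: "test_function \<zeta>"
  defines "f \<equiv> partial_derivative i v" and "g \<equiv> partial_derivative i (partial_derivative i v)"
  shows "(LINT x|lborel. (\<zeta> x)\<^sup>2 * f x ^ 4)
    \<le> (LINT x|lborel. 32 * (partial_derivative i \<zeta> x)\<^sup>2 * (f x)\<^sup>2 + 72 * (\<zeta> x)\<^sup>2 * (g x)\<^sup>2)"
proof -
  let ?z = "partial_derivative i \<zeta>"
  have sf: "smooth f" and sg: "smooth g" unfolding f_def g_def by (intro smooth_partial_derivative v)+
  have dz: "test_function ?z" by (rule test_function_partial_derivative[OF \<zeta>])
  let ?h = "\<lambda>x. \<zeta> x * (\<zeta> x * (f x * (f x * (f x * v x))))"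
  have th: "test_function ?h"
    by (intro test_function_mult_smooth[OF \<zeta>] smooth_mult test_function_smooth[OF \<zeta>] sf v)
  have d: "smooth w \<Longrightarrow> w differentiable (at x)" for w and x :: "real^'n" by (rule smooth_differentiable)
  have pd: "partial_derivative i ?h = (\<lambda>x. ?z x * (\<zeta> x * (f x * (f x * (f x * v x)))) + \<zeta> x *
    (?z x * (f x * (f x * (f x * v x))) + \<zeta> x * (g x * (f x * (f x * v x)) +
      f x * (g x * (f x * v x) + f x * (g x * v x + f x * f x)))))"
    by (simp add: partial_derivative_mult d smooth_mult test_function_smooth[OF \<zeta>] sf v f_def[symmetric] g_def[symmetric])
      (simp add: f_def g_def)
  have pt: "(\<zeta> x)\<^sup>2 * f x ^ 4 \<le> 2 * partial_derivative i ?h x + (32 * (?z x)\<^sup>2 * (f x)\<^sup>2 + 72 * (\<zeta> x)\<^sup>2 * (g x)\<^sup>2)" for x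
  proof -
    \<comment> \<open>With these, twice the derivative of the test product is 2 A^2 + 4 A B v + 6 A
      C v. As |v| \<le> 2, the cross terms are at most 8 |A| |B| and 12 |A| |C|; each is allowed to
      consume A^2 / 2, which produces 32 = 8^2 / 2 and 72 = 12^2 / 2 and leaves A^2.\<close>
    define A B C where "A = \<zeta> x * (f x)\<^sup>2" and "B = ?z x * f x" and "C = \<zeta> x * g x"
    have "\<bar>4 * A * B * v x\<bar> \<le> 8 * (\<bar>A\<bar> * \<bar>B\<bar>)"
      using mult_left_mono[OF v(2)[of x], of "4 * (\<bar>A\<bar> * \<bar>B\<bar>)"] by (simp add: abs_mult mult_ac)
    moreover have "\<bar>6 * A * C * v x\<bar> \<le> 12 * (\<bar>A\<bar> * \<bar>C\<bar>)"
      using mult_left_mono[OF v(2)[of x], of "6 * (\<bar>A\<bar> * \<bar>C\<bar>)"] by (simp add: abs_mult mult_ac)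
    moreover have "8 * (\<bar>A\<bar> * \<bar>B\<bar>) \<le> A\<^sup>2 / 2 + 32 * B\<^sup>2"
      using zero_le_power2[of "\<bar>A\<bar> - 8 * \<bar>B\<bar>"] by (simp add: power2_diff power_mult_distrib)
    moreover have "12 * (\<bar>A\<bar> * \<bar>C\<bar>) \<le> A\<^sup>2 / 2 + 72 * C\<^sup>2"
      using zero_le_power2[of "\<bar>A\<bar> - 12 * \<bar>C\<bar>"] by (simp add: power2_diff power_mult_distrib)
    moreover have "2 * partial_derivative i ?h x = 4 * A * B * v x + 6 * A * C * v x + 2 * A\<^sup>2"
      unfolding pd A_def B_def C_def by (simp add: power2_eq_square algebra_simps)
    ultimately have "A\<^sup>2 \<le> 2 * partial_derivative i ?h x + (32 * B\<^sup>2 + 72 * C\<^sup>2)" by linarith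
    then show ?thesis unfolding A_def B_def C_def by (simp add: power_mult_distrib flip: power_mult)
  qed
  have i1: "integrable lborel (\<lambda>x. (\<zeta> x)\<^sup>2 * f x ^ 4)"
    unfolding power2_eq_square mult.assoc
    by (intro test_function_integrable test_function_mult_smooth[OF \<zeta>] smooth_mult smooth_power test_function_smooth[OF \<zeta>] sf)
  have i2: "integrable lborel (partial_derivative i ?h)"
    by (intro test_function_integrable test_function_partial_derivative th)
  have i3: "integrable lborel (\<lambda>x. ?z x * (?z x * (f x)\<^sup>2))" "integrable lborel (\<lambda>x. \<zeta> x * (\<zeta> x * (g x)\<^sup>2))"
    by (intro test_function_integrable test_function_mult_smooth[OF \<zeta>] test_function_mult_smooth[OF dz]
        smooth_mult smooth_power test_function_smooth[OF \<zeta>] test_function_smooth[OF dz] sf sg)+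
  then have i4: "integrable lborel (\<lambda>x. 32 * (?z x)\<^sup>2 * (f x)\<^sup>2 + 72 * (\<zeta> x)\<^sup>2 * (g x)\<^sup>2)"
    using Bochner_Integration.integrable_add[OF integrable_mult_right[OF i3(1), of 32] integrable_mult_right[OF i3(2), of 72]]
    by (simp add: power2_eq_square mult.assoc)
  have "(LINT x|lborel. (\<zeta> x)\<^sup>2 * f x ^ 4)
    \<le> (LINT x|lborel. 2 * partial_derivative i ?h x + (32 * (?z x)\<^sup>2 * (f x)\<^sup>2 + 72 * (\<zeta> x)\<^sup>2 * (g x)\<^sup>2))"
    by (rule integral_mono) (use i1 i2 i4 pt in \<open>auto intro!: Bochner_Integration.integrable_add\<close>)
  also have "\<dots> = (LINT x|lborel. 32 * (?z x)\<^sup>2 * (f x)\<^sup>2 + 72 * (\<zeta> x)\<^sup>2 * (g x)\<^sup>2)"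
    using i2 i4 integral_partial_derivative[OF test_function_C1_compact[OF th], of i] by simp
  finally show ?thesis .
qed


text \<open>Mollification preserves the bound on u and commutes with the derivatives, so the smooth
  inequality applies at each scale. Its right side converges; on the left Fatou's lemma along an
  almost everywhere convergent subsequence suffices. Nonnegative integration is used because
  integrability of the fourth power is part of what is being learnt.\<close>

lemma weak_L4:
  fixes u f g \<zeta> :: "real^'n::finite \<Rightarrow> real"
  assumes u: "has_weak_derivative [i] u f" "L2_loc u" "\<And>x. \<bar>u x\<bar> \<le> 2"
    and f: "has_weak_derivative [i] f g" "L2_loc f" and g: "L2_loc g" and \<zeta>: "test_function \<zeta>"
  shows "(\<integral>\<^sup>+x. ennreal ((\<zeta> x)\<^sup>2 * f x ^ 4) \<partial>lborel)
    \<le> ennreal (LINT x|lborel. 32 * (partial_derivative i \<zeta> x)\<^sup>2 * (f x)\<^sup>2 + 72 * (\<zeta> x)\<^sup>2 * (g x)\<^sup>2)"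
proof -
  let ?u = "\<lambda>k. mollify (eps k) u" and ?f = "\<lambda>k. mollify (eps k) f" and ?g = "\<lambda>k. mollify (eps k) g"
  let ?z = "partial_derivative i \<zeta>"
  obtain R where R: "\<And>x. x \<notin> cball 0 R \<Longrightarrow> \<zeta> x = 0" using \<zeta> test_functionE by metis
  note Rz = partial_derivative_zero[OF closed_cball R]
  have dz: "test_function ?z" by (rule test_function_partial_derivative[OF \<zeta>])
  obtain B where B: "\<And>x. \<bar>\<zeta> x\<bar> \<le> B" using test_function_bounded[OF \<zeta>] by blast
  obtain C where C: "\<And>x. \<bar>?z x\<bar> \<le> C" using test_function_bounded[OF dz] by blast
  have [measurable]: "\<zeta> \<in> borel_measurable borel" "?z \<in> borel_measurable borel" "f \<in> borel_measurable borel"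
    "g \<in> borel_measurable borel" "\<And>k. mollify (eps k) f \<in> borel_measurable borel"
    by (intro smooth_borel test_function_smooth \<zeta> dz L2_loc_borel f g mollify_smooth)+
  define rhs where "rhs = (\<lambda>f g. LINT x|lborel. 32 * (?z x)\<^sup>2 * (f x)\<^sup>2 + 72 * (\<zeta> x)\<^sup>2 * (g x)\<^sup>2)"
  have m: "(\<lambda>x. 32 * (?z x)\<^sup>2) \<in> borel_measurable borel" "(\<lambda>x. 72 * (\<zeta> x)\<^sup>2) \<in> borel_measurable borel"
    by measurable
  have bd: "\<bar>32 * (?z x)\<^sup>2\<bar> \<le> 32 * C\<^sup>2" "\<bar>72 * (\<zeta> x)\<^sup>2\<bar> \<le> 72 * B\<^sup>2" for x
    using power_mono[OF C[of x], of 2] power_mono[OF B[of x], of 2] by simp_all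
  have van: "32 * (?z x)\<^sup>2 = 0" "72 * (\<zeta> x)\<^sup>2 = 0" if "x \<notin> cball 0 R" for x
    using R[OF that] Rz[OF _ that] by simp_all
  have int: "integrable lborel (\<lambda>x. 32 * (?z x)\<^sup>2 * (w x)\<^sup>2)" "integrable lborel (\<lambda>x. 72 * (\<zeta> x)\<^sup>2 * (w x)\<^sup>2)"
    if "L2_loc w" for w
    using locally_integrable_mult_bounded[OF L2_loc_square[OF that] m(1) compact_cball[of 0 R] van(1) bd(1)]
      locally_integrable_mult_bounded[OF L2_loc_square[OF that] m(2) compact_cball[of 0 R] van(2) bd(2)] by simp_all
  have rhs_eq: "rhs v w = (LINT x|lborel. 32 * (?z x)\<^sup>2 * (v x)\<^sup>2) + (LINT x|lborel. 72 * (\<zeta> x)\<^sup>2 * (w x)\<^sup>2)"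
    if "L2_loc v" "L2_loc w" for v w
    unfolding rhs_def by (rule Bochner_Integration.integral_add[OF int(1)[OF that(1)] int(2)[OF that(2)]])
  have lim: "(\<lambda>k. rhs (?f k) (?g k)) \<longlonglongrightarrow> rhs f g"
    unfolding rhs_eq[OF f(2) g] rhs_eq[OF mollify_L2_loc[OF f(2)] mollify_L2_loc[OF g]]
    by (intro tendsto_add mollify_square[OF f(2) m(1) bd(1) van(1)] mollify_square[OF g m(2) bd(2) van(2)])
  have step: "(\<integral>\<^sup>+x. ennreal ((\<zeta> x)\<^sup>2 * ?f k x ^ 4) \<partial>lborel) \<le> ennreal (rhs (?f k) (?g k))" for k
  proof -
    have b: "\<bar>?u k x\<bar> \<le> 2" for x
    proof -
      have "- 2 \<le> u y \<and> u y \<le> 2" for y using u(3)[of y] by (simp add: abs_le_iff)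
      then show ?thesis
        using mollify_bounds[OF L2_loc_locally_integrable[OF u(2)] eps_pos, of x k "-2" 2] by (simp add: abs_le_iff)
    qed
    note L4 = smooth_L4[OF mollify_smooth[OF u(2)] b \<zeta>, where i=i,
        unfolded mollify_weak_derivative[OF u(1)] mollify_weak_derivative[OF f(1)]]
    have "integrable lborel (\<lambda>x. (\<zeta> x)\<^sup>2 * ?f k x ^ 4)"
      unfolding power2_eq_square mult.assoc
      by (intro test_function_integrable test_function_mult_smooth[OF \<zeta>] smooth_mult smooth_power
          test_function_smooth[OF \<zeta>] mollify_smooth f)
    then have "(\<integral>\<^sup>+x. ennreal ((\<zeta> x)\<^sup>2 * ?f k x ^ 4) \<partial>lborel) = ennreal (LINT x|lborel. (\<zeta> x)\<^sup>2 * ?f k x ^ 4)"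
      by (rule nn_integral_eq_integral) simp
    also have "\<dots> \<le> ennreal (rhs (?f k) (?g k))" unfolding rhs_def by (rule ennreal_leI[OF L4])
    finally show ?thesis .
  qed
  obtain r where r: "strict_mono r" "AE x in lborel. x \<in> cball 0 R \<longrightarrow> (\<lambda>k. ?f (r k) x) \<longlonglongrightarrow> f x"
    by (rule mollify_AE_subseq[OF L2_loc_locally_integrable[OF f(2)]])
  have "(\<integral>\<^sup>+x. ennreal ((\<zeta> x)\<^sup>2 * f x ^ 4) \<partial>lborel)
    = (\<integral>\<^sup>+x. liminf (\<lambda>k. ennreal ((\<zeta> x)\<^sup>2 * ?f (r k) x ^ 4)) \<partial>lborel)"
  proof (rule nn_integral_cong_AE)
    show "AE x in lborel. ennreal ((\<zeta> x)\<^sup>2 * f x ^ 4) = liminf (\<lambda>k. ennreal ((\<zeta> x)\<^sup>2 * ?f (r k) x ^ 4))"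
      using r(2)
    proof eventually_elim
      case (elim x)
      have "(\<lambda>k. ennreal ((\<zeta> x)\<^sup>2 * ?f (r k) x ^ 4)) \<longlonglongrightarrow> ennreal ((\<zeta> x)\<^sup>2 * f x ^ 4)"
      proof (cases "x \<in> cball 0 R")
        case True
        with elim show ?thesis by (intro tendsto_ennrealI tendsto_mult tendsto_const tendsto_power) blast
      next
        case False
        then show ?thesis by (simp add: R)
      qed
      from lim_imp_Liminf[OF _ this] show ?case by simp
    qed
  qed
  also have "\<dots> \<le> liminf (\<lambda>k. \<integral>\<^sup>+x. ennreal ((\<zeta> x)\<^sup>2 * ?f (r k) x ^ 4) \<partial>lborel)"
    by (rule nn_integral_liminf) measurable
  also have "\<dots> \<le> liminf (\<lambda>k. ennreal (rhs (?f (r k)) (?g (r k))))"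
    by (intro Liminf_mono always_eventually allI step)
  also have "\<dots> = ennreal (rhs f g)"
    using LIMSEQ_subseq_LIMSEQ[OF lim r(1)]
    by (intro lim_imp_Liminf tendsto_ennrealI) (simp_all add: o_def)
  finally show ?thesis unfolding rhs_def .
qed

subsection \<open>A pointwise bound in the plane\<close>

definition plane_pair :: "real \<times> real \<Rightarrow> real^2" where
  "plane_pair = (\<lambda>(s, t). s *\<^sub>R axis 1 1 + t *\<^sub>R axis 2 1)"

lemma plane_pair_nth [simp]: "plane_pair (s, t) $ 1 = s" "plane_pair (s, t) $ 2 = t"
  by (simp_all add: plane_pair_def axis_def)

lemma plane_pair_eta: "plane_pair (x $ 1, x $ 2) = x"
  by (simp add: vec_eq_iff forall_2)

lemma plane_pair_measurable [measurable]: "plane_pair \<in> borel_measurable (lborel \<Otimes>\<^sub>M lborel)"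
  unfolding plane_pair_def case_prod_beta by measurable

text \<open>Identifies Lebesgue measure on \<open>real^2\<close> with the product of two lines by
  comparing boxes, so that integrals can be iterated along the coordinates.\<close>

lemma lborel_plane: "lborel = distr (lborel \<Otimes>\<^sub>M lborel) borel plane_pair"
proof (rule lborel_eqI)
  fix l u :: "real^2" assume le: "\<And>b. b \<in> Basis \<Longrightarrow> l \<bullet> b \<le> u \<bullet> b"
  have B: "(Basis :: (real^2) set) = {axis 1 1, axis 2 1}"
    by (auto simp: Basis_vec_def UNIV_2)
  have le': "l $ 1 \<le> u $ 1" "l $ 2 \<le> u $ 2"
    using le[of "axis 1 1"] le[of "axis 2 1"] by (auto simp: B inner_axis)
  have "plane_pair -` box l u = {l $ 1<..<u $ 1} \<times> {l $ 2<..<u $ 2}"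
    by (auto simp: box_def B inner_axis)
  then have "emeasure (distr (lborel \<Otimes>\<^sub>M lborel) borel plane_pair) (box l u)
    = emeasure (lborel \<Otimes>\<^sub>M lborel) ({l $ 1<..<u $ 1} \<times> {l $ 2<..<u $ 2})"
    by (subst emeasure_distr) (auto simp: space_pair_measure)
  also have "\<dots> = ennreal (u $ 1 - l $ 1) * ennreal (u $ 2 - l $ 2)"
    using le' by (subst lborel.emeasure_pair_measure_Times) auto
  also have "\<dots> = (\<Prod>b\<in>Basis. (u - l) \<bullet> b)"
    using le' by (simp add: B inner_axis axis_eq_axis ennreal_mult)
  finally show "emeasure (distr (lborel \<Otimes>\<^sub>M lborel) borel plane_pair) (box l u) = (\<Prod>b\<in>Basis. (u - l) \<bullet> b)" .
qed simp

lemma abs_le_integral_derivative: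
  fixes h h' :: "real \<Rightarrow> real"
  assumes d: "\<And>s. (h has_real_derivative h' s) (at s)" and c: "continuous_on UNIV h'"
    and z: "\<And>s. s \<le> - R \<Longrightarrow> h s = 0"
  shows "ennreal \<bar>h a\<bar> \<le> (\<integral>\<^sup>+s. ennreal \<bar>h' s\<bar> \<partial>lborel)"
proof -
  \<comment> \<open>A starting point to the left of \<open>a\<close> at which h already vanishes,
    wherever \<open>a\<close> lies.\<close>
  define l where "l = min a (- R)"
  have l: "l \<le> a" "h l = 0" using z by (auto simp: l_def)
  have F: "(LINT s|lborel. h' s * indicator {l..a} s) = h a - h l"
    by (rule integral_FTC_Icc_real[OF l(1) d])
      (use c in \<open>simp add: continuous_on_eq_continuous_at\<close>)
  have [measurable]: "h' \<in> borel_measurable borel" using c by (rule borel_measurable_continuous_onI)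
  have "ennreal \<bar>h a\<bar> = ennreal (norm (LINT s|lborel. h' s * indicator {l..a} s))" using F l by simp
  also have "\<dots> \<le> (\<integral>\<^sup>+s. ennreal (norm (h' s * indicator {l..a} s)) \<partial>lborel)"
  proof (rule integral_norm_bound_ennreal)
    show "integrable lborel (\<lambda>s. h' s * indicator {l..a} s)"
      using borel_integrable_compact[of "{l..a}" h'] continuous_on_subset[OF c]
      by (simp add: mult.commute)
  qed
  also have "\<dots> \<le> (\<integral>\<^sup>+s. ennreal \<bar>h' s\<bar> \<partial>lborel)"
    by (intro nn_integral_mono ennreal_leI) (auto simp: indicator_def)
  finally show ?thesis .
qed

text \<open>The endpoint embedding of two derivatives in L^1 into bounded functions of the plane:
  the fundamental theorem of calculus is used along the first coordinate for \<psi> and then along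
  the second for its first partial derivative, and the iterated integral runs over the whole
  plane.\<close>

lemma test_function_sup_bound:
  fixes \<psi> :: "real^2 \<Rightarrow> real"
  assumes \<psi>: "test_function \<psi>"
  shows "\<bar>\<psi> x\<bar> \<le> (LINT y|lborel. \<bar>partial_derivative 2 (partial_derivative 1 \<psi>) y\<bar>)"
proof -
  let ?p = "partial_derivative 1 \<psi>" and ?q = "partial_derivative 2 (partial_derivative 1 \<psi>)"
  have t: "test_function ?p" "test_function ?q" by (intro test_function_partial_derivative \<psi>)+
  have line1: "((\<lambda>s. f (plane_pair (s, t))) has_real_derivative partial_derivative 1 f (plane_pair (s, t))) (at s)"
    and line2: "((\<lambda>t. f (plane_pair (s, t))) has_real_derivative partial_derivative 2 f (plane_pair (s, t))) (at t)"
    if "smooth f" for f :: "real^2 \<Rightarrow> real" and s t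
  proof -
    note D = has_derivative_partials[OF smooth_differentiable[OF that]]
    have "((\<lambda>s. plane_pair (s, t)) has_derivative (\<lambda>h. h *\<^sub>R axis 1 1)) (at s)"
      unfolding plane_pair_def by (auto intro!: derivative_eq_intros)
    from has_derivative_compose[OF this D]
    show "((\<lambda>s. f (plane_pair (s, t))) has_real_derivative partial_derivative 1 f (plane_pair (s, t))) (at s)"
      unfolding has_field_derivative_def
      by (rule has_derivative_eq_rhs) (simp add: fun_eq_iff sum_2 axis_def mult.commute)
    have "((\<lambda>t. plane_pair (s, t)) has_derivative (\<lambda>h. h *\<^sub>R axis 2 1)) (at t)"
      unfolding plane_pair_def by (auto intro!: derivative_eq_intros)
    from has_derivative_compose[OF this D]
    show "((\<lambda>t. f (plane_pair (s, t))) has_real_derivative partial_derivative 2 f (plane_pair (s, t))) (at t)"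
      unfolding has_field_derivative_def
      by (rule has_derivative_eq_rhs) (simp add: fun_eq_iff sum_2 axis_def mult.commute)
  qed
  have cont: "continuous_on UNIV (\<lambda>s. f (plane_pair (s, t)))" "continuous_on UNIV (\<lambda>t. f (plane_pair (s, t)))"
    if "smooth f" for f :: "real^2 \<Rightarrow> real" and s t
    by (intro continuous_at_imp_continuous_on ballI DERIV_isCont[OF line1[OF that]] DERIV_isCont[OF line2[OF that]])+
  have bnd: "ennreal \<bar>f (plane_pair (a, b))\<bar> \<le> (\<integral>\<^sup>+s. ennreal \<bar>partial_derivative 1 f (plane_pair (s, b))\<bar> \<partial>lborel)"
    "ennreal \<bar>f (plane_pair (a, b))\<bar> \<le> (\<integral>\<^sup>+t. ennreal \<bar>partial_derivative 2 f (plane_pair (a, t))\<bar> \<partial>lborel)"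
    if f: "test_function f" for f :: "real^2 \<Rightarrow> real" and a b
  proof -
    obtain R where R: "\<And>x. x \<notin> cball 0 R \<Longrightarrow> f x = 0" using f test_functionE by metis
    \<comment> \<open>The absolute value and the extra 1 put such points strictly outside the closed
      ball, whatever the sign of \<open>R\<close>.\<close>
    have z: "f x = 0" if "x $ i \<le> - (\<bar>R\<bar> + 1)" for x i
    proof (rule R)
      show "x \<notin> cball 0 R" using component_le_norm_cart[of x i] that by auto
    qed
    note sm = test_function_smooth[OF f]
    show "ennreal \<bar>f (plane_pair (a, b))\<bar> \<le> (\<integral>\<^sup>+s. ennreal \<bar>partial_derivative 1 f (plane_pair (s, b))\<bar> \<partial>lborel)"
      by (rule abs_le_integral_derivative[where h="\<lambda>s. f (plane_pair (s, b))" and R="\<bar>R\<bar> + 1"])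
        (auto intro: line1[OF sm] cont smooth_partial_derivative sm z[of _ 1])
    show "ennreal \<bar>f (plane_pair (a, b))\<bar> \<le> (\<integral>\<^sup>+t. ennreal \<bar>partial_derivative 2 f (plane_pair (a, t))\<bar> \<partial>lborel)"
      by (rule abs_le_integral_derivative[where h="\<lambda>t. f (plane_pair (a, t))" and R="\<bar>R\<bar> + 1"])
        (auto intro: line2[OF sm] cont smooth_partial_derivative sm z[of _ 2])
  qed
  have [measurable]: "?q \<in> borel_measurable borel" by (rule smooth_borel[OF test_function_smooth[OF t(2)]])
  have "ennreal \<bar>\<psi> x\<bar> = ennreal \<bar>\<psi> (plane_pair (x $ 1, x $ 2))\<bar>" by (simp only: plane_pair_eta)
  also have "\<dots> \<le> (\<integral>\<^sup>+s. ennreal \<bar>?p (plane_pair (s, x $ 2))\<bar> \<partial>lborel)" by (rule bnd(1)[OF \<psi>])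
  also have "\<dots> \<le> (\<integral>\<^sup>+s. (\<integral>\<^sup>+t. ennreal \<bar>?q (plane_pair (s, t))\<bar> \<partial>lborel) \<partial>lborel)"
    by (intro nn_integral_mono bnd(2)[OF t(1)])
  also have "\<dots> = (\<integral>\<^sup>+z. ennreal \<bar>?q (plane_pair z)\<bar> \<partial>(lborel \<Otimes>\<^sub>M lborel))"
    by (subst lborel.nn_integral_fst[symmetric]) auto
  also have "\<dots> = (\<integral>\<^sup>+y. ennreal \<bar>?q y\<bar> \<partial>distr (lborel \<Otimes>\<^sub>M lborel) borel plane_pair)"
    by (rule nn_integral_distr[symmetric]) measurable
  also have "\<dots> = (\<integral>\<^sup>+y. ennreal \<bar>?q y\<bar> \<partial>lborel)"
    by (simp only: lborel_plane[symmetric])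
  also have "\<dots> = ennreal (LINT y|lborel. \<bar>?q y\<bar>)"
    using test_function_integrable[OF t(2)] by (intro nn_integral_eq_integral) auto
  finally show ?thesis by (subst (asm) ennreal_le_iff) (auto intro: integral_nonneg_AE)
qed

text \<open>Using the sign of the mollification error as a varying weight turns convergence of
  pairings into convergence of the weighted integral of the absolute error.\<close>

lemma mollify_abs_pairing:
  assumes f: "L2_loc f" and \<psi>: "L2_compact R \<psi>" "\<And>x. 0 \<le> \<psi> x"
  shows "(\<lambda>k. LINT x|lborel. \<psi> x * \<bar>mollify (eps k) f x\<bar>) \<longlonglongrightarrow> (LINT x|lborel. \<psi> x * \<bar>f x\<bar>)"
proof -
  let ?f = "\<lambda>k. mollify (eps k) f"
  let ?\<psi> = "\<lambda>k x. \<psi> x * (sgn (?f k x - f x))"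
  have abs: "L2_loc (\<lambda>x. \<bar>h x\<bar>)" if "L2_loc h" for h :: "real^'a \<Rightarrow> real"
    by (rule L2_loc_bound[OF that, of _ 1]) (use L2_loc_borel[OF that] in auto)
  have d: "L2_loc (\<lambda>x. ?f k x - f x)" for k
    using L2_loc_add[OF mollify_L2_loc[OF f] L2_loc_bounded_mult[OF f, of "\<lambda>x. -1" 1]] by simp
  have i: "integrable lborel (\<lambda>x. \<psi> x * \<bar>h x\<bar>)" if "L2_loc h" for h
    by (rule L2_compact_integrable[OF \<psi>(1) abs[OF that]])
  have "(\<lambda>k. LINT x|lborel. ?\<psi> k x * (?f k x - f x)) \<longlonglongrightarrow> 0"
    by (rule mollify_pairing_gen[OF f \<psi>(1)]) (auto simp: abs_mult abs_sgn_eq)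
  then have lim: "(\<lambda>k. LINT x|lborel. \<psi> x * \<bar>?f k x - f x\<bar>) \<longlonglongrightarrow> 0"
    by (simp add: mult.assoc sgn_mult_self_eq abs_sgn mult.commute[of "sgn _"])
  have "norm ((LINT x|lborel. \<psi> x * \<bar>?f k x\<bar>) - (LINT x|lborel. \<psi> x * \<bar>f x\<bar>)) \<le> (LINT x|lborel. \<psi> x * \<bar>?f k x - f x\<bar>)" for k
  proof -
    have "(LINT x|lborel. \<psi> x * \<bar>?f k x\<bar>) - (LINT x|lborel. \<psi> x * \<bar>f x\<bar>) = (LINT x|lborel. \<psi> x * \<bar>?f k x\<bar> - \<psi> x * \<bar>f x\<bar>)"
      using i[OF f] i[OF mollify_L2_loc[OF f]] by simp
    also have "norm \<dots> \<le> (LINT x|lborel. \<psi> x * \<bar>?f k x - f x\<bar>)"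
    proof (rule Bochner_Integration.integral_norm_bound_integral)
      show "norm (\<psi> x * \<bar>?f k x\<bar> - \<psi> x * \<bar>f x\<bar>) \<le> \<psi> x * \<bar>?f k x - f x\<bar>" for x
      proof -
        have "norm (\<psi> x * \<bar>?f k x\<bar> - \<psi> x * \<bar>f x\<bar>) = \<psi> x * \<bar>\<bar>?f k x\<bar> - \<bar>f x\<bar>\<bar>"
          using \<psi>(2)[of x] by (simp add: abs_mult flip: right_diff_distrib)
        also have "\<dots> \<le> \<psi> x * \<bar>?f k x - f x\<bar>"
          by (intro mult_left_mono \<psi>(2) abs_triangle_ineq3)
        finally show ?thesis .
      qed
    qed (use i[OF f] i[OF mollify_L2_loc[OF f]] i[OF d] in auto)
    finally show ?thesis .
  qed
  then have "(\<lambda>k. (LINT x|lborel. \<psi> x * \<bar>?f k x\<bar>) - (LINT x|lborel. \<psi> x * \<bar>f x\<bar>)) \<longlonglongrightarrow> 0"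
    by (intro Lim_null_comparison[OF _ lim]) (auto intro: always_eventually)
  then show ?thesis by (rule LIM_zero_cancel)
qed

text \<open>The bound for test functions is applied to \<zeta> times a mollification of u; the
  product rule gives the four terms. Continuity of u yields the pointwise limit on the left,
  pairings with absolute values the limits on the right.\<close>

lemma weak_sup_bound:
  fixes u U1 U2 U12 \<zeta> :: "real^2 \<Rightarrow> real"
  assumes cu: "continuous_on UNIV u" and U1: "has_weak_derivative [1] u U1" "L2_loc U1"
    and U2: "has_weak_derivative [2] u U2" "L2_loc U2" and U12: "has_weak_derivative [2] U1 U12" "L2_loc U12"
    and \<zeta>: "test_function \<zeta>"
  shows "\<bar>\<zeta> x * u x\<bar> \<le> (LINT y|lborel. \<bar>partial_derivative 2 (partial_derivative 1 \<zeta>) y\<bar> * \<bar>u y\<bar>)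
    + (LINT y|lborel. \<bar>partial_derivative 1 \<zeta> y\<bar> * \<bar>U2 y\<bar>)
    + (LINT y|lborel. \<bar>partial_derivative 2 \<zeta> y\<bar> * \<bar>U1 y\<bar>) + (LINT y|lborel. \<bar>\<zeta> y\<bar> * \<bar>U12 y\<bar>)"
proof -
  have u: "L2_loc u" by (rule L2_loc_continuous[OF cu])
  let ?m = "\<lambda>k. mollify (eps k)"
  have ex: "\<exists>R. L2_compact R (\<lambda>x. \<bar>\<phi> x\<bar>)" if \<phi>: "test_function \<phi>" for \<phi> :: "real^2 \<Rightarrow> real"
  proof -
    obtain R where "L2_compact R (\<lambda>x. \<phi> x * 1)" by (rule test_L2_compact[OF L2_loc_const \<phi>])
    then have "L2_compact R (\<lambda>x. \<bar>\<phi> x\<bar>)" unfolding L2_compact_def by auto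
    then show ?thesis by blast
  qed
  let ?z1 = "partial_derivative 1 \<zeta>" and ?z2 = "partial_derivative 2 \<zeta>"
    and ?z12 = "partial_derivative 2 (partial_derivative 1 \<zeta>)"
  have t: "test_function ?z1" "test_function ?z2" "test_function ?z12"
    by (intro test_function_partial_derivative \<zeta>)+
  have lim: "(\<lambda>k. LINT y|lborel. \<bar>\<phi> y\<bar> * \<bar>?m k f y\<bar>) \<longlonglongrightarrow> (LINT y|lborel. \<bar>\<phi> y\<bar> * \<bar>f y\<bar>)"
    if tf: "test_function \<phi>" "L2_loc f" for \<phi> f :: "real^2 \<Rightarrow> real"
  proof -
    obtain R where "L2_compact R (\<lambda>x. \<bar>\<phi> x\<bar>)" using ex[OF tf(1)] by blast
    from mollify_abs_pairing[OF tf(2) this] show ?thesis by simp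
  qed
  have int: "integrable lborel (\<lambda>y. \<bar>\<phi> y\<bar> * \<bar>f y\<bar>)" if "test_function \<phi>" "smooth f" for \<phi> f :: "real^2 \<Rightarrow> real"
    using integrable_abs[OF test_function_integrable[OF test_function_mult_smooth[OF that]]] by (simp add: abs_mult)
  have step: "\<bar>\<zeta> x * ?m k u x\<bar> \<le> (LINT y|lborel. \<bar>?z12 y\<bar> * \<bar>?m k u y\<bar>)
    + (LINT y|lborel. \<bar>?z1 y\<bar> * \<bar>?m k U2 y\<bar>) + (LINT y|lborel. \<bar>?z2 y\<bar> * \<bar>?m k U1 y\<bar>)
    + (LINT y|lborel. \<bar>\<zeta> y\<bar> * \<bar>?m k U12 y\<bar>)" for k
  proof -
    have sm: "smooth (?m k u)" "smooth (?m k U1)" "smooth (?m k U2)" "smooth (?m k U12)"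
      by (intro mollify_smooth u U1 U2 U12)+
    have th: "test_function (\<lambda>x. \<zeta> x * ?m k u x)" by (rule test_function_mult_smooth[OF \<zeta> sm(1)])
    note df = smooth_differentiable
    have p1: "partial_derivative 1 (\<lambda>x. \<zeta> x * ?m k u x) = (\<lambda>x. ?z1 x * ?m k u x + \<zeta> x * ?m k U1 x)"
      by (simp add: partial_derivative_mult df test_function_smooth \<zeta> sm mollify_weak_derivative[OF U1(1)])
    have p12: "partial_derivative 2 (partial_derivative 1 (\<lambda>x. \<zeta> x * ?m k u x))
      = (\<lambda>x. ?z12 x * ?m k u x + ?z1 x * ?m k U2 x + (?z2 x * ?m k U1 x + \<zeta> x * ?m k U12 x))"
      unfolding p1
      by (simp add: partial_derivative_add partial_derivative_mult df test_function_smooth \<zeta> t sm smooth_mult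
          mollify_weak_derivative[OF U2(1)] mollify_weak_derivative[OF U12(1)])
    have "\<bar>\<zeta> x * ?m k u x\<bar> \<le> (LINT y|lborel. \<bar>?z12 y * ?m k u y + ?z1 y * ?m k U2 y + (?z2 y * ?m k U1 y + \<zeta> y * ?m k U12 y)\<bar>)"
      using test_function_sup_bound[OF th, of x] unfolding p12 .
    also have "\<dots> \<le> (LINT y|lborel. \<bar>?z12 y\<bar> * \<bar>?m k u y\<bar> + \<bar>?z1 y\<bar> * \<bar>?m k U2 y\<bar> + \<bar>?z2 y\<bar> * \<bar>?m k U1 y\<bar> + \<bar>\<zeta> y\<bar> * \<bar>?m k U12 y\<bar>)"
    proof (rule integral_mono)
      show "integrable lborel (\<lambda>y. \<bar>?z12 y * ?m k u y + ?z1 y * ?m k U2 y + (?z2 y * ?m k U1 y + \<zeta> y * ?m k U12 y)\<bar>)"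
        by (intro integrable_abs Bochner_Integration.integrable_add test_function_integrable test_function_mult_smooth t \<zeta> sm)
      show "integrable lborel (\<lambda>y. \<bar>?z12 y\<bar> * \<bar>?m k u y\<bar> + \<bar>?z1 y\<bar> * \<bar>?m k U2 y\<bar> + \<bar>?z2 y\<bar> * \<bar>?m k U1 y\<bar> + \<bar>\<zeta> y\<bar> * \<bar>?m k U12 y\<bar>)"
        by (intro Bochner_Integration.integrable_add int t \<zeta> sm)
      show "\<bar>?z12 y * ?m k u y + ?z1 y * ?m k U2 y + (?z2 y * ?m k U1 y + \<zeta> y * ?m k U12 y)\<bar>
        \<le> \<bar>?z12 y\<bar> * \<bar>?m k u y\<bar> + \<bar>?z1 y\<bar> * \<bar>?m k U2 y\<bar> + \<bar>?z2 y\<bar> * \<bar>?m k U1 y\<bar> + \<bar>\<zeta> y\<bar> * \<bar>?m k U12 y\<bar>" for y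
        unfolding abs_mult[symmetric] by linarith
    qed
    also have "\<dots> = (LINT y|lborel. \<bar>?z12 y\<bar> * \<bar>?m k u y\<bar>)
      + (LINT y|lborel. \<bar>?z1 y\<bar> * \<bar>?m k U2 y\<bar>) + (LINT y|lborel. \<bar>?z2 y\<bar> * \<bar>?m k U1 y\<bar>)
      + (LINT y|lborel. \<bar>\<zeta> y\<bar> * \<bar>?m k U12 y\<bar>)"
      using int[OF t(3) sm(1)] int[OF t(1) sm(3)] int[OF t(2) sm(2)] int[OF \<zeta> sm(4)] by simp
    finally show ?thesis .
  qed
  have l1: "(\<lambda>k. \<bar>\<zeta> x * ?m k u x\<bar>) \<longlonglongrightarrow> \<bar>\<zeta> x * u x\<bar>"
    by (intro tendsto_rabs tendsto_mult_left mollify_tendsto_continuous L2_loc_locally_integrable u cu)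
  show ?thesis
    by (rule LIMSEQ_le[OF l1 tendsto_add[OF tendsto_add[OF tendsto_add[OF lim[OF t(3) u] lim[OF t(1) U2(2)]]
            lim[OF t(2) U1(2)]] lim[OF \<zeta> U12(2)]]])
      (use step in blast)
qed

subsection \<open>Admissible maps in components\<close>

lemma vec_eq_sum_axis: "(u :: real^'m::finite) = (\<Sum>a\<in>UNIV. u $ a *\<^sub>R axis a 1)"
  using basis_expansion[of u] by (simp add: scalar_mult_eq_scaleR)

lemma integrable_vec_iff:
  fixes f :: "'a \<Rightarrow> real^'m::finite"
  shows "integrable M f \<longleftrightarrow> (\<forall>a. integrable M (\<lambda>x. f x $ a))"
proof
  show "integrable M f \<Longrightarrow> \<forall>a. integrable M (\<lambda>x. f x $ a)"
    using integrable_bounded_linear[OF bounded_linear_vec_nth] by blast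
  assume "\<forall>a. integrable M (\<lambda>x. f x $ a)"
  then have "integrable M (\<lambda>x. \<Sum>a\<in>UNIV. f x $ a *\<^sub>R (axis a 1 :: real^'m))" by simp
  then show "integrable M f" by (simp flip: vec_eq_sum_axis)
qed

lemma borel_measurable_vec_iff:
  fixes f :: "'a \<Rightarrow> real^'m::finite"
  shows "f \<in> borel_measurable M \<longleftrightarrow> (\<forall>a. (\<lambda>x. f x $ a) \<in> borel_measurable M)"
proof
  have "(\<lambda>v :: real^'m. v $ a) \<in> borel_measurable borel" for a
    by (intro borel_measurable_continuous_onI continuous_intros)
  from measurable_compose[OF _ this]
  show "f \<in> borel_measurable M \<Longrightarrow> \<forall>a. (\<lambda>x. f x $ a) \<in> borel_measurable M" by blast
  assume "\<forall>a. (\<lambda>x. f x $ a) \<in> borel_measurable M"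
  then have "(\<lambda>x. \<Sum>a\<in>UNIV. f x $ a *\<^sub>R (axis a 1 :: real^'m)) \<in> borel_measurable M"
    by (intro borel_measurable_sum borel_measurable_scaleR borel_measurable_const) blast
  then show "f \<in> borel_measurable M" by (simp flip: vec_eq_sum_axis)
qed

lemma locally_integrable_vec_iff:
  fixes f :: "real^'n::finite \<Rightarrow> real^'m::finite"
  shows "locally_integrable f \<longleftrightarrow> (\<forall>a. locally_integrable (\<lambda>x. f x $ a))"
  unfolding locally_integrable_def set_integrable_def borel_measurable_vec_iff[of f] integrable_vec_iff
  by auto

text \<open>Allows the scalar theory to be applied componentwise; local integrability is what
  permits exchanging a component with the integral.\<close>

lemma has_weak_derivative_vec_iff:
  fixes u g :: "real^'n::finite \<Rightarrow> real^'m::finite"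
  shows "has_weak_derivative \<alpha> u g \<longleftrightarrow> (\<forall>a. has_weak_derivative \<alpha> (\<lambda>x. u x $ a) (\<lambda>x. g x $ a))"
proof -
  have test: "test_function (partial_derivatives \<alpha> \<phi>)" if "test_function \<phi>" for \<phi> :: "real^'n \<Rightarrow> real"
    using that by (induction \<alpha>) auto
  have nth: "(LINT x|lborel. \<psi> x *\<^sub>R w x) $ a = (LINT x|lborel. \<psi> x * w x $ a)"
    if "locally_integrable w" "test_function \<psi>" for w :: "real^'n \<Rightarrow> real^'m" and \<psi> a
    using integral_bounded_linear[OF bounded_linear_vec_nth locally_integrable_test[OF that], of a] by simp
  have "(LINT x|lborel. partial_derivatives \<alpha> \<phi> x *\<^sub>R u x) = (-1) ^ length \<alpha> *\<^sub>R (LINT x|lborel. \<phi> x *\<^sub>R g x)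
    \<longleftrightarrow> (\<forall>a. (LINT x|lborel. partial_derivatives \<alpha> \<phi> x *\<^sub>R u x $ a) = (-1) ^ length \<alpha> *\<^sub>R (LINT x|lborel. \<phi> x *\<^sub>R g x $ a))"
    if "locally_integrable u" "locally_integrable g" "test_function \<phi>" for \<phi>
    using nth[OF that(1) test[OF that(3)]] nth[OF that(2,3)] by (simp add: vec_eq_iff)
  then show ?thesis
    unfolding has_weak_derivative_def locally_integrable_vec_iff[of u] locally_integrable_vec_iff[of g]
    by auto
qed

lemma square_integrable_vec_iff:
  fixes u :: "real^'n::finite \<Rightarrow> real^'m::finite"
  shows "square_integrable u \<longleftrightarrow>
    (\<forall>a. (\<lambda>x. u x $ a) \<in> borel_measurable borel \<and> integrable lborel (\<lambda>x. (u x $ a)\<^sup>2))"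
proof -
  have n: "(norm v)\<^sup>2 = (\<Sum>a\<in>UNIV. (v $ a)\<^sup>2)" for v :: "real^'m"
    by (simp add: norm_vec_def L2_set_def sum_nonneg)
  have "integrable lborel (\<lambda>x. (u x $ a)\<^sup>2)"
    if "integrable lborel (\<lambda>x. (norm (u x))\<^sup>2)" "\<And>a. (\<lambda>x. u x $ a) \<in> borel_measurable borel" for a
  proof (rule Bochner_Integration.integrable_bound[OF that(1)])
    show "(\<lambda>x. (u x $ a)\<^sup>2) \<in> borel_measurable lborel" using that(2)[of a] by simp
    show "AE x in lborel. norm ((u x $ a)\<^sup>2) \<le> norm ((norm (u x))\<^sup>2)"
      by (intro AE_I2) (simp add: component_le_norm_cart power2_le_iff_abs_le)
  qed
  then show ?thesis
    unfolding square_integrable_def borel_measurable_vec_iff[of u] by (auto simp: n)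
qed

lemma L2_loc_square_integrable:
  assumes "f \<in> borel_measurable borel" "integrable lborel (\<lambda>x. (f x)\<^sup>2)" shows "L2_loc f"
  unfolding L2_loc_def locally_integrable_def set_integrable_def
  using assms integrable_mult_indicator[OF _ assms(2)] borel_compact by auto

definition deriv1 :: "(real^2 \<Rightarrow> real^3) \<Rightarrow> 2 \<Rightarrow> 3 \<Rightarrow> real^2 \<Rightarrow> real" where
  "deriv1 m i a x = weak_derivative [i] m x $ a"

definition deriv2 :: "(real^2 \<Rightarrow> real^3) \<Rightarrow> 2 \<Rightarrow> 2 \<Rightarrow> 3 \<Rightarrow> real^2 \<Rightarrow> real" where
  "deriv2 m i j a x = weak_derivative [i, j] m x $ a"

lemma norm_sq_vec3: "(norm (v :: real^3))\<^sup>2 = (\<Sum>a\<in>UNIV. (v $ a)\<^sup>2)"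
  by (simp add: norm_vec_def L2_set_def sum_nonneg)

lemma gradient_sq_eq: "gradient_sq m x = (\<Sum>i\<in>UNIV. \<Sum>a\<in>UNIV. (deriv1 m i a x)\<^sup>2)"
  by (simp add: gradient_sq_def norm_sq_vec3 deriv1_def)

lemma hessian_sq_eq: "hessian_sq m x = (\<Sum>i\<in>UNIV. \<Sum>j\<in>UNIV. \<Sum>a\<in>UNIV. (deriv2 m i j a x)\<^sup>2)"
  by (simp add: hessian_sq_def norm_sq_vec3 deriv2_def)

lemma laplacian_sq_eq: "(norm (weak_laplacian m x))\<^sup>2 = (\<Sum>a\<in>UNIV. (\<Sum>i\<in>UNIV. deriv2 m i i a x)\<^sup>2)"
  by (simp add: norm_sq_vec3 weak_laplacian_def deriv2_def)

text \<open>The integral of a derivative of a test function is zero, so constants are invisible to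
  derivatives of positive order. It transfers the hypothesis on m - e3 to m, which has length 1 and
  so is not itself square integrable.\<close>

lemma has_weak_derivative_const_add:
  fixes u g :: "real^'n::finite \<Rightarrow> real"
  assumes "\<alpha> \<noteq> []"
  shows "has_weak_derivative \<alpha> (\<lambda>x. u x - c) g \<longleftrightarrow> has_weak_derivative \<alpha> u g"
proof -
  obtain i \<beta> where \<alpha>: "\<alpha> = i # \<beta>" using assms by (cases \<alpha>) auto
  have test: "test_function (partial_derivatives \<beta> \<phi>)" if "test_function \<phi>" for \<phi> :: "real^'n \<Rightarrow> real"
    using that by (induction \<beta>) auto
  have dir: "has_weak_derivative \<alpha> (\<lambda>x. u x - c) g" if "has_weak_derivative \<alpha> u g" for u :: "real^'n \<Rightarrow> real" and c
  proof -
    have "(LINT x|lborel. partial_derivatives \<alpha> \<phi> x * (u x - c)) = (LINT x|lborel. partial_derivatives \<alpha> \<phi> x * u x)"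
      if \<phi>: "test_function \<phi>" for \<phi>
    proof -
      note t = test_function_partial_derivative[OF test[OF \<phi>], of i]
      have i1: "integrable lborel (\<lambda>x. partial_derivatives \<alpha> \<phi> x * u x)"
        using locally_integrable_test[OF weak_derivative_locally_integrable(1)[OF \<open>has_weak_derivative \<alpha> u g\<close>] t]
        by (simp add: \<alpha>)
      have i2: "integrable lborel (partial_derivatives \<alpha> \<phi>)" "(LINT x|lborel. partial_derivatives \<alpha> \<phi> x) = 0"
        using test_function_integrable[OF t] integral_partial_derivative[OF test_function_C1_compact[OF test[OF \<phi>]], of i]
        by (simp_all add: \<alpha>)
      show ?thesis using i1 i2 by (simp add: right_diff_distrib)
    qed
    with that show ?thesis
      unfolding has_weak_derivative_def by (auto intro: locally_integrable_diff)
  qed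
  show ?thesis using dir[of u c] dir[of "\<lambda>x. u x - c" "-c"] by auto
qed

text \<open>\<open>weak_derivative\<close> is a choice, while membership in the Sobolev space
  supplies some square integrable derivative. Existence makes the choice meaningful, and almost
  everywhere uniqueness carries square integrability over to it.\<close>

lemma admissible_derivatives:
  assumes m: "m \<in> admissible"
  shows "has_weak_derivative [i] (\<lambda>x. m x $ a) (deriv1 m i a)"
    and "has_weak_derivative [j] (deriv1 m i a) (deriv2 m i j a)"
    and "deriv1 m i a \<in> borel_measurable borel" "integrable lborel (\<lambda>x. (deriv1 m i a x)\<^sup>2)"
    and "deriv2 m i j a \<in> borel_measurable borel" "integrable lborel (\<lambda>x. (deriv2 m i j a x)\<^sup>2)"
    and "integrable lborel (\<lambda>x. ((m x - e3) $ a)\<^sup>2)"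
proof -
  have H: "(\<lambda>x. m x - e3) \<in> sobolev_H 2" using m by (simp add: admissible_def)
  have wd: "has_weak_derivative \<alpha> m (weak_derivative \<alpha> m) \<and> integrable lborel (\<lambda>x. (weak_derivative \<alpha> m x $ a)\<^sup>2)"
    if \<alpha>: "\<alpha> \<noteq> []" "length \<alpha> \<le> 2" for \<alpha>
  proof -
    obtain g where g: "has_weak_derivative \<alpha> (\<lambda>x. m x - e3) g" "square_integrable g"
      using H \<alpha>(2) unfolding sobolev_H_def by blast
    have g': "has_weak_derivative \<alpha> m g"
      using g(1) unfolding has_weak_derivative_vec_iff by (simp add: has_weak_derivative_const_add[OF \<alpha>(1)])
    have w: "has_weak_derivative \<alpha> m (weak_derivative \<alpha> m)"
      unfolding weak_derivative_def by (rule someI[of "has_weak_derivative \<alpha> m", OF g'])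
    have "has_weak_derivative \<alpha> (\<lambda>x. m x $ a) (\<lambda>x. g x $ a)"
      "has_weak_derivative \<alpha> (\<lambda>x. m x $ a) (\<lambda>x. weak_derivative \<alpha> m x $ a)"
      using g' w unfolding has_weak_derivative_vec_iff[of \<alpha> m] by blast+
    then have "AE x in lborel. g x $ a = weak_derivative \<alpha> m x $ a" by (rule weak_derivative_unique)
    then have ae: "AE x in lborel. (g x $ a)\<^sup>2 = (weak_derivative \<alpha> m x $ a)\<^sup>2" by eventually_elim simp
    have "locally_integrable (\<lambda>x. weak_derivative \<alpha> m x $ a)"
      using w unfolding has_weak_derivative_vec_iff[of \<alpha> m] by (blast intro: weak_derivative_locally_integrable(2))
    then have [measurable]: "(\<lambda>x. weak_derivative \<alpha> m x $ a) \<in> borel_measurable borel" by (rule locally_integrable_borel)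
    have "integrable lborel (\<lambda>x. (weak_derivative \<alpha> m x $ a)\<^sup>2)"
      by (rule integrable_cong_AE_imp[OF _ _ ae])
        (use g(2) in \<open>auto simp: square_integrable_vec_iff\<close>)
    with w show ?thesis by blast
  qed
  have w1: "has_weak_derivative [i] (\<lambda>x. m x $ a) (deriv1 m i a)" for i
    using wd[of "[i]"] unfolding has_weak_derivative_vec_iff deriv1_def[abs_def] by simp
  then show "has_weak_derivative [i] (\<lambda>x. m x $ a) (deriv1 m i a)" .
  have "has_weak_derivative [i, j] (\<lambda>x. m x $ a) (deriv2 m i j a)"
    using wd[of "[i, j]"] unfolding has_weak_derivative_vec_iff deriv2_def[abs_def] by simp
  then show w2: "has_weak_derivative [j] (deriv1 m i a) (deriv2 m i j a)"
    using weak_derivative_second[OF w1] by blast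
  show "deriv1 m i a \<in> borel_measurable borel" "deriv2 m i j a \<in> borel_measurable borel"
    using weak_derivative_locally_integrable[OF w2] by (auto intro: locally_integrable_borel)
  show "integrable lborel (\<lambda>x. (deriv1 m i a x)\<^sup>2)" "integrable lborel (\<lambda>x. (deriv2 m i j a x)\<^sup>2)"
    using wd[of "[i]"] wd[of "[i, j]"] by (simp_all add: deriv1_def deriv2_def)
  obtain g where g: "has_weak_derivative [] (\<lambda>x. m x - e3) g" "square_integrable g"
    using H unfolding sobolev_H_def mem_Collect_eq by (metis le0 list.size(3))
  have uc: "uniformly_continuous_on UNIV m" using m by (simp add: admissible_def)
  have c: "continuous_on UNIV (\<lambda>x. (m x - e3) $ a)"
    by (intro continuous_intros uniformly_continuous_imp_continuous uc)
  have "has_weak_derivative [] (\<lambda>x. (m x - e3) $ a) (\<lambda>x. (m x - e3) $ a)"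
    using L2_loc_locally_integrable[OF L2_loc_continuous[OF c]] by (simp add: has_weak_derivative_def)
  moreover have "has_weak_derivative [] (\<lambda>x. (m x - e3) $ a) (\<lambda>x. g x $ a)"
    using g(1) unfolding has_weak_derivative_vec_iff by blast
  ultimately have "AE x in lborel. (m x - e3) $ a = g x $ a" by (rule weak_derivative_unique)
  then have ae: "AE x in lborel. (g x $ a)\<^sup>2 = ((m x - e3) $ a)\<^sup>2" by eventually_elim simp
  have [measurable]: "(\<lambda>x. (m x - e3) $ a) \<in> borel_measurable borel" by (rule borel_measurable_continuous_onI[OF c])
  have "integrable lborel (\<lambda>x. (g x $ a)\<^sup>2)" using g(2) unfolding square_integrable_vec_iff by blast
  then show "integrable lborel (\<lambda>x. ((m x - e3) $ a)\<^sup>2)"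
    by (rule integrable_cong_AE_imp[OF _ _ ae]) measurable
qed

lemma admissible_continuous:
  assumes "m \<in> admissible" shows "continuous_on UNIV m" "continuous_on UNIV (\<lambda>x. m x $ a)"
proof -
  show "continuous_on UNIV m" using assms by (simp add: admissible_def uniformly_continuous_imp_continuous)
  then show "continuous_on UNIV (\<lambda>x. m x $ a)" by (intro continuous_intros)
qed

lemma admissible_sphere:
  assumes "m \<in> admissible" shows "(\<Sum>a\<in>UNIV. (m x $ a)\<^sup>2) = 1" "\<bar>m x $ a\<bar> \<le> 1"
proof -
  have n: "norm (m x) = 1" using assms by (simp add: admissible_def)
  then show "(\<Sum>a\<in>UNIV. (m x $ a)\<^sup>2) = 1" by (simp flip: norm_sq_vec3)
  show "\<bar>m x $ a\<bar> \<le> 1" using component_le_norm_cart[of "m x" a] n by simp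
qed

text \<open>Converse packaging: scalar first derivatives and their first derivatives are enough,
  because second derivatives are read as iterated ones and multi-indices of length at most 2 leave
  just three cases.\<close>

lemma admissibleI:
  fixes m :: "real^2 \<Rightarrow> real^3" and U1 :: "3 \<Rightarrow> 2 \<Rightarrow> real^2 \<Rightarrow> real" and U2 :: "3 \<Rightarrow> 2 \<Rightarrow> 2 \<Rightarrow> real^2 \<Rightarrow> real"
  assumes "\<And>x. norm (m x) = 1" "uniformly_continuous_on UNIV m"
    and "\<And>a. integrable lborel (\<lambda>x. ((m x - e3) $ a)\<^sup>2)"
    and w1: "\<And>a i. has_weak_derivative [i] (\<lambda>x. m x $ a) (U1 a i)" "\<And>a i. integrable lborel (\<lambda>x. (U1 a i x)\<^sup>2)"
    and w2: "\<And>a i j. has_weak_derivative [j] (U1 a i) (U2 a i j)" "\<And>a i j. integrable lborel (\<lambda>x. (U2 a i j x)\<^sup>2)"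
  shows "m \<in> admissible"
proof -
  have c: "continuous_on UNIV (\<lambda>x. (m x - e3) $ a)" for a
    by (intro continuous_intros uniformly_continuous_imp_continuous assms)
  have "\<exists>g. has_weak_derivative \<alpha> (\<lambda>x. m x - e3) g \<and> square_integrable g" if len: "length \<alpha> \<le> 2" for \<alpha>
  proof -
    consider "\<alpha> = []" | i where "\<alpha> = [i]" | i j where "\<alpha> = [i, j]"
      using len by (auto simp: le_Suc_eq length_Suc_conv numeral_2_eq_2)
    then show ?thesis
    proof cases
      case 1
      have "has_weak_derivative [] (\<lambda>x. m x - e3) (\<lambda>x. m x - e3)"
        unfolding has_weak_derivative_vec_iff
        using L2_loc_locally_integrable[OF L2_loc_continuous[OF c]] by (simp add: has_weak_derivative_def)
      moreover have "square_integrable (\<lambda>x. m x - e3)"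
        unfolding square_integrable_vec_iff using borel_measurable_continuous_onI[OF c] assms(3) by blast
      ultimately show ?thesis unfolding 1 by blast
    next
      case (2 i)
      have "has_weak_derivative [i] (\<lambda>x. m x - e3) (\<lambda>x. \<chi> a. U1 a i x)"
        unfolding has_weak_derivative_vec_iff using w1(1) by (simp add: has_weak_derivative_const_add)
      moreover have "square_integrable (\<lambda>x. \<chi> a. U1 a i x)"
        unfolding square_integrable_vec_iff
        using w1(2) locally_integrable_borel[OF weak_derivative_locally_integrable(2)[OF w1(1)]] by simp
      ultimately show ?thesis unfolding 2 by blast
    next
      case (3 i j)
      have "has_weak_derivative [i, j] (\<lambda>x. m x - e3) (\<lambda>x. \<chi> a. U2 a i j x)"
        unfolding has_weak_derivative_vec_iff
        using w2(1) weak_derivative_second[OF w1(1)] by (simp add: has_weak_derivative_const_add)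
      moreover have "square_integrable (\<lambda>x. \<chi> a. U2 a i j x)"
        unfolding square_integrable_vec_iff
        using w2(2) locally_integrable_borel[OF weak_derivative_locally_integrable(2)[OF w2(1)]] by simp
      ultimately show ?thesis unfolding 3 by blast
    qed
  qed
  then show ?thesis using assms(1,2) by (simp add: admissible_def sobolev_H_def)
qed

lemma deriv_local_unique:
  assumes m: "m \<in> admissible" and m': "m' \<in> admissible" and O: "open O'" "\<And>x. x \<in> O' \<Longrightarrow> m x = m' x"
  shows "AE x in lborel. x \<in> O' \<longrightarrow> deriv1 m i a x = deriv1 m' i a x"
    and "AE x in lborel. x \<in> O' \<longrightarrow> deriv2 m i j a x = deriv2 m' i j a x"
proof -
  note A = admissible_derivatives
  show "AE x in lborel. x \<in> O' \<longrightarrow> deriv1 m i a x = deriv1 m' i a x"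
    by (rule weak_derivative_local_unique[OF A(1)[OF m] A(1)[OF m'] O(1)]) (simp add: O(2))
  have "has_weak_derivative [i, j] (\<lambda>x. m x $ a) (deriv2 m i j a)" if "m \<in> admissible" for m
    using weak_derivative_second[OF A(1)[OF that]] A(2)[OF that] by blast
  from weak_derivative_local_unique[OF this[OF m] this[OF m'] O(1)]
  show "AE x in lborel. x \<in> O' \<longrightarrow> deriv2 m i j a x = deriv2 m' i j a x" by (simp add: O(2))
qed

lemma e3_admissible: "(\<lambda>x. e3) \<in> admissible"
proof (rule admissibleI[of _ "\<lambda>a i x. 0" "\<lambda>a i j x. 0"])
  show "norm e3 = 1" by (simp add: e3_def norm_vec_def L2_set_def sum_3)
qed (auto intro: weak_derivative_const uniformly_continuous_on_const)

text \<open>Even for a constant map the chosen representative of the derivative need not vanish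
  everywhere.\<close>

lemma e3_derivs:
  "AE x in lborel. deriv1 (\<lambda>x. e3) i a x = 0" "AE x in lborel. deriv2 (\<lambda>x. e3) i j a x = 0"
proof -
  note A = admissible_derivatives[OF e3_admissible]
  show ae: "AE x in lborel. deriv1 (\<lambda>x. e3) i a x = 0" for i
    by (rule weak_derivative_unique[OF A(1) weak_derivative_const])
  have "has_weak_derivative [i, j] (\<lambda>x :: real^2. e3 $ a) (deriv2 (\<lambda>x. e3) i j a)"
    using weak_derivative_second[OF A(1)] A(2) by blast
  moreover have "has_weak_derivative [i, j] (\<lambda>x :: real^2. e3 $ a) (\<lambda>x. 0)"
    using weak_derivative_second[OF weak_derivative_const] weak_derivative_const by blast
  ultimately show "AE x in lborel. deriv2 (\<lambda>x. e3) i j a x = 0" by (rule weak_derivative_unique)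
qed

subsection \<open>The area form as an exact form\<close>

text \<open>On the sphere the area form is the differential of \<open>G(m\<^sub>3) (m\<^sub>1 dm\<^sub>2 - m\<^sub>2 dm\<^sub>1)\<close> wherever
  \<open>G(s) = 1 / (1 + s)\<close>; near the south pole \<open>G\<close> is replaced by a \<open>C\<^sup>1\<close> extension, which
  multiplies the area form by \<open>area_weight\<close>.\<close>

definition polar_weight :: "real \<Rightarrow> real" where
  "polar_weight s = 1 / (1 + max s 0) - min s 0"

definition polar_weight' :: "real \<Rightarrow> real" where
  "polar_weight' s = - 1 / (1 + max s 0)\<^sup>2"

definition area_weight :: "real \<Rightarrow> real" where
  "area_weight s = 2 * s * polar_weight s - (1 - s\<^sup>2) * polar_weight' s"

text \<open>On the hemisphere around e3 the weighted form is the area form itself, because (1 - s^2)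
  / (1 + s)^2 = (1 - s) / (1 + s).\<close>

lemma area_weight_nonneg: "s \<ge> 0 \<Longrightarrow> area_weight s = 1"
proof -
  assume s: "s \<ge> 0"
  then have "(1 - s\<^sup>2) / (1 + s)\<^sup>2 = (1 - s) / (1 + s)"
    by (simp add: power2_eq_square divide_simps) (simp add: algebra_simps)
  moreover have "2 * s / (1 + s) + (1 - s) / (1 + s) = 1"
    using s by (simp add: divide_simps)
  ultimately show ?thesis using s by (simp add: area_weight_def polar_weight_def polar_weight'_def)
qed

text \<open>The branches 1 / (1 + s) and 1 - s meet at s = 0 with common value 1 and common slope
  -1; the origin is treated by its difference quotient.\<close>

lemma polar_weight_derivative: "(polar_weight has_real_derivative polar_weight' s) (at s)"
proof (cases "0 :: real" s rule: linorder_cases)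
  case less
  have "((\<lambda>s. 1 / (1 + s)) has_real_derivative polar_weight' s) (at s)"
    using less by (auto intro!: derivative_eq_intros simp: polar_weight'_def power2_eq_square)
  then show ?thesis
    by (rule has_field_derivative_transform_within_open[where S="{0<..}"]) (use less in \<open>auto simp: polar_weight_def\<close>)
next
  case greater
  have "((\<lambda>s. 1 - s) has_real_derivative polar_weight' s) (at s)"
    using greater by (auto intro!: derivative_eq_intros simp: polar_weight'_def)
  then show ?thesis
    by (rule has_field_derivative_transform_within_open[where S="{..<0}"]) (use greater in \<open>auto simp: polar_weight_def\<close>)
next
  case equal
  have "(\<lambda>h :: real. - 1 / (1 + max h 0)) \<midarrow>0\<rightarrow> - 1 / (1 + max 0 0)"
    by (intro tendsto_intros) auto
  moreover have "- 1 / (1 + max h 0) = (polar_weight (0 + h) - polar_weight 0) / h" if "h \<noteq> 0" for h :: real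
  proof (cases "h > 0")
    case True
    then have "0 < h + h * h" by (intro add_pos_pos mult_pos_pos)
    with True show ?thesis by (auto simp: polar_weight_def field_simps)
  qed (use that in \<open>auto simp: polar_weight_def\<close>)
  then have "\<forall>\<^sub>F h in at 0. - 1 / (1 + max h 0) = (polar_weight (0 + h) - polar_weight 0) / h"
    by (simp add: eventually_at_filter)
  ultimately have "(\<lambda>h. (polar_weight (0 + h) - polar_weight 0) / h) \<midarrow>0\<rightarrow> - 1 / (1 + max 0 0)"
    by (rule Lim_transform_eventually)
  then show ?thesis unfolding DERIV_def equal[symmetric] by (simp add: polar_weight'_def)
qed

lemma polar_weight'_continuous: "continuous_on A polar_weight'"
  unfolding polar_weight'_def[abs_def] by (intro continuous_intros) auto

section \<open>Cutoff functions with bounds independent of the radius\<close>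

lemma convolve_bounded:
  fixes w :: "real^'n::finite \<Rightarrow> real"
  assumes w: "locally_integrable w" "\<And>x. \<bar>w x\<bar> \<le> 1" and \<phi>: "test_function \<phi>"
  shows "\<bar>convolve \<phi> w x\<bar> \<le> (LINT y|lborel. \<bar>\<phi> y\<bar>)"
proof -
  have b: "\<phi> \<in> borel_measurable borel" by (rule smooth_borel[OF test_function_smooth[OF \<phi>]])
  have [measurable]: "\<phi> \<in> borel_measurable borel" by fact
  have m: "(\<lambda>y. \<bar>\<phi> y\<bar>) \<in> borel_measurable borel" by measurable
  have "\<bar>convolve \<phi> w x\<bar> \<le> (LINT y|lborel. \<bar>\<phi> (x - y)\<bar>)"
    unfolding convolve_def
  proof (rule integral_abs_bound_integral)
    show "integrable lborel (\<lambda>y. \<phi> (x - y) * w y)" by (rule convolve_integrable[OF w(1) \<phi>])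
    show "integrable lborel (\<lambda>y. \<bar>\<phi> (x - y)\<bar>)"
      by (rule integrable_abs[OF test_function_integrable[OF test_function_reflect[OF \<phi>]]])
    show "\<bar>\<phi> (x - y) * w y\<bar> \<le> \<bar>\<phi> (x - y)\<bar>" for y
      using mult_left_mono[OF w(2)[of y], of "\<bar>\<phi> (x - y)\<bar>"] by (simp add: abs_mult)
  qed
  also have "\<dots> = (LINT y|lborel. \<bar>\<phi> y\<bar>)" by (rule integral_lborel_reflect(1)[OF m])
  finally show ?thesis .
qed

text \<open>The transition has half-width 1/4 around the radius R, so R = r + 1/2 keeps it inside
  the annulus from r to r + 1 with room on both sides. Any real R is meaningful; for R \<le> 1/4 the
  inner condition is void.\<close>

definition cutoff :: "real \<Rightarrow> real \<Rightarrow> (real^'n::finite \<Rightarrow> real) \<Rightarrow> bool" where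
  "cutoff B R \<xi> \<longleftrightarrow> test_function \<xi> \<and> (\<forall>x. 0 \<le> \<xi> x \<and> \<xi> x \<le> 1) \<and>
    (\<forall>x. norm x < R - 1 / 4 \<longrightarrow> \<xi> x = 1) \<and> (\<forall>x. norm x > R + 1 / 4 \<longrightarrow> \<xi> x = 0) \<and>
    (\<forall>i x. \<bar>partial_derivative i \<xi> x\<bar> \<le> B) \<and> (\<forall>i j x. \<bar>partial_derivative j (partial_derivative i \<xi>) x\<bar> \<le> B)"

lemma cutoffD:
  assumes "cutoff B R \<xi>"
  shows "test_function \<xi>" "0 \<le> \<xi> x" "\<xi> x \<le> 1" "norm x < R - 1 / 4 \<Longrightarrow> \<xi> x = 1" "norm x > R + 1 / 4 \<Longrightarrow> \<xi> x = 0"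
    "\<bar>partial_derivative i \<xi> x\<bar> \<le> B" "\<bar>partial_derivative j (partial_derivative i \<xi>) x\<bar> \<le> B"
  using assms unfolding cutoff_def by blast+

text \<open>The cutoff is the indicator of the ball of radius R convolved with the mollifier of
  scale 1/4. All derivatives fall on the mollifier, so their sup norms are bounded by L^1 norms that
  know nothing of R; B adds these up.\<close>

lemma cutoff_exists:
  "\<exists>B\<ge>1. \<forall>R. \<exists>\<xi> :: real^'n::finite \<Rightarrow> real. cutoff B R \<xi>"
proof -
  let ?\<rho> = "mollifier (1 / 4) :: real^'n \<Rightarrow> real"
  let ?d1 = "\<lambda>i. partial_derivative i ?\<rho>" and ?d2 = "\<lambda>i j. partial_derivative j (partial_derivative i ?\<rho>)"
  have \<rho>: "test_function ?\<rho>" by (rule mollifier_test) simp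
  note t = test_function_partial_derivative
  define B where "B = 1 + (\<Sum>i\<in>UNIV. LINT y|lborel. \<bar>?d1 i y\<bar>) + (\<Sum>i\<in>UNIV. \<Sum>j\<in>UNIV. LINT y|lborel. \<bar>?d2 i j y\<bar>)"
  have nn: "0 \<le> (LINT y|lborel. \<bar>\<phi> y\<bar>)" for \<phi> :: "real^'n \<Rightarrow> real" by (intro integral_nonneg_AE) simp
  have B1: "(LINT y|lborel. \<bar>?d1 i y\<bar>) \<le> B" for i
  proof -
    have "(LINT y|lborel. \<bar>?d1 i y\<bar>) \<le> (\<Sum>i\<in>UNIV. LINT y|lborel. \<bar>?d1 i y\<bar>)"
      by (rule member_le_sum) (auto intro: nn)
    moreover have "0 \<le> (\<Sum>i\<in>UNIV. \<Sum>j\<in>UNIV. LINT y|lborel. \<bar>?d2 i j y\<bar>)" by (intro sum_nonneg nn)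
    ultimately show ?thesis by (simp add: B_def)
  qed
  have B2: "(LINT y|lborel. \<bar>?d2 i j y\<bar>) \<le> B" for i j
  proof -
    have "(LINT y|lborel. \<bar>?d2 i j y\<bar>) \<le> (\<Sum>j\<in>UNIV. LINT y|lborel. \<bar>?d2 i j y\<bar>)"
      by (rule member_le_sum) (auto intro: nn)
    also have "\<dots> \<le> (\<Sum>i\<in>UNIV. \<Sum>j\<in>UNIV. LINT y|lborel. \<bar>?d2 i j y\<bar>)"
      by (rule member_le_sum) (auto intro: nn sum_nonneg)
    finally show ?thesis using sum_nonneg[of UNIV "\<lambda>i. LINT y|lborel. \<bar>?d1 i y\<bar>"] nn by (simp add: B_def)
  qed
  have "1 \<le> B" unfolding B_def using sum_nonneg[of UNIV "\<lambda>i. LINT y|lborel. \<bar>?d1 i y\<bar>"] nn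
    by (simp add: add_nonneg_nonneg sum_nonneg)
  moreover have "\<exists>\<xi> :: real^'n \<Rightarrow> real. cutoff B R \<xi>" for R
  proof -
    let ?w = "indicator (ball (0 :: real^'n) R) :: real^'n \<Rightarrow> real"
    have li: "locally_integrable ?w"
      by (rule L2_loc_locally_integrable[OF L2_loc_bounded[where B=1]])
        (simp_all add: borel_measurable_indicator indicator_def[of "ball 0 R" "_ :: real^'n"] del: of_bool_eq_iff)
    let ?\<xi> = "convolve ?\<rho> ?w"
    have pos: "(0 :: real) < 1 / 4" by simp
    have tri: "\<bar>norm x - norm y\<bar> \<le> norm (x - y)" for x y :: "real^'n" by (rule norm_triangle_ineq3)
    have one: "?\<xi> x = 1" if "norm x < R - 1 / 4" for x
    proof -
      have "1 \<le> ?w y \<and> ?w y \<le> 1" if y: "norm (x - y) < 1 / 4" for y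
        using tri[of x y] y \<open>norm x < R - 1 / 4\<close> by (auto simp: indicator_def)
      from mollify_bounds[OF li pos this] show ?thesis by (simp add: order_antisym)
    qed
    have zero: "?\<xi> x = 0" if "norm x > R + 1 / 4" for x
    proof -
      have "0 \<le> ?w y \<and> ?w y \<le> 0" if y: "norm (x - y) < 1 / 4" for y
        using tri[of x y] y \<open>norm x > R + 1 / 4\<close> by (auto simp: indicator_def)
      from mollify_bounds[OF li pos this] show ?thesis by (simp add: order_antisym)
    qed
    have rng: "0 \<le> ?\<xi> x" "?\<xi> x \<le> 1" for x
      using mollify_bounds[OF li pos, of x 0 1] by (auto simp: indicator_def)
    have test: "test_function ?\<xi>"
      by (rule test_functionI[OF convolve_smooth[OF li \<rho>] compact_cball[of 0 "R + 1 / 4"]]) (use zero in auto)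
    have p1: "partial_derivative i ?\<xi> = convolve (?d1 i) ?w" for i
      by (rule convolve_partial_derivative[OF li test_function_C1_compact[OF \<rho>]])
    have p2: "partial_derivative j (partial_derivative i ?\<xi>) = convolve (?d2 i j) ?w" for i j
      unfolding p1 by (rule convolve_partial_derivative[OF li test_function_C1_compact[OF t[OF \<rho>]]])
    have w1: "\<bar>?w x\<bar> \<le> 1" for x by (simp add: indicator_def)
    have "\<bar>partial_derivative i ?\<xi> x\<bar> \<le> B" for i x
      unfolding p1 by (rule order_trans[OF convolve_bounded[OF li w1 t[OF \<rho>]] B1])
    moreover have "\<bar>partial_derivative j (partial_derivative i ?\<xi>) x\<bar> \<le> B" for i j x
      unfolding p2 by (rule order_trans[OF convolve_bounded[OF li w1 t[OF t[OF \<rho>]]] B2])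
    ultimately have "cutoff B R ?\<xi>" unfolding cutoff_def using test one zero rng by blast
    then show ?thesis by blast
  qed
  ultimately show ?thesis by blast
qed

section \<open>Fourth powers of first derivatives\<close>

text \<open>Global form of the local fourth-power bound: cutoffs of growing radius have uniformly
  bounded derivatives, so the right side stays below a fixed K and monotone convergence
  applies.\<close>

lemma weak_L4_integrable:
  fixes u f g :: "real^'n::finite \<Rightarrow> real"
  assumes u: "has_weak_derivative [i] u f" "L2_loc u" "\<And>x. \<bar>u x\<bar> \<le> 2"
    and f: "has_weak_derivative [i] f g" "f \<in> borel_measurable borel" "integrable lborel (\<lambda>x. (f x)\<^sup>2)"
    and g: "g \<in> borel_measurable borel" "integrable lborel (\<lambda>x. (g x)\<^sup>2)"
  shows "integrable lborel (\<lambda>x. f x ^ 4)"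
proof -
  obtain B where B: "\<And>R. \<exists>\<xi> :: real^'n \<Rightarrow> real. cutoff B R \<xi>" using cutoff_exists by metis
  define K where "K = (LINT x|lborel. 32 * B\<^sup>2 * (f x)\<^sup>2 + 72 * (g x)\<^sup>2)"
  have [measurable]: "f \<in> borel_measurable borel" by fact
  have Lf: "L2_loc f" and Lg: "L2_loc g" using f g by (auto intro: L2_loc_square_integrable)
  have "(\<integral>\<^sup>+x. indicator (ball 0 (real N)) x * ennreal (f x ^ 4) \<partial>lborel) \<le> ennreal K" for N
  proof -
    \<comment> \<open>The offset 1/4 makes the cutoff equal to 1 on the whole open ball of radius
      N.\<close>
    obtain \<xi> :: "real^'n \<Rightarrow> real" where "cutoff B (real N + 1 / 4) \<xi>" using B by blast
    note \<xi> = cutoffD(1-4,6)[OF this]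
    have bd: "32 * (partial_derivative i \<xi> x)\<^sup>2 * (f x)\<^sup>2 + 72 * (\<xi> x)\<^sup>2 * (g x)\<^sup>2 \<le> 32 * B\<^sup>2 * (f x)\<^sup>2 + 72 * (g x)\<^sup>2" for x
    proof (rule add_mono)
      have "(partial_derivative i \<xi> x)\<^sup>2 \<le> B\<^sup>2" using power_mono[OF \<xi>(5)[of i x], of 2] by simp
      then show "32 * (partial_derivative i \<xi> x)\<^sup>2 * (f x)\<^sup>2 \<le> 32 * B\<^sup>2 * (f x)\<^sup>2" by (intro mult_right_mono) auto
      have "(\<xi> x)\<^sup>2 \<le> 1" using \<xi>(2,3)[of x] by (simp add: power_le_one)
      then show "72 * (\<xi> x)\<^sup>2 * (g x)\<^sup>2 \<le> 72 * (g x)\<^sup>2" using mult_right_mono[of "(\<xi> x)\<^sup>2" 1 "(g x)\<^sup>2"] by simp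
    qed
    have [measurable]: "\<xi> \<in> borel_measurable borel" "partial_derivative i \<xi> \<in> borel_measurable borel" "g \<in> borel_measurable borel"
      by (intro smooth_borel smooth_partial_derivative test_function_smooth \<xi> g)+
    have "(\<integral>\<^sup>+x. indicator (ball 0 (real N)) x * ennreal (f x ^ 4) \<partial>lborel) \<le> (\<integral>\<^sup>+x. ennreal ((\<xi> x)\<^sup>2 * f x ^ 4) \<partial>lborel)"
      using \<xi>(4) by (intro nn_integral_mono) (auto simp: indicator_def)
    also have "\<dots> \<le> ennreal (LINT x|lborel. 32 * (partial_derivative i \<xi> x)\<^sup>2 * (f x)\<^sup>2 + 72 * (\<xi> x)\<^sup>2 * (g x)\<^sup>2)"
      by (rule weak_L4[OF u f(1) Lf Lg \<xi>(1)])
    also have "\<dots> \<le> ennreal K"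
      unfolding K_def
    proof (intro ennreal_leI integral_mono)
      show i: "integrable lborel (\<lambda>x. 32 * B\<^sup>2 * (f x)\<^sup>2 + 72 * (g x)\<^sup>2)" using f g by simp
      show "integrable lborel (\<lambda>x. 32 * (partial_derivative i \<xi> x)\<^sup>2 * (f x)\<^sup>2 + 72 * (\<xi> x)\<^sup>2 * (g x)\<^sup>2)"
        by (rule Bochner_Integration.integrable_bound[OF i]) (use bd in \<open>auto intro: order_trans[OF bd abs_ge_self]\<close>)
    qed (rule bd)
    finally show ?thesis .
  qed
  then have "(SUP N. \<integral>\<^sup>+x. indicator (ball 0 (real N)) x * ennreal (f x ^ 4) \<partial>lborel) \<le> ennreal K"
    by (intro SUP_least)
  moreover have "(\<integral>\<^sup>+x. ennreal (f x ^ 4) \<partial>lborel) = (\<integral>\<^sup>+x. (SUP N. indicator (ball 0 (real N)) x * ennreal (f x ^ 4)) \<partial>lborel)"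
  proof (intro nn_integral_cong)
    fix x :: "real^'n"
    obtain N :: nat where N: "norm x < real N" using reals_Archimedean2 by blast
    show "ennreal (f x ^ 4) = (SUP N. indicator (ball 0 (real N)) x * ennreal (f x ^ 4))"
      using N by (intro antisym SUP_least SUP_upper2[of N]) (auto simp: indicator_def)
  qed
  moreover have "\<dots> = (SUP N. \<integral>\<^sup>+x. indicator (ball 0 (real N)) x * ennreal (f x ^ 4) \<partial>lborel)"
    by (rule nn_integral_monotone_convergence_SUP)
      (auto simp: incseq_def le_fun_def indicator_def)
  ultimately have "(\<integral>\<^sup>+x. ennreal (f x ^ 4) \<partial>lborel) \<le> ennreal K" by simp
  from le_less_trans[OF this ennreal_less_top]
  show ?thesis by (intro integrableI_bounded) auto
qed

lemma admissible_L4: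
  assumes m: "m \<in> admissible"
  shows "integrable lborel (\<lambda>x. deriv1 m i a x ^ 4)"
proof (rule weak_L4_integrable)
  note A = admissible_derivatives[OF m]
  show "has_weak_derivative [i] (\<lambda>x. m x $ a) (deriv1 m i a)" "has_weak_derivative [i] (deriv1 m i a) (deriv2 m i i a)"
    "integrable lborel (\<lambda>x. (deriv1 m i a x)\<^sup>2)" "integrable lborel (\<lambda>x. (deriv2 m i i a x)\<^sup>2)"
    "deriv1 m i a \<in> borel_measurable borel" "deriv2 m i i a \<in> borel_measurable borel"
    by (rule A)+
  show "L2_loc (\<lambda>x. m x $ a)" by (rule L2_loc_continuous[OF admissible_continuous(2)[OF m]])
  show "\<bar>m x $ a\<bar> \<le> 2" for x using admissible_sphere(2)[OF m, of x a] by simp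
qed

text \<open>Products of two first derivatives are square integrable because their fourth powers are
  integrable; the Leibniz rule for the weighted angle form needs this.\<close>

lemma L2_loc_mult_L4:
  fixes f g :: "real^'n::finite \<Rightarrow> real"
  assumes [measurable]: "f \<in> borel_measurable borel" "g \<in> borel_measurable borel"
    and "integrable lborel (\<lambda>x. f x ^ 4)" "integrable lborel (\<lambda>x. g x ^ 4)"
  shows "L2_loc (\<lambda>x. f x * g x)"
proof (rule L2_loc_square_integrable)
  show "(\<lambda>x. f x * g x) \<in> borel_measurable borel" by measurable
  show "integrable lborel (\<lambda>x. (f x * g x)\<^sup>2)"
  proof (rule Bochner_Integration.integrable_bound)
    show "integrable lborel (\<lambda>x. f x ^ 4 + g x ^ 4)" by (intro Bochner_Integration.integrable_add assms)
    show "AE x in lborel. norm ((f x * g x)\<^sup>2) \<le> norm (f x ^ 4 + g x ^ 4)"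
    proof (rule AE_I2)
      fix x
      have "2 * ((f x)\<^sup>2 * (g x)\<^sup>2) \<le> ((f x)\<^sup>2)\<^sup>2 + ((g x)\<^sup>2)\<^sup>2"
        using sum_squares_bound[of "(f x)\<^sup>2" "(g x)\<^sup>2"] by simp
      moreover have "0 \<le> (f x)\<^sup>2 * (g x)\<^sup>2" by simp
      moreover have "((f x)\<^sup>2)\<^sup>2 = f x ^ 4" "((g x)\<^sup>2)\<^sup>2 = g x ^ 4" by (simp_all flip: power_mult)
      ultimately have "(f x)\<^sup>2 * (g x)\<^sup>2 \<le> f x ^ 4 + g x ^ 4" by linarith
      then show "norm ((f x * g x)\<^sup>2) \<le> norm (f x ^ 4 + g x ^ 4)" by (simp add: power_mult_distrib)
    qed
  qed measurable
qed

section \<open>Exactness of the weighted area density\<close>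

definition area_density :: "(real^2 \<Rightarrow> real^3) \<Rightarrow> real^2 \<Rightarrow> real" where
  "area_density m x = m x \<bullet> cross3 (weak_derivative [1] m x) (weak_derivative [2] m x)"

text \<open>The i-th coefficient of the pullback under m of the primitive whose differential is the
  weighted area form.\<close>

definition angle_form :: "(real^2 \<Rightarrow> real^3) \<Rightarrow> 2 \<Rightarrow> real^2 \<Rightarrow> real" where
  "angle_form m i x = polar_weight (m x $ 3) * (m x $ 1 * deriv1 m i 2 x - m x $ 2 * deriv1 m i 1 x)"

text \<open>The cross product of two tangent vectors is normal to the sphere, hence a multiple of m.
  Formally, m crossed with it vanishes, and crossing once more expands by the Lagrange
  identity.\<close>

lemma cross3_parallel:
  fixes m p q :: "real^3"
  assumes "norm m = 1" "m \<bullet> p = 0" "m \<bullet> q = 0"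
  shows "cross3 p q = (m \<bullet> cross3 p q) *\<^sub>R m"
proof -
  have "cross3 m (cross3 p q) = 0" using assms by (simp add: Lagrange)
  then have "cross3 m (cross3 m (cross3 p q)) = 0" by simp
  moreover have "m \<bullet> m = 1" using assms(1) by (simp add: norm_eq_1)
  ultimately show ?thesis using Lagrange[of m m "cross3 p q"] by simp
qed

text \<open>Weak differentiation of the constant |m|^2 = 1 by the product rule, followed by
  uniqueness of weak derivatives.\<close>

lemma admissible_orthogonal:
  assumes m: "m \<in> admissible"
  shows "AE x in lborel. m x \<bullet> weak_derivative [i] m x = 0"
proof -
  note A = admissible_derivatives[OF m]
  have L: "L2_loc (\<lambda>x. m x $ a)" "L2_loc (deriv1 m i a)" for a
    by (rule L2_loc_continuous[OF admissible_continuous(2)[OF m]], rule L2_loc_square_integrable[OF A(3,4)])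
  have q: "has_weak_derivative [i] (\<lambda>x. m x $ a * m x $ a) (\<lambda>x. deriv1 m i a x * m x $ a + m x $ a * deriv1 m i a x)" for a
    by (rule weak_derivative_mult[OF A(1) A(1) L(1) L(1) L(2) L(2)])
  note S = weak_derivative_add[OF weak_derivative_add[OF q[of 1] q[of 2]] q[of 3]]
  have "(\<lambda>x. m x $ 1 * m x $ 1 + m x $ 2 * m x $ 2 + m x $ 3 * m x $ 3) = (\<lambda>x. 1)"
    using admissible_sphere(1)[OF m] by (simp add: sum_3 power2_eq_square)
  from weak_derivative_unique[OF S[unfolded this] weak_derivative_const]
  show ?thesis
    by eventually_elim (simp add: inner_vec_def sum_3 deriv1_def algebra_simps)
qed

text \<open>The curl of the angle form is computed almost everywhere and found to be the weighted
  area density; testing it with \<eta> then moves both derivatives onto \<eta>. Integrability of the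
  fourth powers makes the product rule applicable to the coefficients.\<close>

lemma area_density_exact:
  assumes m: "m \<in> admissible" and \<eta>: "test_function \<eta>"
  shows "locally_integrable (angle_form m i)"
    and "integrable lborel (\<lambda>x. \<eta> x * (area_weight (m x $ 3) * area_density m x))"
    and "(LINT x|lborel. \<eta> x * (area_weight (m x $ 3) * area_density m x))
    = (LINT x|lborel. partial_derivative 2 \<eta> x * angle_form m 1 x) - (LINT x|lborel. partial_derivative 1 \<eta> x * angle_form m 2 x)"
proof -
  note A = admissible_derivatives[OF m]
  let ?D = "deriv1 m" and ?H = "deriv2 m" and ?w = "\<lambda>x. polar_weight (m x $ 3)" and ?w' = "\<lambda>x. polar_weight' (m x $ 3)"
  have c: "continuous_on UNIV (\<lambda>x. m x $ a)" for a by (rule admissible_continuous(2)[OF m])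
  have Lm: "L2_loc (\<lambda>x. m x $ a)" for a by (rule L2_loc_continuous[OF c])
  have LD: "L2_loc (?D i a)" for i a by (rule L2_loc_square_integrable[OF A(3,4)])
  have LH: "L2_loc (?H i j a)" for i j a by (rule L2_loc_square_integrable[OF A(5,6)])
  have LDD: "L2_loc (\<lambda>x. ?D i a x * ?D j b x)" for i j a b
    by (intro L2_loc_mult_L4 A admissible_L4 m)
  have mb: "\<bar>m x $ a\<bar> \<le> 1" for x a by (rule admissible_sphere(2)[OF m])
  have Lb: "L2_loc (\<lambda>x. m x $ a * f x)" if "L2_loc f" for a f
    by (rule L2_loc_bounded_mult[OF that borel_measurable_continuous_onI[OF c] mb])
  have cw: "continuous_on UNIV ?w" "continuous_on UNIV ?w'"
    using continuous_on_compose2[OF continuous_at_imp_continuous_on[of UNIV polar_weight] c[of 3]]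
      continuous_on_compose2[OF polar_weight'_continuous[of UNIV] c[of 3]] DERIV_isCont[OF polar_weight_derivative] by auto
  have bw: "\<bar>?w x\<bar> \<le> 2" "\<bar>?w' x\<bar> \<le> 1" for x
  proof -
    have "1 \<le> 1 + max (m x $ 3) 0" by simp
    then have "1 / (1 + max (m x $ 3) 0) \<le> 1" "1 / (1 + max (m x $ 3) 0)\<^sup>2 \<le> 1" "0 \<le> 1 / (1 + max (m x $ 3) 0)"
      by (auto simp: divide_le_eq_1)
    moreover have "- 1 \<le> min (m x $ 3) 0" "min (m x $ 3) 0 \<le> 0" using mb[of x 3] by (simp_all add: abs_le_iff)
    ultimately have "\<bar>1 / (1 + max (m x $ 3) 0) - min (m x $ 3) 0\<bar> \<le> 2" by linarith
    then show "\<bar>?w x\<bar> \<le> 2" by (simp only: polar_weight_def)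
    show "\<bar>?w' x\<bar> \<le> 1" using \<open>1 / (1 + max (m x $ 3) 0)\<^sup>2 \<le> 1\<close> by (simp add: polar_weight'_def)
  qed
  have w: "has_weak_derivative [i] ?w (\<lambda>x. ?w' x * ?D i 3 x)" for i
  proof (rule weak_derivative_compose[OF A(1) LD c, of "-1" 3 1])
    show "- 1 \<le> m x $ 3 \<and> m x $ 3 \<le> 1" for x using mb[of x 3] by (simp add: abs_le_iff)
  qed (auto intro: polar_weight_derivative polar_weight'_continuous)
  let ?p = "\<lambda>i x. m x $ 1 * ?D i 2 x + (-1) * (m x $ 2 * ?D i 1 x)"
  let ?q = "\<lambda>i j x. (?D j 1 x * ?D i 2 x + m x $ 1 * ?H i j 2 x) + (-1) * (?D j 2 x * ?D i 1 x + m x $ 2 * ?H i j 1 x)"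
  have p: "has_weak_derivative [j] (?p i) (?q i j)" for i j
    by (intro weak_derivative_add weak_derivative_cmult weak_derivative_mult A Lm LD LH)
  have neg: "L2_loc (\<lambda>x. (-1) * f x)" if "L2_loc f" for f :: "real^2 \<Rightarrow> real"
    by (rule L2_loc_bounded_mult[OF that, of _ 1]) auto
  have Lp: "L2_loc (?p i)" for i by (intro L2_loc_add neg Lb LD)
  have Lq: "L2_loc (?q i j)" for i j by (intro L2_loc_add neg Lb LDD LH)
  have Lw: "L2_loc ?w" by (rule L2_loc_continuous[OF cw(1)])
  have Lw': "L2_loc (\<lambda>x. ?w' x * ?D i 3 x)" for i
    by (rule L2_loc_bounded_mult[OF LD borel_measurable_continuous_onI[OF cw(2)] bw(2)])
  have ang: "angle_form m i = (\<lambda>x. ?w x * ?p i x)" for i by (simp add: angle_form_def fun_eq_iff)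
  have a: "has_weak_derivative [j] (angle_form m i) (\<lambda>x. ?w' x * ?D j 3 x * ?p i x + ?w x * ?q i j x)" for i j
    unfolding ang by (rule weak_derivative_mult[OF w p Lw Lp Lw' Lq])
  let ?r = "\<lambda>i j x. ?w' x * ?D j 3 x * ?p i x + ?w x * ?q i j x"
  show "locally_integrable (angle_form m i)" for i by (rule weak_derivative_locally_integrable(1)[OF a])
  have comm: "AE x in lborel. ?H 1 2 a x = ?H 2 1 a x" for a
    by (rule weak_derivative_commute[OF A(1) A(1) A(2) A(2)])
  have curl: "AE x in lborel. area_weight (m x $ 3) * area_density m x = ?r 2 1 x - ?r 1 2 x"
    using comm[of 1] comm[of 2] admissible_orthogonal[OF m, of 1] admissible_orthogonal[OF m, of 2]
  proof eventually_elim
    case (elim x)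
    let ?P = "weak_derivative [1] m x" and ?Q = "weak_derivative [2] m x"
    define \<omega> where "\<omega> = area_density m x"
    have n: "norm (m x) = 1" using m by (simp add: admissible_def)
    have "cross3 ?P ?Q = \<omega> *\<^sub>R m x"
      unfolding \<omega>_def area_density_def by (rule cross3_parallel[OF n elim(3,4)])
    then have C: "?D 1 2 x * ?D 2 3 x - ?D 2 2 x * ?D 1 3 x = \<omega> * m x $ 1"
      "?D 1 3 x * ?D 2 1 x - ?D 2 3 x * ?D 1 1 x = \<omega> * m x $ 2"
      "?D 1 1 x * ?D 2 2 x - ?D 2 1 x * ?D 1 2 x = \<omega> * m x $ 3"
      unfolding deriv1_def by (auto simp flip: cross_components)
    have S: "(m x $ 1)\<^sup>2 + (m x $ 2)\<^sup>2 = 1 - (m x $ 3)\<^sup>2"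
      using admissible_sphere(1)[OF m, of x] by (simp add: sum_3)
    \<comment> \<open>Mixed second derivatives cancel and only the 2 by 2 minors of the derivative
      remain. They are the components of the cross product, that is \<omega> times those of m, and
      |m| = 1 turns the rest into \<open>area_weight\<close>.\<close>
    have "?r 2 1 x - ?r 1 2 x = ?w x * (2 * (?D 1 1 x * ?D 2 2 x - ?D 2 1 x * ?D 1 2 x))
      - ?w' x * (m x $ 1 * (?D 1 2 x * ?D 2 3 x - ?D 2 2 x * ?D 1 3 x) + m x $ 2 * (?D 1 3 x * ?D 2 1 x - ?D 2 3 x * ?D 1 1 x))"
      using elim(1,2) by (simp add: algebra_simps)
    also have "\<dots> = 2 * m x $ 3 * ?w x * \<omega> - ?w' x * (((m x $ 1)\<^sup>2 + (m x $ 2)\<^sup>2) * \<omega>)"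
      unfolding C by (simp add: power2_eq_square algebra_simps)
    also have "\<dots> = area_weight (m x $ 3) * \<omega>"
      unfolding S area_weight_def by (simp add: algebra_simps)
    finally show ?case by (simp add: \<omega>_def)
  qed
  have int: "integrable lborel (\<lambda>x. \<eta> x * ?r i j x)" for i j
    using locally_integrable_test[OF weak_derivative_locally_integrable(2)[OF a] \<eta>] by simp
  have [measurable]: "\<eta> \<in> borel_measurable borel" by (rule smooth_borel[OF test_function_smooth[OF \<eta>]])
  have rm: "?r i j \<in> borel_measurable borel" for i j
    by (rule locally_integrable_borel[OF weak_derivative_locally_integrable(2)[OF a]])
  have wm: "(\<lambda>x. area_weight (m x $ 3) * area_density m x) \<in> borel_measurable borel"
  proof -
    have [measurable]: "(\<lambda>x. m x $ a) \<in> borel_measurable borel" "?D i a \<in> borel_measurable borel" for a i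
      by (rule borel_measurable_continuous_onI[OF c] A(3))+
    have [measurable]: "?w \<in> borel_measurable borel" "?w' \<in> borel_measurable borel"
      by (intro borel_measurable_continuous_onI cw)+
    have "area_density m = (\<lambda>x. m x $ 1 * (?D 1 2 x * ?D 2 3 x - ?D 2 2 x * ?D 1 3 x)
      + m x $ 2 * (?D 1 3 x * ?D 2 1 x - ?D 2 3 x * ?D 1 1 x) + m x $ 3 * (?D 1 1 x * ?D 2 2 x - ?D 2 1 x * ?D 1 2 x))"
      by (simp add: fun_eq_iff area_density_def inner_vec_def sum_3 cross_components deriv1_def)
    then have [measurable]: "area_density m \<in> borel_measurable borel" by simp
    show ?thesis unfolding area_weight_def by measurable
  qed
  have ae: "AE x in lborel. \<eta> x * (?r 2 1 x - ?r 1 2 x) = \<eta> x * (area_weight (m x $ 3) * area_density m x)"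
    using curl by eventually_elim simp
  have meas: "(\<lambda>x. \<eta> x * (area_weight (m x $ 3) * area_density m x)) \<in> borel_measurable lborel"
    "(\<lambda>x. \<eta> x * (?r 2 1 x - ?r 1 2 x)) \<in> borel_measurable lborel"
    using wm rm[of 2 1] rm[of 1 2] by (simp_all add: borel_measurable_times borel_measurable_diff)
  have "integrable lborel (\<lambda>x. \<eta> x * (?r 2 1 x - ?r 1 2 x))"
    using int[of 2 1] int[of 1 2] by (simp only: right_diff_distrib Bochner_Integration.integrable_diff)
  then show "integrable lborel (\<lambda>x. \<eta> x * (area_weight (m x $ 3) * area_density m x))"
    by (rule integrable_cong_AE_imp[OF _ meas(1) ae])
  have "(LINT x|lborel. \<eta> x * (area_weight (m x $ 3) * area_density m x)) = (LINT x|lborel. \<eta> x * (?r 2 1 x - ?r 1 2 x))"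
    by (rule integral_cong_AE[OF meas ae[THEN AE_mp]]) simp
  also have "\<dots> = (LINT x|lborel. \<eta> x * ?r 2 1 x) - (LINT x|lborel. \<eta> x * ?r 1 2 x)"
    using int[of 2 1] int[of 1 2] by (simp only: right_diff_distrib Bochner_Integration.integral_diff)
  also have "\<dots> = (LINT x|lborel. partial_derivative 2 \<eta> x * angle_form m 1 x) - (LINT x|lborel. partial_derivative 1 \<eta> x * angle_form m 2 x)"
    using weak_derivativeD[OF a \<eta>] by simp
  finally show "(LINT x|lborel. \<eta> x * (area_weight (m x $ 3) * area_density m x))
    = (LINT x|lborel. partial_derivative 2 \<eta> x * angle_form m 1 x) - (LINT x|lborel. partial_derivative 1 \<eta> x * angle_form m 2 x)" .
qed

subsection \<open>Functions controlled by an envelope\<close>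

text \<open>The envelopes bound a function and its first and second derivatives. Since \<open>e2\<close> also bounds
  \<open>e1\<^sup>2\<close>, functions below the envelopes are stable under products and compositions.\<close>

locale envelope =
  fixes e0 e1 e2 :: "real^'n::finite \<Rightarrow> real"
  assumes e0_nonneg: "0 \<le> e0 x" and e0_le_e1: "e0 x \<le> e1 x" and e1_le_e2: "e1 x \<le> e2 x"
    and e0_le: "e0 x \<le> 6" and e1_sq: "(e1 x)\<^sup>2 \<le> 24 * e2 x" and e2_L2: "L2_loc e2"
begin

lemma e1_nonneg: "0 \<le> e1 x" and e2_nonneg: "0 \<le> e2 x" and e0_le_e2: "e0 x \<le> e2 x"
  using e0_nonneg[of x] e0_le_e1[of x] e1_le_e2[of x] by linarith+

definition jet :: "real \<Rightarrow> (real^'n \<Rightarrow> real) \<Rightarrow> ('n \<Rightarrow> real^'n \<Rightarrow> real) \<Rightarrow> ('n \<Rightarrow> 'n \<Rightarrow> real^'n \<Rightarrow> real) \<Rightarrow> bool" where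
  "jet C u U1 U2 \<longleftrightarrow> 0 \<le> C \<and> continuous_on UNIV u \<and> (\<forall>x. \<bar>u x\<bar> \<le> C * e0 x) \<and>
    (\<forall>i. has_weak_derivative [i] u (U1 i)) \<and> (\<forall>i j. has_weak_derivative [j] (U1 i) (U2 i j)) \<and>
    (\<forall>i x. \<bar>U1 i x\<bar> \<le> C * e1 x) \<and> (\<forall>i j x. \<bar>U2 i j x\<bar> \<le> C * e2 x)"

text \<open>Hiding the derivatives lets the closure rules below be chained with only the constant
  recorded.\<close>

definition small :: "real \<Rightarrow> (real^'n \<Rightarrow> real) \<Rightarrow> bool" where
  "small C u \<longleftrightarrow> (\<exists>U1 U2. jet C u U1 U2)"

text \<open>Beyond unfolding, domination by \<open>e2\<close> makes the function and all its
  derivatives locally square integrable, which is what the product and chain rules ask for.\<close>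

lemma jetD:
  assumes "jet C u U1 U2"
  shows "0 \<le> C" "continuous_on UNIV u" "\<bar>u x\<bar> \<le> C * e0 x"
    "has_weak_derivative [i] u (U1 i)" "has_weak_derivative [j] (U1 i) (U2 i j)"
    "\<bar>U1 i x\<bar> \<le> C * e1 x" "\<bar>U2 i j x\<bar> \<le> C * e2 x"
    "L2_loc u" "L2_loc (U1 i)" "L2_loc (U2 i j)"
proof -
  show U: "0 \<le> C" "continuous_on UNIV u" "\<bar>u x\<bar> \<le> C * e0 x"
    "has_weak_derivative [i] u (U1 i)" "has_weak_derivative [j] (U1 i) (U2 i j)"
    "\<bar>U1 i x\<bar> \<le> C * e1 x" "\<bar>U2 i j x\<bar> \<le> C * e2 x" for x i j
    using assms unfolding jet_def by blast+
  have L: "L2_loc f" if "f \<in> borel_measurable borel" "\<And>x. \<bar>f x\<bar> \<le> C * e2 x" for f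
    by (rule L2_loc_bound[OF e2_L2 that(1)]) (rule order_trans[OF that(2) abs_ge_self])
  have "\<bar>U1 i x\<bar> \<le> C * e2 x" for i x
    using U(6)[of i x] mult_left_mono[OF e1_le_e2 U(1), of x] by linarith
  then show "L2_loc (U1 i)"
    by (intro L) (rule locally_integrable_borel[OF weak_derivative_locally_integrable(2)[OF U(4)]])
  show "L2_loc (U2 i j)"
    by (intro L U(7)) (rule locally_integrable_borel[OF weak_derivative_locally_integrable(2)[OF U(5)]])
  show "L2_loc u" by (rule L2_loc_continuous[OF U(2)])
qed

lemma smallI:
  assumes "0 \<le> C" "continuous_on UNIV u" "\<And>x. \<bar>u x\<bar> \<le> C * e0 x"
    "\<And>i. has_weak_derivative [i] u (U1 i)" "\<And>i j. has_weak_derivative [j] (U1 i) (U2 i j)"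
    "\<And>i x. \<bar>U1 i x\<bar> \<le> C * e1 x" "\<And>i j x. \<bar>U2 i j x\<bar> \<le> C * e2 x"
  shows "small C u"
  using assms unfolding small_def jet_def by blast

lemma small_add:
  assumes "small C u" "small D w" shows "small (C + D) (\<lambda>x. u x + w x)"
proof -
  obtain U1 U2 where "jet C u U1 U2" using assms(1) unfolding small_def by blast
  note U = jetD[OF this]
  obtain W1 W2 where "jet D w W1 W2" using assms(2) unfolding small_def by blast
  note W = jetD[OF this]
  have tri: "\<bar>a + b\<bar> \<le> (C + D) * e" if "\<bar>a\<bar> \<le> C * e" "\<bar>b\<bar> \<le> D * e" for a b e
    using that abs_triangle_ineq[of a b] by (simp add: distrib_right)
  show ?thesis
    by (rule smallI[where ?U1.0="\<lambda>i x. U1 i x + W1 i x" and ?U2.0="\<lambda>i j x. U2 i j x + W2 i j x"])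
      (intro add_nonneg_nonneg continuous_on_add weak_derivative_add tri U W)+
qed

text \<open>The second derivative decides the constant: two products of order 0 and 2 cost 6 each by
  the bound on \<open>e0\<close>, two products of first derivatives cost 24 each by the bound on
  \<open>e1\<close> squared, in total 60.\<close>

lemma small_mult:
  assumes "small C u" "small D w" shows "small (60 * C * D) (\<lambda>x. u x * w x)"
proof -
  obtain U1 U2 where "jet C u U1 U2" using assms(1) unfolding small_def by blast
  note U = jetD[OF this]
  obtain W1 W2 where "jet D w W1 W2" using assms(2) unfolding small_def by blast
  note W = jetD[OF this]
  have prod: "\<bar>a * b\<bar> \<le> C * D * (e * f)" if "\<bar>a\<bar> \<le> C * e" "\<bar>b\<bar> \<le> D * f" for a b e f
    using mult_mono[OF that] that order_trans[OF abs_ge_zero that(1)] by (simp add: abs_mult mult_ac)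
  have CD: "0 \<le> C * D" using U(1) W(1) by simp
  have b00: "e0 x * e0 x \<le> 6 * e0 x" and b01: "e0 x * e1 x \<le> 6 * e1 x" and b02: "e0 x * e2 x \<le> 6 * e2 x"
    and b11: "e1 x * e1 x \<le> 24 * e2 x" for x
    using mult_right_mono[OF e0_le[of x] e0_nonneg[of x]] mult_right_mono[OF e0_le[of x] e1_nonneg[of x]]
      mult_right_mono[OF e0_le[of x] e2_nonneg[of x]] e1_sq[of x] by (simp_all add: power2_eq_square)
  note scale = mult_left_mono[OF _ CD]
  show ?thesis
  proof (rule smallI[where ?U1.0="\<lambda>i x. U1 i x * w x + u x * W1 i x" and
        ?U2.0="\<lambda>i j x. (U2 i j x * w x + U1 i x * W1 j x) + (U1 j x * W1 i x + u x * W2 i j x)"])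
    show "0 \<le> 60 * C * D" using CD by simp
    show "continuous_on UNIV (\<lambda>x. u x * w x)" by (intro continuous_on_mult U W)
    show "\<bar>u x * w x\<bar> \<le> 60 * C * D * e0 x" for x
      using prod[OF U(3)[of x] W(3)[of x]] scale[OF b00[of x]] mult_nonneg_nonneg[OF CD e0_nonneg[of x]]
      by (simp add: mult.assoc) 
    show "has_weak_derivative [i] (\<lambda>x. u x * w x) (\<lambda>x. U1 i x * w x + u x * W1 i x)" for i
      by (intro weak_derivative_mult U W)
    show "has_weak_derivative [j] (\<lambda>x. U1 i x * w x + u x * W1 i x)
      (\<lambda>x. (U2 i j x * w x + U1 i x * W1 j x) + (U1 j x * W1 i x + u x * W2 i j x))" for i j
      by (intro weak_derivative_add weak_derivative_mult U W)
    show "\<bar>U1 i x * w x + u x * W1 i x\<bar> \<le> 60 * C * D * e1 x" for i x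
    proof -
      have "\<bar>U1 i x * w x\<bar> \<le> C * D * (e0 x * e1 x)" "\<bar>u x * W1 i x\<bar> \<le> C * D * (e0 x * e1 x)"
        using prod[OF U(6)[of i x] W(3)[of x]] prod[OF U(3)[of x] W(6)[of i x]] by (simp_all add: mult_ac)
      moreover have "C * D * (e0 x * e1 x) \<le> C * D * (6 * e1 x)" by (rule scale[OF b01])
      ultimately show ?thesis
        using mult_nonneg_nonneg[OF CD e1_nonneg[of x]] abs_triangle_ineq[of "U1 i x * w x" "u x * W1 i x"]
        by (simp add: mult.assoc mult.left_commute[of _ 6])
    qed
    show "\<bar>(U2 i j x * w x + U1 i x * W1 j x) + (U1 j x * W1 i x + u x * W2 i j x)\<bar> \<le> 60 * C * D * e2 x" for i j x
    proof -
      have "\<bar>U2 i j x * w x\<bar> \<le> C * D * (e0 x * e2 x)" "\<bar>u x * W2 i j x\<bar> \<le> C * D * (e0 x * e2 x)"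
        "\<bar>U1 i x * W1 j x\<bar> \<le> C * D * (e1 x * e1 x)" "\<bar>U1 j x * W1 i x\<bar> \<le> C * D * (e1 x * e1 x)"
        using prod[OF U(7)[of i j x] W(3)[of x]] prod[OF U(3)[of x] W(7)[of i j x]]
          prod[OF U(6)[of i x] W(6)[of j x]] prod[OF U(6)[of j x] W(6)[of i x]] by (simp_all add: mult_ac)
      moreover have "C * D * (e0 x * e2 x) \<le> C * D * (6 * e2 x)" "C * D * (e1 x * e1 x) \<le> C * D * (24 * e2 x)"
        by (rule scale[OF b02], rule scale[OF b11])
      moreover have "60 * C * D * e2 x = C * D * (6 * e2 x) + C * D * (24 * e2 x) + C * D * (24 * e2 x) + C * D * (6 * e2 x)"
        by (simp add: algebra_simps)
      ultimately show ?thesis by linarith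
    qed
  qed
qed

text \<open>A smooth coefficient is bounded but lies below no envelope, so the product rule above
  does not cover it. The 4 counts the terms in the second derivative of a product.\<close>

lemma small_coefficient:
  assumes u: "small C u" and f: "smooth f" and B: "\<And>x. \<bar>f x\<bar> \<le> B" "\<And>i x. \<bar>partial_derivative i f x\<bar> \<le> B"
    "\<And>i j x. \<bar>partial_derivative j (partial_derivative i f) x\<bar> \<le> B"
  shows "small (4 * B * C) (\<lambda>x. f x * u x)"
proof -
  obtain U1 U2 where "jet C u U1 U2" using u unfolding small_def by blast
  note U = jetD[OF this]
  have B0: "0 \<le> B" using B(1)[of 0] by simp
  let ?D = "\<lambda>i. partial_derivative i f" and ?H = "\<lambda>i j. partial_derivative j (partial_derivative i f)"
  have s: "smooth (?D i)" "smooth (?H i j)" for i j by (intro smooth_partial_derivative f)+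
  note W = weak_derivative_smooth and L = smooth_L2_loc
  have prod: "\<bar>a * b\<bar> \<le> B * (C * e)" if "\<bar>a\<bar> \<le> B" "\<bar>b\<bar> \<le> C * e" for a b e
    using mult_mono[OF that B0] by (simp add: abs_mult)
  have BC: "0 \<le> B * C" using B0 U(1) by simp
  have le: "B * (C * e0 x) \<le> B * (C * e1 x)" "B * (C * e0 x) \<le> B * (C * e2 x)" "B * (C * e1 x) \<le> B * (C * e2 x)" for x
    using B0 U(1) e0_le_e1[of x] e0_le_e2[of x] e1_le_e2[of x] by (auto intro!: mult_left_mono)
  have nn: "0 \<le> B * (C * e0 x)" "0 \<le> B * (C * e1 x)" for x
    using B0 U(1) e0_nonneg e1_nonneg by auto
  show ?thesis
  proof (rule smallI[where ?U1.0="\<lambda>i x. ?D i x * u x + f x * U1 i x" and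
        ?U2.0="\<lambda>i j x. (?H i j x * u x + ?D i x * U1 j x) + (?D j x * U1 i x + f x * U2 i j x)"])
    show "0 \<le> 4 * B * C" using BC by simp
    show "continuous_on UNIV (\<lambda>x. f x * u x)" by (intro continuous_on_mult U smooth_continuous f)
    show "\<bar>f x * u x\<bar> \<le> 4 * B * C * e0 x" for x
      using prod[OF B(1)[of x] U(3)[of x]] nn(1)[of x] by (simp add: mult.assoc)
    show "has_weak_derivative [i] (\<lambda>x. f x * u x) (\<lambda>x. ?D i x * u x + f x * U1 i x)" for i
      by (intro weak_derivative_mult U W L f s)
    show "has_weak_derivative [j] (\<lambda>x. ?D i x * u x + f x * U1 i x)
      (\<lambda>x. (?H i j x * u x + ?D i x * U1 j x) + (?D j x * U1 i x + f x * U2 i j x))" for i j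
      by (intro weak_derivative_add weak_derivative_mult U W L f s)
    show "\<bar>?D i x * u x + f x * U1 i x\<bar> \<le> 4 * B * C * e1 x" for i x
      using prod[OF B(2)[of i x] U(3)[of x]] prod[OF B(1)[of x] U(6)[of i x]] le(1)[of x] nn(2)[of x]
        abs_triangle_ineq[of "?D i x * u x" "f x * U1 i x"] by (simp add: mult.assoc)
    show "\<bar>(?H i j x * u x + ?D i x * U1 j x) + (?D j x * U1 i x + f x * U2 i j x)\<bar> \<le> 4 * B * C * e2 x" for i j x
    proof -
      have "4 * B * C * e2 x = 4 * (B * (C * e2 x))" by simp
      then show ?thesis
        using prod[OF B(3)[of j i x] U(3)[of x]] prod[OF B(2)[of i x] U(6)[of j x]]
          prod[OF B(2)[of j x] U(6)[of i x]] prod[OF B(1)[of x] U(7)[of i j x]] le(2,3)[of x] by linarith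
    qed
  qed
qed

text \<open>The second derivative F''(u) Du Du + F'(u) D^2 u explains B (24 C^2 + C), the quadratic
  part being absorbed by \<open>e2\<close>. The condition F 0 = 0 puts F(u) below a multiple of
  \<open>e0\<close>.\<close>

lemma small_compose:
  fixes F F' F'' :: "real \<Rightarrow> real"
  assumes u: "small C u" and ab: "\<And>x. a \<le> u x \<and> u x \<le> b" "a \<le> 0" "0 \<le> b" and F0: "F 0 = 0"
    and F: "\<And>s. a \<le> s \<Longrightarrow> s \<le> b \<Longrightarrow> (F has_real_derivative F' s) (at s)"
    and F': "\<And>s. a \<le> s \<Longrightarrow> s \<le> b \<Longrightarrow> (F' has_real_derivative F'' s) (at s)" "continuous_on {a..b} F''"
    and B: "\<And>s. a \<le> s \<Longrightarrow> s \<le> b \<Longrightarrow> \<bar>F' s\<bar> \<le> B" "\<And>s. a \<le> s \<Longrightarrow> s \<le> b \<Longrightarrow> \<bar>F'' s\<bar> \<le> B"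
  shows "small (B * (24 * C\<^sup>2 + C)) (\<lambda>x. F (u x))"
proof -
  obtain U1 U2 where "jet C u U1 U2" using u unfolding small_def by blast
  note U = jetD[OF this]
  have B0: "0 \<le> B" using B(1)[OF ab(2,3)] by simp
  have cont: "continuous_on {a..b} G" if "\<And>s. a \<le> s \<Longrightarrow> s \<le> b \<Longrightarrow> (G has_real_derivative G' s) (at s)" for G G'
    by (intro continuous_at_imp_continuous_on ballI DERIV_isCont) (rule that; simp)
  note cF = cont[OF F] and cF' = cont[OF F'(1)]
  have rng: "range u \<subseteq> {a..b}" using ab(1) by (simp add: image_subset_iff)
  have cu: "continuous_on UNIV (\<lambda>x. F (u x))" "continuous_on UNIV (\<lambda>x. F' (u x))" "continuous_on UNIV (\<lambda>x. F'' (u x))"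
    using continuous_on_compose2[OF _ U(2) rng] cF cF' F'(2) by blast+
  have w: "has_weak_derivative [i] (\<lambda>x. F (u x)) (\<lambda>x. F' (u x) * U1 i x)" for i
    by (rule weak_derivative_compose[OF U(4,9,2) ab(1) F cF'])
  have w': "has_weak_derivative [i] (\<lambda>x. F' (u x)) (\<lambda>x. F'' (u x) * U1 i x)" for i
    by (rule weak_derivative_compose[OF U(4,9,2) ab(1) F'])
  have L: "L2_loc (\<lambda>x. F'' (u x) * U1 i x)" for i
    by (rule L2_loc_bounded_mult[OF U(9) borel_measurable_continuous_onI[OF cu(3)]]) (use B(2) ab(1) in blast)
  have prod: "\<bar>a * b\<bar> \<le> B * c" if "\<bar>a\<bar> \<le> B" "\<bar>b\<bar> \<le> c" for a b c :: real
    using mult_mono[OF that B0] by (simp add: abs_mult)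
  have C2: "C \<le> 24 * C\<^sup>2 + C" by simp
  have C2': "B * (C * e) \<le> B * (24 * C\<^sup>2 + C) * e" if "0 \<le> e" for e
    using mult_left_mono[OF mult_right_mono[OF C2 that] B0] by (simp add: mult.assoc)
  show ?thesis
  proof (rule smallI[where ?U1.0="\<lambda>i x. F' (u x) * U1 i x" and
        ?U2.0="\<lambda>i j x. F'' (u x) * U1 j x * U1 i x + F' (u x) * U2 i j x"])
    show "0 \<le> B * (24 * C\<^sup>2 + C)" using B0 U(1) by simp
    show "continuous_on UNIV (\<lambda>x. F (u x))" by (rule cu)
    show "has_weak_derivative [i] (\<lambda>x. F (u x)) (\<lambda>x. F' (u x) * U1 i x)" for i by (rule w)
    show "has_weak_derivative [j] (\<lambda>x. F' (u x) * U1 i x) (\<lambda>x. F'' (u x) * U1 j x * U1 i x + F' (u x) * U2 i j x)" for i j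
      by (rule weak_derivative_mult[OF w' U(5) L2_loc_continuous[OF cu(2)] U(9) L U(10)])
    show "\<bar>F' (u x) * U1 i x\<bar> \<le> B * (24 * C\<^sup>2 + C) * e1 x" for i x
      by (rule order_trans[OF prod[OF B(1) U(6)] C2'[OF e1_nonneg]]) (use ab(1) in auto)
    show "\<bar>F (u x)\<bar> \<le> B * (24 * C\<^sup>2 + C) * e0 x" for x
    proof -
      \<comment> \<open>Mean value bound between 0 and u(x); both lie in [a, b] because a \<le> 0
        \<le> b.\<close>
      have "norm (F (u x) - F 0) \<le> B * norm (u x - 0)"
      proof (rule field_differentiable_bound[of "{a..b}"])
        show "(F has_field_derivative F' z) (at z within {a..b})" if "z \<in> {a..b}" for z
          using F[of z] that by (auto intro: has_field_derivative_at_within)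
      qed (use B(1) ab in auto)
      also have "\<dots> \<le> B * (C * e0 x)" using U(3)[of x] B0 by (simp add: mult_left_mono)
      finally show ?thesis using F0 C2'[OF e0_nonneg[of x]] by simp
    qed
    show "\<bar>F'' (u x) * U1 j x * U1 i x + F' (u x) * U2 i j x\<bar> \<le> B * (24 * C\<^sup>2 + C) * e2 x" for i j x
    proof -
      have "\<bar>U1 j x * U1 i x\<bar> \<le> (C * e1 x) * (C * e1 x)"
        unfolding abs_mult using U(6)[of j x] U(6)[of i x] by (intro mult_mono) auto
      also have "\<dots> = C\<^sup>2 * (e1 x)\<^sup>2" by (simp add: power2_eq_square mult_ac)
      also have "\<dots> \<le> C\<^sup>2 * (24 * e2 x)" by (intro mult_left_mono e1_sq) simp
      finally have "\<bar>F'' (u x) * (U1 j x * U1 i x)\<bar> \<le> B * (C\<^sup>2 * (24 * e2 x))"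
        using prod B(2) ab(1) by blast
      moreover have "\<bar>F' (u x) * U2 i j x\<bar> \<le> B * (C * e2 x)"
        using prod[OF B(1) U(7)] ab(1) by blast
      moreover have "B * (24 * C\<^sup>2 + C) * e2 x = B * (C\<^sup>2 * (24 * e2 x)) + B * (C * e2 x)"
        by (simp add: algebra_simps)
      ultimately show ?thesis
        using abs_triangle_ineq[of "F'' (u x) * U1 j x * U1 i x" "F' (u x) * U2 i j x"] by (simp add: mult.assoc)
    qed
  qed
qed

end

section \<open>Envelopes of an admissible map\<close>

definition defect :: "(real^2 \<Rightarrow> real^3) \<Rightarrow> 3 \<Rightarrow> real^2 \<Rightarrow> real" where
  "defect m a x = (m x - e3) $ a"

definition env0 :: "(real^2 \<Rightarrow> real^3) \<Rightarrow> real^2 \<Rightarrow> real" where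
  "env0 m x = (\<Sum>a\<in>UNIV. \<bar>defect m a x\<bar>)"

definition env1 :: "(real^2 \<Rightarrow> real^3) \<Rightarrow> real^2 \<Rightarrow> real" where
  "env1 m x = env0 m x + (\<Sum>i\<in>UNIV. \<Sum>a\<in>UNIV. \<bar>deriv1 m i a x\<bar>)"

text \<open>The squares of first derivatives are included so that the square of \<open>env1\<close>
  is dominated; they are the reason why fourth powers, collected in \<open>quartic\<close>, enter
  the square of this envelope.\<close>

definition env2 :: "(real^2 \<Rightarrow> real^3) \<Rightarrow> real^2 \<Rightarrow> real" where
  "env2 m x = env1 m x + (\<Sum>i\<in>UNIV. \<Sum>a\<in>UNIV. (deriv1 m i a x)\<^sup>2) + (\<Sum>i\<in>UNIV. \<Sum>j\<in>UNIV. \<Sum>a\<in>UNIV. \<bar>deriv2 m i j a x\<bar>)"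

definition quartic :: "(real^2 \<Rightarrow> real^3) \<Rightarrow> real^2 \<Rightarrow> real" where
  "quartic m x = (\<Sum>i\<in>UNIV. \<Sum>a\<in>UNIV. deriv1 m i a x ^ 4)"

lemma map_density_eq:
  "map_density m x = (\<Sum>a\<in>UNIV. (defect m a x)\<^sup>2) + (\<Sum>i\<in>UNIV. \<Sum>a\<in>UNIV. (deriv1 m i a x)\<^sup>2)
    + (\<Sum>i\<in>UNIV. \<Sum>j\<in>UNIV. \<Sum>a\<in>UNIV. (deriv2 m i j a x)\<^sup>2)"
  by (simp add: map_density_def gradient_sq_eq hessian_sq_eq norm_sq_vec3 defect_def)

lemma map_density_nonneg: "0 \<le> map_density m x"
  unfolding map_density_eq by (intro add_nonneg_nonneg sum_nonneg) auto

lemma square_sum_le: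
  fixes f :: "'a::finite \<Rightarrow> real"
  shows "(\<Sum>a\<in>UNIV. f a)\<^sup>2 \<le> real CARD('a) * (\<Sum>a\<in>UNIV. (f a)\<^sup>2)"
  using sum_squared_le_sum_of_squares[of f UNIV] by (simp add: mult.commute)

lemma square_sum2_le:
  fixes f :: "'a::finite \<Rightarrow> 'b::finite \<Rightarrow> real"
  shows "(\<Sum>i\<in>UNIV. \<Sum>a\<in>UNIV. f i a)\<^sup>2 \<le> real CARD('a) * real CARD('b) * (\<Sum>i\<in>UNIV. \<Sum>a\<in>UNIV. (f i a)\<^sup>2)"
proof -
  have "(\<Sum>i\<in>UNIV. \<Sum>a\<in>UNIV. f i a)\<^sup>2 \<le> real CARD('a) * (\<Sum>i\<in>UNIV. (\<Sum>a\<in>UNIV. f i a)\<^sup>2)"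
    by (rule square_sum_le)
  also have "\<dots> \<le> real CARD('a) * (\<Sum>i\<in>UNIV. real CARD('b) * (\<Sum>a\<in>UNIV. (f i a)\<^sup>2))"
    by (intro mult_left_mono sum_mono square_sum_le) simp
  finally show ?thesis by (simp add: sum_distrib_left mult.assoc)
qed

lemma square_sum_triple_le:
  fixes f :: "'a::finite \<Rightarrow> 'b::finite \<Rightarrow> 'c::finite \<Rightarrow> real"
  shows "(\<Sum>i\<in>UNIV. \<Sum>j\<in>UNIV. \<Sum>a\<in>UNIV. f i j a)\<^sup>2 \<le> real CARD('a) * real CARD('b) * real CARD('c)
    * (\<Sum>i\<in>UNIV. \<Sum>j\<in>UNIV. \<Sum>a\<in>UNIV. (f i j a)\<^sup>2)"
proof -
  have "(\<Sum>i\<in>UNIV. \<Sum>j\<in>UNIV. \<Sum>a\<in>UNIV. f i j a)\<^sup>2 \<le> real CARD('a) * (\<Sum>i\<in>UNIV. (\<Sum>j\<in>UNIV. \<Sum>a\<in>UNIV. f i j a)\<^sup>2)"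
    by (rule square_sum_le)
  also have "\<dots> \<le> real CARD('a) * (\<Sum>i\<in>UNIV. real CARD('b) * real CARD('c) * (\<Sum>j\<in>UNIV. \<Sum>a\<in>UNIV. (f i j a)\<^sup>2))"
    by (intro mult_left_mono sum_mono square_sum2_le) simp
  finally show ?thesis by (simp add: sum_distrib_left mult.assoc)
qed

text \<open>Cauchy-Schwarz twice: four groups give a factor 4, and no group has more than 12 terms
  (3, 6, 6 and 12), giving 4 times 12 = 48.\<close>

lemma env2_sq: "(env2 m x)\<^sup>2 \<le> 48 * (map_density m x + quartic m x)"
proof -
  define a b c d where "a = env0 m x" and "b = (\<Sum>i\<in>UNIV. \<Sum>a\<in>UNIV. \<bar>deriv1 m i a x\<bar>)"
    and "c = (\<Sum>i\<in>UNIV. \<Sum>a\<in>UNIV. (deriv1 m i a x)\<^sup>2)" and "d = (\<Sum>i\<in>UNIV. \<Sum>j\<in>UNIV. \<Sum>a\<in>UNIV. \<bar>deriv2 m i j a x\<bar>)"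
  have "(env2 m x)\<^sup>2 = (a + b + c + d)\<^sup>2" by (simp add: env2_def env1_def a_def b_def c_def d_def)
  also have "\<dots> \<le> 4 * (a\<^sup>2 + b\<^sup>2 + c\<^sup>2 + d\<^sup>2)"
  proof -
    have "4 * (a\<^sup>2 + b\<^sup>2 + c\<^sup>2 + d\<^sup>2) - (a + b + c + d)\<^sup>2
      = (a - b)\<^sup>2 + (a - c)\<^sup>2 + (a - d)\<^sup>2 + (b - c)\<^sup>2 + (b - d)\<^sup>2 + (c - d)\<^sup>2"
      by (simp add: power2_eq_square algebra_simps)
    moreover have "0 \<le> (a - b)\<^sup>2 + (a - c)\<^sup>2 + (a - d)\<^sup>2 + (b - c)\<^sup>2 + (b - d)\<^sup>2 + (c - d)\<^sup>2" by simp
    ultimately show ?thesis by linarith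
  qed
  also have "\<dots> \<le> 4 * (12 * (\<Sum>a\<in>UNIV. (defect m a x)\<^sup>2) + 12 * (\<Sum>i\<in>UNIV. \<Sum>a\<in>UNIV. (deriv1 m i a x)\<^sup>2)
    + 12 * quartic m x + 12 * (\<Sum>i\<in>UNIV. \<Sum>j\<in>UNIV. \<Sum>a\<in>UNIV. (deriv2 m i j a x)\<^sup>2))"
  proof (intro mult_left_mono add_mono)
    show "a\<^sup>2 \<le> 12 * (\<Sum>a\<in>UNIV. (defect m a x)\<^sup>2)"
      using square_sum_le[of "\<lambda>a. \<bar>defect m a x\<bar>"] sum_nonneg[of UNIV "\<lambda>a. (defect m a x)\<^sup>2"]
      unfolding a_def env0_def by simp
    show "b\<^sup>2 \<le> 12 * (\<Sum>i\<in>UNIV. \<Sum>a\<in>UNIV. (deriv1 m i a x)\<^sup>2)"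
      using square_sum2_le[of "\<lambda>i a. \<bar>deriv1 m i a x\<bar>"]
        sum_nonneg[of UNIV "\<lambda>i. \<Sum>a\<in>UNIV. (deriv1 m i a x)\<^sup>2", OF sum_nonneg[OF zero_le_power2]]
      unfolding b_def by simp
    show "c\<^sup>2 \<le> 12 * quartic m x"
      using square_sum2_le[of "\<lambda>i a. (deriv1 m i a x)\<^sup>2"]
        sum_nonneg[of UNIV "\<lambda>i. \<Sum>a\<in>UNIV. ((deriv1 m i a x)\<^sup>2)\<^sup>2", OF sum_nonneg[OF zero_le_power2]]
      unfolding c_def quartic_def by (simp flip: power_mult)
    show "d\<^sup>2 \<le> 12 * (\<Sum>i\<in>UNIV. \<Sum>j\<in>UNIV. \<Sum>a\<in>UNIV. (deriv2 m i j a x)\<^sup>2)"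
      using square_sum_triple_le[of "\<lambda>i j a. \<bar>deriv2 m i j a x\<bar>"] unfolding d_def by simp
  qed simp
  also have "\<dots> = 48 * (map_density m x + quartic m x)" by (simp add: map_density_eq)
  finally show ?thesis .
qed

lemma admissible_integrable:
  assumes m: "m \<in> admissible"
  shows "integrable lborel (map_density m)" "integrable lborel (quartic m)"
    and "env2 m \<in> borel_measurable borel" "integrable lborel (\<lambda>x. (env2 m x)\<^sup>2)"
proof -
  note A = admissible_derivatives[OF m]
  show i: "integrable lborel (map_density m)" "integrable lborel (quartic m)"
    unfolding map_density_eq[abs_def] quartic_def[abs_def] defect_def
    by (intro Bochner_Integration.integrable_add Bochner_Integration.integrable_sum A admissible_L4 m)+
  have [measurable]: "deriv1 m i a \<in> borel_measurable borel" "deriv2 m i j a \<in> borel_measurable borel" for i j a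
    by (rule A)+
  have [measurable]: "defect m a \<in> borel_measurable borel" for a
    unfolding defect_def[abs_def] by (intro borel_measurable_continuous_onI continuous_intros admissible_continuous m)
  show m2: "env2 m \<in> borel_measurable borel"
    unfolding env2_def[abs_def] env1_def env0_def by measurable
  show "integrable lborel (\<lambda>x. (env2 m x)\<^sup>2)"
  proof (rule Bochner_Integration.integrable_bound)
    show "integrable lborel (\<lambda>x. 48 * (map_density m x + quartic m x))" using i by simp
    show "(\<lambda>x. (env2 m x)\<^sup>2) \<in> borel_measurable lborel" using m2 by simp
    show "AE x in lborel. norm ((env2 m x)\<^sup>2) \<le> norm (48 * (map_density m x + quartic m x))"
      using env2_sq[of m] by (intro AE_I2) (auto intro: order_trans[OF _ abs_ge_self])
  qed
qed

lemma defect_le: "m \<in> admissible \<Longrightarrow> \<bar>defect m a x\<bar> \<le> 2"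
proof -
  assume m: "m \<in> admissible"
  have "norm e3 = 1" by (simp add: e3_def norm_vec_def L2_set_def sum_3)
  then have "\<bar>e3 $ a\<bar> \<le> 1" using component_le_norm_cart[of e3 a] by simp
  then show ?thesis using admissible_sphere(2)[OF m, of x a] by (simp add: defect_def)
qed

text \<open>Each of the three defects is at most 2, hence the bound 6. Splitting the square of
  \<open>env1\<close> into 2 times each square, with a factor 6 from that bound and another from the
  six first derivatives, yields 12, which is below 24.\<close>

lemma admissible_envelope:
  assumes m: "m \<in> admissible" shows "envelope (env0 m) (env1 m) (env2 m)"
proof
  fix x
  show n0: "0 \<le> env0 m x" by (simp add: env0_def sum_nonneg)
  show "env0 m x \<le> env1 m x" by (simp add: env1_def sum_nonneg)
  have c: "0 \<le> (\<Sum>i\<in>UNIV. \<Sum>a\<in>UNIV. (deriv1 m i a x)\<^sup>2)" by (intro sum_nonneg) simp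
  have d: "0 \<le> (\<Sum>i\<in>UNIV. \<Sum>j\<in>UNIV. \<Sum>a\<in>UNIV. \<bar>deriv2 m i j a x\<bar>)" by (intro sum_nonneg) simp
  have b: "0 \<le> (\<Sum>i\<in>UNIV. \<Sum>a\<in>UNIV. \<bar>deriv1 m i a x\<bar>)" by (intro sum_nonneg) simp
  show "env1 m x \<le> env2 m x" using c d by (simp add: env2_def)
  show e6: "env0 m x \<le> 6"
    using defect_le[OF m, of 1 x] defect_le[OF m, of 2 x] defect_le[OF m, of 3 x] by (simp add: env0_def sum_3)
  have "(env1 m x)\<^sup>2 \<le> 2 * (env0 m x)\<^sup>2 + 2 * (\<Sum>i\<in>UNIV. \<Sum>a\<in>UNIV. \<bar>deriv1 m i a x\<bar>)\<^sup>2"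
    unfolding env1_def using sum_squares_bound[of "env0 m x" "\<Sum>i\<in>UNIV. \<Sum>a\<in>UNIV. \<bar>deriv1 m i a x\<bar>"]
    by (simp add: power2_sum)
  moreover have "(env0 m x)\<^sup>2 \<le> 6 * env0 m x"
    unfolding power2_eq_square by (rule mult_right_mono[OF e6 n0])
  moreover have "(\<Sum>i\<in>UNIV. \<Sum>a\<in>UNIV. \<bar>deriv1 m i a x\<bar>)\<^sup>2 \<le> 6 * (\<Sum>i\<in>UNIV. \<Sum>a\<in>UNIV. (deriv1 m i a x)\<^sup>2)"
    using square_sum2_le[of "\<lambda>i a. \<bar>deriv1 m i a x\<bar>"] by simp
  moreover have "y \<le> 24 * (e + s + q + h)"
    if "y \<le> 2 * e' + 2 * s'" "e' \<le> 6 * e" "s' \<le> 6 * q" "0 \<le> s" "0 \<le> q" "0 \<le> h" "0 \<le> e" for y e e' s s' q h :: real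
    using that by argo
  ultimately show "(env1 m x)\<^sup>2 \<le> 24 * env2 m x"
    using b c d n0 unfolding env2_def env1_def by blast
next
  show "L2_loc (env2 m)" by (rule L2_loc_square_integrable[OF admissible_integrable(3,4)[OF m]])
qed

lemma admissible_small:
  assumes m: "m \<in> admissible"
  shows "envelope.small (env0 m) (env1 m) (env2 m) 1 (defect m a)"
proof -
  interpret envelope "env0 m" "env1 m" "env2 m" by (rule admissible_envelope[OF m])
  note A = admissible_derivatives[OF m]
  have c: "0 \<le> (\<Sum>i\<in>UNIV. \<Sum>a\<in>UNIV. (deriv1 m i a x)\<^sup>2)" for x by (intro sum_nonneg) simp
  show ?thesis
  proof (rule smallI[where ?U1.0="\<lambda>i. deriv1 m i a" and ?U2.0="\<lambda>i j. deriv2 m i j a"])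
    show "continuous_on UNIV (defect m a)"
      unfolding defect_def[abs_def] by (intro continuous_intros admissible_continuous m)
    show "has_weak_derivative [i] (defect m a) (deriv1 m i a)" for i
      using A(1)[of i a] by (simp add: defect_def[abs_def] has_weak_derivative_const_add)
    show "has_weak_derivative [j] (deriv1 m i a) (deriv2 m i j a)" for i j by (rule A)
    show "\<bar>defect m a x\<bar> \<le> 1 * env0 m x" for x
      unfolding env0_def using member_le_sum[of a UNIV "\<lambda>a. \<bar>defect m a x\<bar>"] by simp
    show "\<bar>deriv1 m i a x\<bar> \<le> 1 * env1 m x" for i x
    proof -
      have "\<bar>deriv1 m i a x\<bar> \<le> (\<Sum>a\<in>UNIV. \<bar>deriv1 m i a x\<bar>)" by (rule member_le_sum) auto
      also have "\<dots> \<le> (\<Sum>i\<in>UNIV. \<Sum>a\<in>UNIV. \<bar>deriv1 m i a x\<bar>)"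
        by (rule member_le_sum) (auto intro: sum_nonneg)
      finally show ?thesis using e0_nonneg[of x] by (simp add: env1_def)
    qed
    show "\<bar>deriv2 m i j a x\<bar> \<le> 1 * env2 m x" for i j x
    proof -
      have "\<bar>deriv2 m i j a x\<bar> \<le> (\<Sum>a\<in>UNIV. \<bar>deriv2 m i j a x\<bar>)" by (rule member_le_sum) auto
      also have "\<dots> \<le> (\<Sum>j\<in>UNIV. \<Sum>a\<in>UNIV. \<bar>deriv2 m i j a x\<bar>)"
        by (rule member_le_sum) (auto intro: sum_nonneg)
      also have "\<dots> \<le> (\<Sum>i\<in>UNIV. \<Sum>j\<in>UNIV. \<Sum>a\<in>UNIV. \<bar>deriv2 m i j a x\<bar>)"
        by (rule member_le_sum) (auto intro: sum_nonneg)
      finally show ?thesis using e1_nonneg[of x] c[of x] by (simp add: env2_def)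
    qed
  qed simp
qed

subsection \<open>Estimates on the transition annulus\<close>

text \<open>The annulus between the radii r and r + 1 with a margin of 2 on each side: the local
  estimates use disks of radius 3/4 and cutoffs reaching from r - 1 to r + 2, all of which must fit
  inside.\<close>

definition shell :: "real \<Rightarrow> (real^2) set" where
  "shell r = ball 0 (r + 3) - ball 0 (r - 2)"

lemma shell_borel [measurable]: "shell r \<in> sets borel"
  by (simp add: shell_def)

lemma shell_iff: "x \<in> shell r \<longleftrightarrow> r - 2 \<le> norm x \<and> norm x < r + 3"
  by (auto simp: shell_def)

definition shell_mass :: "(real^2 \<Rightarrow> real^3) \<Rightarrow> real \<Rightarrow> real" where
  "shell_mass m r = (LINT x:shell r|lborel. map_density m x)"

lemma shell_mass_eq: "shell_mass m r = (LINT x|lborel. indicator (shell r) x * map_density m x)"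
  by (simp add: shell_mass_def set_lebesgue_integral_def)

lemma shell_mass_nonneg: "0 \<le> shell_mass m r"
  unfolding shell_mass_eq by (intro integral_nonneg_AE AE_I2 mult_nonneg_nonneg map_density_nonneg) simp

lemma shell_integrable:
  assumes "m \<in> admissible" "f \<in> borel_measurable borel" "\<And>x. 0 \<le> f x" "\<And>x. f x \<le> map_density m x"
  shows "integrable lborel (\<lambda>x. indicator (shell r) x * f x)"
    "(LINT x|lborel. indicator (shell r) x * f x) \<le> shell_mass m r"
proof -
  have [measurable]: "f \<in> borel_measurable borel" by fact
  have i0: "integrable lborel (\<lambda>x. indicator (shell r) x * map_density m x)"
    using integrable_mult_indicator[OF _ admissible_integrable(1)[OF assms(1)], of "shell r"] by simp
  have le: "indicator (shell r) x * f x \<le> indicator (shell r) x * map_density m x" for x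
    by (intro mult_left_mono assms) simp
  show i: "integrable lborel (\<lambda>x. indicator (shell r) x * f x)"
  proof (rule Bochner_Integration.integrable_bound[OF i0])
    show "AE x in lborel. norm (indicator (shell r) x * f x) \<le> norm (indicator (shell r) x * map_density m x)"
      using le assms(3) map_density_nonneg[of m] by (intro AE_I2) (simp add: abs_mult)
  qed measurable
  show "(LINT x|lborel. indicator (shell r) x * f x) \<le> shell_mass m r"
    unfolding shell_mass_eq by (rule integral_mono[OF i i0 le])
qed

lemma component_squares_le:
  "(defect m a x)\<^sup>2 \<le> map_density m x" "(deriv1 m i a x)\<^sup>2 \<le> map_density m x" "(deriv2 m i j a x)\<^sup>2 \<le> map_density m x"
proof -
  have a: "(defect m a x)\<^sup>2 \<le> (\<Sum>a\<in>UNIV. (defect m a x)\<^sup>2)" by (rule member_le_sum) auto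
  have "(deriv1 m i a x)\<^sup>2 \<le> (\<Sum>a\<in>UNIV. (deriv1 m i a x)\<^sup>2)" by (rule member_le_sum) auto
  also have "\<dots> \<le> (\<Sum>i\<in>UNIV. \<Sum>a\<in>UNIV. (deriv1 m i a x)\<^sup>2)" by (rule member_le_sum) (auto intro: sum_nonneg)
  finally have b: "(deriv1 m i a x)\<^sup>2 \<le> (\<Sum>i\<in>UNIV. \<Sum>a\<in>UNIV. (deriv1 m i a x)\<^sup>2)" .
  have "(deriv2 m i j a x)\<^sup>2 \<le> (\<Sum>a\<in>UNIV. (deriv2 m i j a x)\<^sup>2)" by (rule member_le_sum) auto
  also have "\<dots> \<le> (\<Sum>j\<in>UNIV. \<Sum>a\<in>UNIV. (deriv2 m i j a x)\<^sup>2)" by (rule member_le_sum) (auto intro: sum_nonneg)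
  also have "\<dots> \<le> (\<Sum>i\<in>UNIV. \<Sum>j\<in>UNIV. \<Sum>a\<in>UNIV. (deriv2 m i j a x)\<^sup>2)" by (rule member_le_sum) (auto intro!: sum_nonneg)
  finally have c: "(deriv2 m i j a x)\<^sup>2 \<le> (\<Sum>i\<in>UNIV. \<Sum>j\<in>UNIV. \<Sum>a\<in>UNIV. (deriv2 m i j a x)\<^sup>2)" .
  have "0 \<le> (\<Sum>a\<in>UNIV. (defect m a x)\<^sup>2)" "0 \<le> (\<Sum>i\<in>UNIV. \<Sum>a\<in>UNIV. (deriv1 m i a x)\<^sup>2)"
    "0 \<le> (\<Sum>i\<in>UNIV. \<Sum>j\<in>UNIV. \<Sum>a\<in>UNIV. (deriv2 m i j a x)\<^sup>2)" by (auto intro!: sum_nonneg)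
  with a b c show "(defect m a x)\<^sup>2 \<le> map_density m x" "(deriv1 m i a x)\<^sup>2 \<le> map_density m x" "(deriv2 m i j a x)\<^sup>2 \<le> map_density m x"
    unfolding map_density_eq by linarith+
qed

lemma defect_borel: "m \<in> admissible \<Longrightarrow> continuous_on A (defect m a)" "m \<in> admissible \<Longrightarrow> defect m a \<in> borel_measurable borel"
proof -
  assume m: "m \<in> admissible"
  have "continuous_on UNIV (defect m a)"
    unfolding defect_def[abs_def] by (intro continuous_intros admissible_continuous m)
  then show "continuous_on A (defect m a)" "defect m a \<in> borel_measurable borel"
    by (auto intro: continuous_on_subset borel_measurable_continuous_onI)
qed

text \<open>Young's inequality |f| \<le> t + f^2 / (4 t). A small t controls the first term on a set
  of finite measure, and for this t a small integral of f^2 controls the second.\<close>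

lemma weighted_integral_le:
  fixes c f :: "real^2 \<Rightarrow> real"
  assumes c: "c \<in> borel_measurable borel" "\<And>y. \<bar>c y\<bar> \<le> B * indicator S y" and S: "S \<in> sets borel" "emeasure lborel S < \<infinity>"
    and f: "f \<in> borel_measurable borel" "integrable lborel (\<lambda>y. indicator S y * (f y)\<^sup>2)" and t: "0 < t" and B: "0 \<le> B"
  shows "(LINT y|lborel. \<bar>c y\<bar> * \<bar>f y\<bar>) \<le> B * t * measure lborel S + B / (4 * t) * (LINT y|lborel. indicator S y * (f y)\<^sup>2)"
proof -
  have iS: "integrable lborel (indicator S :: real^2 \<Rightarrow> real)" using S by (simp add: integrable_indicator_iff)
  have i: "integrable lborel (\<lambda>y. B * t * indicator S y + B / (4 * t) * (indicator S y * (f y)\<^sup>2))"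
    using iS f(2) by simp
  have pt: "\<bar>c y\<bar> * \<bar>f y\<bar> \<le> B * t * indicator S y + B / (4 * t) * (indicator S y * (f y)\<^sup>2)" for y
  proof (cases "y \<in> S")
    case True
    have "(\<bar>f y\<bar> - 2 * t)\<^sup>2 = (f y)\<^sup>2 - 4 * t * \<bar>f y\<bar> + 4 * t * t"
      by (simp add: power2_diff) (simp add: power2_eq_square)
    then have "4 * t * \<bar>f y\<bar> \<le> 4 * t * t + (f y)\<^sup>2" using zero_le_power2[of "\<bar>f y\<bar> - 2 * t"] by linarith
    then have "\<bar>f y\<bar> \<le> t + (f y)\<^sup>2 / (4 * t)" using t by (simp add: field_simps)
    then have "\<bar>c y\<bar> * \<bar>f y\<bar> \<le> B * (t + (f y)\<^sup>2 / (4 * t))" using c(2)[of y] True B by (intro mult_mono) auto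
    then show ?thesis using True by (simp add: distrib_left)
  qed (use c(2)[of y] in simp)
  have [measurable]: "c \<in> borel_measurable borel" "f \<in> borel_measurable borel" by fact+
  have "integrable lborel (\<lambda>y. \<bar>c y\<bar> * \<bar>f y\<bar>)"
  proof (rule Bochner_Integration.integrable_bound[OF i])
    show "AE y in lborel. norm (\<bar>c y\<bar> * \<bar>f y\<bar>) \<le> norm (B * t * indicator S y + B / (4 * t) * (indicator S y * (f y)\<^sup>2))"
      using pt by (intro AE_I2) (simp add: abs_mult order_trans[OF _ abs_ge_self])
  qed measurable
  from integral_mono[OF this i pt] show ?thesis using iS f(2) S by simp
qed

text \<open>A single cutoff is translated to x, where it equals 1, with support in a disk of radius
  3/4 inside the shell. The sup bound then involves only integrals over that disk, so the threshold
  depends neither on r nor on the map.\<close>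

lemma annulus_defect_small:
  "\<exists>\<delta>>0. \<forall>m\<in>admissible. \<forall>r x a. shell_mass m r \<le> \<delta> \<longrightarrow> r \<le> norm x \<longrightarrow> norm x \<le> r + 1 \<longrightarrow> \<bar>defect m a x\<bar> \<le> 1 / 2"
proof -
  obtain B where B: "B \<ge> 1" "\<And>R. \<exists>\<xi> :: real^2 \<Rightarrow> real. cutoff B R \<xi>" using cutoff_exists by metis
  \<comment> \<open>Radius 1/2 gives the value 1 near the origin and support in the disk of radius
    3/4.\<close>
  obtain \<xi> :: "real^2 \<Rightarrow> real" where \<xi>: "cutoff B (1 / 2) \<xi>" using B(2) by blast
  define V where "V = measure lborel (cball (0 :: real^2) (3 / 4))"
  \<comment> \<open>Makes the measure term of each integral at most 1/16.\<close>
  define t where "t = 1 / (16 * B * (V + 1))"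
  have V: "V \<ge> 0" by (simp add: V_def)
  have t: "t > 0" using B(1) V by (simp add: t_def)
  have "B * t * V = V / (16 * (V + 1))" using B(1) by (simp add: t_def)
  also have "\<dots> \<le> 1 / 16" using V by (simp add: divide_simps)
  finally have tV: "B * t * V \<le> 1 / 16" .
  \<comment> \<open>Makes the energy term \<open>B / (4 * t) * \<delta>\<close> equal to 1/16, so
    each of the four integrals in the sup bound is at most 1/8 and their sum at most 1/2.\<close>
  define \<delta> where "\<delta> = t / (4 * B)"
  have \<delta>: "\<delta> > 0" using t B(1) by (simp add: \<delta>_def)
  have "\<bar>defect m a x\<bar> \<le> 1 / 2"
    if m: "m \<in> admissible" and s: "shell_mass m r \<le> \<delta>" and x: "r \<le> norm x" "norm x \<le> r + 1" for m r x a
  proof -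
    note A = admissible_derivatives[OF m]
    let ?z = "\<lambda>y. \<xi> (1 *\<^sub>R y + (- x))" and ?S = "cball x (3 / 4)"
    note d = smooth_differentiable[OF test_function_smooth]
    have tz: "test_function ?z" by (rule test_function_affine[OF cutoffD(1)[OF \<xi>]]) simp
    have p1: "partial_derivative i ?z = (\<lambda>y. partial_derivative i \<xi> (1 *\<^sub>R y + (- x)))" for i
      using partial_derivative_affine(1)[OF d[OF cutoffD(1)[OF \<xi>]], of i 1 "- x"] by simp
    have p2: "partial_derivative j (partial_derivative i ?z) = (\<lambda>y. partial_derivative j (partial_derivative i \<xi>) (1 *\<^sub>R y + (- x)))" for i j
      unfolding p1 using partial_derivative_affine(1)[OF d[OF test_function_partial_derivative[OF cutoffD(1)[OF \<xi>]]], of j i 1 "- x"] by simp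
    have z0: "\<xi> w = 0" if "w \<notin> cball 0 (3 / 4)" for w using cutoffD(5)[OF \<xi>, of w] that by simp
    have z1: "partial_derivative i \<xi> w = 0" if "w \<notin> cball 0 (3 / 4)" for w i
      by (rule partial_derivative_zero[OF closed_cball z0 that])
    have z2: "partial_derivative j (partial_derivative i \<xi>) w = 0" if "w \<notin> cball 0 (3 / 4)" for w i j
      by (rule partial_derivative_zero[OF closed_cball z1 that])
    have S: "1 *\<^sub>R y + (- x) \<in> cball 0 (3 / 4) \<longleftrightarrow> y \<in> ?S" for y by (simp add: dist_norm norm_minus_commute)
    have bz: "\<bar>?z y\<bar> \<le> B * indicator ?S y" for y
      using cutoffD(2,3)[OF \<xi>, of "1 *\<^sub>R y + (- x)"] z0[unfolded S, of "1 *\<^sub>R y + (- x)"] B(1) S[of y]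
      by (cases "y \<in> ?S") auto
    have b1: "\<bar>partial_derivative i ?z y\<bar> \<le> B * indicator ?S y" for i y
      unfolding p1 using cutoffD(6)[OF \<xi>, of i "1 *\<^sub>R y + (- x)"] z1[of "1 *\<^sub>R y + (- x)" i] S[of y]
      by (cases "y \<in> ?S") auto
    have b2: "\<bar>partial_derivative j (partial_derivative i ?z) y\<bar> \<le> B * indicator ?S y" for i j y
      unfolding p2 using cutoffD(7)[OF \<xi>, of j i "1 *\<^sub>R y + (- x)"] z2[of "1 *\<^sub>R y + (- x)" j i] S[of y]
      by (cases "y \<in> ?S") auto
    have sub: "?S \<subseteq> shell r"
    proof
      fix y assume "y \<in> ?S"
      then have "norm (x - y) \<le> 3 / 4" by (simp add: dist_norm)
      with norm_triangle_ineq3[of x y] x show "y \<in> shell r" unfolding shell_iff by linarith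
    qed
    have fin: "emeasure lborel ?S < \<infinity>" "measure lborel ?S = V"
      unfolding V_def by (simp_all add: emeasure_cball content_cball)
    have part: "(LINT y|lborel. \<bar>c y\<bar> * \<bar>f y\<bar>) \<le> 1 / 8"
      if c: "test_function c" "\<And>y. \<bar>c y\<bar> \<le> B * indicator ?S y" and f: "f \<in> borel_measurable borel"
        "\<And>y. (f y)\<^sup>2 \<le> map_density m y" for c f :: "real^2 \<Rightarrow> real"
    proof -
      have [measurable]: "f \<in> borel_measurable borel" by fact
      have m2: "(\<lambda>y. (f y)\<^sup>2) \<in> borel_measurable borel" by measurable
      note si = shell_integrable[OF m m2 zero_le_power2 f(2), of r]
      have le: "indicator ?S y * (f y)\<^sup>2 \<le> indicator (shell r) y * (f y)\<^sup>2" for y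
        using sub by (auto simp: indicator_def)
      have i: "integrable lborel (\<lambda>y. indicator ?S y * (f y)\<^sup>2)"
      proof (rule Bochner_Integration.integrable_bound[OF si(1)])
        show "AE y in lborel. norm (indicator ?S y * (f y)\<^sup>2) \<le> norm (indicator (shell r) y * (f y)\<^sup>2)"
          using le by (intro AE_I2) (simp add: abs_mult)
        have "(\<lambda>y. indicator ?S y * (f y)\<^sup>2) \<in> borel_measurable borel"
          by (intro borel_measurable_times borel_measurable_indicator m2) simp
        then show "(\<lambda>y. indicator ?S y * (f y)\<^sup>2) \<in> borel_measurable lborel" by simp
      qed
      have "(LINT y|lborel. \<bar>c y\<bar> * \<bar>f y\<bar>) \<le> B * t * V + B / (4 * t) * (LINT y|lborel. indicator ?S y * (f y)\<^sup>2)"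
        using weighted_integral_le[OF smooth_borel[OF test_function_smooth[OF c(1)]] c(2) _ fin(1) f(1) i t]
          fin(2) B(1) by simp
      moreover have "(LINT y|lborel. indicator ?S y * (f y)\<^sup>2) \<le> \<delta>"
        using integral_mono[OF i si(1) le] si(2) s by linarith
      then have "B / (4 * t) * (LINT y|lborel. indicator ?S y * (f y)\<^sup>2) \<le> B / (4 * t) * \<delta>"
        using B(1) t by (intro mult_left_mono) auto
      moreover have "B / (4 * t) * \<delta> = 1 / 16" using B(1) t by (simp add: \<delta>_def)
      ultimately show ?thesis using tV by linarith
    qed
    have wd: "has_weak_derivative [i] (defect m a) (deriv1 m i a)" for i
      using A(1)[of i a] by (simp add: defect_def[abs_def] has_weak_derivative_const_add)
    have L: "L2_loc (deriv1 m i a)" "L2_loc (deriv2 m i j a)" for i j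
      by (rule L2_loc_square_integrable[OF A(3,4)] L2_loc_square_integrable[OF A(5,6)])+
    note tp = test_function_partial_derivative
    have "\<bar>?z x * defect m a x\<bar> \<le> 1 / 8 + 1 / 8 + 1 / 8 + 1 / 8"
      by (rule order_trans[OF weak_sup_bound[OF defect_borel(1)[OF m] wd L(1) wd L(1) A(2) L(2) tz]])
        (intro add_mono part tz tp bz b1 b2 defect_borel(2)[OF m] A(3) A(5) component_squares_le)
    moreover have "?z x = 1" using cutoffD(4)[OF \<xi>, of 0] by simp
    ultimately show ?thesis by simp
  qed
  with \<delta> show ?thesis by blast
qed

text \<open>The only part of the envelope not already in the density is the quartic one. It is
  estimated by the local fourth-power inequality with a cutoff that is 1 on the annulus and
  supported in the shell.\<close>

lemma annulus_env2:
  "\<exists>K>0. \<forall>m\<in>admissible. \<forall>r. (LINT x|lborel. indicator {x. r \<le> norm x \<and> norm x \<le> r + 1} x * (env2 m x)\<^sup>2) \<le> K * shell_mass m r"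
proof -
  obtain B where B: "B \<ge> 1" "\<And>R. \<exists>\<xi> :: real^2 \<Rightarrow> real. cutoff B R \<xi>" using cutoff_exists by metis
  \<comment> \<open>The difference of two cutoffs has gradient components at most 2 B, so 32 becomes
    32 (2 B)^2 = 128 B^2; the 6 in \<open>K\<close> counts the first derivatives and 48 comes from
    the bound on the squared envelope.\<close>
  define K4 where "K4 = 128 * B\<^sup>2 + 72"
  define K where "K = 48 * (1 + 6 * K4)"
  have "(LINT x|lborel. indicator {x. r \<le> norm x \<and> norm x \<le> r + 1} x * (env2 m x)\<^sup>2) \<le> K * shell_mass m r"
    if m: "m \<in> admissible" for m r
  proof -
    note A = admissible_derivatives[OF m]
    let ?A = "{x :: real^2. r \<le> norm x \<and> norm x \<le> r + 1}"
    have "closed ?A" by (intro closed_Collect_conj closed_Collect_le continuous_intros)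
    then have [measurable]: "?A \<in> sets borel" by simp
    have sub: "?A \<subseteq> shell r" by (auto simp: shell_iff)
    \<comment> \<open>The outer cutoff is 1 up to r + 5/4 and the inner one is 0 beyond r - 1/4, so
      the difference is 1 on the annulus; it vanishes beyond r + 7/4 and below r - 3/4.\<close>
    obtain \<xi>1 \<xi>2 :: "real^2 \<Rightarrow> real" where \<xi>: "cutoff B (r + 3 / 2) \<xi>1" "cutoff B (r - 1 / 2) \<xi>2" using B(2) by blast
    let ?\<zeta> = "\<lambda>x. \<xi>1 x - \<xi>2 x"
    note t1 = cutoffD(1)[OF \<xi>(1)] and t2 = cutoffD(1)[OF \<xi>(2)]
    have t\<zeta>: "test_function ?\<zeta>" by (rule test_function_diff[OF t1 t2])
    have one: "?\<zeta> x = 1" if "x \<in> ?A" for x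
      using that cutoffD(4)[OF \<xi>(1), of x] cutoffD(5)[OF \<xi>(2), of x] by simp
    have zero: "?\<zeta> x = 0" if "x \<notin> cball 0 (r + 2) - ball 0 (r - 1)" for x
      using that cutoffD(4)[OF \<xi>(1), of x] cutoffD(5)[OF \<xi>(2), of x] cutoffD(5)[OF \<xi>(1), of x] cutoffD(4)[OF \<xi>(2), of x]
      by (auto simp: not_less not_le)
    have cl: "closed (cball (0 :: real^2) (r + 2) - ball 0 (r - 1))" by (intro closed_Diff) auto
    have p\<zeta>: "partial_derivative i ?\<zeta> = (\<lambda>x. partial_derivative i \<xi>1 x + (- 1) * partial_derivative i \<xi>2 x)" for i
    proof -
      note d = smooth_differentiable[OF test_function_smooth]
      have "?\<zeta> = (\<lambda>x. \<xi>1 x + (- 1) * \<xi>2 x)" by auto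
      then show ?thesis
        using partial_derivative_add[OF d[OF t1] differentiable_const_mult_real[OF d[OF t2]], of i "-1"]
          partial_derivative_cmult[OF d[OF t2], of i "-1"] by simp
    qed
    have b0: "(?\<zeta> x)\<^sup>2 \<le> indicator (shell r) x" for x
    proof (cases "x \<in> shell r")
      case True
      have "\<bar>?\<zeta> x\<bar> \<le> 1" using cutoffD(2,3)[OF \<xi>(1), of x] cutoffD(2,3)[OF \<xi>(2), of x] by (simp add: abs_le_iff)
      then show ?thesis using True by (simp add: abs_square_le_1)
    next
      case False
      then have "?\<zeta> x = 0" by (intro zero) (auto simp: shell_iff)
      then show ?thesis by simp
    qed
    have b1: "(partial_derivative i ?\<zeta> x)\<^sup>2 \<le> 4 * B\<^sup>2 * indicator (shell r) x" for i x
    proof (cases "x \<in> shell r")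
      case True
      have "\<bar>partial_derivative i ?\<zeta> x\<bar> \<le> 2 * B"
        unfolding p\<zeta> using cutoffD(6)[OF \<xi>(1), of i x] cutoffD(6)[OF \<xi>(2), of i x] by (simp add: abs_le_iff)
      from power_mono[OF this, of 2] show ?thesis using True by (simp add: power_mult_distrib)
    next
      case False
      then have "partial_derivative i ?\<zeta> x = 0"
        by (intro partial_derivative_zero[OF cl zero]) (auto simp: shell_iff)
      then show ?thesis by simp
    qed
    have q: "(LINT x|lborel. indicator ?A x * deriv1 m i a x ^ 4) \<le> K4 * shell_mass m r" for i a
    proof -
      let ?f = "deriv1 m i a" and ?g = "deriv2 m i i a"
      have [measurable]: "?f \<in> borel_measurable borel" "?g \<in> borel_measurable borel" by (rule A)+
      have [measurable]: "?\<zeta> \<in> borel_measurable borel" "partial_derivative i ?\<zeta> \<in> borel_measurable borel"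
        by (intro smooth_borel test_function_smooth test_function_partial_derivative t\<zeta>)+
      have u2: "\<bar>m x $ a\<bar> \<le> 2" for x using admissible_sphere(2)[OF m, of x a] by simp
      have fm: "(\<lambda>x. (?f x)\<^sup>2) \<in> borel_measurable borel" "(\<lambda>x. (?g x)\<^sup>2) \<in> borel_measurable borel" by measurable
      note sf = shell_integrable[OF m fm(1) zero_le_power2 component_squares_le(2), of r]
      note sg = shell_integrable[OF m fm(2) zero_le_power2 component_squares_le(3), of r]
      have iA: "integrable lborel (\<lambda>x. indicator ?A x * ?f x ^ 4)"
        using integrable_mult_indicator[OF _ admissible_L4[OF m, of i a], of ?A] by simp
      let ?h = "\<lambda>x. 128 * B\<^sup>2 * (indicator (shell r) x * (?f x)\<^sup>2) + 72 * (indicator (shell r) x * (?g x)\<^sup>2)"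
      have bd: "32 * (partial_derivative i ?\<zeta> x)\<^sup>2 * (?f x)\<^sup>2 + 72 * (?\<zeta> x)\<^sup>2 * (?g x)\<^sup>2 \<le> ?h x" for x
        using mult_right_mono[OF b1[of i x], of "32 * (?f x)\<^sup>2"] mult_right_mono[OF b0[of x], of "72 * (?g x)\<^sup>2"]
        by (simp add: mult_ac)
      have ih: "integrable lborel ?h" using sf(1) sg(1) by simp
      have "ennreal (LINT x|lborel. indicator ?A x * ?f x ^ 4) = (\<integral>\<^sup>+x. ennreal (indicator ?A x * ?f x ^ 4) \<partial>lborel)"
        by (rule nn_integral_eq_integral[OF iA, symmetric]) simp
      also have "\<dots> \<le> (\<integral>\<^sup>+x. ennreal ((?\<zeta> x)\<^sup>2 * ?f x ^ 4) \<partial>lborel)"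
        using one by (intro nn_integral_mono ennreal_leI) (auto simp: indicator_def)
      also have "\<dots> \<le> ennreal (LINT x|lborel. 32 * (partial_derivative i ?\<zeta> x)\<^sup>2 * (?f x)\<^sup>2 + 72 * (?\<zeta> x)\<^sup>2 * (?g x)\<^sup>2)"
        by (rule weak_L4[OF A(1) L2_loc_continuous[OF admissible_continuous(2)[OF m]] u2 A(2)
              L2_loc_square_integrable[OF A(3,4)] L2_loc_square_integrable[OF A(5,6)] t\<zeta>])
      also have "\<dots> \<le> ennreal (LINT x|lborel. ?h x)"
      proof (intro ennreal_leI integral_mono ih bd)
        show "integrable lborel (\<lambda>x. 32 * (partial_derivative i ?\<zeta> x)\<^sup>2 * (?f x)\<^sup>2 + 72 * (?\<zeta> x)\<^sup>2 * (?g x)\<^sup>2)"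
        proof (rule Bochner_Integration.integrable_bound[OF ih])
          show "AE x in lborel. norm (32 * (partial_derivative i ?\<zeta> x)\<^sup>2 * (?f x)\<^sup>2 + 72 * (?\<zeta> x)\<^sup>2 * (?g x)\<^sup>2) \<le> norm (?h x)"
            using bd by (intro AE_I2) (simp add: order_trans[OF _ abs_ge_self])
        qed measurable
      qed
      also have "\<dots> \<le> ennreal (K4 * shell_mass m r)"
      proof (rule ennreal_leI)
        have "(LINT x|lborel. ?h x) = 128 * B\<^sup>2 * (LINT x|lborel. indicator (shell r) x * (?f x)\<^sup>2) + 72 * (LINT x|lborel. indicator (shell r) x * (?g x)\<^sup>2)"
          using sf(1) sg(1) by simp
        also have "\<dots> \<le> 128 * B\<^sup>2 * shell_mass m r + 72 * shell_mass m r"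
          using sf(2) sg(2) by (intro add_mono mult_left_mono) auto
        finally show "(LINT x|lborel. ?h x) \<le> K4 * shell_mass m r" by (simp add: K4_def distrib_right)
      qed
      finally show ?thesis
        by (subst (asm) ennreal_le_iff) (simp_all add: K4_def shell_mass_nonneg add_nonneg_nonneg)
    qed
    have iq: "integrable lborel (\<lambda>x. indicator ?A x * deriv1 m i a x ^ 4)" for i a
      using integrable_mult_indicator[OF _ admissible_L4[OF m, of i a], of ?A] by simp
    have iQ: "integrable lborel (\<lambda>x. indicator ?A x * quartic m x)"
      using integrable_mult_indicator[OF _ admissible_integrable(2)[OF m], of ?A] by simp
    have "(LINT x|lborel. indicator ?A x * quartic m x) = (\<Sum>i\<in>UNIV. \<Sum>a\<in>UNIV. LINT x|lborel. indicator ?A x * deriv1 m i a x ^ 4)"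
      by (simp only: quartic_def sum_distrib_left Bochner_Integration.integral_sum Bochner_Integration.integrable_sum iq)
    also have "\<dots> \<le> (\<Sum>i\<in>(UNIV :: 2 set). \<Sum>a\<in>(UNIV :: 3 set). K4 * shell_mass m r)" by (intro sum_mono q)
    finally have Q: "(LINT x|lborel. indicator ?A x * quartic m x) \<le> 6 * (K4 * shell_mass m r)" by simp
    have iR: "integrable lborel (\<lambda>x. indicator ?A x * map_density m x)" "integrable lborel (\<lambda>x. indicator (shell r) x * map_density m x)"
      using integrable_mult_indicator[OF _ admissible_integrable(1)[OF m], of ?A]
        integrable_mult_indicator[OF _ admissible_integrable(1)[OF m], of "shell r"] by simp_all
    have R: "(LINT x|lborel. indicator ?A x * map_density m x) \<le> shell_mass m r"
      unfolding shell_mass_eq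
      by (rule integral_mono[OF iR]) (use sub map_density_nonneg[of m] in \<open>auto simp: indicator_def\<close>)
    have "(LINT x|lborel. indicator ?A x * (env2 m x)\<^sup>2) \<le> (LINT x|lborel. 48 * (indicator ?A x * map_density m x + indicator ?A x * quartic m x))"
    proof (rule integral_mono)
      show "integrable lborel (\<lambda>x. indicator ?A x * (env2 m x)\<^sup>2)"
        using integrable_mult_indicator[OF _ admissible_integrable(4)[OF m], of ?A] by simp
      show "integrable lborel (\<lambda>x. 48 * (indicator ?A x * map_density m x + indicator ?A x * quartic m x))"
        using iR(1) iQ by simp
      show "indicator ?A x * (env2 m x)\<^sup>2 \<le> 48 * (indicator ?A x * map_density m x + indicator ?A x * quartic m x)" for x
        using env2_sq[of m x] by (simp add: indicator_def)
    qed
    also have "\<dots> = 48 * ((LINT x|lborel. indicator ?A x * map_density m x) + (LINT x|lborel. indicator ?A x * quartic m x))"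
      using iR(1) iQ by simp
    also have "\<dots> \<le> 48 * (shell_mass m r + 6 * (K4 * shell_mass m r))" using R Q by simp
    also have "\<dots> = K * shell_mass m r" by (simp add: K_def algebra_simps)
    finally show ?thesis .
  qed
  moreover have "K > 0" by (simp add: K_def K4_def add_pos_nonneg)
  ultimately show ?thesis by blast
qed

subsection \<open>Cutting a map off towards the pole\<close>

text \<open>Normalising \<open>e3 + \<eta> (m - e3)\<close>: since \<open>2 e3 \<bullet> (m - e3) = - |m - e3|\<^sup>2\<close> on the sphere, its squared
  length is \<open>1 - cut_off_deficit \<eta> m\<close>.\<close>

definition cut_off_deficit :: "(real^2 \<Rightarrow> real) \<Rightarrow> (real^2 \<Rightarrow> real^3) \<Rightarrow> real^2 \<Rightarrow> real" where
  "cut_off_deficit \<eta> m x = \<eta> x * (1 - \<eta> x) * (\<Sum>a\<in>UNIV. defect m a x * defect m a x)"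

text \<open>The inverse square root of the squared length, minus 1. The subtraction makes it vanish
  at deficit 0, as composition within the envelopes requires.\<close>

definition renorm :: "real \<Rightarrow> real" where
  "renorm t = (1 - t) powr (- 1 / 2) - 1"

definition cut_off :: "(real^2 \<Rightarrow> real) \<Rightarrow> (real^2 \<Rightarrow> real^3) \<Rightarrow> real^2 \<Rightarrow> real^3" where
  "cut_off \<eta> m x = (1 + renorm (cut_off_deficit \<eta> m x)) *\<^sub>R (e3 + \<eta> x *\<^sub>R (m x - e3))"

lemma cut_off_1: "\<eta> x = 1 \<Longrightarrow> cut_off \<eta> m x = m x" and cut_off_0: "\<eta> x = 0 \<Longrightarrow> cut_off \<eta> m x = e3"
  by (simp_all add: cut_off_def cut_off_deficit_def renorm_def)

lemma norm_e3: "norm e3 = 1"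
  by (simp add: e3_def norm_vec_def L2_set_def sum_3)

lemma e3_nth: "e3 $ 1 = 0" "e3 $ 2 = 0" "e3 $ 3 = 1"
  by (simp_all add: e3_def)

lemma e3_inner_defect:
  assumes "m \<in> admissible"
  shows "2 * defect m 3 x = - (\<Sum>a\<in>UNIV. defect m a x * defect m a x)"
proof -
  have "(m x $ 1)\<^sup>2 + (m x $ 2)\<^sup>2 + (m x $ 3)\<^sup>2 = 1" using admissible_sphere(1)[OF assms, of x] by (simp add: sum_3)
  then show ?thesis by (simp add: defect_def sum_3 e3_nth power2_eq_square algebra_simps)
qed

lemma norm_cut_off:
  assumes m: "m \<in> admissible" and d: "cut_off_deficit \<eta> m x \<le> 1 / 2"
  shows "norm (cut_off \<eta> m x) = 1"
proof -
  let ?p = "e3 + \<eta> x *\<^sub>R (m x - e3)" and ?T = "cut_off_deficit \<eta> m x"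
  have "(norm ?p)\<^sup>2 = 1 + \<eta> x * (2 * defect m 3 x) + (\<eta> x)\<^sup>2 * (\<Sum>a\<in>UNIV. defect m a x * defect m a x)"
    unfolding norm_sq_vec3 by (simp add: sum_3 defect_def e3_nth power2_eq_square algebra_simps)
  also have "\<dots> = 1 - ?T"
    unfolding e3_inner_defect[OF m] by (simp add: cut_off_deficit_def power2_eq_square algebra_simps)
  finally have p: "norm ?p = sqrt (1 - ?T)" by (metis norm_ge_zero real_sqrt_unique)
  have "norm (cut_off \<eta> m x) = (1 - ?T) powr (- 1 / 2) * sqrt (1 - ?T)"
    by (simp add: cut_off_def renorm_def p)
  also have "\<dots> = (1 - ?T) powr (- 1 / 2 + 1 / 2)"
    using d by (simp only: powr_add powr_half_sqrt)
  also have "\<dots> = 1" using d by simp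
  finally show ?thesis .
qed

lemma renorm_derivative:
  assumes "t < 1"
  shows "(renorm has_real_derivative 1 / 2 * (1 - t) powr (- 3 / 2)) (at t)"
    and "((\<lambda>t. 1 / 2 * (1 - t) powr (- 3 / 2)) has_real_derivative 3 / 4 * (1 - t) powr (- 5 / 2)) (at t)"
  unfolding renorm_def[abs_def]
  using assms by (auto intro!: derivative_eq_intros)

text \<open>The cut-off map is assembled from the defects of m by products, a smooth coefficient and
  one composition, each of which respects the envelopes. The constant is fixed before the map and
  the cutoff, so it depends only on B.\<close>

lemma cut_off_small:
  assumes B: "1 \<le> B"
  shows "\<exists>C\<ge>1. \<forall>m\<in>admissible. \<forall>\<eta>. smooth \<eta> \<longrightarrow> (\<forall>x. 0 \<le> \<eta> x \<and> \<eta> x \<le> 1) \<longrightarrow> (\<forall>i x. \<bar>partial_derivative i \<eta> x\<bar> \<le> B) \<longrightarrow>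
    (\<forall>i j x. \<bar>partial_derivative j (partial_derivative i \<eta>) x\<bar> \<le> B) \<longrightarrow> (\<forall>x. cut_off_deficit \<eta> m x \<le> 1 / 2) \<longrightarrow>
    (\<forall>a. envelope.small (env0 m) (env1 m) (env2 m) C (defect (cut_off \<eta> m) a))"
proof -
  let ?F' = "\<lambda>t :: real. 1 / 2 * (1 - t) powr (- 3 / 2)" and ?F'' = "\<lambda>t :: real. 3 / 4 * (1 - t) powr (- 5 / 2)"
  have cF: "continuous_on {0..1/2} ?F'" "continuous_on {0..1/2} ?F''" by (intro continuous_intros; simp)+
  obtain P Q where P: "\<And>s. 0 \<le> s \<Longrightarrow> s \<le> 1 / 2 \<Longrightarrow> \<bar>?F' s\<bar> \<le> P" and Q: "\<And>s. 0 \<le> s \<Longrightarrow> s \<le> 1 / 2 \<Longrightarrow> \<bar>?F'' s\<bar> \<le> Q"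
    using bounded_on_interval[OF cF(1)] bounded_on_interval[OF cF(2)] by metis
  define M where "M = max P Q"
  have M: "\<bar>?F' s\<bar> \<le> M" "\<bar>?F'' s\<bar> \<le> M" if "0 \<le> s" "s \<le> 1 / 2" for s
    using P[OF that] Q[OF that] by (auto simp: M_def)
  \<comment> \<open>The constants replay the closure rules: C1 for the coefficient times the sum of
    three squares, C2 for composition with \<open>renorm\<close>, and C for the three summands of
    the resulting defect.\<close>
  define C1 where "C1 = 4 * (4 * B\<^sup>2) * (60 * 1 * 1 + 60 * 1 * 1 + 60 * 1 * 1)"
  define C2 where "C2 = M * (24 * C1\<^sup>2 + C1)"
  define C where "C = 4 * 1 * C2 + 60 * C2 * (4 * B * 1) + 4 * B * 1"
  have "envelope.small (env0 m) (env1 m) (env2 m) C (defect (cut_off \<eta> m) a)" (is ?goal) and "1 \<le> C" (is ?C)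
    if m: "m \<in> admissible" and \<eta>: "smooth \<eta>" "\<And>x. 0 \<le> \<eta> x \<and> \<eta> x \<le> 1" "\<And>i x. \<bar>partial_derivative i \<eta> x\<bar> \<le> B"
      "\<And>i j x. \<bar>partial_derivative j (partial_derivative i \<eta>) x\<bar> \<le> B" and d: "\<And>x. cut_off_deficit \<eta> m x \<le> 1 / 2" for m \<eta> a
  proof -
    interpret envelope "env0 m" "env1 m" "env2 m" by (rule admissible_envelope[OF m])
    note sv = admissible_small[OF m]
    have \<eta>B: "\<bar>\<eta> x\<bar> \<le> B" "\<bar>1 - \<eta> x\<bar> \<le> 1" "\<bar>\<eta> x\<bar> \<le> 1" for x using \<eta>(2)[of x] B by auto
    note df = smooth_differentiable
    have s1: "smooth (\<lambda>x. 1 - \<eta> x)" by (intro smooth_diff smooth_const \<eta>)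
    have p1: "partial_derivative i (\<lambda>x. 1 - \<eta> x) = (\<lambda>x. (- 1) * partial_derivative i \<eta> x)" for i
    proof -
      have "(\<lambda>x. 1 - \<eta> x) = (\<lambda>x. 1 + (- 1) * \<eta> x)" by auto
      then show ?thesis
        using partial_derivative_add[of "\<lambda>x. 1" "\<lambda>x. (-1) * \<eta> x" i] partial_derivative_cmult[OF df[OF \<eta>(1)], of i "-1"]
          differentiable_const_mult_real[OF df[OF \<eta>(1)], of "-1"] by simp
    qed
    let ?\<theta> = "\<lambda>x. \<eta> x * (1 - \<eta> x)"
    let ?D = "\<lambda>i. partial_derivative i \<eta>"
    have s\<theta>: "smooth ?\<theta>" by (intro smooth_mult s1 \<eta>)
    have q1: "partial_derivative i ?\<theta> = (\<lambda>x. ?D i x * (1 - \<eta> x) + \<eta> x * ((- 1) * ?D i x))" for i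
      unfolding partial_derivative_mult[OF df[OF \<eta>(1)] df[OF s1]] p1 ..
    have q1': "partial_derivative i ?\<theta> = (\<lambda>x. ?D i x * (1 - \<eta> x) + (- 1) * (\<eta> x * ?D i x))" for i
      unfolding q1 by (simp add: mult.left_commute)
    have sD: "smooth (?D i)" for i by (intro smooth_partial_derivative \<eta>)
    have q2: "partial_derivative j (partial_derivative i ?\<theta>) = (\<lambda>x. (partial_derivative j (?D i) x * (1 - \<eta> x) + ?D i x * ((- 1) * ?D j x))
      + (- 1) * (?D j x * ?D i x + \<eta> x * partial_derivative j (?D i) x))" for i j
    proof -
      have d1: "(\<lambda>x. ?D i x * (1 - \<eta> x)) differentiable (at x)" "(\<lambda>x. \<eta> x * ?D i x) differentiable (at x)" for x
        by (intro df smooth_mult sD s1 \<eta>)+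
      show ?thesis
        unfolding q1' partial_derivative_add[OF d1(1) differentiable_const_mult_real[OF d1(2)]]
          partial_derivative_cmult[OF d1(2)] partial_derivative_mult[OF df[OF sD] df[OF s1]]
          partial_derivative_mult[OF df[OF \<eta>(1)] df[OF sD]] p1 ..
    qed
    have BB: "B \<le> B\<^sup>2" "1 \<le> B\<^sup>2" using B by (simp_all add: power2_eq_square mult_le_cancel_left1 mult_ge1_I)
    have le1: "\<bar>a * b\<bar> \<le> B\<^sup>2" if "\<bar>a\<bar> \<le> B" "\<bar>b\<bar> \<le> B" for a b :: real
      using mult_mono[OF that] B by (simp add: abs_mult power2_eq_square)
    have \<eta>B': "\<bar>1 - \<eta> x\<bar> \<le> B" for x using \<eta>B(2)[of x] B by linarith
    \<comment> \<open>A second derivative of \<eta> (1 - \<eta>) is a sum of four products of two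
      factors bounded by B; as B \<ge> 1, the same bound covers lower orders.\<close>
    have b\<theta>: "\<bar>?\<theta> x\<bar> \<le> 4 * B\<^sup>2" "\<bar>partial_derivative i ?\<theta> x\<bar> \<le> 4 * B\<^sup>2" "\<bar>partial_derivative j (partial_derivative i ?\<theta>) x\<bar> \<le> 4 * B\<^sup>2" for i j x
    proof -
      show "\<bar>?\<theta> x\<bar> \<le> 4 * B\<^sup>2" using le1[OF \<eta>B(1) \<eta>B', of x x] BB by linarith
      show "\<bar>partial_derivative i ?\<theta> x\<bar> \<le> 4 * B\<^sup>2"
        unfolding q1' using le1[OF \<eta>(3)[of i x] \<eta>B'[of x]] le1[OF \<eta>B(1)[of x] \<eta>(3)[of i x]] BB by linarith
      have four: "\<bar>(s + t * ((- 1) * u)) + (- 1) * (u * t + v)\<bar> \<le> 4 * B\<^sup>2"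
        if "\<bar>s\<bar> \<le> B\<^sup>2" "\<bar>t * u\<bar> \<le> B\<^sup>2" "\<bar>v\<bar> \<le> B\<^sup>2" for s t u v :: real
      proof -
        have "(s + t * ((- 1) * u)) + (- 1) * (u * t + v) = s - t * u - t * u - v" by (simp add: mult.commute)
        with that show ?thesis by linarith
      qed
      show "\<bar>partial_derivative j (partial_derivative i ?\<theta>) x\<bar> \<le> 4 * B\<^sup>2"
        unfolding q2 by (rule four) (intro le1 \<eta> \<eta>B \<eta>B')+
    qed
    have "small (60 * 1 * 1 + 60 * 1 * 1 + 60 * 1 * 1) (\<lambda>x. defect m 1 x * defect m 1 x + defect m 2 x * defect m 2 x + defect m 3 x * defect m 3 x)"
      by (intro small_add small_mult sv)
    from small_coefficient[OF this s\<theta> b\<theta>]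
    have T: "small C1 (cut_off_deficit \<eta> m)"
      unfolding C1_def cut_off_deficit_def[abs_def] sum_3 .
    have T0: "0 \<le> cut_off_deficit \<eta> m x" for x
    proof -
      have "0 \<le> (\<Sum>a\<in>UNIV. defect m a x * defect m a x)" by (intro sum_nonneg) simp
      then show ?thesis unfolding cut_off_deficit_def using \<eta>(2)[of x] by simp
    qed
    have "small C2 (\<lambda>x. renorm (cut_off_deficit \<eta> m x))"
      unfolding C2_def
      by (rule small_compose[OF T, where a=0 and b="1/2" and F'="?F'" and F''="?F''"])
        (use T0 d M cF(2) renorm_derivative in \<open>auto simp: renorm_def[of 0]\<close>)
    note sR = this
    have sE: "small (4 * 1 * C2) (\<lambda>x. e3 $ a * renorm (cut_off_deficit \<eta> m x))"
    proof (rule small_coefficient[OF sR smooth_const])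
      show "\<bar>e3 $ a\<bar> \<le> 1" using component_le_norm_cart[of e3 a] norm_e3 by simp
    qed simp_all
    have sN: "small (4 * B * 1) (\<lambda>x. \<eta> x * defect m a x)" by (rule small_coefficient[OF sv \<eta>(1) \<eta>B(1) \<eta>(3,4)])
    \<comment> \<open>Expansion of (1 + R)(e3 + \<eta> v) - e3 with R the renormalisation term:
      every summand contains R or v, so nothing of order one remains.\<close>
    have "defect (cut_off \<eta> m) a = (\<lambda>x. e3 $ a * renorm (cut_off_deficit \<eta> m x)
      + renorm (cut_off_deficit \<eta> m x) * (\<eta> x * defect m a x) + \<eta> x * defect m a x)"
      by (simp add: fun_eq_iff defect_def cut_off_def algebra_simps)
    then show ?goal
      unfolding C_def by (simp only:) (intro small_add small_mult sE sR sN)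
    have "0 \<le> C2" using sR unfolding small_def jet_def by blast
    then show ?C using B unfolding C_def by (simp add: add_increasing)
  qed
  note * = this
  \<comment> \<open>Nonnegativity of C2 is part of being \<open>small\<close>, so it is read off
    from one instance; the zero cutoff and the constant map provide it.\<close>
  have "1 \<le> C" by (rule *(2)[OF e3_admissible smooth_const[of 0]]) (use B in \<open>auto simp: cut_off_deficit_def\<close>)
  with *(1) show ?thesis by blast
qed

subsection \<open>Local comparison of densities\<close>

text \<open>Equality at one point of all data entering the densities; it refers to the chosen
  representatives, so it is available only almost everywhere.\<close>

definition jets_agree :: "(real^2 \<Rightarrow> real^3) \<Rightarrow> (real^2 \<Rightarrow> real^3) \<Rightarrow> real^2 \<Rightarrow> bool" where
  "jets_agree m m' x \<longleftrightarrow> m x = m' x \<and> (\<forall>i. weak_derivative [i] m x = weak_derivative [i] m' x) \<and>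
    (\<forall>i j. weak_derivative [i, j] m x = weak_derivative [i, j] m' x)"

lemma AE_all_finite:
  fixes P :: "'i::finite \<Rightarrow> 'a \<Rightarrow> bool"
  assumes "\<And>i. AE x in M. P i x" shows "AE x in M. \<forall>i. P i x"
proof -
  have "AE x in M. \<forall>i\<in>UNIV. P i x" by (rule AE_finite_allI) (auto intro: assms)
  then show ?thesis by simp
qed

lemma jets_agree_local:
  assumes "m \<in> admissible" "m' \<in> admissible" "open O'" "\<And>x. x \<in> O' \<Longrightarrow> m x = m' x"
  shows "AE x in lborel. x \<in> O' \<longrightarrow> jets_agree m m' x"
proof -
  have "AE x in lborel. \<forall>i a. x \<in> O' \<longrightarrow> deriv1 m i a x = deriv1 m' i a x"
    by (intro AE_all_finite deriv_local_unique(1)[OF assms])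
  moreover have "AE x in lborel. \<forall>i j a. x \<in> O' \<longrightarrow> deriv2 m i j a x = deriv2 m' i j a x"
    by (intro AE_all_finite deriv_local_unique(2)[OF assms])
  ultimately show ?thesis
    by eventually_elim (simp add: jets_agree_def vec_eq_iff deriv1_def deriv2_def assms(4))
qed

definition jet_zero :: "real^2 \<Rightarrow> bool" where
  "jet_zero x \<longleftrightarrow> (\<forall>i. weak_derivative [i] (\<lambda>x. e3) x = 0) \<and> (\<forall>i j. weak_derivative [i, j] (\<lambda>x. e3) x = 0)"

lemma AE_jet_zero: "AE x in lborel. jet_zero x"
proof -
  have "AE x in lborel. \<forall>i a. deriv1 (\<lambda>x. e3) i a x = 0" by (intro AE_all_finite e3_derivs(1))
  moreover have "AE x in lborel. \<forall>i j a. deriv2 (\<lambda>x. e3) i j a x = 0" by (intro AE_all_finite e3_derivs(2))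
  ultimately show ?thesis
    by eventually_elim (simp add: jet_zero_def vec_eq_iff deriv1_def deriv2_def)
qed

definition energy_density :: "real \<Rightarrow> (real^2 \<Rightarrow> real^3) \<Rightarrow> real^2 \<Rightarrow> real" where
  "energy_density \<delta> m x = (norm (weak_laplacian m x))\<^sup>2 + (norm (m x - e3))\<^sup>2 - \<delta> * gradient_sq m x"

lemma jets_agree_densities:
  assumes "jets_agree m m' x"
  shows "map_density m x = map_density m' x" "energy_density \<delta> m x = energy_density \<delta> m' x"
    "area_density m x = area_density m' x" "angle_form m i x = angle_form m' i x" "m x = m' x"
  using assms unfolding jets_agree_def
  by (simp_all add: map_density_def energy_density_def area_density_def angle_form_def weak_laplacian_def
      gradient_sq_def hessian_sq_def deriv1_def)

lemma jet_zero_densities: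
  assumes "jet_zero x"
  shows "energy_density \<delta> (\<lambda>x. e3) x = 0" "area_density (\<lambda>x. e3) x = 0" "angle_form (\<lambda>x. e3) i x = 0"
  using assms unfolding jet_zero_def
  by (simp_all add: energy_density_def area_density_def angle_form_def weak_laplacian_def gradient_sq_def deriv1_def)

text \<open>The derivatives witnessing \<open>small\<close> are bounded everywhere, whereas the
  energy uses the chosen ones; uniqueness identifies the two almost everywhere. All orders are
  relaxed to the largest envelope.\<close>

lemma small_derivs:
  assumes m: "m \<in> admissible" and M: "M \<in> admissible"
    and s: "\<And>a. envelope.small (env0 m) (env1 m) (env2 m) C (defect M a)"
  shows "AE x in lborel. (\<forall>a. \<bar>defect M a x\<bar> \<le> C * env2 m x) \<and> (\<forall>i a. \<bar>deriv1 M i a x\<bar> \<le> C * env2 m x) \<and>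
    (\<forall>i j a. \<bar>deriv2 M i j a x\<bar> \<le> C * env2 m x)"
proof -
  interpret envelope "env0 m" "env1 m" "env2 m" by (rule admissible_envelope[OF m])
  note A = admissible_derivatives[OF M]
  have "\<forall>a. \<exists>U1 U2. jet C (defect M a) U1 U2" using s unfolding small_def by blast
  then obtain U1 U2 where "\<And>a. jet C (defect M a) (U1 a) (U2 a)" by metis
  note J = jetD[OF this]
  have wd: "has_weak_derivative [i] (defect M a) (deriv1 M i a)" for i a
    using A(1)[of i a] by (simp add: defect_def[abs_def] has_weak_derivative_const_add)
  have u1: "AE x in lborel. deriv1 M i a x = U1 a i x" for i a
    by (rule weak_derivative_unique[OF wd J(4)])
  have u2: "AE x in lborel. deriv2 M i j a x = U2 a i j x" for i j a
  proof -
    have "has_weak_derivative [i, j] (defect M a) (deriv2 M i j a)" "has_weak_derivative [i, j] (defect M a) (U2 a i j)"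
      using weak_derivative_second[OF wd] weak_derivative_second[OF J(4)] A(2) J(5) by blast+
    then show ?thesis by (rule weak_derivative_unique)
  qed
  have C0: "0 \<le> C" by (rule J(1))
  have "AE x in lborel. \<forall>i a. deriv1 M i a x = U1 a i x" by (intro AE_all_finite u1)
  moreover have "AE x in lborel. \<forall>i j a. deriv2 M i j a x = U2 a i j x" by (intro AE_all_finite u2)
  ultimately show ?thesis
  proof eventually_elim
    case (elim x)
    have "\<bar>defect M a x\<bar> \<le> C * env2 m x" for a
      by (rule order_trans[OF J(3) mult_left_mono[OF e0_le_e2 C0]])
    moreover have "\<bar>deriv1 M i a x\<bar> \<le> C * env2 m x" for i a
      using order_trans[OF J(6) mult_left_mono[OF e1_le_e2 C0]] elim(1) by metis
    moreover have "\<bar>deriv2 M i j a x\<bar> \<le> C * env2 m x" for i j a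
      using J(7) elim(2) by metis
    ultimately show ?case by blast
  qed
qed

text \<open>The Laplacian has three components, each a sum of two terms, and contributes 12; the
  defect contributes 3; the six first derivatives with factor at most 2 contribute 12. Hence
  27.\<close>

lemma energy_density_bound:
  assumes b: "(\<forall>a. \<bar>defect M a x\<bar> \<le> e) \<and> (\<forall>i a. \<bar>deriv1 M i a x\<bar> \<le> e) \<and> (\<forall>i j a. \<bar>deriv2 M i j a x\<bar> \<le> e)"
    and \<delta>: "0 \<le> \<delta>" "\<delta> \<le> 2"
  shows "\<bar>energy_density \<delta> M x\<bar> \<le> 27 * e\<^sup>2"
proof -
  have sq: "t\<^sup>2 \<le> e\<^sup>2" if "\<bar>t\<bar> \<le> e" for t using power_mono[OF that, of 2] by simp
  have "(norm (weak_laplacian M x))\<^sup>2 \<le> (\<Sum>a\<in>(UNIV :: 3 set). 4 * e\<^sup>2)"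
    unfolding laplacian_sq_eq
  proof (rule sum_mono)
    fix a :: 3
    have "\<bar>\<Sum>i\<in>UNIV. deriv2 M i i a x\<bar> \<le> (\<Sum>i\<in>(UNIV :: 2 set). e)"
      using b by (intro order_trans[OF sum_abs] sum_mono) blast
    from power_mono[OF this, of 2] show "(\<Sum>i\<in>UNIV. deriv2 M i i a x)\<^sup>2 \<le> 4 * e\<^sup>2"
      by (simp add: power_mult_distrib)
  qed
  then have 1: "(norm (weak_laplacian M x))\<^sup>2 \<le> 12 * e\<^sup>2" by simp
  have "(norm (M x - e3))\<^sup>2 \<le> (\<Sum>a\<in>(UNIV :: 3 set). e\<^sup>2)"
    unfolding norm_sq_vec3 using b by (intro sum_mono sq) (simp add: defect_def)
  then have 2: "(norm (M x - e3))\<^sup>2 \<le> 3 * e\<^sup>2" by simp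
  have "gradient_sq M x \<le> (\<Sum>i\<in>(UNIV :: 2 set). \<Sum>a\<in>(UNIV :: 3 set). e\<^sup>2)"
    unfolding gradient_sq_eq using b by (intro sum_mono sq) blast
  then have 3: "gradient_sq M x \<le> 6 * e\<^sup>2" by simp
  have g0: "0 \<le> gradient_sq M x" unfolding gradient_sq_eq by (intro sum_nonneg) simp
  then have 4: "0 \<le> \<delta> * gradient_sq M x" "\<delta> * gradient_sq M x \<le> 2 * gradient_sq M x"
    using \<delta> by (auto intro: mult_right_mono)
  have 5: "0 \<le> (norm (weak_laplacian M x))\<^sup>2" "0 \<le> (norm (M x - e3))\<^sup>2" by simp_all
  have 6: "\<bar>p + q - d\<bar> \<le> 27 * E" if "p \<le> 12 * E" "q \<le> 3 * E" "g \<le> 6 * E" "0 \<le> d" "d \<le> 2 * g" "0 \<le> p" "0 \<le> q" for p q d g E :: real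
    using that by argo
  show ?thesis unfolding energy_density_def by (rule 6[OF 1 2 3 4 5])
qed

lemma energy_density_measurable:
  assumes "m \<in> admissible" shows "energy_density \<delta> m \<in> borel_measurable borel"
proof -
  note A = admissible_derivatives[OF assms]
  have [measurable]: "deriv1 m i a \<in> borel_measurable borel" "deriv2 m i j a \<in> borel_measurable borel"
    "defect m a \<in> borel_measurable borel" for i j a
    by (rule A defect_borel(2)[OF assms])+
  have "energy_density \<delta> m = (\<lambda>x. (\<Sum>a\<in>UNIV. (\<Sum>i\<in>UNIV. deriv2 m i i a x)\<^sup>2) + (\<Sum>a\<in>UNIV. (defect m a x)\<^sup>2)
    - \<delta> * (\<Sum>i\<in>UNIV. \<Sum>a\<in>UNIV. (deriv1 m i a x)\<^sup>2))"
    unfolding energy_density_def[abs_def] laplacian_sq_eq gradient_sq_eq defect_def norm_sq_vec3[of "m _ - e3"] ..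
  then show ?thesis by simp
qed

lemma energy_density_integrable:
  assumes m: "m \<in> admissible" and \<delta>: "0 \<le> \<delta>" "\<delta> \<le> 2"
  shows "integrable lborel (energy_density \<delta> m)"
proof (rule Bochner_Integration.integrable_bound)
  show "integrable lborel (\<lambda>x. 27 * (env2 m x)\<^sup>2)" using admissible_integrable(4)[OF m] by simp
  show "energy_density \<delta> m \<in> borel_measurable lborel" using energy_density_measurable[OF m] by simp
  show "AE x in lborel. norm (energy_density \<delta> m x) \<le> norm (27 * (env2 m x)\<^sup>2)"
    using small_derivs[OF m m admissible_small[OF m]]
  proof eventually_elim
    case (elim x)
    then have "\<bar>energy_density \<delta> m x\<bar> \<le> 27 * (1 * env2 m x)\<^sup>2" by (rule energy_density_bound[OF _ \<delta>])
    then show ?case by simp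
  qed
qed

text \<open>The triple product with a unit vector is at most |P| |Q|, hence at most the gradient
  part of the density.\<close>

lemma area_density_integrable:
  assumes m: "m \<in> admissible" shows "integrable lborel (area_density m)"
proof (rule Bochner_Integration.integrable_bound[OF admissible_integrable(1)[OF m]])
  note A = admissible_derivatives[OF m]
  have [measurable]: "(\<lambda>x. m x $ a) \<in> borel_measurable borel" "deriv1 m i a \<in> borel_measurable borel" for a i
    by (rule borel_measurable_continuous_onI[OF admissible_continuous(2)[OF m]] A(3))+
  have "area_density m = (\<lambda>x. m x $ 1 * (deriv1 m 1 2 x * deriv1 m 2 3 x - deriv1 m 2 2 x * deriv1 m 1 3 x)
    + m x $ 2 * (deriv1 m 1 3 x * deriv1 m 2 1 x - deriv1 m 2 3 x * deriv1 m 1 1 x)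
    + m x $ 3 * (deriv1 m 1 1 x * deriv1 m 2 2 x - deriv1 m 2 1 x * deriv1 m 1 2 x))"
    by (simp add: fun_eq_iff area_density_def inner_vec_def sum_3 cross_components deriv1_def)
  then show "area_density m \<in> borel_measurable lborel" by simp
  show "AE x in lborel. norm (area_density m x) \<le> norm (map_density m x)"
  proof (rule AE_I2)
    fix x
    let ?P = "weak_derivative [1] m x" and ?Q = "weak_derivative [2] m x"
    have "norm (m x) = 1" using m by (simp add: admissible_def)
    then have "\<bar>area_density m x\<bar> \<le> norm (cross3 ?P ?Q)"
      unfolding area_density_def using Cauchy_Schwarz_ineq2[of "m x" "cross3 ?P ?Q"] by simp
    also have "\<dots> \<le> norm ?P * norm ?Q"
    proof (rule power2_le_imp_le)
      show "(norm (cross3 ?P ?Q))\<^sup>2 \<le> (norm ?P * norm ?Q)\<^sup>2"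
        using norm_cross[of ?P ?Q] by (simp add: power_mult_distrib)
    qed simp
    also have "\<dots> \<le> (norm ?P)\<^sup>2 + (norm ?Q)\<^sup>2"
      using sum_squares_bound[of "norm ?P" "norm ?Q"] mult_nonneg_nonneg[OF norm_ge_zero norm_ge_zero, of ?P ?Q]
      by linarith
    also have "\<dots> = gradient_sq m x" by (simp add: gradient_sq_def sum_2)
    also have "\<dots> \<le> map_density m x" by (simp add: map_density_def hessian_sq_def sum_nonneg)
    finally show "norm (area_density m x) \<le> norm (map_density m x)" by simp
  qed
qed

subsection \<open>The decomposition\<close>

lemma uniformly_continuous_perturb:
  fixes M M' :: "real^2 \<Rightarrow> real^3"
  assumes "continuous_on UNIV M" "uniformly_continuous_on UNIV M'" "\<And>x. x \<notin> cball 0 R \<Longrightarrow> M x = M' x"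
  shows "uniformly_continuous_on UNIV M"
proof -
  have "uniformly_continuous_on UNIV (\<lambda>x. M x - M' x)"
  proof (rule compact_support_uniformly_continuous)
    show "continuous_on UNIV (\<lambda>x. M x - M' x)"
      by (intro continuous_on_diff assms(1) uniformly_continuous_imp_continuous[OF assms(2)])
    show "M x - M' x = 0" if "x \<notin> cball 0 R" for x using assms(3)[OF that] by simp
  qed
  from uniformly_continuous_on_add[OF this assms(2)] show ?thesis by simp
qed

text \<open>The envelope bounds supply square integrability. Uniform continuity comes from
  comparison with a uniformly continuous map outside a ball: the constant e3 for the inner part, m
  itself for the outer part.\<close>

lemma cut_off_admissible:
  assumes m: "m \<in> admissible" and d: "\<And>x. cut_off_deficit \<eta> m x \<le> 1 / 2"
    and s: "\<And>a. envelope.small (env0 m) (env1 m) (env2 m) C (defect (cut_off \<eta> m) a)"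
    and M': "uniformly_continuous_on UNIV M'" "\<And>x. x \<notin> cball 0 R \<Longrightarrow> cut_off \<eta> m x = M' x"
  shows "cut_off \<eta> m \<in> admissible"
proof -
  interpret envelope "env0 m" "env1 m" "env2 m" by (rule admissible_envelope[OF m])
  let ?M = "cut_off \<eta> m"
  have "\<forall>a. \<exists>U1 U2. jet C (defect ?M a) U1 U2" using s unfolding small_def by blast
  then obtain U1 U2 where "\<And>a. jet C (defect ?M a) (U1 a) (U2 a)" by metis
  note J = jetD[OF this]
  have C0: "0 \<le> C" by (rule J(1))
  have sq: "integrable lborel (\<lambda>x. (f x)\<^sup>2)" if "f \<in> borel_measurable borel" "\<And>x. \<bar>f x\<bar> \<le> C * env2 m x" for f
  proof (rule Bochner_Integration.integrable_bound)
    show "integrable lborel (\<lambda>x. C\<^sup>2 * (env2 m x)\<^sup>2)" using admissible_integrable(4)[OF m] by simp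
    show "(\<lambda>x. (f x)\<^sup>2) \<in> borel_measurable lborel" using that(1) by simp
    show "AE x in lborel. norm ((f x)\<^sup>2) \<le> norm (C\<^sup>2 * (env2 m x)\<^sup>2)"
    proof (rule AE_I2)
      show "norm ((f x)\<^sup>2) \<le> norm (C\<^sup>2 * (env2 m x)\<^sup>2)" for x
        using power_mono[OF that(2)[of x], of 2] by (simp add: power_mult_distrib)
    qed
  qed
  show ?thesis
  proof (rule admissibleI[of _ U1 U2])
    show "norm (?M x) = 1" for x by (rule norm_cut_off[OF m d])
    have eq: "e3 + (\<Sum>a\<in>UNIV. defect ?M a x *\<^sub>R axis a 1) = ?M x" for x
      unfolding defect_def vec_eq_sum_axis[symmetric] by simp
    have "continuous_on UNIV (\<lambda>x. e3 + (\<Sum>a\<in>UNIV. defect ?M a x *\<^sub>R axis a 1))"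
      by (intro continuous_intros J(2))
    then have "continuous_on UNIV ?M" by (simp only: eq)
    then show "uniformly_continuous_on UNIV ?M" by (rule uniformly_continuous_perturb[OF _ M'])
    show "integrable lborel (\<lambda>x. ((?M x - e3) $ a)\<^sup>2)" for a
      using sq[OF borel_measurable_continuous_onI[OF J(2)] order_trans[OF J(3) mult_left_mono[OF e0_le_e2 C0]]]
      by (simp add: defect_def)
    show "has_weak_derivative [i] (\<lambda>x. ?M x $ a) (U1 a i)" for a i
      using J(4)[of i a] by (simp add: defect_def[abs_def] has_weak_derivative_const_add)
    show "integrable lborel (\<lambda>x. (U1 a i x)\<^sup>2)" for a i
      by (rule sq[OF L2_loc_borel[OF J(9)] order_trans[OF J(6) mult_left_mono[OF e1_le_e2 C0]]])
    show "has_weak_derivative [j] (U1 a i) (U2 a i j)" for a i j by (rule J(5))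
    show "integrable lborel (\<lambda>x. (U2 a i j x)\<^sup>2)" for a i j by (rule sq[OF L2_loc_borel[OF J(10)] J(7)])
  qed
qed

text \<open>Where the parts are m and e3 in either order, any local quantity vanishing at e3 cancels
  between the parts and m; in between, the weight is 1 because all third components are nonnegative.
  The total difference of areas is thus that of the weighted densities times \<eta>, which exactness
  turns into integrals of angle forms against derivatives of \<eta>, and these cancel as
  well.\<close>

lemma degree_split:
  assumes adm: "m \<in> admissible" "m1 \<in> admissible" "m2 \<in> admissible" and r: "0 < r"
    and agree: "AE x in lborel. norm x < r + 1 / 4 \<longrightarrow> jets_agree m1 m x \<and> jets_agree m2 (\<lambda>x. e3) x"
      "AE x in lborel. norm x > r + 3 / 4 \<longrightarrow> jets_agree m1 (\<lambda>x. e3) x \<and> jets_agree m2 m x"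
    and pos: "\<And>x M. r \<le> norm x \<Longrightarrow> norm x \<le> r + 1 \<Longrightarrow> M \<in> {m, m1, m2} \<Longrightarrow> 0 \<le> M x $ 3"
  shows "top_degree m1 + top_degree m2 = top_degree m"
proof -
  \<comment> \<open>Radius r + 2 makes \<eta> equal to 1 up to r + 7/4, so its derivatives are
    supported well outside the transition, where the parts are already e3 and m.\<close>
  obtain B and \<eta> :: "real^2 \<Rightarrow> real" where \<eta>: "cutoff B (r + 2) \<eta>" using cutoff_exists by metis
  note t\<eta> = cutoffD(1)[OF \<eta>]
  let ?w = "\<lambda>M x. \<eta> x * (area_weight (M x $ 3) * area_density M x)"
  let ?d = "\<lambda>i. partial_derivative i \<eta>"
  have d0: "?d i x = 0" if "norm x < r + 7 / 4" for i x
  proof -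
    have "(\<eta> has_derivative (\<lambda>h. 0)) (at x)"
    proof (rule has_derivative_transform_within_open)
      show "((\<lambda>x. 1) has_derivative (\<lambda>h. 0)) (at x)" by (rule has_derivative_const)
      show "open (ball (0 :: real^2) (r + 7 / 4))" by simp
      show "x \<in> ball 0 (r + 7 / 4)" using that by simp
      show "1 = \<eta> y" if "y \<in> ball 0 (r + 7 / 4)" for y using cutoffD(4)[OF \<eta>, of y] that by simp
    qed
    then show ?thesis by (rule partial_derivative_eq)
  qed
  \<comment> \<open>Both sides vanish inside r + 1/4 and outside r + 3/4; only the closed annulus in
    between uses the sign of the third components.\<close>
  have area: "AE x in lborel. area_density m1 x + area_density m2 x - area_density m x = ?w m1 x + ?w m2 x - ?w m x"
    using agree AE_jet_zero
  proof eventually_elim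
    case (elim x)
    note z = jet_zero_densities[OF elim(3)]
    consider "norm x < r + 1 / 4" | "norm x > r + 3 / 4" | "r + 1 / 4 \<le> norm x" "norm x \<le> r + 3 / 4" by linarith
    then show ?case
    proof cases
      case 1
      with elim(1) have J: "jets_agree m1 m x" "jets_agree m2 (\<lambda>x. e3) x" by auto
      show ?thesis using jets_agree_densities(3,5)[OF J(1)] jets_agree_densities(3)[OF J(2)] z(2) by simp
    next
      case 2
      with elim(2) have J: "jets_agree m1 (\<lambda>x. e3) x" "jets_agree m2 m x" by auto
      show ?thesis using jets_agree_densities(3,5)[OF J(2)] jets_agree_densities(3)[OF J(1)] z(2) by simp
    next
      case 3
      have "area_weight (M x $ 3) = 1" if "M \<in> {m, m1, m2}" for M
        by (rule area_weight_nonneg[OF pos[OF _ _ that]]) (use 3 in auto)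
      moreover have "\<eta> x = 1" using cutoffD(4)[OF \<eta>, of x] 3 by simp
      ultimately show ?thesis by simp
    qed
  qed
  have angle: "AE x in lborel. ?d j x * angle_form m1 i x + ?d j x * angle_form m2 i x - ?d j x * angle_form m i x = 0" for i j
    using agree AE_jet_zero
  proof eventually_elim
    case (elim x)
    note z = jet_zero_densities(3)[OF elim(3)]
    consider "norm x < r + 7 / 4" | "norm x > r + 3 / 4" by linarith
    then show ?case
    proof cases
      case 1
      then show ?thesis by (simp add: d0)
    next
      case 2
      with elim(2) have J: "jets_agree m1 (\<lambda>x. e3) x" "jets_agree m2 m x" by auto
      show ?thesis using jets_agree_densities(4)[OF J(1)] jets_agree_densities(4)[OF J(2)] z by simp
    qed
  qed
  note X = area_density_exact[OF _ t\<eta>]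
  have ia: "integrable lborel (\<lambda>x. ?d j x * angle_form M i x)" if "M \<in> admissible" for M i j
    using locally_integrable_test[OF X(1)[OF that] test_function_partial_derivative[OF t\<eta>]] by simp
  have angle0: "(LINT x|lborel. ?d j x * angle_form m1 i x) + (LINT x|lborel. ?d j x * angle_form m2 i x)
    - (LINT x|lborel. ?d j x * angle_form m i x) = 0" for i j
  proof -
    have "(LINT x|lborel. ?d j x * angle_form m1 i x) + (LINT x|lborel. ?d j x * angle_form m2 i x)
      - (LINT x|lborel. ?d j x * angle_form m i x)
      = (LINT x|lborel. ?d j x * angle_form m1 i x + ?d j x * angle_form m2 i x - ?d j x * angle_form m i x)"
      using ia[OF adm(1), of j i] ia[OF adm(2), of j i] ia[OF adm(3), of j i] by simp
    also have "\<dots> = 0" by (rule integral_eq_zero_AE[OF angle])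
    finally show ?thesis .
  qed
  have "(LINT x|lborel. area_density m1 x) + (LINT x|lborel. area_density m2 x) - (LINT x|lborel. area_density m x)
    = (LINT x|lborel. area_density m1 x + area_density m2 x - area_density m x)"
    using area_density_integrable adm by simp
  also have "\<dots> = (LINT x|lborel. ?w m1 x + ?w m2 x - ?w m x)"
  proof (rule integral_cong_AE[OF _ _ area])
    show "(\<lambda>x. area_density m1 x + area_density m2 x - area_density m x) \<in> borel_measurable lborel"
      using area_density_integrable adm by (intro borel_measurable_integrable) auto
    show "(\<lambda>x. ?w m1 x + ?w m2 x - ?w m x) \<in> borel_measurable lborel"
      using X(2) adm by (intro borel_measurable_integrable) auto
  qed
  also have "\<dots> = (LINT x|lborel. ?w m1 x) + (LINT x|lborel. ?w m2 x) - (LINT x|lborel. ?w m x)"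
    using X(2) adm by simp
  also have "\<dots> = 0"
    unfolding X(3)[OF adm(1)] X(3)[OF adm(2)] X(3)[OF adm(3)] using angle0[of 2 1] angle0[of 1 2] by linarith
  finally have "(LINT x|lborel. area_density m1 x) + (LINT x|lborel. area_density m2 x) = (LINT x|lborel. area_density m x)"
    by simp
  from arg_cong[OF this, of "\<lambda>t. 1 / (4 * pi) * t"]
  show ?thesis unfolding top_degree_def area_density_def[symmetric] by (simp only: distrib_left)
qed

text \<open>Away from the transition the energy densities cancel pointwise, since that of e3 is
  zero. Within it three terms of size 27 C^2 times the squared envelope add up to 81; the factor 1/2
  of the energy is given away.\<close>

lemma energy_split:
  assumes adm: "m \<in> admissible" "m1 \<in> admissible" "m2 \<in> admissible"
    and agree: "AE x in lborel. norm x < r + 1 / 4 \<longrightarrow> jets_agree m1 m x \<and> jets_agree m2 (\<lambda>x. e3) x"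
      "AE x in lborel. norm x > r + 3 / 4 \<longrightarrow> jets_agree m1 (\<lambda>x. e3) x \<and> jets_agree m2 m x"
    and s: "\<And>a. envelope.small (env0 m) (env1 m) (env2 m) C (defect m1 a)"
      "\<And>a. envelope.small (env0 m) (env1 m) (env2 m) C (defect m2 a)"
    and C: "1 \<le> C" and \<delta>: "0 \<le> \<delta>" "\<delta> \<le> 2"
    and K: "(LINT x|lborel. indicator {x. r \<le> norm x \<and> norm x \<le> r + 1} x * (env2 m x)\<^sup>2) \<le> k"
  shows "\<bar>energy \<delta> m1 + energy \<delta> m2 - energy \<delta> m\<bar> \<le> 81 * C\<^sup>2 * k"
proof -
  let ?A = "{x :: real^2. r \<le> norm x \<and> norm x \<le> r + 1}"
  let ?E = "energy_density \<delta>"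
  have "closed ?A" by (intro closed_Collect_conj closed_Collect_le continuous_intros)
  then have A [measurable]: "?A \<in> sets borel" by simp
  note i = energy_density_integrable[OF _ \<delta>]
  have iA: "integrable lborel (\<lambda>x. indicator ?A x * (env2 m x)\<^sup>2)"
    using integrable_mult_indicator[OF _ admissible_integrable(4)[OF adm(1)], of ?A] by simp
  have "AE x in lborel. \<bar>?E m1 x + ?E m2 x - ?E m x\<bar> \<le> 81 * C\<^sup>2 * (indicator ?A x * (env2 m x)\<^sup>2)"
    using agree AE_jet_zero small_derivs[OF adm(1,2) s(1)] small_derivs[OF adm(1,3) s(2)]
      small_derivs[OF adm(1,1) admissible_small[OF adm(1)]]
  proof eventually_elim
    case (elim x)
    note z = jet_zero_densities(1)[OF elim(3)]
    consider "norm x < r + 1 / 4" | "norm x > r + 3 / 4" | "r + 1 / 4 \<le> norm x" "norm x \<le> r + 3 / 4" by linarith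
    then show ?case
    proof cases
      case 1
      with elim(1) have J: "jets_agree m1 m x" "jets_agree m2 (\<lambda>x. e3) x" by auto
      show ?thesis using jets_agree_densities(2)[OF J(1)] jets_agree_densities(2)[OF J(2)] z by simp
    next
      case 2
      with elim(2) have J: "jets_agree m1 (\<lambda>x. e3) x" "jets_agree m2 m x" by auto
      show ?thesis using jets_agree_densities(2)[OF J(1)] jets_agree_densities(2)[OF J(2)] z by simp
    next
      case 3
      have "\<bar>?E m1 x\<bar> \<le> 27 * (C * env2 m x)\<^sup>2" "\<bar>?E m2 x\<bar> \<le> 27 * (C * env2 m x)\<^sup>2" "\<bar>?E m x\<bar> \<le> 27 * (1 * env2 m x)\<^sup>2"
        by (rule energy_density_bound[OF elim(4) \<delta>] energy_density_bound[OF elim(5) \<delta>] energy_density_bound[OF elim(6) \<delta>])+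
      moreover have "(1 * env2 m x)\<^sup>2 \<le> (C * env2 m x)\<^sup>2"
        using mult_right_mono[OF power_mono[OF C, of 2], of "(env2 m x)\<^sup>2"] by (simp add: power_mult_distrib)
      ultimately have "\<bar>?E m1 x + ?E m2 x - ?E m x\<bar> \<le> 81 * (C * env2 m x)\<^sup>2" by linarith
      then show ?thesis using 3 by (simp add: power_mult_distrib)
    qed
  qed
  then have "\<bar>LINT x|lborel. ?E m1 x + ?E m2 x - ?E m x\<bar> \<le> (LINT x|lborel. 81 * C\<^sup>2 * (indicator ?A x * (env2 m x)\<^sup>2))"
    by (intro order_trans[OF integral_abs_bound integral_mono_AE] integrable_abs Bochner_Integration.integrable_add
        Bochner_Integration.integrable_diff integrable_mult_right i adm iA)
  also have "\<dots> = 81 * C\<^sup>2 * (LINT x|lborel. indicator ?A x * (env2 m x)\<^sup>2)" by simp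
  also have "\<dots> \<le> 81 * C\<^sup>2 * k" using K by (intro mult_left_mono) auto
  finally have *: "\<bar>LINT x|lborel. ?E m1 x + ?E m2 x - ?E m x\<bar> \<le> 81 * C\<^sup>2 * k" .
  have "energy \<delta> m1 + energy \<delta> m2 - energy \<delta> m = 1 / 2 * (LINT x|lborel. ?E m1 x + ?E m2 x - ?E m x)"
    using i[OF adm(1)] i[OF adm(2)] i[OF adm(3)]
    by (simp add: energy_def energy_density_def[symmetric])
  with * show ?thesis by (simp add: abs_mult)
qed

text \<open>Bundled into one predicate so that both parts can be chosen at once for every index. One
  K serves all parameters between 0 and 2, which is what the supremum needs, and almost everywhere
  equality of densities suffices for their integrals.\<close>

definition splits :: "real \<Rightarrow> (real^2 \<Rightarrow> real^3) \<Rightarrow> real \<Rightarrow> (real^2 \<Rightarrow> real^3) \<Rightarrow> (real^2 \<Rightarrow> real^3) \<Rightarrow> bool" where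
  "splits K m r m1 m2 \<longleftrightarrow> m1 \<in> admissible \<and> m2 \<in> admissible \<and>
    (\<forall>x\<in>ball 0 r. m1 x = m x \<and> m2 x = e3) \<and> (\<forall>x\<in>UNIV - ball 0 (r + 1). m1 x = e3 \<and> m2 x = m x) \<and>
    top_degree m1 + top_degree m2 = top_degree m \<and>
    (AE x in lborel. norm x < r \<longrightarrow> map_density m1 x = map_density m x) \<and>
    (AE x in lborel. norm x > r + 1 \<longrightarrow> map_density m2 x = map_density m x) \<and>
    (\<forall>\<delta>\<in>{0..2}. \<bar>energy \<delta> m1 + energy \<delta> m2 - energy \<delta> m\<bar> \<le> K * shell_mass m r)"

text \<open>The threshold and K are fixed before the map and the radius, so along a sequence the
  error is governed by the shell mass alone.\<close>

lemma decomposition: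
  obtains \<delta>0 K where "\<delta>0 > 0"
    and "\<And>m r. m \<in> admissible \<Longrightarrow> r > 0 \<Longrightarrow> shell_mass m r \<le> \<delta>0 \<Longrightarrow> \<exists>m1 m2. splits K m r m1 m2"
proof -
  obtain B where B: "B \<ge> 1" "\<And>R. \<exists>\<xi> :: real^2 \<Rightarrow> real. cutoff B R \<xi>" using cutoff_exists by metis
  obtain \<delta>0 where \<delta>0: "\<delta>0 > 0" "\<And>m r x a. m \<in> admissible \<Longrightarrow> shell_mass m r \<le> \<delta>0 \<Longrightarrow> r \<le> norm x \<Longrightarrow> norm x \<le> r + 1 \<Longrightarrow> \<bar>defect m a x\<bar> \<le> 1 / 2"
    using annulus_defect_small by blast
  obtain K1 where K1: "\<And>m r. m \<in> admissible \<Longrightarrow> (LINT x|lborel. indicator {x. r \<le> norm x \<and> norm x \<le> r + 1} x * (env2 m x)\<^sup>2) \<le> K1 * shell_mass m r"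
    using annulus_env2 by blast
  obtain C where C1: "C \<ge> 1" and C: "\<forall>m\<in>admissible. \<forall>\<eta>. smooth \<eta> \<longrightarrow> (\<forall>x. 0 \<le> \<eta> x \<and> \<eta> x \<le> 1) \<longrightarrow> (\<forall>i x. \<bar>partial_derivative i \<eta> x\<bar> \<le> B) \<longrightarrow>
    (\<forall>i j x. \<bar>partial_derivative j (partial_derivative i \<eta>) x\<bar> \<le> B) \<longrightarrow> (\<forall>x. cut_off_deficit \<eta> m x \<le> 1 / 2) \<longrightarrow>
    (\<forall>a. envelope.small (env0 m) (env1 m) (env2 m) C (defect (cut_off \<eta> m) a))"
    using cut_off_small[OF B(1)] by (elim exE conjE)
  have main: "\<exists>m1 m2. splits (81 * C\<^sup>2 * K1) m r m1 m2"
    if m: "m \<in> admissible" and r: "r > 0" and sm: "shell_mass m r \<le> \<delta>0" for m r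
  proof -
    obtain \<xi> :: "real^2 \<Rightarrow> real" where \<xi>: "cutoff B (r + 1 / 2) \<xi>" using B(2) by blast
    note sx = test_function_smooth[OF cutoffD(1)[OF \<xi>]]
    let ?c = "\<lambda>x. 1 - \<xi> x"
    let ?m1 = "cut_off \<xi> m" and ?m2 = "cut_off ?c m"
    have in1: "\<xi> x = 1" if "norm x < r + 1 / 4" for x using cutoffD(4)[OF \<xi>, of x] that by simp
    have out0: "\<xi> x = 0" if "norm x > r + 3 / 4" for x using cutoffD(5)[OF \<xi>, of x] that by simp
    note sd = \<delta>0(2)[OF m sm]
    have deficit: "\<xi> x * (1 - \<xi> x) * (\<Sum>a\<in>UNIV. defect m a x * defect m a x) \<le> 1 / 2" for x
    proof (cases "r \<le> norm x \<and> norm x \<le> r + 1")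
      case True
      have q: "defect m a x * defect m a x \<le> 1 / 4" for a
        using power_mono[OF sd[of x a], of 2] True by (simp add: power2_eq_square)
      have S: "(\<Sum>a\<in>UNIV. defect m a x * defect m a x) \<le> 3 / 4"
        using q[of 1] q[of 2] q[of 3] by (simp add: sum_3)
      have "0 \<le> (\<xi> x - 1 / 2)\<^sup>2" by simp
      then have t: "\<xi> x * (1 - \<xi> x) \<le> 1 / 4" by (simp add: power2_eq_square algebra_simps)
      \<comment> \<open>Three squares of defects at most 1/2 sum to at most 3/4, and \<xi> (1 -
        \<xi>) \<le> 1/4; the deficit is at most 3/16, safely below 1/2.\<close>
      have "\<xi> x * (1 - \<xi> x) * (\<Sum>a\<in>UNIV. defect m a x * defect m a x) \<le> 1 / 4 * (3 / 4)"
        by (rule mult_mono[OF t S]) (auto intro: sum_nonneg)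
      then show ?thesis by simp
    next
      case False
      then have "\<xi> x = 1 \<or> \<xi> x = 0" using in1[of x] out0[of x] by linarith
      then show ?thesis by auto
    qed
    have d1: "cut_off_deficit \<xi> m x \<le> 1 / 2" and d2: "cut_off_deficit ?c m x \<le> 1 / 2" for x
      using deficit[of x] by (simp_all add: cut_off_deficit_def mult_ac)
    note df = smooth_differentiable
    have sc: "smooth ?c" by (intro smooth_diff smooth_const sx)
    have pc: "partial_derivative i ?c = (\<lambda>x. (- 1) * partial_derivative i \<xi> x)" for i
    proof -
      have "?c = (\<lambda>x. 1 + (- 1) * \<xi> x)" by auto
      then show ?thesis
        using partial_derivative_add[of "\<lambda>x. 1" "\<lambda>x. (-1) * \<xi> x" i] partial_derivative_cmult[OF df[OF sx], of i "-1"]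
          differentiable_const_mult_real[OF df[OF sx], of "-1"] by simp
    qed
    have pc2: "partial_derivative j (partial_derivative i ?c) = (\<lambda>x. (- 1) * partial_derivative j (partial_derivative i \<xi>) x)" for i j
      unfolding pc by (rule partial_derivative_cmult[OF df[OF smooth_partial_derivative[OF sx]]])
    have s1: "envelope.small (env0 m) (env1 m) (env2 m) C (defect ?m1 a)" for a
      by (rule C[rule_format, OF m sx]) (use cutoffD[OF \<xi>] d1 in auto)
    have s2: "envelope.small (env0 m) (env1 m) (env2 m) C (defect ?m2 a)" for a
    proof (rule C[rule_format, OF m sc])
      show "\<bar>partial_derivative i ?c x\<bar> \<le> B" for i x unfolding pc using cutoffD(6)[OF \<xi>] by simp
      show "\<bar>partial_derivative j (partial_derivative i ?c) x\<bar> \<le> B" for i j x unfolding pc2 using cutoffD(7)[OF \<xi>] by simp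
      show "0 \<le> ?c x \<and> ?c x \<le> 1" for x using cutoffD(2,3)[OF \<xi>, of x] by simp
    qed (rule d2)
    have e1: "?m1 x = m x" "?m2 x = e3" if "norm x < r + 1 / 4" for x
      using in1[OF that] by (simp_all add: cut_off_1 cut_off_0)
    have e2: "?m1 x = e3" "?m2 x = m x" if "norm x > r + 3 / 4" for x
      using out0[OF that] by (simp_all add: cut_off_1 cut_off_0)
    have a1: "?m1 \<in> admissible"
      by (rule cut_off_admissible[OF m d1 s1 uniformly_continuous_on_const, of "r + 1" e3]) (use e2 in auto)
    have ucm: "uniformly_continuous_on UNIV m" using m by (simp add: admissible_def)
    have a2: "?m2 \<in> admissible"
      by (rule cut_off_admissible[OF m d2 s2 ucm, of "r + 1"]) (use e2 in auto)
    have o1: "open {x :: real^2. norm x < r + 1 / 4}" and o2: "open {x :: real^2. norm x > r + 3 / 4}"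
      by (intro open_Collect_less continuous_intros)+
    have g1: "AE x in lborel. norm x < r + 1 / 4 \<longrightarrow> jets_agree ?m1 m x \<and> jets_agree ?m2 (\<lambda>x. e3) x"
    proof -
      have "AE x in lborel. x \<in> {x. norm x < r + 1 / 4} \<longrightarrow> jets_agree ?m1 m x"
        "AE x in lborel. x \<in> {x. norm x < r + 1 / 4} \<longrightarrow> jets_agree ?m2 (\<lambda>x. e3) x"
        by (rule jets_agree_local[OF a1 m o1] jets_agree_local[OF a2 e3_admissible o1]; simp add: e1)+
      then show ?thesis by eventually_elim simp
    qed
    have g2: "AE x in lborel. norm x > r + 3 / 4 \<longrightarrow> jets_agree ?m1 (\<lambda>x. e3) x \<and> jets_agree ?m2 m x"
    proof -
      have "AE x in lborel. x \<in> {x. r + 3 / 4 < norm x} \<longrightarrow> jets_agree ?m1 (\<lambda>x. e3) x"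
        "AE x in lborel. x \<in> {x. r + 3 / 4 < norm x} \<longrightarrow> jets_agree ?m2 m x"
        by (rule jets_agree_local[OF a1 e3_admissible o2] jets_agree_local[OF a2 m o2]; simp add: e2)+
      then show ?thesis by eventually_elim simp
    qed
    have pos: "0 \<le> M x $ 3" if x: "r \<le> norm x" "norm x \<le> r + 1" and M: "M \<in> {m, ?m1, ?m2}" for x M
    proof -
      have v: "- (1 / 2) \<le> defect m 3 x" "m x $ 3 = 1 + defect m 3 x"
        using sd[OF x, of 3] by linarith (simp add: defect_def e3_nth)
      \<comment> \<open>Before normalisation the third component is 1 plus \<eta> times a defect of
        at least -1/2, hence positive; the normalising factor is nonnegative.\<close>
      have cut3: "0 \<le> cut_off \<eta> m x $ 3" if "0 \<le> \<eta> x" "\<eta> x \<le> 1" for \<eta>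
      proof -
        have "\<eta> x * (- (1 / 2)) \<le> \<eta> x * defect m 3 x" by (rule mult_left_mono[OF v(1) that(1)])
        then have "0 \<le> 1 + \<eta> x * defect m 3 x" using that by linarith
        then show ?thesis by (simp add: cut_off_def renorm_def e3_nth v(2))
      qed
      show ?thesis using M v cut3[of \<xi>] cut3[of ?c] cutoffD(2,3)[OF \<xi>, of x] by auto
    qed
    have deg: "top_degree ?m1 + top_degree ?m2 = top_degree m"
      by (rule degree_split[where m=m and ?m1.0="?m1" and ?m2.0="?m2" and r=r, OF m a1 a2 r g1 g2]) (rule pos)
    have en: "\<bar>energy \<delta> ?m1 + energy \<delta> ?m2 - energy \<delta> m\<bar> \<le> (81 * C\<^sup>2 * K1) * shell_mass m r" if "\<delta> \<in> {0..2}" for \<delta>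
      using energy_split[where m=m and ?m1.0="?m1" and ?m2.0="?m2" and r=r, OF m a1 a2 g1 g2 s1 s2 C1 _ _ K1[OF m], of \<delta>] that
      by (simp add: mult.assoc)
    have h1: "AE x in lborel. norm x < r \<longrightarrow> map_density ?m1 x = map_density m x"
      using g1 by eventually_elim (auto dest: jets_agree_densities(1))
    have h2: "AE x in lborel. norm x > r + 1 \<longrightarrow> map_density ?m2 x = map_density m x"
      using g2 by eventually_elim (auto dest: jets_agree_densities(1))
    show ?thesis
      unfolding splits_def using a1 a2 deg h1 h2 en e1 e2
      by (intro exI[of _ ?m1] exI[of _ ?m2]) (auto simp: not_less)
  qed
  show ?thesis by (rule that[OF \<delta>0(1) main])
qed

section \<open>From a single map to the sequence\<close>

lemma set_integral_map_density_cong: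
  assumes "m \<in> admissible" "m' \<in> admissible" "S \<in> sets borel"
    and "AE x in lborel. x \<in> S \<longrightarrow> map_density m x = map_density m' x"
  shows "(LINT x:S|lborel. map_density m x) = (LINT x:S|lborel. map_density m' x)"
  unfolding set_lebesgue_integral_def
proof (rule integral_cong_AE)
  have "map_density m \<in> borel_measurable lborel" "map_density m' \<in> borel_measurable lborel"
    using admissible_integrable(1)[OF assms(1)] admissible_integrable(1)[OF assms(2)] by auto
  then show "(\<lambda>x. indicator S x *\<^sub>R map_density m x) \<in> borel_measurable lborel"
    "(\<lambda>x. indicator S x *\<^sub>R map_density m' x) \<in> borel_measurable lborel"
    using assms(3) by (auto intro!: borel_measurable_scaleR borel_measurable_indicator)
  show "AE x in lborel. indicator S x *\<^sub>R map_density m x = indicator S x *\<^sub>R map_density m' x"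
    using assms(4) by eventually_elim (auto simp: indicator_def)
qed

theorem proposition2p3:
  fixes n :: "nat \<Rightarrow> real^2 \<Rightarrow> real^3" and r :: "nat \<Rightarrow> real" and \<epsilon> M \<beta> :: real
  assumes "0 \<le> \<epsilon>" and "\<epsilon> < 2"
    and "\<And>k. n k \<in> admissible_of_degree (-1)"
    and "(\<lambda>k. energy \<epsilon> (n k)) \<longlonglongrightarrow> min_energy (-1) \<epsilon>"
    and "(\<lambda>k. LINT x|lborel. map_density (n k) x) \<longlonglongrightarrow> M" and "M > 0"
    and "dichotomy (\<lambda>k. map_density (n k)) M"
    and "filterlim r at_top sequentially" and "\<beta> > 0"
    and "(\<lambda>k. LINT x:ball 0 (r k + 3) - ball 0 (r k - 2)|lborel. map_density (n k) x) \<longlonglongrightarrow> 0"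
    and "\<And>k. (LINT x:ball 0 (r k - 2)|lborel. map_density (n k) x) \<ge> \<beta>"
    and "\<And>k. (LINT x:UNIV - ball 0 (r k + 3)|lborel. map_density (n k) x) \<ge> \<beta>"
  shows "\<exists>n_in n_out :: nat \<Rightarrow> real^2 \<Rightarrow> real^3.
    (\<forall>\<^sub>F k in sequentially.
       n_in k \<in> admissible \<and> n_out k \<in> admissible \<and>
       (\<forall>x \<in> ball 0 (r k). n_in k x = n k x) \<and>
       (\<forall>x \<in> UNIV - ball 0 (r k + 1). n_in k x = e3) \<and>
       (\<forall>x \<in> ball 0 (r k). n_out k x = e3) \<and>
       (\<forall>x \<in> UNIV - ball 0 (r k + 1). n_out k x = n k x) \<and>
       top_degree (n_in k) + top_degree (n_out k) = top_degree (n k) \<and>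
       (LINT x:ball 0 (r k - 2)|lborel. map_density (n_in k) x) \<ge> \<beta> \<and>
       (LINT x:UNIV - ball 0 (r k + 3)|lborel. map_density (n_out k) x) \<ge> \<beta>) \<and>
    (\<lambda>k. SUP \<delta>\<in>{0..2}. \<bar>energy \<delta> (n_in k) + energy \<delta> (n_out k) - energy \<delta> (n k)\<bar>)
      \<longlonglongrightarrow> 0"
proof -
  have adm: "n k \<in> admissible" for k using assms(3)[of k] by (simp add: admissible_of_degree_def)
  have mass: "(\<lambda>k. shell_mass (n k) (r k)) \<longlonglongrightarrow> 0"
    using assms(10) by (simp add: shell_mass_def shell_def)
  obtain \<delta>0 K where \<delta>0: "\<delta>0 > 0"
    and K: "\<And>m r. m \<in> admissible \<Longrightarrow> r > 0 \<Longrightarrow> shell_mass m r \<le> \<delta>0 \<Longrightarrow> \<exists>m1 m2. splits K m r m1 m2"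
    by (rule decomposition, erule that, blast)
  have "\<forall>\<^sub>F k in sequentially. shell_mass (n k) (r k) < \<delta>0"
    by (rule order_tendstoD(2)[OF mass \<delta>0])
  moreover have "\<forall>\<^sub>F k in sequentially. r k > 0"
    using assms(8) by (simp add: filterlim_at_top_dense)
  ultimately have good: "\<forall>\<^sub>F k in sequentially. \<exists>m1 m2. splits K (n k) (r k) m1 m2"
    by eventually_elim (simp add: K adm)
  \<comment> \<open>Choice is made for all indices at once, conditionally on the existence of a
    splitting; the finitely many early indices without one receive arbitrary maps.\<close>
  have "\<exists>n_in n_out. \<forall>k. (\<exists>m1 m2. splits K (n k) (r k) m1 m2) \<longrightarrow> splits K (n k) (r k) (n_in k) (n_out k)"
    by (subst choice_iff[symmetric])+ blast
  then obtain n_in n_out where splits: "\<And>k. \<exists>m1 m2. splits K (n k) (r k) m1 m2 \<Longrightarrow> splits K (n k) (r k) (n_in k) (n_out k)"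
    by blast
  have ev: "\<forall>\<^sub>F k in sequentially. splits K (n k) (r k) (n_in k) (n_out k)"
    using good by eventually_elim (rule splits)
  show ?thesis
  proof (rule exI[of _ n_in], rule exI[of _ n_out], rule conjI)
    show "\<forall>\<^sub>F k in sequentially.
       n_in k \<in> admissible \<and> n_out k \<in> admissible \<and>
       (\<forall>x \<in> ball 0 (r k). n_in k x = n k x) \<and>
       (\<forall>x \<in> UNIV - ball 0 (r k + 1). n_in k x = e3) \<and>
       (\<forall>x \<in> ball 0 (r k). n_out k x = e3) \<and>
       (\<forall>x \<in> UNIV - ball 0 (r k + 1). n_out k x = n k x) \<and>
       top_degree (n_in k) + top_degree (n_out k) = top_degree (n k) \<and>
       (LINT x:ball 0 (r k - 2)|lborel. map_density (n_in k) x) \<ge> \<beta> \<and>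
       (LINT x:UNIV - ball 0 (r k + 3)|lborel. map_density (n_out k) x) \<ge> \<beta>"
      using ev
    proof eventually_elim
      case (elim k)
      have a: "n_in k \<in> admissible" "n_out k \<in> admissible"
        and AE_in: "AE x in lborel. norm x < r k \<longrightarrow> map_density (n_in k) x = map_density (n k) x"
        and AE_out: "AE x in lborel. norm x > r k + 1 \<longrightarrow> map_density (n_out k) x = map_density (n k) x"
        using elim unfolding splits_def by blast+
      \<comment> \<open>The two masses are in fact equal, since the smaller ball lies where the
        inner part equals the original map; the lower bound is inherited from it.\<close>
      have i: "(LINT x:ball 0 (r k - 2)|lborel. map_density (n_in k) x)
          = (LINT x:ball 0 (r k - 2)|lborel. map_density (n k) x)"
        by (rule set_integral_map_density_cong[OF a(1) adm borel_open[OF open_ball]])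
          (use AE_in in eventually_elim, simp)
      have o: "(LINT x:UNIV - ball 0 (r k + 3)|lborel. map_density (n_out k) x)
          = (LINT x:UNIV - ball 0 (r k + 3)|lborel. map_density (n k) x)"
        by (rule set_integral_map_density_cong[OF a(2) adm])
          (simp, use AE_out in eventually_elim, simp)
      show ?case using elim assms(11)[of k] assms(12)[of k] i o unfolding splits_def by simp
    qed
    show "(\<lambda>k. SUP \<delta>\<in>{0..2}. \<bar>energy \<delta> (n_in k) + energy \<delta> (n_out k) - energy \<delta> (n k)\<bar>) \<longlonglongrightarrow> 0"
      (is "(\<lambda>k. SUP \<delta>\<in>{0..2}. ?d k \<delta>) \<longlonglongrightarrow> 0")
    proof (rule real_tendsto_sandwich)
      show "\<forall>\<^sub>F k in sequentially. 0 \<le> (SUP \<delta>\<in>{0..2}. ?d k \<delta>)" using ev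
      proof eventually_elim
        case (elim k)
        \<comment> \<open>Needed before the supremum can be compared with any member: on an
          unbounded set its value would be unspecified.\<close>
        then have "bdd_above (?d k ` {0..2})"
          unfolding splits_def by (intro bdd_aboveI2[where M = "K * shell_mass (n k) (r k)"]) auto
        then have "?d k 0 \<le> (SUP \<delta>\<in>{0..2}. ?d k \<delta>)" by (rule cSUP_upper[rotated]) simp
        then show ?case by linarith
      qed
      show "\<forall>\<^sub>F k in sequentially. (SUP \<delta>\<in>{0..2}. ?d k \<delta>) \<le> K * shell_mass (n k) (r k)" using ev
        by eventually_elim (rule cSUP_least; simp add: splits_def)
      show "(\<lambda>k. K * shell_mass (n k) (r k)) \<longlonglongrightarrow> 0"
        using tendsto_mult_left[OF mass, of K] by simp
    qed simp
  qed
qed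

end
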